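(* Let $q$ be a power of an odd prime and let $\phi$ be a monic polynomial of degree $n$ over $F_q$ with nonzero constant term which factors into irreducibles as $$\phi=(z-1)^{a}(z+1)^{b}\prod_i\phi_i^{j_i}\prod_{i'}[\phi_{i'}\bar\phi_{i'}]^{j_{i'}},$$ where $\phi_i=\bar\phi_i$, $\phi_i\neq z\pm1$, and $\phi_{i'}\neq\bar\phi_{i'}$ (the $\phi_i,\phi_{i'},\bar\phi_{i'}$ being pairwise distinct monic irreducible polynomials). Then $\frac12$ of the sum of the proportion of elements of $O^+(n,q)$ with characteristic polynomial $\phi$ and the proportion of elements of $O^-(n,q)$ with characteristic polynomial $\phi$ equals $$\frac{F(a)F(b)}{2}\ \prod_i\frac{q^{\frac{m_{\phi_i}j_i(j_i-1)}{2}}}{|U(j_i,q^{\frac{m_{\phi_i}}{2}})|}\ \prod_{i'}\frac{q^{m_{\phi_{i'}}j_{i'}(j_{i'}-1)}}{|GL(j_{i'},q^{m_{\phi_{i'}}})|},$$ where, for an integer $k\ge0$, $F(k)=\dfrac{q^{k^2/2}}{|Sp(k,q)|}$ if $k$ is even and $F(k)=\dfrac{q^{(k-1)^2/2}}{|Sp(k-1,q)|}$ if $k$ is odd.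
   Context: Let $\delta$ be a non-square in $F_q$. For $n=2l+1$ odd, $O^+(n,q)$ and $O^-(n,q)$ are the subgroups of $GL(n,q)$ preserving the non-degenerate symmetric bilinear forms with matrices $A$ and $\delta A$ respectively, where $A$ is the orthogonal sum of $(1)$ and $\begin{pmatrix}0_l & I_l \\ I_l & 0_l\end{pmatrix}$ (the two groups are isomorphic). For $n=2l$ even, $O^+(n,q)$ preserves the form with matrix $\begin{pmatrix}0_l & I_l \\ I_l & 0_l\end{pmatrix}$ and $O^-(n,q)$ the form which is the orthogonal sum of $\begin{pmatrix}0_{l-1} & I_{l-1} \\ I_{l-1} & 0_{l-1}\end{pmatrix}$ and $\mathrm{diag}(1,-\delta)$. $Sp(2l,q)$ is the symplectic group, $|Sp(2l,q)|=q^{l^2}\prod_{i=1}^l(q^{2i}-1)$, $|Sp(0,q)|=1$. $U(n,Q)\subset GL(n,Q^2)$ is the unitary group, $|U(n,Q)|=Q^{\binom n2}\prod_{i=1}^n(Q^i-(-1)^i)$. $m_\phi$ denotes the degree of $\phi$. For $\phi$ over $F_q$ with $\phi(0)\ne0$, $\bar\phi(z)=z^{m_\phi}\phi(1/z)/\phi(0)$ (the paper raises coefficients to the $q$th power, which is trivial on $F_q$). Irreducible $\phi\neq z\pm1$ with $\phi=\bar\phi$ have even degree. *)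

theory Defs
  imports
    "HOL-Library.Cardinality"
    "HOL-Algebra.Algebraic_Closure_Type"
    "Jordan_Normal_Form.Char_Poly"
begin

definition GL :: "nat \<Rightarrow> 'k::field mat set" where
  "GL n = {A \<in> carrier_mat n n. invertible_mat A}"

definition isometry_group :: "nat \<Rightarrow> 'k::field mat \<Rightarrow> 'k mat set" where
  "isometry_group n B = {A \<in> GL n. transpose_mat A * B * A = B}"

definition hyperbolic_form :: "nat \<Rightarrow> 'k::field mat" where
  "hyperbolic_form l = four_block_mat (0\<^sub>m l l) (1\<^sub>m l) (1\<^sub>m l) (0\<^sub>m l l)"

definition form_plus :: "nat \<Rightarrow> 'k::field mat" where
  "form_plus n =
     (if even n then hyperbolic_form (n div 2)
      else diag_block_mat [1\<^sub>m 1, hyperbolic_form (n div 2)])"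

(* meaningful for n > 0 and \<delta> a non-square *)
definition form_minus :: "'k::field \<Rightarrow> nat \<Rightarrow> 'k mat" where
  "form_minus \<delta> n =
     (if even n
      then diag_block_mat [hyperbolic_form (n div 2 - 1), mat_of_rows_list 2 [[1, 0], [0, - \<delta>]]]
      else \<delta> \<cdot>\<^sub>m form_plus n)"

definition O_plus :: "nat \<Rightarrow> 'k::field mat set" where
  "O_plus n = isometry_group n (form_plus n)"

definition O_minus :: "'k::field \<Rightarrow> nat \<Rightarrow> 'k mat set" where
  "O_minus \<delta> n = isometry_group n (form_minus \<delta> n)"

(* intended for even k; the dimension is k, not k div 2 *)
definition Sp :: "nat \<Rightarrow> 'k::field mat set" where
  "Sp k = (let l = k div 2 in
     isometry_group k (four_block_mat (0\<^sub>m l l) (1\<^sub>m l) (- 1\<^sub>m l) (0\<^sub>m l l)))"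

(* If 'k is algebraically closed of characteristic p and Q is a positive power of p, then
   fixed_field Q is the subfield of 'k with exactly Q elements.  Below, 'k is the algebraic
   closure of the finite base field, so that all fields of order q^m live in one type. *)
definition fixed_field :: "nat \<Rightarrow> 'k::field set" where
  "fixed_field Q = {x. x ^ Q = x}"

(* the inverse of an invertible matrix with entries in a subfield has entries in that subfield *)
definition GL_over :: "nat \<Rightarrow> nat \<Rightarrow> 'k::field mat set" where
  "GL_over n Q = {A \<in> GL n. elements_mat A \<subseteq> fixed_field Q}"

(* x \<mapsto> x ^ Q is the involution of the field of order Q\<^sup>2 over the field of order Q *)
definition U_over :: "nat \<Rightarrow> nat \<Rightarrow> 'k::field mat set" where
  "U_over n Q = {A \<in> GL_over n (Q\<^sup>2). transpose_mat (map_mat (\<lambda>x. x ^ Q) A) * A = 1\<^sub>m n}"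

(* reflect_poly \<phi> is z ^ degree \<phi> * \<phi> (1 / z) *)
definition conj_poly :: "'k::field poly \<Rightarrow> 'k poly" where
  "conj_poly \<phi> = smult (inverse (coeff \<phi> 0)) (reflect_poly \<phi>)"

definition char_poly_proportion :: "'k::field mat set \<Rightarrow> 'k poly \<Rightarrow> real" where
  "char_poly_proportion G \<phi> = real (card {A \<in> G. char_poly A = \<phi>}) / real (card G)"

(* all divisions in exponents, here and in the theorem, are exact *)
definition F :: "'k::{field,finite} itself \<Rightarrow> nat \<Rightarrow> real" where
  "F _ k =
     (if even k
      then real CARD('k) ^ (k\<^sup>2 div 2) / real (card (Sp k :: 'k mat set))
      else real CARD('k) ^ ((k - 1)\<^sup>2 div 2) / real (card (Sp (k - 1) :: 'k mat set)))"

end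

theory Submission
  imports Defs "HOL-Computational_Algebra.Formal_Power_Series"
begin

text \<open>
  By orbit counting, and since nondegenerate symmetric forms over a finite field of odd order fall
  into two congruence classes, the sum of the two proportions is the number of pairs \<open>(A, B)\<close> of a
  nondegenerate symmetric form \<open>B\<close> and an isometry \<open>A\<close> of \<open>B\<close> with characteristic polynomial \<open>\<phi>\<close>,
  divided by the order of the general linear group; call it the mass of \<open>\<phi>\<close>. Adding a vector \<open>v\<close> to
  \<open>(A, B)\<close> and sorting by the form \<open>(h, k) \<mapsto> B(h(A)v, k(A)v)\<close> on polynomials, whose radical is
  generated by some \<open>\<chi>\<close>, and by the annihilator \<open>\<chi>\<rho>\<close> of \<open>v\<close>, expresses \<open>q\<^sup>n\<close> times the mass of
  \<open>\<phi>\<close> by the masses of the quotients of \<open>\<phi>\<close> by \<open>\<chi>\<rho>\<close> times the conjugate of \<open>\<rho>\<close>. This recursion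
  determines the mass, shows that it is multiplicative on coprime self-conjugate factors, and for
  powers of one factor becomes an identity of power series whose solution is compared with the
  recursions for the orders of the symplectic, unitary and general linear groups.
\<close>

text \<open>Summing over both types of forms removes discriminants: no sign has to be followed
  through a factorization, and it is the sum that turns out to be multiplicative. The conjugate of
  \<rho> appears because the radical of the cyclic space of v, of dimension deg \<rho>, is totally
  isotropic; it is dual to a second isotropic space, on which A acts, modulo the rest, by the
  inverse transpose. The vector v = 0 returns the mass of \<phi> itself, so the recursion has the
  coefficient q^n - 1, nonzero for n > 0. The obstacle is the number of forms whose radical is
  exactly the ideal of \<chi>. It is reached through its sum over the divisors of a self-conjugate
  polynomial \<psi>: these forms are the solutions of a symmetric Toeplitz system, a space of
  dimension about half of deg \<psi>, with corrections caused by the roots 1 and -1. The corrections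
  are why powers of z - 1 and z + 1 lead to symplectic groups; the number of polynomials with a
  given norm \<rho> times its conjugate tells unitary from general linear groups. The number of
  auxiliary frames cancels and is never evaluated.\<close>

abbreviation mats :: "nat \<Rightarrow> nat \<Rightarrow> 'a mat set" where "mats \<equiv> carrier_mat"
abbreviation zm :: "nat \<Rightarrow> nat \<Rightarrow> 'a::zero mat" where "zm \<equiv> zero_mat"
abbreviation im :: "nat \<Rightarrow> 'a::{zero,one} mat" where "im \<equiv> one_mat"
abbreviation bil :: "'a::semiring_0 mat \<Rightarrow> 'a mat \<Rightarrow> 'a mat \<Rightarrow> 'a mat" where
 "bil B S U \<equiv> S\<^sup>T * (B * U)"

section \<open>Matrix identities under dimension conditions\<close>

lemma mat_assoc: "dim_col A = dim_row B ==> dim_col B = dim_row C ==> A * B * C = A * (B * C)"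
 for A B C :: "'a::semiring_0 mat"
 by (rule assoc_mult_mat) auto

lemma mat_distrib_left: "dim_col A = dim_row B ==> dim_row B = dim_row C ==> dim_col B = dim_col C
  ==> A * (B + C) = A * B + A * C"
 for A B C :: "'a::semiring_0 mat"
 by (rule mult_add_distrib_mat) auto

lemma mat_distrib_right: "dim_col A = dim_row C ==> dim_row A = dim_row B ==> dim_col A = dim_col B
  ==> (A + B) * C = A * C + B * C"
 for A B C :: "'a::semiring_0 mat"
 by (rule add_mult_distrib_mat[of _ "dim_row A" "dim_col A"]) auto

lemma mat_diff_left: "dim_col A = dim_row B ==> dim_row B = dim_row C ==> dim_col B = dim_col C
  ==> A * (B - C) = A * B - A * C"
 for A B C :: "'a::ring mat"
 by (rule mult_minus_distrib_mat) auto

lemma mat_diff_right: "dim_col A = dim_row C ==> dim_row A = dim_row B ==> dim_col A = dim_col B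
  ==> (A - B) * C = A * C - B * C"
 for A B C :: "'a::ring mat"
 by (rule minus_mult_distrib_mat[of _ "dim_row A" "dim_col A"]) auto

lemma mat_transpose_mult: "dim_col A = dim_row B ==> (A * B)\<^sup>T = B\<^sup>T * A\<^sup>T"
 for A B :: "'a::comm_semiring_0 mat"
 by (rule transpose_mult) auto

lemma mat_smult_left: "dim_col A = dim_row B ==> (k \<cdot>\<^sub>m A) * B = k \<cdot>\<^sub>m (A * B)"
 for A B :: "'a::comm_semiring_0 mat"
 by (rule mult_smult_assoc_mat) auto

lemma mat_smult_right: "dim_col A = dim_row B ==> A * (k \<cdot>\<^sub>m B) = k \<cdot>\<^sub>m (A * B)"
 for A B :: "'a::comm_semiring_0 mat"
 by (rule mult_smult_distrib) auto

lemma transpose_smult: "(k \<cdot>\<^sub>m A)\<^sup>T = k \<cdot>\<^sub>m A\<^sup>T"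
 by (rule eq_matI) auto

lemma mat_zero_left: "dim_row B = m ==> zm n m * B = zm n (dim_col B)"
 for B :: "'a::semiring_0 mat"
 by (rule left_mult_zero_mat) auto

lemma mat_zero_right: "dim_col A = m ==> A * zm m k = zm (dim_row A) k"
 for A :: "'a::semiring_0 mat"
 by (rule right_mult_zero_mat) auto

lemma mat_one_left: "dim_row B = n ==> im n * B = B"
 for B :: "'a::semiring_1 mat"
 by (rule left_mult_one_mat) auto

lemma mat_one_right: "dim_col B = n ==> B * im n = B"
 for B :: "'a::semiring_1 mat"
 by (rule right_mult_one_mat) auto

lemma mat_add_zero_left: "dim_row B = n ==> dim_col B = m ==> zm n m + B = B"
 for B :: "'a::comm_monoid_add mat"
 by (rule left_add_zero_mat) auto

lemma mat_add_zero_right: "dim_row B = n ==> dim_col B = m ==> B + zm n m = B"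
 for B :: "'a::comm_monoid_add mat"
 by (rule right_add_zero_mat) auto

lemma transpose_add_dim: "dim_row A = dim_row B ==> dim_col A = dim_col B
  ==> (A + B)\<^sup>T = A\<^sup>T + B\<^sup>T"
 by (rule transpose_add[of _ "dim_row A" "dim_col A"]) auto

lemma transpose_diff_dim: "dim_row A = dim_row B ==> dim_col A = dim_col B
  ==> (A - B)\<^sup>T = A\<^sup>T - B\<^sup>T"
 by (rule transpose_minus[of _ "dim_row A" "dim_col A"]) auto

lemmas mat_ring = mat_assoc mat_distrib_left mat_distrib_right mat_diff_left mat_diff_right
 mat_transpose_mult mat_smult_left mat_smult_right mat_zero_left mat_zero_right
 mat_one_left mat_one_right mat_add_zero_left mat_add_zero_right
 transpose_add_dim transpose_diff_dim transpose_smult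

text \<open>Products are normalised to the right, so a product with a known value is no longer a
  subterm once another factor follows it. This lemma and the next put the known value back.\<close>

lemma mat_mult_eqD:
 fixes A1 A2 A3 A4 :: "'a::semiring_0 mat"
 assumes "A1 * A2 = A3" and "dim_col A1 = dim_row A2" and "dim_col A2 = dim_row A4"
 shows "A1 * (A2 * A4) = A3 * A4"
 using assms mat_assoc by metis

lemma mat_mult3_eqD:
 fixes A1 A2 A3 A4 A5 :: "'a::semiring_0 mat"
 assumes "A1 * (A2 * A5) = A3" and "dim_col A1 = dim_row A2" and "dim_col A2 = dim_row A5" and "dim_col A5 = dim_row A4"
 shows "A1 * (A2 * (A5 * A4)) = A3 * A4"
 using assms by (metis mat_assoc index_mult_mat(2) index_mult_mat(3))

section \<open>Invertible matrices and frames\<close>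

lemma GL_iff_det: "A : GL n \<longleftrightarrow> A : mats n n & det A ~= 0"
proof
 assume A: "A : GL n"
 hence c: "A : mats n n" by (simp add: GL_def)
 from A obtain B where B: "inverts_mat A B" "inverts_mat B A" by (auto simp: GL_def invertible_mat_def)
 have AB: "A * B = im n" using B(1) c by (auto simp: inverts_mat_def)
 have BA: "B * A = im (dim_row B)" using B(2) by (simp add: inverts_mat_def)
 have "dim_col B = n" using arg_cong[OF AB, of dim_col] by simp
 moreover have "dim_row B = n" using arg_cong[OF BA, of dim_col] c by simp
 ultimately have "B : mats n n" by auto
 hence "det A * det B = 1" using det_mult[OF c] AB by (metis det_one)
 thus "A : mats n n & det A ~= 0" using c by auto
next
 assume A: "A : mats n n & det A ~= 0"
 hence "A \<in> Units (ring_mat TYPE('a) n ())" by (intro det_non_zero_imp_unit) auto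
 then obtain B where "B : mats n n" "B * A = im n" "A * B = im n"
  by (auto simp: Units_def ring_mat_def)
 thus "A : GL n" using A by (auto simp: GL_def invertible_mat_def inverts_mat_def)
qed

lemma GL_carrier: "A : GL n ==> A : mats n n"
 by (simp add: GL_def)

lemma GL_dim: "A : GL n ==> dim_row A = n" "A : GL n ==> dim_col A = n"
 by (auto dest: GL_carrier)

lemma GL_inverse:
 assumes "A : GL n"
 obtains B where "B : GL n" "A * B = im n" "B * A = im n"
proof -
 have A: "A : mats n n" "det A ~= 0" using assms by (auto simp: GL_iff_det)
 hence "A \<in> Units (ring_mat TYPE('a) n ())" by (intro det_non_zero_imp_unit) auto
 then obtain B where B: "B : mats n n" "B * A = im n" "A * B = im n"
  by (auto simp: Units_def ring_mat_def)
 hence "det B * det A = 1" using det_mult[OF B(1) A(1)] by simp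
 hence "det B ~= 0" by auto
 thus ?thesis using that B by (auto simp: GL_iff_det)
qed

lemma GL_mult: "A : GL n ==> B : GL n ==> A * B : GL n"
 by (auto simp: GL_iff_det det_mult)

lemma GL_one: "im n : GL n"
 by (auto simp: GL_iff_det)

lemma GL_transpose: "A : GL n ==> A\<^sup>T : GL n"
 by (auto simp: GL_iff_det det_transpose)

lemma GL_mult_cancel:
 assumes "A * B : GL n" and "A : mats n n" and "B : mats n n"
 shows "A : GL n" "B : GL n"
 using assms by (auto simp: GL_iff_det det_mult)

lemma GL_one_sided_inverse:
 assumes "A * B = im n" and "A : mats n n" and "B : mats n n"
 shows "A : GL n" "B : GL n" "B * A = im n"
proof -
 have "A * B : GL n" using assms GL_one by simp
 thus "A : GL n" "B : GL n" using GL_mult_cancel[of A B n] assms by blast+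
 show "B * A = im n" using mat_mult_left_right_inverse assms by blast
qed

lemma GL_cancel_left:
 assumes "A : GL n" and "A * M0 = A * Y" and "dim_row M0 = n" and "dim_row Y = n"
 shows "M0 = Y"
proof -
 obtain B where B: "B : GL n" "B * A = im n" using GL_inverse assms by blast
 have "M0 = B * (A * M0)"
  using B(2) assms(3,4) GL_dim[OF assms(1)] GL_dim[OF B(1)] by (simp add: mat_assoc[symmetric] mat_one_left)
 also have "... = B * (A * Y)" using assms by simp
 also have "... = Y"
  using B(2) assms(3,4) GL_dim[OF assms(1)] GL_dim[OF B(1)] by (simp add: mat_assoc[symmetric] mat_one_left)
 finally show ?thesis .
qed

text \<open>Vectors are matrices with one column throughout, so that one associativity law covers
  matrices, vectors and pairings alike.\<close>

definition injective_mat :: "'a::field mat => bool" where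
 "injective_mat M \<longleftrightarrow> (\<forall>c \<in> mats (dim_col M) 1. M * c = zm (dim_row M) 1 \<longrightarrow> c = zm (dim_col M) 1)"

lemma injective_matD:
 assumes "injective_mat M" and "M * C = zm (dim_row M) (dim_col C)" and "dim_row C = dim_col M"
 shows "C = zm (dim_col M) (dim_col C)"
proof (rule eq_matI)
 fix i j assume ij: "i < dim_row (zm (dim_col M) (dim_col C) :: 'a mat)"
  "j < dim_col (zm (dim_col M) (dim_col C) :: 'a mat)"
 define c where "c = mat (dim_row C) 1 (%(i, _). C $$ (i, j))"
 have col: "col c 0 = col C j" using ij by (auto simp: c_def)
 have "M * c = zm (dim_row M) 1"
 proof (rule eq_matI)
  fix k l assume kl: "k < dim_row (zm (dim_row M) 1 :: 'a mat)" "l < dim_col (zm (dim_row M) 1 :: 'a mat)"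
  hence "(M * c) $$ (k, l) = row M k \<bullet> col C j" using col by (simp add: c_def)
  also have "... = (M * C) $$ (k, j)" using kl ij by simp
  finally show "(M * c) $$ (k, l) = zm (dim_row M) 1 $$ (k, l)" using assms(2) kl ij by simp
 qed (auto simp: c_def)
 hence "c = zm (dim_col M) 1" using assms(1,3) by (auto simp: injective_mat_def c_def)
 hence "c $$ (i, 0) = 0" using ij by simp
 thus "C $$ (i, j) = zm (dim_col M) (dim_col C) $$ (i, j)" using ij assms(3) by (simp add: c_def)
qed (use assms in auto)

lemma injective_mat_vecD:
 assumes "injective_mat M" and "M * c = zm n 1" and "M : mats n m" and "c : mats m 1"
 shows "c = zm m 1"
 using assms unfolding injective_mat_def by auto

lemma injective_mat_eqD:
 assumes "injective_mat M" and "M * C = M * D" and "dim_row C = dim_col M" and "dim_row D = dim_col M"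
 shows "C = D"
proof -
 have d: "dim_col C = dim_col D" using arg_cong[OF assms(2), of dim_col] by simp
 have "M * (C - D) = zm (dim_row M) (dim_col (C - D))" using assms d by (simp add: mat_ring) auto
 hence "C - D = zm (dim_col M) (dim_col (C - D))"
  using assms d by (intro injective_matD) auto
 hence z: "C - D = zm (dim_col M) (dim_col D)" by simp
 show ?thesis
 proof (rule eq_matI)
  fix i j assume "i < dim_row D" "j < dim_col D"
  thus "C $$ (i,j) = D $$ (i,j)" using arg_cong[OF z, of "%M0. M0 $$ (i,j)"] assms d by simp
 qed (use assms d in auto)
qed

lemma injective_GL:
 assumes "M : mats n n" and "injective_mat M"
 shows "M : GL n"
proof (rule ccontr)
 assume "M \<notin> GL n"
 hence "det M = 0" using assms by (simp add: GL_iff_det)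
 then obtain v where v: "v \<in> carrier_vec n" "v ~= 0\<^sub>v n" "M *\<^sub>v v = 0\<^sub>v n"
  using det_0_iff_vec_prod_zero_field[OF assms(1)] by auto
 define c where "c = mat n 1 (%(i, _). v $ i)"
 have "M * c = zm n 1"
 proof (rule eq_matI)
  fix k l assume kl: "k < dim_row (zm n 1 :: 'a mat)" "l < dim_col (zm n 1 :: 'a mat)"
  have "col c 0 = v" using v by (auto simp: c_def)
  hence "(M * c) $$ (k, l) = (M *\<^sub>v v) $ k" using kl assms by (simp add: c_def)
  thus "(M * c) $$ (k, l) = zm n 1 $$ (k, l)" using v kl by simp
 qed (use assms in "auto simp: c_def")
 hence "c = zm n 1" using assms by (auto simp: injective_mat_def c_def)
 hence "c $$ (i, 0) = 0" if "i < n" for i using that by simp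
 hence "v $ i = 0" if "i < n" for i using that by (simp add: c_def)
 hence "v = 0\<^sub>v n" using v(1) by auto
 thus False using v by simp
qed

lemma GL_injective: assumes "M : GL n" shows "injective_mat M"
 unfolding injective_mat_def
proof (intro ballI impI)
 fix c assume c: "c : mats (dim_col M) 1" "M * c = zm (dim_row M) 1"
 hence "M * c = M * zm (dim_col M) 1" using GL_dim[OF assms] by (simp add: mat_ring)
 thus "c = zm (dim_col M) 1" by (rule GL_cancel_left[OF assms]) (use c GL_dim[OF assms] in auto)
qed

lemma injective_mat_left_factor:
 assumes "injective_mat (L * M)" and "dim_col L = dim_row M"
 shows "injective_mat M"
 unfolding injective_mat_def
proof (intro ballI impI)
 fix c assume c: "c : mats (dim_col M) 1" "M * c = zm (dim_row M) 1"
 hence "L * M * c = zm (dim_row (L * M)) 1" using assms(2) by (simp add: mat_ring)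
 thus "c = zm (dim_col M) 1" using assms(1) c by (auto simp: injective_mat_def)
qed

text \<open>The entries come from an arbitrary finite set, so that the count serves both a finite
  field as a whole type and the finite subfields \<open>fixed_field Q\<close> of an algebraic
  closure.\<close>

lemma card_matrices_over:
 fixes K :: "'a set"
 assumes "finite K"
 shows "finite {A : mats n m. elements_mat A \<subseteq> K}"
  and "card {A : mats n m. elements_mat A \<subseteq> K} = card K ^ (n * m)"
proof -
 let ?D = "{..<n} \<times> {..<m}"
 let ?P = "PiE ?D (%_. K)"
 have bij: "bij_betw (mat n m) ?P {A : mats n m. elements_mat A \<subseteq> K}"
 proof (rule bij_betwI[where g = "%A. restrict (%ij. A $$ ij) ?D"])
  show "mat n m \<in> ?P \<rightarrow> {A : mats n m. elements_mat A \<subseteq> K}"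
   by (auto simp: elements_mat_def PiE_def Pi_def)
  show "(%A. restrict (%ij. A $$ ij) ?D) \<in> {A : mats n m. elements_mat A \<subseteq> K} \<rightarrow> ?P"
  proof (intro funcsetI)
   fix A assume "A \<in> {A : mats n m. elements_mat A \<subseteq> K}"
   hence A: "A : mats n m" "elements_mat A \<subseteq> K" by auto
   have "A $$ ij : K" if "ij \<in> ?D" for ij
    using that A(1) by (intro subsetD[OF A(2)]) (cases ij, auto)
   thus "restrict (%ij. A $$ ij) ?D \<in> ?P" by (intro restrict_PiE_iff[THEN iffD2]) auto
  qed
  show "restrict (%ij. mat n m f $$ ij) ?D = f" if "f \<in> ?P" for f
   using that by (auto simp: fun_eq_iff PiE_def extensional_def restrict_def)
  show "mat n m (restrict (%ij. A $$ ij) ?D) = A" if "A \<in> {A : mats n m. elements_mat A \<subseteq> K}" for A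
   using that by (intro eq_matI) auto
 qed
 have "finite ?P" using assms by (intro finite_PiE) auto
 thus "finite {A : mats n m. elements_mat A \<subseteq> K}" using bij bij_betw_finite by blast
 have "card ?P = card K ^ (n * m)" by (subst card_PiE) (auto simp: card_cartesian_product)
 thus "card {A : mats n m. elements_mat A \<subseteq> K} = card K ^ (n * m)"
  using bij_betw_same_card[OF bij] by simp
qed

lemma finite_carrier_mat: "finite (mats n m :: 'a::finite mat set)"
 using card_matrices_over(1)[of "UNIV :: 'a set" n m] by simp

lemma card_carrier_mat: "card (mats n m :: 'a::finite mat set) = CARD('a) ^ (n * m)"
 using card_matrices_over(2)[of "UNIV :: 'a set" n m] by simp

section \<open>Block columns and block rows\<close>

definition hc :: "'a mat => 'a mat => 'a mat" where
 "hc A B = mat (dim_row A) (dim_col A + dim_col B)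
  (%(i, j). if j < dim_col A then A $$ (i, j) else B $$ (i, j - dim_col A))"

definition vc :: "'a mat => 'a mat => 'a mat" where
 "vc A B = mat (dim_row A + dim_row B) (dim_col A)
  (%(i, j). if i < dim_row A then A $$ (i, j) else B $$ (i - dim_row A, j))"

lemma hc_dim [simp]: "dim_row (hc A B) = dim_row A" "dim_col (hc A B) = dim_col A + dim_col B"
 by (auto simp: hc_def)

lemma vc_dim [simp]: "dim_row (vc A B) = dim_row A + dim_row B" "dim_col (vc A B) = dim_col A"
 by (auto simp: vc_def)

lemma hc_carrier: "A : mats n a ==> B : mats n b ==> hc A B : mats n (a + b)"
 by (auto simp: hc_def)

lemma vc_carrier: "A : mats a n ==> B : mats b n ==> vc A B : mats (a + b) n"
 by (auto simp: vc_def)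

lemma transpose_hc: "dim_row A = dim_row B ==> (hc A B)\<^sup>T = vc (A\<^sup>T) (B\<^sup>T)"
 by (rule eq_matI) (auto simp: hc_def vc_def)

lemma transpose_vc: "dim_col A = dim_col B ==> (vc A B)\<^sup>T = hc (A\<^sup>T) (B\<^sup>T)"
 by (rule eq_matI) (auto simp: hc_def vc_def)

lemma mult_hc:
 assumes "dim_col M = dim_row A" and "dim_row A = dim_row B"
 shows "M * hc A B = hc (M * A) (M * B)"
proof (rule eq_matI)
 fix i j assume ij: "i < dim_row (hc (M * A) (M * B))" "j < dim_col (hc (M * A) (M * B))"
 have "col (hc A B) j = (if j < dim_col A then col A j else col B (j - dim_col A))"
  using ij assms by (auto simp: hc_def)
 thus "(M * hc A B) $$ (i, j) = hc (M * A) (M * B) $$ (i, j)"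
  using ij by (auto simp: hc_def)
qed (use assms in auto)

lemma vc_mult:
 assumes "dim_row M = dim_col A" and "dim_col A = dim_col B"
 shows "vc A B * M = vc (A * M) (B * M)"
proof (rule eq_matI)
 fix i j assume ij: "i < dim_row (vc (A * M) (B * M))" "j < dim_col (vc (A * M) (B * M))"
 have "row (vc A B) i = (if i < dim_row A then row A i else row B (i - dim_row A))"
  using ij assms by (auto simp: vc_def)
 thus "(vc A B * M) $$ (i, j) = vc (A * M) (B * M) $$ (i, j)"
  using ij by (auto simp: vc_def)
qed (use assms in auto)

lemma sum_lessThan_add: "(\<Sum>k<a + b. f k) = (\<Sum>k<a. f k) + (\<Sum>k<b. f (a + k :: nat))"
 for f :: "nat => 'a::comm_monoid_add"
 by (induction b) (auto simp: add.assoc)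

text \<open>A frame times stacked coordinates is a linear combination of its blocks; every expansion
  of a vector in a frame rests on this identity.\<close>

lemma hc_mult_vc:
 fixes A :: "'a::semiring_0 mat"
 assumes "dim_row A = dim_row B" and "dim_col A = dim_row C" and "dim_col B = dim_row D" and "dim_col C = dim_col D"
 shows "hc A B * vc C D = A * C + B * D"
proof (rule eq_matI)
 fix i j assume ij: "i < dim_row (A * C + B * D)" "j < dim_col (A * C + B * D)"
 have "(hc A B * vc C D) $$ (i, j) = (\<Sum>k<dim_row C + dim_row D. hc A B $$ (i, k) * vc C D $$ (k, j))"
  using ij assms by (simp add: scalar_prod_def lessThan_atLeast0)
 also have "... = (\<Sum>k<dim_row C. hc A B $$ (i, k) * vc C D $$ (k, j))
   + (\<Sum>k<dim_row D. hc A B $$ (i, dim_row C + k) * vc C D $$ (dim_row C + k, j))"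
  by (rule sum_lessThan_add)
 also have "... = (A * C + B * D) $$ (i, j)"
  using ij assms by (auto simp: scalar_prod_def lessThan_atLeast0 hc_def vc_def intro!: arg_cong2[where f = "(+)"] sum.cong)
 finally show "(hc A B * vc C D) $$ (i, j) = (A * C + B * D) $$ (i, j)" .
qed (use assms in auto)

lemma hc_eqD:
 assumes "hc A B = hc C D" and "dim_col A = dim_col C" and "dim_row A = dim_row B" and "dim_row C = dim_row D"
 shows "A = C" "B = D"
proof -
 have dr: "dim_row A = dim_row C" using arg_cong[OF assms(1), of dim_row] by simp
 have dc: "dim_col B = dim_col D" using arg_cong[OF assms(1), of dim_col] assms(2) by simp
 have e: "hc A B $$ (i, j) = hc C D $$ (i, j)" for i j using assms(1) by simp
 show "A = C"
 proof (rule eq_matI)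
  fix i j assume "i < dim_row C" "j < dim_col C"
  thus "A $$ (i,j) = C $$ (i,j)" using e[of i j] assms dr dc by (simp add: hc_def)
 qed (use assms dr in auto)
 show "B = D"
 proof (rule eq_matI)
  fix i j assume "i < dim_row D" "j < dim_col D"
  thus "B $$ (i,j) = D $$ (i,j)" using e[of i "dim_col A + j"] assms dr dc by (simp add: hc_def)
 qed (use assms dr dc in auto)
qed

lemma vc_eqD:
 assumes "vc A B = vc C D" and "dim_row A = dim_row C" and "dim_col A = dim_col B" and "dim_col C = dim_col D"
 shows "A = C" "B = D"
proof -
 have "hc (A\<^sup>T) (B\<^sup>T) = hc (C\<^sup>T) (D\<^sup>T)"
  using assms by (simp add: transpose_vc[symmetric])
 hence "A\<^sup>T = C\<^sup>T" "B\<^sup>T = D\<^sup>T"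
  using assms by (auto dest: hc_eqD)
 thus "A = C" "B = D" by (metis transpose_transpose)+
qed

lemma hc_split:
 assumes "M : mats n (a + b)"
 obtains A B where "A : mats n a" "B : mats n b" "M = hc A B"
proof
 show "M = hc (mat n a (%ij. M $$ ij)) (mat n b (%(i, j). M $$ (i, a + j)))"
  using assms by (intro eq_matI) (auto simp: hc_def)
qed auto

lemma vc_split:
 assumes "M : mats (a + b) n"
 obtains A B where "A : mats a n" "B : mats b n" "M = vc A B"
proof
 show "M = vc (mat a n (%ij. M $$ ij)) (mat b n (%(i, j). M $$ (a + i, j)))"
  using assms by (intro eq_matI) (auto simp: vc_def)
qed auto

lemma hc_assoc:
 assumes "dim_row A = dim_row B"
 shows "hc (hc A B) C = hc A (hc B C)"
 using assms by (intro eq_matI) (auto simp: hc_def)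

lemma vc_zero: "vc (zm a n) (zm b n) = zm (a + b) n"
 by (rule eq_matI) (auto simp: vc_def)

lemma hc_zero: "hc (zm n a) (zm n b) = zm n (a + b)"
 by (rule eq_matI) (auto simp: hc_def)

lemma four_block_hc_vc:
 assumes "A : mats a c" "B : mats a d" "C : mats b c" "D : mats b d"
 shows "four_block_mat A B C D = vc (hc A B) (hc C D)"
 using assms by (intro eq_matI) (auto simp: vc_def hc_def)

lemma vc_hc:
 assumes "A : mats a c" "B : mats a d" "C : mats b c" "D : mats b d"
 shows "vc (hc A B) (hc C D) = hc (vc A C) (vc B D)"
 using assms by (intro eq_matI) (auto simp: vc_def hc_def)

section \<open>Completion of frames and orthogonal complements\<close>

lemma injective_mat_extend:
 fixes M :: "'a::{field,finite} mat"
 assumes "M : mats n m" and "injective_mat M"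
 shows "m <= n & (\<exists>N \<in> mats n (n - m). hc M N : GL n)"
proof -
 have le: "m <= n" if "M : mats n m" "injective_mat M" for m and M :: "'a mat"
 proof -
  have "inj_on (%c. M * c) (mats m 1)"
   using that by (intro inj_onI) (auto intro!: injective_mat_eqD[of M])
  moreover have "(%c. M * c) ` mats m 1 \<subseteq> mats n 1" using that by auto
  ultimately have "card (mats m 1 :: 'a mat set) <= card (mats n 1 :: 'a mat set)"
   using card_inj_on_le finite_carrier_mat by blast
  moreover have "1 < CARD('a)"
   using card_mono[of "UNIV :: 'a set" "{0, 1}"] by auto
  ultimately show "m <= n" by (simp add: card_carrier_mat power_increasing_iff)
 qed
 from assms show ?thesis
 proof (induction "n - m" arbitrary: m M)
  case 0
  hence m: "m = n" using le by fastforce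
  hence "M : GL n" using 0 injective_GL by auto
  moreover have "hc M (zm n 0) = M" using 0 m by (intro eq_matI) (auto simp: hc_def)
  ultimately show ?case using m by (intro conjI bexI[of _ "zm n 0"]) auto
 next
  case (Suc k)
  \<comment> \<open>Counting replaces dimension theory: \<open>m < n\<close> columns reach at most
    q^m of the q^n vectors, and a missed vector \<open>w\<close> becomes the next column.\<close>
  have "(%c. M * c) ` mats m 1 ~= (mats n 1)"
  proof
   assume "(%c. M * c) ` mats m 1 = (mats n 1)"
   hence "card (mats n 1 :: 'a mat set) <= card (mats m 1 :: 'a mat set)"
    using card_image_le[OF finite_carrier_mat] by metis
   moreover have "1 < CARD('a)"
    using card_mono[of "UNIV :: 'a set" "{0, 1}"] by auto
   ultimately show False using Suc(2) by (simp add: card_carrier_mat power_increasing_iff)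
  qed
  moreover have "(%c. M * c) ` mats m 1 \<subseteq> mats n 1" using Suc.prems(1) by auto
  ultimately obtain w where w: "w : mats n 1" "w \<notin> (%c. M * c) ` mats m 1"
   by blast
  have w2: "M * c ~= w" if "c : mats m 1" for c using w(2) that by blast
  have inj: "injective_mat (hc M w)"
   unfolding injective_mat_def
  proof (intro ballI impI)
   fix c assume c: "c : mats (dim_col (hc M w)) 1" "hc M w * c = zm (dim_row (hc M w)) 1"
   obtain a b where ab: "a : mats m 1" "b : mats 1 1" "c = vc a b"
    using vc_split[of c m 1 1] c(1) Suc.prems w by auto
   define x where "x = b $$ (0, 0)"
   have b: "b = x \<cdot>\<^sub>m im 1" using ab(2) by (auto simp: x_def)
   have e: "M * a + x \<cdot>\<^sub>m w = zm n 1"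
    using c(2) ab Suc.prems w by (simp add: hc_mult_vc b mat_ring)
   \<comment> \<open>A nonzero coefficient \<open>x\<close> of \<open>w\<close> could be divided
     out, which would put \<open>w\<close> into the image of \<open>M\<close>.\<close>
   have "x = 0"
   proof (rule ccontr)
    assume x: "x ~= 0"
    have "M * ((- inverse x) \<cdot>\<^sub>m a) = (- inverse x) \<cdot>\<^sub>m (M * a)"
     using ab Suc.prems by (simp add: mat_ring)
    also have "... = w"
    proof (rule eq_matI)
     fix i j assume ij: "i < dim_row w" "j < dim_col w"
     have "(M * a + x \<cdot>\<^sub>m w) $$ (i, j) = 0" using e ij w by simp
     hence "(M * a) $$ (i, j) = - x * w $$ (i, j)" using ij w Suc.prems ab
      by (simp add: add_eq_0_iff2 del: index_mult_mat(1))
     thus "((- inverse x) \<cdot>\<^sub>m (M * a)) $$ (i, j) = w $$ (i, j)"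
      using ij w Suc.prems ab x by (simp del: index_mult_mat(1))
    qed (use w Suc.prems ab in auto)
    finally show False using w2[of "(- inverse x) \<cdot>\<^sub>m a"] ab by auto
   qed
   hence "b = zm 1 1" using b by auto
   moreover have "M * a = zm n 1" 
   proof -
    have "x \<cdot>\<^sub>m w = zm n 1" using w(1) by (intro eq_matI) (auto simp: \<open>x = 0\<close>)
    thus ?thesis using e Suc.prems ab by (simp add: mat_add_zero_right)
   qed
   ultimately have "a = zm m 1" "b = zm 1 1" using Suc.prems ab by (auto simp: injective_mat_def)
   thus "c = zm (dim_col (hc M w)) 1" using ab vc_zero[of m 1 1] Suc.prems w by simp
  qed
  have "Suc m <= n & (\<exists>N\<in>mats n (n - Suc m). hc (hc M w) N : GL n)"
   using Suc.prems w inj Suc(2) by (intro Suc(1)) (auto simp: hc_carrier)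
  then obtain N where N: "N : mats n (n - Suc m)" "hc (hc M w) N : GL n" "Suc m <= n" by auto
  hence "hc M (hc w N) : GL n" using Suc.prems w by (simp add: hc_assoc)
  moreover have "hc w N : mats n (n - m)"
   using hc_carrier[OF w(1) N(1)] N(3) by (simp add: Suc_diff_Suc)
  ultimately show ?case using N by auto
 qed
qed

text \<open>Gram-Schmidt for a whole block: an arbitrary completion \<open>N\<close> of
  \<open>U\<close> is corrected by its projection to the span of \<open>U\<close>. The projection
  exists because the Gram matrix of \<open>U\<close> is invertible.\<close>

lemma orthogonal_complement_frame:
 fixes B :: "'a::{field,finite} mat"
 assumes B: "B : mats n n" and U: "U : mats n u"
  and G: "bil B U U : GL u"
 shows "u <= n & (\<exists>Z \<in> mats n (n - u). hc U Z : GL n & bil B U Z = zm u (n - u))"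
proof -
 have "injective_mat (U\<^sup>T * B * U)" using GL_injective[OF G] B U by (simp add: mat_ring)
 hence injU: "injective_mat U" using B U injective_mat_left_factor by fastforce
 then obtain N where un: "u <= n" and N: "N : mats n (n - u)" "hc U N : GL n"
  using injective_mat_extend[OF U] by auto
 obtain H where H: "H : GL u" "bil B U U * H = im u" using G GL_inverse by blast
 have Hc: "H : mats u u" using H GL_carrier by blast
 define S where "S = H * (bil B U N)"
 have S: "S : mats u (n - u)" using Hc U B N unfolding S_def by auto
 define Z where "Z = N - U * S"
 have Z: "Z : mats n (n - u)" using N U S unfolding Z_def by auto
 have H2: "U\<^sup>T * (B * (U * H)) = im u" using H(2) Hc U B by (simp add: mat_ring)
 have "U\<^sup>T * (B * (U * S)) = U\<^sup>T * (B * (U * H)) * (bil B U N)"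
  unfolding S_def using Hc U B N by (simp add: mat_ring)
 also have "... = bil B U N" using H2 U B N by (simp add: mat_ring)
 finally have US: "U\<^sup>T * (B * (U * S)) = bil B U N" .
 have UZ: "bil B U Z = zm u (n - u)"
  unfolding Z_def using U S N B by (simp add: mat_ring US)
 have "hc U Z : mats n n" using U Z un hc_carrier[OF U Z] by simp
 moreover have "injective_mat (hc U Z)"
  unfolding injective_mat_def
 proof (intro ballI impI)
  fix c assume c: "c : mats (dim_col (hc U Z)) 1" "hc U Z * c = zm (dim_row (hc U Z)) 1"
  obtain a b where ab: "a : mats u 1" "b : mats (n - u) 1" "c = vc a b"
   using vc_split[of c u "n - u" 1] c(1) U Z by auto
  have e: "U * a + Z * b = zm n 1" using c(2) ab U Z by (simp add: hc_mult_vc)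
  have Zb: "Z * b = N * b - U * (S * b)" unfolding Z_def using U S N ab by (simp add: mat_ring)
  \<comment> \<open>The correction is a unipotent change of coordinates: \<open>(a, b)\<close> in
    the new frame is the same vector as \<open>(a - S * b, b)\<close> in the old one.\<close>
  have "hc U N * vc (a - S * b) b = U * (a - S * b) + N * b"
   using U N S ab by (intro hc_mult_vc) auto
  also have "... = U * a + Z * b" unfolding Zb using U N S ab by (simp add: mat_ring) (intro eq_matI; simp)
  finally have "hc U N * vc (a - S * b) b = zm n 1" using e by simp
  moreover have "injective_mat (hc U N)" using N GL_injective by blast
  moreover have "vc (a - S * b) b : mats n 1"
   using vc_carrier[of "a - S * b" u 1 b "n - u"] ab S un by auto
  moreover have "hc U N : mats n n" using N(2) GL_carrier by blast
  ultimately have "vc (a - S * b) b = zm n 1"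
   using injective_mat_vecD[of "hc U N" _ n n] by simp
  hence z: "vc (a - S * b) b = vc (zm u 1) (zm (n - u) 1)" using un by (simp add: vc_zero)
  have "a - S * b = zm u 1" "b = zm (n - u) 1"
   using vc_eqD[OF z] ab S by auto
  moreover have "a - zm u 1 = a" using ab by (intro eq_matI) auto
  ultimately have "a = zm u 1" "b = zm (n - u) 1" using S by (auto simp: mat_zero_right)
  thus "c = zm (dim_col (hc U Z)) 1" using ab vc_zero U Z by auto
 qed
 ultimately have "hc U Z : GL n" using injective_GL by auto
 thus ?thesis using un Z UZ by blast
qed

text \<open>A vector in the span of \<open>Z\<close> that is orthogonal to \<open>Z\<close> is
  orthogonal to \<open>U\<close> as well, hence to a whole basis, and must vanish since
  \<open>B\<close> is invertible.\<close>

lemma complement_nondegenerate: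
 fixes B :: "'a::field mat"
 assumes B: "B : GL n" and P: "hc U Z : GL n" and U: "U : mats n u" and Z: "Z : mats n m"
  and UZ: "bil B U Z = zm u m"
 shows "bil B Z Z : GL m"
proof (rule injective_GL)
 have Bc: "B : mats n n" using B GL_carrier by blast
 have nm: "n = u + m" using GL_dim[OF P] U Z by auto
 show "bil B Z Z : mats m m" using Bc Z by auto
 show "injective_mat (bil B Z Z)"
  unfolding injective_mat_def
 proof (intro ballI impI)
  fix c assume c: "c : mats (dim_col (bil B Z Z)) 1"
   "bil B Z Z * c = zm (dim_row (bil B Z Z)) 1"
  hence cm: "c : mats m 1" using Z by simp
  have 1: "Z\<^sup>T * (B * (Z * c)) = zm m 1" using c(2) cm Z Bc by (simp add: mat_ring)
  have 2: "U\<^sup>T * (B * (Z * c)) = zm u 1"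
   using mat_mult3_eqD[OF UZ, of c] cm Z Bc U by (simp add: mat_ring)
  have "(hc U Z)\<^sup>T * (B * (Z * c)) = vc (U\<^sup>T * (B * (Z * c))) (Z\<^sup>T * (B * (Z * c)))"
   using U Z Bc cm by (simp add: transpose_hc vc_mult)
  also have "... = zm n 1" using 1 2 nm by (simp add: vc_zero)
  finally have "(hc U Z)\<^sup>T * (B * (Z * c)) = (hc U Z)\<^sup>T * zm n 1"
   using GL_dim[OF P] by (simp add: mat_zero_right)
  hence "B * (Z * c) = zm n 1" by (rule GL_cancel_left[OF GL_transpose[OF P]]) (use Bc Z cm in auto)
  hence "B * (Z * c) = B * zm n 1" using Bc by (simp add: mat_zero_right)
  hence "Z * c = zm n 1" by (rule GL_cancel_left[OF B]) (use Z cm in auto)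
  hence "hc U Z * vc (zm u 1) c = zm n 1" using U Z cm by (simp add: hc_mult_vc mat_ring)
  moreover have "vc (zm u 1) c : mats n 1" using vc_carrier[of "zm u 1" u 1 c m] cm nm by simp
  ultimately have "vc (zm u 1) c = zm n 1"
   using injective_mat_vecD[OF GL_injective[OF P] _ GL_carrier[OF P]] by simp
  hence "vc (zm u 1) c = vc (zm u 1) (zm m 1)" using nm by (simp add: vc_zero)
  hence "c = zm m 1" using vc_eqD(2)[of "zm u 1" c "zm u 1" "zm m 1"] cm by auto
  thus "c = zm (dim_col (bil B Z Z)) 1" using Z by simp
 qed
qed

section \<open>Polynomials in a matrix applied to a vector: \<open>pv A v p\<close> is p(A) v by
  Horner's scheme\<close>

definition pv :: "'a::field mat => 'a mat => 'a poly => 'a mat" where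
 "pv A v p = fold_coeffs (%c w. c \<cdot>\<^sub>m v + A * w) p (zm (dim_row v) 1)"

context
 fixes A v :: "'a::field mat" and n :: nat
 assumes A: "A : mats n n" and v: "v : mats n 1"
begin

lemma pv_0: "pv A v 0 = zm n 1"
 using v by (simp add: pv_def)

lemma pv_pCons: "pv A v (pCons c p) = c \<cdot>\<^sub>m v + A * pv A v p"
proof (cases "p = 0 & c = 0")
 case True
 have "0 \<cdot>\<^sub>m v = zm n 1" using v by (intro eq_matI) auto
 thus ?thesis using True A by (simp add: pv_0 mat_ring)
next
 case False
 thus ?thesis
  by (cases "c = 0") (simp_all add: pv_def fold_coeffs_pCons_coeff_not_0_eq fold_coeffs_pCons_not_0_0_eq)
qed

lemma pv_carrier: "pv A v p : mats n 1"
 by (induction p rule: pCons_induct) (use A v in "auto simp: pv_0 pv_pCons")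

lemma pv_dim [simp]: "dim_row (pv A v p) = n" "dim_col (pv A v p) = Suc 0"
 using pv_carrier[of p] by auto

lemma pv_add: "pv A v (p + q) = pv A v p + pv A v q"
proof (induction p arbitrary: q rule: pCons_induct)
 case 0
 thus ?case by (simp add: pv_0 mat_ring)
next
 case (pCons a p)
 obtain b r where q: "q = pCons b r" by (cases q)
 show ?case unfolding q using A v
  by (simp add: pv_pCons pCons.IH mat_ring) (intro eq_matI; simp add: algebra_simps)
qed

lemma pv_smult: "pv A v (smult c p) = c \<cdot>\<^sub>m pv A v p"
proof (induction p rule: pCons_induct)
 case 0
 thus ?case by (simp add: pv_0)
next
 case (pCons a p)
 thus ?case using A v
  by (simp add: pv_pCons mat_ring) (intro eq_matI; simp add: algebra_simps)
qed

lemma pv_diff: "pv A v (p - q) = pv A v p - pv A v q"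
proof -
 have "pv A v (p - q) = pv A v (p + smult (-1) q)" by simp
 also have "... = pv A v p - pv A v q"
  by (simp only: pv_add pv_smult) (intro eq_matI; simp)
 finally show ?thesis .
qed

lemma pv_one: "pv A v 1 = v"
 using pv_pCons[of 1 0] A v by (simp add: pv_0 mat_ring one_pCons) (intro eq_matI; simp)

end

lemma pv_mult:
 fixes A v :: "'a::field mat"
 assumes A: "A : mats n n" and v: "v : mats n 1"
 shows "pv A v (p * q) = pv A (pv A v q) p"
proof (induction p rule: pCons_induct)
 case 0
 thus ?case using A v pv_carrier[OF A v] by (simp add: pv_0)
next
 case (pCons a p)
 have "pv A v (pCons a p * q) = a \<cdot>\<^sub>m pv A v q + (0 \<cdot>\<^sub>m v + A * pv A v (p * q))"
  by (simp add: pv_add[OF A v] pv_smult[OF A v] pv_pCons[OF A v])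
 also have "0 \<cdot>\<^sub>m v + A * pv A v (p * q) = A * pv A v (p * q)"
  using A v by (intro eq_matI) auto
 finally show ?case using pCons.IH by (simp add: pv_pCons[OF A pv_carrier[OF A v]])
qed

lemma pv_shift:
 fixes A v :: "'a::field mat"
 assumes A: "A : mats n n" and v: "v : mats n 1"
 shows "pv A v (pCons 0 p) = A * pv A v p"
proof -
 have "0 \<cdot>\<^sub>m v + A * pv A v p = A * pv A v p"
  using A v by (intro eq_matI) auto
 thus ?thesis by (simp add: pv_pCons[OF A v])
qed

text \<open>\<open>P\<close> carries the cyclic module of \<open>v'\<close> under \<open>A'\<close>
  to that of \<open>P * v'\<close> under \<open>A\<close>; changes of coordinates act on cyclic
  vectors through this identity.\<close>

lemma pv_intertwine:
 fixes A v :: "'a::field mat"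
 assumes A: "A : mats n n" and A': "A' : mats m m" and v': "v' : mats m 1"
  and P: "P : mats n m" and AP: "A * P = P * A'"
 shows "pv A (P * v') p = P * pv A' v' p"
proof -
 have v: "P * v' : mats n 1" using P v' by auto
 show ?thesis
 proof (induction p rule: pCons_induct)
  case 0
  thus ?case using P v' by (simp add: pv_0[OF A v] pv_0[OF A' v'] mat_ring)
 next
  case (pCons a p)
  have "A * (P * pv A' v' p) = P * (A' * pv A' v' p)"
   using mat_mult_eqD[OF AP, of "pv A' v' p"] A A' P pv_dim[OF A' v'] by (simp add: mat_assoc)
  thus ?case using A A' P v' pv_dim[OF A' v']
   by (simp add: pv_pCons[OF A v] pv_pCons[OF A' v'] pCons.IH mat_ring)
 qed
qed

section \<open>Coefficient vectors and Krylov matrices\<close>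

definition cvec :: "nat => 'a::field poly => 'a mat" where
 "cvec d p = mat d 1 (%(i, _). coeff p i)"

definition vpoly :: "'a::field mat => 'a poly" where
 "vpoly c = (\<Sum>i<dim_row c. monom (c $$ (i, 0)) i)"

lemma cvec_dim [simp]: "dim_row (cvec d p) = d" "dim_col (cvec d p) = Suc 0"
 by (auto simp: cvec_def)

lemma cvec_carrier: "cvec d p : mats d 1"
 by (auto simp: cvec_def)

lemma cvec_add: "cvec d (p + q) = cvec d p + cvec d q"
 by (rule eq_matI) (auto simp: cvec_def)

lemma cvec_smult: "cvec d (smult c p) = c \<cdot>\<^sub>m cvec d p"
 by (rule eq_matI) (auto simp: cvec_def)

lemma cvec_0: "cvec d 0 = zm d 1"
 by (rule eq_matI) (auto simp: cvec_def)

lemma coeff_vpoly: "coeff (vpoly c) i = (if i < dim_row c then c $$ (i, 0) else 0)"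
 by (auto simp: vpoly_def coeff_sum if_distrib cong: if_cong)

lemma cvec_vpoly: "c : mats d 1 ==> cvec d (vpoly c) = c"
 by (rule eq_matI) (auto simp: cvec_def coeff_vpoly)

lemma vpoly_cvec: "(!!i. i >= d ==> coeff p i = 0) ==> vpoly (cvec d p) = p"
 by (rule poly_eqI) (auto simp: cvec_def coeff_vpoly)

lemma cvec_eq_0D: "cvec d p = zm d 1 ==> (!!i. i >= d ==> coeff p i = 0) ==> p = 0"
proof (rule poly_eqI)
 fix i assume *: "cvec d p = zm d 1" "!!i. i >= d ==> coeff p i = 0"
 show "coeff p i = coeff 0 i"
 proof (cases "i < d")
  case True
  hence "cvec d p $$ (i, 0) = 0" using *(1) by simp
  thus ?thesis using True by (simp add: cvec_def)
 qed (use *(2) in simp)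
qed

text \<open>A Krylov matrix: the columns are s(A) A^j v for j < d. With \<open>s = 1\<close> they
  run through the cyclic space, with \<open>s\<close> a divisor of the annihilator of
  \<open>v\<close> through a submodule of it.\<close>

definition kr :: "'a::field mat => 'a mat => 'a poly => nat => 'a mat" where
 "kr A v s d = mat (dim_row v) d (%(i, j). pv A v (s * monom 1 j) $$ (i, 0))"

lemma kr_dim [simp]: "dim_row (kr A v s d) = dim_row v" "dim_col (kr A v s d) = d"
 by (auto simp: kr_def)

lemma kr_carrier: "v : mats n 1 ==> kr A v s d : mats n d"
 by (auto simp: kr_def)

text \<open>Stated for an arbitrary linear functional because it is applied to entries of
  \<open>pv\<close>, to either argument of a form and to coefficients of remainders.\<close>

lemma linear_poly_sum:
 fixes F :: "'a::field poly => 'a"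
 assumes "!!p q. F (p + q) = F p + F q" and "!!c p. F (smult c p) = c * F p"
  and "!!i. i >= d ==> coeff p i = 0"
 shows "F p = (\<Sum>j<d. coeff p j * F (monom 1 j))"
proof -
 have F0: "F 0 = 0" using assms(2)[of 0 0] by simp
 have s: "F (\<Sum>j\<in>S. g j) = (\<Sum>j\<in>S. F (g j))" if "finite S" for g :: "nat => 'a poly" and S
  using that by (induction S rule: finite_induct) (auto simp: assms(1) F0)
 have "p = (\<Sum>j<d. monom (coeff p j) j)"
  by (rule poly_eqI) (auto simp: coeff_sum assms(3) if_distrib not_less cong: if_cong)
 hence "F p = F (\<Sum>j<d. monom (coeff p j) j)" by (rule arg_cong)
 also have "... = (\<Sum>j<d. F (monom (coeff p j) j))" by (rule s) simp
 also have "... = (\<Sum>j<d. coeff p j * F (monom 1 j))"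
  by (rule sum.cong) (auto simp: assms(2)[symmetric] smult_monom)
 finally show ?thesis .
qed

lemma kr_mult_cvec:
 fixes A v :: "'a::field mat"
 assumes A: "A : mats n n" and v: "v : mats n 1" and p: "!!i. i >= d ==> coeff p i = 0"
 shows "kr A v s d * cvec d p = pv A v (s * p)"
proof (rule eq_matI)
 fix i j assume ij: "i < dim_row (pv A v (s * p))" "j < dim_col (pv A v (s * p))"
 hence i: "i < n" and j: "j = 0" using pv_dim[OF A v] by auto
 have "pv A v (s * p) $$ (i, 0) = (\<Sum>j<d. coeff p j * pv A v (s * monom 1 j) $$ (i, 0))"
  by (rule linear_poly_sum[where F = "%p. pv A v (s * p) $$ (i, 0)"])
   (use i p in "auto simp: distrib_left pv_add[OF A v] pv_smult[OF A v] pv_dim[OF A v]")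
 also have "... = (kr A v s d * cvec d p) $$ (i, 0)"
  using i v by (auto simp: kr_def cvec_def scalar_prod_def lessThan_atLeast0 mult.commute intro!: sum.cong)
 finally show "(kr A v s d * cvec d p) $$ (i, j) = pv A v (s * p) $$ (i, j)" using j by simp
qed (use v pv_dim[OF A v] in auto)

text \<open>With columns indexed by monomials, a matrix is a linear map on polynomials of bounded
  degree, and matrix identities can be read off from polynomial ones.\<close>

lemma mat_eq_by_cvec:
 fixes M M' :: "'a::field mat"
 assumes "M : mats n d" and "M' : mats n d"
  and "!!p. (!!i. i >= d ==> coeff p i = 0) ==> M * cvec d p = M' * cvec d p"
 shows "M = M'"
proof (rule eq_matI)
 fix i j assume ij: "i < dim_row M'" "j < dim_col M'"
 have e: "(N * cvec d (monom 1 j)) $$ (i, 0) = N $$ (i, j)" if "N : mats n d" for N :: "'a mat"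
 proof -
  have "col (cvec d (monom 1 j)) 0 = (unit_vec d j :: 'a vec)" using ij assms
   by (intro eq_vecI) (auto simp: cvec_def unit_vec_def)
  thus ?thesis using that ij assms by simp
 qed
 have "M * cvec d (monom 1 j) = M' * cvec d (monom 1 j)" using ij assms by (intro assms(3)) auto
 thus "M $$ (i, j) = M' $$ (i, j)" using e assms by metis
qed (use assms in auto)

section \<open>Totally isotropic blocks and their dual blocks\<close>

definition skew :: "nat => 'a::field mat set" where
 "skew d = {K : mats d d. K\<^sup>T = - K}"

lemma mat_self_diff: "A - A = zm (dim_row A) (dim_col A)" for A :: "'a::group_add mat"
 by (rule eq_matI) auto

lemma mat_add_cancel_left:
 fixes A C D :: "'a::group_add mat"
 assumes "A + C = A + D" and "C : mats n m" and "D : mats n m" and "A : mats n m"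
 shows "C = D"
proof (rule eq_matI)
 fix i j assume ij: "i < dim_row D" "j < dim_col D"
 have "(A + C) $$ (i, j) = (A + D) $$ (i, j)" by (simp only: assms(1))
 thus "C $$ (i, j) = D $$ (i, j)" using assms(2-4) ij by simp
qed (use assms in auto)

lemma gram_transpose:
 fixes B :: "'a::field mat"
 assumes "B\<^sup>T = B" and "B : mats n n" and "S : mats n s" and "T : mats n t"
 shows "(bil B S T)\<^sup>T = bil B T S"
 using assms by (simp add: mat_ring)

lemma gram_swap:
 fixes B :: "'a::field mat"
 assumes "bil B S T = H" and "B\<^sup>T = B" and "B : mats n n"
  and "S : mats n s" and "T : mats n t"
 shows "bil B T S = H\<^sup>T"
 using gram_transpose[OF assms(2-5)] assms(1) by simp

lemma hc_gram:
 fixes B :: "'a::field mat"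
 assumes "B : mats n n" and "W : mats n e" and "Z : mats n m"
 shows "(hc W Z)\<^sup>T * (B * hc W Z)
  = vc (hc (bil B W W) (bil B W Z))
    (hc (bil B Z W) (bil B Z Z))"
proof -
 have "(hc W Z)\<^sup>T * (B * hc W Z)
  = vc (W\<^sup>T * hc (B * W) (B * Z)) (Z\<^sup>T * hc (B * W) (B * Z))"
  using assms by (simp add: transpose_hc mult_hc[of B] vc_mult)
 thus ?thesis using assms by (simp add: mult_hc)
qed

lemma diag_blocks_GL:
 fixes G H :: "'a::field mat"
 assumes "G : GL e" and "H : GL m"
 shows "vc (hc G (zm e m)) (hc (zm m e) H) : GL (e + m)"
proof -
 have c: "G : mats e e" "H : mats m m" using assms GL_carrier by auto
 have "det (four_block_mat G (zm e m) (zm m e) H) = det G * det H"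
  by (rule det_four_block_mat_lower_left_zero) (use c in auto)
 thus ?thesis
  using assms c four_block_hc_vc[OF c(1) zero_carrier_mat[of e m] zero_carrier_mat[of m e] c(2)]
  by (auto simp: GL_iff_det intro: four_block_carrier_mat)
qed

text \<open>Three corrections in turn: \<open>Y1\<close> has the right pairing with
  \<open>R\<close>, \<open>Y2\<close> loses its component along \<open>N\<close>, and
  \<open>Y\<close> becomes isotropic by a shift along \<open>R\<close>. Since \<open>R\<close> is
  orthogonal to \<open>R\<close> and \<open>N\<close>, the last shift spoils nothing achieved
  before.\<close>

lemma dual_frame_exists:
 fixes B :: "'a::{field,finite} mat"
 assumes B: "B : GL n" "B\<^sup>T = B" and two: "(2::'a) ~= 0"
  and R: "R : mats n d" "injective_mat R" and N: "N : mats n k"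
  and RR: "bil B R R = zm d d" and RN: "bil B R N = zm d k"
  and NN: "bil B N N : GL k"
 shows "\<exists>Y \<in> mats n d. bil B R Y = im d & bil B N Y = zm k d
     & bil B Y Y = zm d d"
proof -
 have Bc: "B : mats n n" using B GL_carrier by blast
 have NR: "bil B N R = zm k d"
  using gram_swap[OF RN B(2) Bc R(1) N] by simp
 obtain N' where N': "d <= n" "N' : mats n (n - d)" "hc R N' : GL n"
  using injective_mat_extend[OF R] by auto
 \<comment> \<open>After completing \<open>R\<close> to a basis by \<open>N'\<close>, the matrix
   \<open>Q\<close> is invertible, so the pairings of a vector with that basis can be prescribed:
   here 1 on \<open>R\<close> and 0 on \<open>N'\<close>.\<close>
 define Q where "Q = (hc R N')\<^sup>T * B"
 have "Q : GL n" unfolding Q_def using N' B GL_mult GL_transpose by blast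
 then obtain H where H: "H : GL n" "Q * H = im n" using GL_inverse by blast
 have Hc: "H : mats n n" using H GL_carrier by blast
 define T where "T = vc (im d) (zm (n - d) d :: 'a mat)"
 have T: "T : mats n d" unfolding T_def using N' vc_carrier[of "im d" d d "zm (n-d) d" "n - d"] by auto
 define Y1 where "Y1 = H * T"
 have Y1: "Y1 : mats n d" unfolding Y1_def using Hc T by auto
 have "Q * Y1 = T" unfolding Y1_def using H Hc T GL_dim[OF \<open>Q : GL n\<close>] by (simp add: mat_assoc[symmetric] mat_one_left)
 hence "vc (bil B R Y1) (bil B N' Y1) = vc (im d) (zm (n - d) d)"
  unfolding Q_def T_def using R N' Bc Y1 by (simp add: transpose_hc vc_mult mat_assoc)
 hence RY1: "bil B R Y1 = im d"
  by (rule vc_eqD) (use R N' Bc Y1 in auto)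
 obtain M where M: "M : GL k" "bil B N N * M = im k" using NN GL_inverse by blast
 have Mc: "M : mats k k" using M GL_carrier by blast
 have NM: "N\<^sup>T * (B * (N * M)) = im k" using M(2) Mc N Bc by (simp add: mat_assoc)
 define S where "S = bil B N Y1"
 have S: "S : mats k d" unfolding S_def using N Bc Y1 by auto
 define Y2 where "Y2 = Y1 - N * (M * S)"
 have Y2: "Y2 : mats n d" unfolding Y2_def using Y1 N Mc S by auto
 have a1: "R\<^sup>T * (B * (N * (M * S))) = zm d d"
  using mat_mult3_eqD[OF RN, of "M * S"] R Bc N Mc S by (simp add: mat_zero_left)
 have a2: "N\<^sup>T * (B * (N * (M * S))) = S"
  using arg_cong[OF NM, of "%t. t * S"] Bc N Mc S by (simp add: mat_assoc mat_one_left)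
 have RY2: "bil B R Y2 = im d"
  unfolding Y2_def using R Bc N Mc S Y1 RY1 a1 by (simp add: mat_diff_left) (intro eq_matI; simp)
 have NY2: "bil B N Y2 = zm k d"
  unfolding Y2_def using R Bc N Mc S Y1 a2 by (simp add: mat_diff_left S_def[symmetric])
 define V where "V = bil B Y2 Y2"
 have V: "V : mats d d" unfolding V_def using Y2 Bc by auto
 have Vt: "V\<^sup>T = V" unfolding V_def using gram_transpose[OF B(2) Bc Y2 Y2] .
 \<comment> \<open>Subtracting \<open>R * K\<close> lowers the Gram matrix of \<open>Y2\<close> by
   \<open>K + K\<^sup>T\<close>. Half of the symmetric matrix \<open>V\<close> is the choice of
   \<open>K\<close> that leaves nothing, which is why 2 must be invertible.\<close>
 define c where "c = inverse (2::'a)"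
 define Y where "Y = Y2 - R * (c \<cdot>\<^sub>m V)"
 have Y: "Y : mats n d" unfolding Y_def using Y2 R V by auto
 have b1: "R\<^sup>T * (B * (R * (c \<cdot>\<^sub>m V))) = zm d d"
  using mat_mult3_eqD[OF RR, of "c \<cdot>\<^sub>m V"] R Bc V by (simp add: mat_zero_left)
 have b2: "N\<^sup>T * (B * (R * (c \<cdot>\<^sub>m V))) = zm k d"
  using mat_mult3_eqD[OF NR, of "c \<cdot>\<^sub>m V"] R Bc V N by (simp add: mat_zero_left)
 have Y2R: "bil B Y2 R = im d"
  using gram_swap[OF RY2 B(2) Bc R(1) Y2] by simp
 have b3: "Y2\<^sup>T * (B * (R * (c \<cdot>\<^sub>m V))) = c \<cdot>\<^sub>m V"
  using mat_mult3_eqD[OF Y2R, of "c \<cdot>\<^sub>m V"] R Bc V Y2 by (simp add: mat_one_left)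
 have RY: "bil B R Y = im d"
  unfolding Y_def using R Bc V Y2 RY2 b1 by (simp add: mat_diff_left) (intro eq_matI; simp)
 have NY: "bil B N Y = zm k d"
  unfolding Y_def using R Bc V Y2 N NY2 b2 by (simp add: mat_diff_left)
 have "bil B Y Y = bil B Y2 Y - c \<cdot>\<^sub>m V * (bil B R Y)"
 proof -
  have "Y\<^sup>T = Y2\<^sup>T - c \<cdot>\<^sub>m V * R\<^sup>T"
   unfolding Y_def using R V Y2 by (simp add: mat_transpose_mult transpose_diff_dim transpose_smult Vt)
  thus ?thesis using R Bc V Y2 Y by (simp add: mat_diff_right mat_assoc)
 qed
 also have "bil B Y2 Y = V - c \<cdot>\<^sub>m V"
  unfolding Y_def using R Bc V Y2 b3 by (simp add: mat_diff_left V_def[symmetric])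
 also have "V - c \<cdot>\<^sub>m V - c \<cdot>\<^sub>m V * (bil B R Y) = zm d d"
 proof (rule eq_matI)
  fix i j assume ij: "i < dim_row (zm d d :: 'a mat)" "j < dim_col (zm d d :: 'a mat)"
  have "c + c = 1" unfolding c_def using two by (metis mult_2 right_inverse)
  hence "c * x + c * x = x" for x by (metis distrib_right mult_1)
  hence "x - c * x - c * x = 0" for x by (metis add_diff_cancel_left' diff_self)
  thus "(V - c \<cdot>\<^sub>m V - c \<cdot>\<^sub>m V * (bil B R Y)) $$ (i, j) = zm d d $$ (i, j)"
   using ij V unfolding RY by (simp add: mat_one_right)
 qed (use V R Bc Y RY in auto)
 finally show ?thesis using Y RY NY by blast
qed

lemma frame_mult:
 fixes R N Y :: "'a::field mat"
 assumes "R : mats n d" "N : mats n k" "Y : mats n d'"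
  "r : mats d l" "x : mats k l" "y : mats d' l"
 shows "hc (hc R N) Y * vc (vc r x) y = R * r + N * x + Y * y"
 using assms by (simp add: hc_mult_vc)

lemma gram3:
 fixes B :: "'a::field mat"
 assumes "B : mats n n" "T : mats n t"
  "R : mats n d" "N : mats n k" "Y : mats n d'"
  "r : mats d l" "x : mats k l" "y : mats d' l"
  and "bil B T R = GR" and "bil B T N = GN" and "bil B T Y = GY"
 shows "T\<^sup>T * (B * (R * r + N * x + Y * y)) = GR * r + GN * x + GY * y"
proof -
 have "T\<^sup>T * (B * (R * r)) = GR * r" "T\<^sup>T * (B * (N * x)) = GN * x"
  "T\<^sup>T * (B * (Y * y)) = GY * y"
  using mat_mult3_eqD[OF assms(9), of r] mat_mult3_eqD[OF assms(10), of x] mat_mult3_eqD[OF assms(11), of y] assms by simp_all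
 thus ?thesis using assms(1-8) by (simp add: mat_distrib_left)
qed

text \<open>The Gram matrix of \<open>R\<close>, \<open>N\<close>, \<open>Y\<close> is triangular up
  to the order of its blocks: pairing with \<open>R\<close> isolates \<open>y\<close>, then pairing
  with \<open>N\<close> isolates \<open>x\<close>, then pairing with \<open>Y\<close> isolates
  \<open>r\<close>.\<close>

lemma frame_kernel:
 fixes B :: "'a::field mat"
 assumes B: "B : mats n n" "B\<^sup>T = B"
  and R: "R : mats n d" and N: "N : mats n k" and Y: "Y : mats n d"
  and RR: "bil B R R = zm d d" and RN: "bil B R N = zm d k"
  and NN: "bil B N N : GL k"
  and RY: "bil B R Y = im d" and NY: "bil B N Y = zm k d"
  and rxy: "r : mats d 1" "x : mats k 1" "y : mats d 1"
  and z: "B * (R * r + N * x + Y * y) = zm n 1"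
 shows "r = zm d 1 & x = zm k 1 & y = zm d 1"
proof -
 have YR: "bil B Y R = im d" using gram_swap[OF RY B(2,1) R Y] by simp
 have NR: "bil B N R = zm k d" using gram_swap[OF RN B(2,1) R N] by simp
 note dims = R N Y rxy
 have "zm d d * r + zm d k * x + im d * y = zm d 1"
  using gram3[OF B(1) R dims RR RN RY] z R by (simp add: mat_zero_right)
 hence y: "y = zm d 1" using rxy by (simp add: mat_ring)
 have "zm k d * r + bil B N N * x + zm k d * y = zm k 1"
  using gram3[OF B(1) N dims NR refl NY] z N by (simp add: mat_zero_right)
 hence "bil B N N * x = zm k 1"
  using rxy N B y by (simp add: mat_zero_left mat_add_zero_left mat_add_zero_right)
 hence x: "x = zm k 1" using injective_mat_vecD[OF GL_injective[OF NN] _ GL_carrier[OF NN]] rxy by simp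
 have "im d * r + bil B Y N * x + bil B Y Y * y = zm d 1"
  using gram3[OF B(1) Y dims YR refl refl] z Y by (simp add: mat_zero_right)
 hence "r = zm d 1" using x y Y B N rxy
  by (simp add: mat_zero_left mat_add_zero_left mat_add_zero_right mat_zero_right mat_one_left)
 thus ?thesis using x y by simp
qed

lemma vc3_split:
 assumes "c : mats (a + b + b') l"
 obtains r x y where "r : mats a l" "x : mats b l" "y : mats b' l" "c = vc (vc r x) y"
 using vc_split[OF assms] vc_split by metis

text \<open>The count \<open>n = d + k + d\<close> makes the frame square, so a trivial kernel
  suffices. Computing the kernel of \<open>B\<close> times the frame settles the frame and
  \<open>B\<close> at once.\<close>

lemma frame_GL:
 fixes B :: "'a::field mat"
 assumes B: "B : mats n n" "B\<^sup>T = B" and n: "n = d + k + d"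
  and R: "R : mats n d" and N: "N : mats n k" and Y: "Y : mats n d"
  and RR: "bil B R R = zm d d" and RN: "bil B R N = zm d k"
  and NN: "bil B N N : GL k"
  and RY: "bil B R Y = im d" and NY: "bil B N Y = zm k d"
 shows "hc (hc R N) Y : GL n" and "B : GL n"
proof -
 have c: "hc (hc R N) Y : mats n n" using hc_carrier[OF hc_carrier[OF R N] Y] n by simp
 have main: "c = zm n 1" if cc: "c : mats n 1" "B * (hc (hc R N) Y * c) = zm n 1" for c
 proof -
  obtain r x y where 1: "r : mats d 1" "x : mats k 1" "y : mats d 1" "c = vc (vc r x) y"
   using vc3_split[of c d k d 1] cc n by auto
  have "B * (R * r + N * x + Y * y) = zm n 1" using cc(2) frame_mult[OF R N Y 1(1-3)] 1(4) by simp
  from frame_kernel[OF B R N Y RR RN NN RY NY 1(1-3) this] show ?thesis using 1 n by (simp add: vc_zero)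
 qed
 have "c = zm n 1" if cc: "c : mats n 1" "hc (hc R N) Y * c = zm n 1" for c
  using main[OF cc(1)] cc(2) B by (simp add: mat_zero_right)
 hence "injective_mat (hc (hc R N) Y)" unfolding injective_mat_def carrier_matD[OF c] by blast
 thus P: "hc (hc R N) Y : GL n" by (rule injective_GL[OF c])
 obtain H where H: "H : GL n" "hc (hc R N) Y * H = im n" using GL_inverse[OF P] by blast
 have "c = zm n 1" if cc: "c : mats n 1" "B * c = zm n 1" for c
 proof -
  have Hc: "H * c : mats n 1" using cc(1) GL_carrier[OF H(1)] by auto
  have "hc (hc R N) Y * (H * c) = hc (hc R N) Y * H * c"
   by (rule assoc_mult_mat[OF c GL_carrier[OF H(1)] cc(1), symmetric])
  hence Pc: "hc (hc R N) Y * (H * c) = c" using H(2) cc(1) by (simp add: mat_one_left)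
  have "H * c = zm n 1" by (rule main[OF Hc]) (simp add: Pc cc(2))
  thus ?thesis using Pc right_mult_zero_mat[OF c] by simp
 qed
 hence "injective_mat B" unfolding injective_mat_def carrier_matD[OF B(1)] by blast
 thus "B : GL n" by (rule injective_GL[OF B(1)])
qed

text \<open>The solutions form a torsor under the skew matrices. The difference of two solutions is
  orthogonal to \<open>R\<close> and \<open>N\<close>, hence of the form \<open>R * K\<close>, and
  isotropy of both says \<open>K + K\<^sup>T = 0\<close>.\<close>

lemma dual_frame_count:
 fixes B :: "'a::{field,finite} mat"
 assumes B: "B : GL n" "B\<^sup>T = B" and two: "(2::'a) ~= 0" and n: "n = d + k + d"
  and R: "R : mats n d" "injective_mat R" and N: "N : mats n k"
  and RR: "bil B R R = zm d d" and RN: "bil B R N = zm d k"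
  and NN: "bil B N N : GL k"
 shows "card {Y : mats n d. bil B R Y = im d & bil B N Y = zm k d
     & bil B Y Y = zm d d} = card (skew d :: 'a mat set)" (is "card ?S = _")
proof -
 have Bc: "B : mats n n" using B GL_carrier by blast
 obtain Y0 where Y0: "Y0 : mats n d" "bil B R Y0 = im d"
  "bil B N Y0 = zm k d" "bil B Y0 Y0 = zm d d"
  using dual_frame_exists[OF B two R N RR RN NN] by auto
 have YR: "bil B Y0 R = im d" using gram_swap[OF Y0(2) B(2) Bc R(1) Y0(1)] by simp
 have NR: "bil B N R = zm k d" using gram_swap[OF RN B(2) Bc R(1) N] by simp
 have P: "hc (hc R N) Y0 : GL n"
  by (rule frame_GL(1)[OF Bc B(2) n R(1) N Y0(1) RR RN NN Y0(2,3)])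
 have gram: "(Y0 + R * K)\<^sup>T * (B * (Y0 + R * K)) = K + K\<^sup>T"
  if K: "K : mats d d" for K :: "'a mat"
 proof -
  have r1: "Y0\<^sup>T * (B * (R * K)) = K"
   using mat_mult3_eqD[OF YR, of K] Y0 Bc R K by (simp add: mat_one_left)
  have r2: "R\<^sup>T * (B * (R * K)) = zm d d"
   using mat_mult3_eqD[OF RR, of K] Bc R K by (simp add: mat_zero_left)
  show ?thesis
   using Y0 Bc R K r1 r2 by (simp add: mat_ring) (intro eq_matI; simp)
 qed
 have "bij_betw (%K. Y0 + R * K) (skew d) ?S"
 proof (rule bij_betwI')
  fix K K' :: "'a mat" assume K: "K \<in> skew d" "K' \<in> skew d"
  hence Kc: "K : mats d d" "K' : mats d d" by (auto simp: skew_def)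
  show "(Y0 + R * K = Y0 + R * K') \<longleftrightarrow> K = K'"
  proof
   assume e: "Y0 + R * K = Y0 + R * K'"
   have "R * K = R * K'" by (rule mat_add_cancel_left[OF e]) (use R Kc Y0 in auto)
   thus "K = K'" by (rule injective_mat_eqD[OF R(2)]) (use Kc R in auto)
  qed simp
 next
  fix K :: "'a mat" assume "K \<in> skew d"
  hence K: "K : mats d d" "K\<^sup>T = - K" by (auto simp: skew_def)
  have r1: "R\<^sup>T * (B * (R * K)) = zm d d"
   using mat_mult3_eqD[OF RR, of K] Bc R K by (simp add: mat_zero_left)
  have r2: "N\<^sup>T * (B * (R * K)) = zm k d"
   using mat_mult3_eqD[OF NR, of K] Bc R K N by (simp add: mat_zero_left)
  have "K + K\<^sup>T = zm d d" using K by (intro eq_matI) auto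
  thus "Y0 + R * K \<in> ?S"
   using gram[OF K(1)] Y0 R K(1) Bc N r1 r2 by (simp add: mat_distrib_left mat_add_zero_right)
 next
  \<comment> \<open>For surjectivity, \<open>Y - Y0\<close> is expanded in the frame
    \<open>R\<close>, \<open>N\<close>, \<open>Y0\<close>; its pairings with \<open>R\<close> and
    \<open>N\<close> vanish and leave only the \<open>R\<close> coordinate.\<close>
  fix Y assume "Y \<in> ?S"
  hence Y: "Y : mats n d" "bil B R Y = im d" "bil B N Y = zm k d"
   "bil B Y Y = zm d d" by auto
  obtain H where H: "H : GL n" "hc (hc R N) Y0 * H = im n" using GL_inverse[OF P] by blast
  have Hc: "H : mats n n" using H GL_carrier by blast
  define c where "c = H * (Y - Y0)"
  have Pc: "hc (hc R N) Y0 * c = Y - Y0" unfolding c_def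
   using H Hc Y Y0 GL_dim[OF P] by (simp add: mat_assoc[symmetric] mat_one_left)
  have c: "c : mats (d + k + d) d" unfolding c_def using Hc Y Y0 n by auto
  obtain rx y where 1: "rx : mats (d + k) d" "y : mats d d" "c = vc rx y"
   using vc_split[OF c] by auto
  obtain r x where 2: "r : mats d d" "x : mats k d" "rx = vc r x"
   using vc_split[OF 1(1)] by auto
  note dims = R(1) N Y0(1) 2(1,2) 1(2)
  have z: "R * r + N * x + Y0 * y = Y - Y0" using Pc frame_mult[OF dims] 1 2 by simp
  have "zm d d * r + zm d k * x + im d * y = zm d d"
   using gram3[OF Bc R(1) dims RR RN Y0(2), symmetric] z R Bc Y Y0 by (simp add: mat_diff_left mat_self_diff)
  hence y: "y = zm d d" using 1 2 by (simp add: mat_ring)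
  have "zm k d * r + bil B N N * x + zm k d * y = zm k d"
   using gram3[OF Bc N dims NR refl Y0(3), symmetric] z N Bc Y Y0 by (simp add: mat_diff_left mat_self_diff)
  hence "bil B N N * x = zm k d"
   using 1 2 N Bc y by (simp add: mat_zero_left mat_add_zero_left mat_add_zero_right)
  hence "x = zm (dim_col (bil B N N)) (dim_col x)"
   by (intro injective_matD[OF GL_injective[OF NN]]) (use 2 N in auto)
  hence x: "x = zm k d" using N 2 by simp
  have YY: "Y = Y0 + R * r"
  proof (rule eq_matI)
   fix i j assume ij: "i < dim_row (Y0 + R * r)" "j < dim_col (Y0 + R * r)"
   have "R * r = Y - Y0" using z x y N Y0 R 2 Y by (simp add: mat_zero_right mat_add_zero_right)
   thus "Y $$ (i, j) = (Y0 + R * r) $$ (i, j)" using ij Y0 Y R 2 by (simp del: index_mult_mat(1))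
  qed (use Y Y0 R 2 in auto)
  have kk: "r + r\<^sup>T = zm d d" using gram[OF 2(1)] Y(4) YY by simp
  have "r\<^sup>T = - r"
  proof (rule eq_matI)
   fix i j assume ij: "i < dim_row (- r)" "j < dim_col (- r)"
   have "(r + r\<^sup>T) $$ (i, j) = 0" unfolding kk using ij 2 by simp
   thus "r\<^sup>T $$ (i, j) = (- r) $$ (i, j)" using ij 2 by (simp add: add_eq_0_iff)
  qed (use 2 in auto)
  thus "\<exists>K\<in>skew d. Y = Y0 + R * K" using 2 YY by (intro bexI[of _ r]) (auto simp: skew_def)
 qed
 thus ?thesis by (simp add: bij_betw_same_card)
qed

lemma diag_gram_GL:
 fixes B :: "'a::field mat"
 assumes B: "B\<^sup>T = B" "B : mats n n" and W: "W : mats n e" and Z: "Z : mats n m"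
  and WW: "bil B W W : GL e" and WZ: "bil B W Z = zm e m"
  and ZZ: "bil B Z Z : GL m"
 shows "(hc W Z)\<^sup>T * (B * hc W Z) : GL (e + m)"
proof -
 have "bil B Z W = zm m e" using gram_swap[OF WZ B W Z] by simp
 thus ?thesis using diag_blocks_GL[OF WW ZZ] by (simp add: hc_gram[OF B(2) W Z] WZ)
qed

lemma hc_gram_right:
 fixes B :: "'a::field mat"
 assumes "B : mats n n" and "T : mats n t" and "W : mats n e" and "Z : mats n m"
 shows "T\<^sup>T * (B * hc W Z) = hc (bil B T W) (bil B T Z)"
 using assms by (simp add: mult_hc)

lemma hc_gram_left:
 fixes B :: "'a::field mat"
 assumes "B : mats n n" and "T : mats n t" and "W : mats n e" and "Z : mats n m"
 shows "(hc W Z)\<^sup>T * (B * T) = vc (bil B W T) (bil B Z T)"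
 using assms by (simp add: transpose_hc vc_mult)

text \<open>Expand \<open>Z\<close> in the frame \<open>R\<close>, \<open>W\<close>,
  \<open>Z0\<close>, \<open>Y0\<close>: orthogonality to \<open>R\<close> kills the
  \<open>Y0\<close> coordinates and orthogonality to \<open>W\<close> kills the \<open>W\<close>
  coordinates.\<close>

lemma isotropic_perp:
 fixes B :: "'a::{field,finite} mat"
 assumes B: "B : GL n" "B\<^sup>T = B" and two: "(2::'a) ~= 0" and n: "n = d + (e + m) + d"
  and R: "R : mats n d" "injective_mat R" and W: "W : mats n e" and Z0: "Z0 : mats n m"
  and RR: "bil B R R = zm d d" and RW: "bil B R W = zm d e"
  and RZ: "bil B R Z0 = zm d m"
  and WW: "bil B W W : GL e" and WZ: "bil B W Z0 = zm e m"
  and ZZ: "bil B Z0 Z0 : GL m"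
  and Z: "Z : mats n l" "bil B R Z = zm d l" "bil B W Z = zm e l"
 shows "\<exists>a \<in> mats d l. \<exists>h \<in> mats m l. Z = R * a + Z0 * h"
proof -
 have Bc: "B : mats n n" using B GL_carrier by blast
 define N where "N = hc W Z0"
 have N: "N : mats n (e + m)" unfolding N_def using hc_carrier[OF W Z0] .
 have NN: "bil B N N : GL (e + m)"
  unfolding N_def by (rule diag_gram_GL[OF B(2) Bc W Z0 WW WZ ZZ])
 have RN: "bil B R N = zm d (e + m)"
  unfolding N_def using hc_gram_right[OF Bc R(1) W Z0] RW RZ by (simp add: hc_zero)
 obtain Y0 where Y0: "Y0 : mats n d" "bil B R Y0 = im d"
  "bil B N Y0 = zm (e + m) d"
  using dual_frame_exists[OF B two R N RR RN NN] by auto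
 have P: "hc (hc R N) Y0 : GL n"
  by (rule frame_GL(1)[OF Bc B(2) n R(1) N Y0(1) RR RN NN Y0(2,3)])
 obtain H where H: "H : GL n" "hc (hc R N) Y0 * H = im n" using GL_inverse[OF P] by blast
 have Hc: "H : mats n n" using H GL_carrier by blast
 define c where "c = H * Z"
 have Pc: "hc (hc R N) Y0 * c = Z" unfolding c_def
  using H Hc Z GL_dim[OF P] by (simp add: mat_assoc[symmetric] mat_one_left)
 have c: "c : mats (d + (e + m) + d) l" unfolding c_def using Hc Z n by auto
 obtain rx y where 1: "rx : mats (d + (e + m)) l" "y : mats d l" "c = vc rx y"
  using vc_split[OF c] by auto
 obtain r x where 2: "r : mats d l" "x : mats (e + m) l" "rx = vc r x"
  using vc_split[OF 1(1)] by auto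
 obtain w h where 3: "w : mats e l" "h : mats m l" "x = vc w h"
  using vc_split[OF 2(2)] by auto
 note dims = R(1) N Y0(1) 2(1,2) 1(2)
 have z: "Z = R * r + N * x + Y0 * y" using Pc frame_mult[OF dims] 1 2 by simp
 have "zm d d * r + zm d (e + m) * x + im d * y = zm d l"
  using gram3[OF Bc R(1) dims RR RN Y0(2)] Z(2) unfolding z by simp
 hence y: "y = zm d l" using 1 2 by (simp add: mat_ring)
 have Nx: "N * x = W * w + Z0 * h" unfolding N_def 3(3) using W Z0 3 by (intro hc_mult_vc) auto
 have zz: "Z = R * r + W * w + Z0 * h" unfolding z Nx using y Y0 R W Z0 2 3
  by (simp add: mat_zero_right mat_add_zero_right) (intro eq_matI; simp add: add.assoc)
 have WR: "bil B W R = zm e d" using gram_swap[OF RW B(2) Bc R(1) W] by simp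
 have "zm e d * r + bil B W W * w + zm e m * h = zm e l"
  using gram3[OF Bc W R(1) W Z0 2(1) 3(1,2) WR refl WZ] Z(3) unfolding zz by simp
 hence "bil B W W * w = zm e l"
  using 2 3 W Bc by (simp add: mat_zero_left mat_add_zero_left mat_add_zero_right)
 hence "w = zm (dim_col (bil B W W)) (dim_col w)"
  by (intro injective_matD[OF GL_injective[OF WW]]) (use 3 W in auto)
 hence "w = zm e l" using W 3 by simp
 hence "Z = R * r + Z0 * h" using zz R W Z0 2 3 by (simp add: mat_zero_right mat_add_zero_right)
 thus ?thesis using 2 3 by blast
qed

text \<open>The ways to enlarge \<open>R\<close>, \<open>W\<close> by blocks \<open>Z\<close>,
  \<open>Y\<close> of the desired pairings, where \<open>Z\<close> is \<open>Z0 * h\<close> modulo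
  \<open>R\<close>. So \<open>h\<close> is the class of \<open>Z\<close> in the orthogonal
  complement of \<open>R\<close> and \<open>W\<close>, taken modulo \<open>R\<close>.\<close>

definition completions :: "nat => nat => nat => nat => 'a::field mat => 'a mat => 'a mat => 'a mat => 'a mat => ('a mat \<times> 'a mat) set" where
 "completions n d e m B R W Z0 h = {(Z, Y). Z : mats n m & Y : mats n d
  & (\<exists>a \<in> mats d m. Z = R * a + Z0 * h)
  & bil B R Y = im d & bil B W Y = zm e d
  & bil B Z Y = zm m d & bil B Y Y = zm d d}"

text \<open>\<open>R\<close> is orthogonal to \<open>R\<close>, \<open>W\<close> and
  \<open>Z0\<close>, so the summand \<open>R * a\<close> is invisible to each of these
  pairings.\<close>

lemma completion_gram:
 fixes B :: "'a::field mat"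
 assumes B: "B : mats n n" "B\<^sup>T = B"
  and R: "R : mats n d" and W: "W : mats n e" and Z0: "Z0 : mats n m"
  and RR: "bil B R R = zm d d" and RW: "bil B R W = zm d e"
  and RZ: "bil B R Z0 = zm d m"
  and WZ: "bil B W Z0 = zm e m"
  and a: "a : mats d l" and h: "h : mats m l"
 shows "R\<^sup>T * (B * (R * a + Z0 * h)) = zm d l"
  and "W\<^sup>T * (B * (R * a + Z0 * h)) = zm e l"
  and "(R * a + Z0 * h)\<^sup>T * (B * (R * a + Z0 * h)) = h\<^sup>T * (bil B Z0 Z0 * h)"
proof -
 have WR: "bil B W R = zm e d" using gram_swap[OF RW B(2,1) R W] by simp
 have ZR: "bil B Z0 R = zm m d" using gram_swap[OF RZ B(2,1) R Z0] by simp
 have e1: "R\<^sup>T * (B * (R * a)) = zm d l" "R\<^sup>T * (B * (Z0 * h)) = zm d l"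
  "W\<^sup>T * (B * (R * a)) = zm e l" "W\<^sup>T * (B * (Z0 * h)) = zm e l"
  "Z0\<^sup>T * (B * (R * a)) = zm m l"
  using mat_mult3_eqD[OF RR, of a] mat_mult3_eqD[OF RZ, of h] mat_mult3_eqD[OF WR, of a]
   mat_mult3_eqD[OF WZ, of h] mat_mult3_eqD[OF ZR, of a] B R W Z0 a h by (simp_all add: mat_zero_left)
 show 1: "R\<^sup>T * (B * (R * a + Z0 * h)) = zm d l"
  using B R Z0 a h e1 by (simp add: mat_distrib_left mat_add_zero_right)
 show "W\<^sup>T * (B * (R * a + Z0 * h)) = zm e l"
  using B R W Z0 a h e1 by (simp add: mat_distrib_left mat_add_zero_right)
 have 2: "Z0\<^sup>T * (B * (R * a + Z0 * h)) = bil B Z0 Z0 * h"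
  using B R Z0 a h e1 by (simp add: mat_distrib_left mat_add_zero_left mat_assoc)
 have "(R * a + Z0 * h)\<^sup>T = a\<^sup>T * R\<^sup>T + h\<^sup>T * Z0\<^sup>T"
  using R Z0 a h by (simp add: transpose_add_dim mat_transpose_mult)
 hence "(R * a + Z0 * h)\<^sup>T * (B * (R * a + Z0 * h))
  = a\<^sup>T * (R\<^sup>T * (B * (R * a + Z0 * h)))
   + h\<^sup>T * (Z0\<^sup>T * (B * (R * a + Z0 * h)))"
  using B R Z0 a h by (simp add: mat_distrib_right mat_assoc del: mat_distrib_left)
 thus "(R * a + Z0 * h)\<^sup>T * (B * (R * a + Z0 * h)) = h\<^sup>T * (bil B Z0 Z0 * h)"
  unfolding 1 2 using a h Z0 B by (simp add: mat_zero_right mat_add_zero_left)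
qed

text \<open>The matrix \<open>a\<close> is free, and for each choice the blocks \<open>Y\<close> are
  the dual frames of \<open>R\<close> relative to \<open>W\<close> and the new \<open>Z\<close>. The
  count depends on \<open>d\<close> and \<open>m\<close> only; this uniformity lets it cancel
  later.\<close>

lemma card_completions:
 fixes B :: "'a::{field,finite} mat"
 assumes B: "B : GL n" "B\<^sup>T = B" and two: "(2::'a) ~= 0" and n: "n = d + (e + m) + d"
  and R: "R : mats n d" "injective_mat R" and W: "W : mats n e" and Z0: "Z0 : mats n m"
  and RR: "bil B R R = zm d d" and RW: "bil B R W = zm d e"
  and RZ: "bil B R Z0 = zm d m"
  and WW: "bil B W W : GL e" and WZ: "bil B W Z0 = zm e m"
  and ZZ: "bil B Z0 Z0 : GL m" and h: "h : GL m"
 shows "card (completions n d e m B R W Z0 h) = card (mats d m :: 'a mat set) * card (skew d :: 'a mat set)"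
proof -
 have Bc: "B : mats n n" using B GL_carrier by blast
 have hc': "h : mats m m" using h GL_carrier by blast
 define T where "T = (%Z. {Y : mats n d. bil B R Y = im d
  & (hc W Z)\<^sup>T * (B * Y) = zm (e + m) d & bil B Y Y = zm d d})"
 define f where "f a = R * a + Z0 * h" for a
 have fc: "f a : mats n m" if "a : mats d m" for a
  unfolding f_def using that R Z0 hc' by auto
 have eq: "completions n d e m B R W Z0 h = Sigma (f ` mats d m) T"
 proof -
  have "(hc W Z)\<^sup>T * (B * Y) = zm (e + m) d \<longleftrightarrow>
    bil B W Y = zm e d & bil B Z Y = zm m d"
   if "Z : mats n m" "Y : mats n d" for Z Y
  proof
   assume "(hc W Z)\<^sup>T * (B * Y) = zm (e + m) d"
   hence "vc (bil B W Y) (bil B Z Y) = vc (zm e d) (zm m d)"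
    using hc_gram_left[OF Bc that(2) W that(1)] by (simp add: vc_zero)
   thus "bil B W Y = zm e d & bil B Z Y = zm m d"
    using W that by (auto dest: vc_eqD)
  qed (use hc_gram_left[OF Bc that(2) W that(1)] in "simp add: vc_zero")
  hence "(Z, Y) \<in> completions n d e m B R W Z0 h \<longleftrightarrow> Z \<in> f ` mats d m & Y \<in> T Z" for Z Y
   using fc unfolding completions_def T_def mem_Collect_eq prod.case image_iff f_def by blast
  note * = this
  show ?thesis
  proof (rule Set.set_eqI)
   show "p \<in> completions n d e m B R W Z0 h \<longleftrightarrow> p \<in> Sigma (f ` mats d m) T" for p
    using *[of "fst p" "snd p"] by (cases p) auto
  qed
 qed
 have cardT: "card (T (f a)) = card (skew d :: 'a mat set)" if a: "a : mats d m" for a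
 proof -
  have N: "hc W (f a) : mats n (e + m)" using hc_carrier[OF W fc[OF a]] .
  note g = completion_gram[OF Bc B(2) R(1) W Z0 RR RW RZ WZ a hc', folded f_def]
  have "(f a)\<^sup>T * (B * f a) : GL m" unfolding g(3)
   by (rule GL_mult[OF GL_transpose[OF h] GL_mult[OF ZZ h]])
  hence "(hc W (f a))\<^sup>T * (B * hc W (f a)) : GL (e + m)"
   by (rule diag_gram_GL[OF B(2) Bc W fc[OF a] WW g(2)])
  moreover have "R\<^sup>T * (B * hc W (f a)) = zm d (e + m)"
   unfolding hc_gram_right[OF Bc R(1) W fc[OF a]] RW g(1) by (simp add: hc_zero)
  ultimately show ?thesis unfolding T_def
   using dual_frame_count[OF B two n R N RR] by blast
 qed
 have inj: "inj_on f (mats d m)"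
 proof (rule inj_onI)
  fix a a' :: "'a mat" assume aa: "a : mats d m" "a' : mats d m" "f a = f a'"
  have e: "Z0 * h + R * a = Z0 * h + R * a'"
   using aa(3) comm_add_mat[of "R * a" n m "Z0 * h"] comm_add_mat[of "R * a'" n m "Z0 * h"] R Z0 hc' aa(1,2)
   unfolding f_def by simp
  have "R * a = R * a'" by (rule mat_add_cancel_left[OF e]) (use R Z0 hc' aa in auto)
  thus "a = a'" by (rule injective_mat_eqD[OF R(2)]) (use R aa in auto)
 qed
 have fin: "finite (T Z)" for Z unfolding T_def using finite_carrier_mat[of n d, where 'a = 'a] by (rule finite_subset[rotated]) auto
 have "card (completions n d e m B R W Z0 h) = (\<Sum>Z\<in>f ` mats d m. card (T Z))"
  unfolding eq using fin finite_carrier_mat by (intro card_SigmaI) auto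
 also have "... = (\<Sum>a\<in>mats d m. card (T (f a)))" by (rule sum.reindex_cong[OF inj]) auto
 also have "... = (\<Sum>a\<in>(mats d m :: 'a mat set). card (skew d :: 'a mat set))" using cardT by (intro sum.cong) auto
 finally show ?thesis by simp
qed

section \<open>Characteristic polynomials of block, inverse and companion matrices\<close>

lemma hc_mult_four_block:
 fixes EU EV :: "'a::semiring_0 mat"
 assumes "EU : mats n a" "EV : mats n b"
  "A : mats a c" "B : mats a d" "C : mats b c" "D : mats b d"
 shows "hc EU EV * four_block_mat A B C D = hc (EU * A + EV * C) (EU * B + EV * D)"
 unfolding four_block_hc_vc[OF assms(3-6)] vc_hc[OF assms(3-6)]
 using assms by (simp add: mult_hc hc_mult_vc)

lemma char_poly_four_block_upper:
 fixes A :: "'a::field mat"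
 assumes A: "A : mats a a" and B: "B : mats a b" and D: "D : mats b b"
 shows "char_poly (four_block_mat A B (zm b a) D) = char_poly A * char_poly D"
proof -
 have "char_poly_matrix (four_block_mat A B (zm b a) D)
  = four_block_mat (char_poly_matrix A) (map_mat (%a. [:- a:]) B) (zm b a) (char_poly_matrix D)"
  using A B D by (intro eq_matI) (auto simp: char_poly_matrix_def)
 thus ?thesis unfolding char_poly_def
  by (simp, intro det_four_block_mat_lower_left_zero) (use A B D in auto)
qed

text \<open>The reversal is taken with respect to the formal degree \<open>card S\<close>, not the
  true degree, so it survives factors whose leading coefficient is zero. Such factors occur in every
  off-diagonal term of Leibniz's formula.\<close>

lemma coeff_prod_linear_reverse:
 fixes f g :: "'i => 'a::comm_ring_1"
 assumes "finite S" and "k <= card S"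
 shows "coeff (\<Prod>i\<in>S. [:f i, g i:]) k = coeff (\<Prod>i\<in>S. [:g i, f i:]) (card S - k)"
 using assms
proof (induction S arbitrary: k rule: finite_induct)
 case (insert x S)
 have z: "coeff (\<Prod>i\<in>S. [:u i, v i:]) k = 0" if "k > card S" for u v :: "'i => 'a" and k
 proof (rule coeff_eq_0)
  have "degree (\<Prod>i\<in>S. [:u i, v i:]) <= (\<Sum>i\<in>S. degree [:u i, v i:])" by (rule degree_prod_sum_le[OF insert(1), unfolded o_def])
  also have "... <= (\<Sum>i\<in>S. 1)" by (intro sum_mono) auto
  finally show "degree (\<Prod>i\<in>S. [:u i, v i:]) < k" using that by simp
 qed
 have lin: "coeff ([:u, w:] * p) k = u * coeff p k + (if k = 0 then 0 else w * coeff p (k - 1))" for u w :: 'a and p k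
  by (cases k) (auto simp: coeff_pCons)
 show ?case
 proof (cases "k = 0")
  case True
  thus ?thesis using insert.IH[of 0] insert(1,2) z[of "Suc (card S)"] by (simp add: lin del: mult_pCons_left)
 next
  case k: False
  show ?thesis
  proof (cases "k = Suc (card S)")
   case True
   thus ?thesis using insert.IH[of "card S"] insert(1,2) z[of "Suc (card S)"] by (simp add: lin del: mult_pCons_left)
  next
   case False
   hence "k <= card S" "k - 1 <= card S" "Suc (card S) - k = Suc (card S - k)" using insert k by auto
   thus ?thesis using insert.IH[of k] insert.IH[of "k - 1"] insert(1,2) k
    by (simp add: lin del: mult_pCons_left)
  qed
 qed
qed simp

lemma coeff_signof_mult: "coeff (signof p * q) k = signof p * coeff q k" for q :: "'a::comm_ring_1 poly"
 by (simp add: sign_def)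

text \<open>This is z^d det(1/z - M) = det(1 - z M). To stay with polynomials, the two determinants
  are compared coefficientwise in Leibniz's formula, one permutation at a time.\<close>

lemma char_poly_reflect:
 fixes M :: "'a::field mat"
 assumes M: "M : mats d d"
 shows "reflect_poly (char_poly M) = det (im d + map_mat (%a. [:0, - a:]) M)"
proof (rule poly_eqI)
 fix k
 let ?R = "im d + map_mat (%a. [:0, - a:]) M"
 let ?L = "char_poly_matrix M"
 have deg: "degree (char_poly M) = d" using degree_monic_char_poly[OF M] by simp
 have L: "?L : mats d d" and R: "?R : mats d d" using M by auto
 define u where "u p i = (if i = p i then 1 else 0 :: 'a)" for p :: "nat => nat" and i
 have eL: "?L $$ (i, p i) = [:- M $$ (i, p i), u p i:]" and eR: "?R $$ (i, p i) = [:u p i, - M $$ (i, p i):]"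
  if "i \<in> {0..<d}" "p permutes {0..<d}" for p i
  using that M permutes_in_image[OF that(2), of i] by (auto simp: char_poly_matrix_def u_def one_pCons)
 show "coeff (reflect_poly (char_poly M)) k = coeff (det ?R) k"
 proof (cases "k <= d")
  case True
  have "coeff (det ?R) k = (\<Sum>p\<in>{p. p permutes {0..<d}}. signof p * coeff (\<Prod>i = 0..<d. ?R $$ (i, p i)) k)"
   unfolding det_def'[OF R] coeff_sum coeff_signof_mult ..
  also have "... = (\<Sum>p\<in>{p. p permutes {0..<d}}. signof p * coeff (\<Prod>i = 0..<d. ?L $$ (i, p i)) (d - k))"
  proof (intro sum.cong refl arg_cong2[where f = "(*)"])
   fix p assume "p \<in> {p. p permutes {0..<d}}"
   hence p: "p permutes {0..<d}" by simp
   have "(\<Prod>i = 0..<d. ?R $$ (i, p i)) = (\<Prod>i = 0..<d. [:u p i, - M $$ (i, p i):])"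
    using eR p by (intro prod.cong) auto
   moreover have "(\<Prod>i = 0..<d. ?L $$ (i, p i)) = (\<Prod>i = 0..<d. [:- M $$ (i, p i), u p i:])"
    using eL p by (intro prod.cong) auto
   ultimately show "coeff (\<Prod>i = 0..<d. ?R $$ (i, p i)) k = coeff (\<Prod>i = 0..<d. ?L $$ (i, p i)) (d - k)"
    using coeff_prod_linear_reverse[of "{0..<d}" k "u p" "%i. - M $$ (i, p i)"] True by simp
  qed
  also have "... = coeff (char_poly M) (d - k)"
   unfolding char_poly_def det_def'[OF L] coeff_sum coeff_signof_mult ..
  finally show ?thesis using True deg by (simp add: coeff_reflect_poly)
 next
  case False
  have "degree (det ?R) <= 1 * d"
   by (rule degree_det_le[OF _ R]) (use M in "auto simp: one_pCons")
  thus ?thesis using False deg by (simp add: coeff_reflect_poly coeff_eq_0)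
 qed
qed

lemma coeff_char_poly_0: "M : mats d d ==> coeff (char_poly M) 0 = (-1) ^ d * det M"
 for M :: "'a::field mat"
proof -
 assume M: "M : mats d d"
 have "coeff (char_poly M) 0 = det (map_mat (%p. poly p 0) (char_poly_matrix M))"
  unfolding char_poly_def poly_0_coeff_0[symmetric]
  by (rule poly_det_cong[of _ d]) (use carrier_matD[OF char_poly_matrix_closed[OF M]] in auto)
 also have "map_mat (%p. poly p 0) (char_poly_matrix M) = (-1) \<cdot>\<^sub>m M"
  using M by (intro eq_matI) (auto simp: char_poly_matrix_def)
 finally show ?thesis using M by simp
qed

text \<open>Take determinants in M (z - N) = z M - 1 = -(1 - z M); the right side is the reflected
  characteristic polynomial of \<open>M\<close> up to sign, and det M is its constant term up to
  sign.\<close>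

lemma char_poly_inverse:
 fixes M N :: "'a::field mat"
 assumes M: "M : mats d d" and N: "N : mats d d" and MN: "M * N = im d"
 shows "char_poly N = conj_poly (char_poly M)"
proof -
 let ?c = "map_mat (%a. [:a:])"
 interpret c: comm_ring_hom "%a::'a. [:a:]" by unfold_locales (auto simp: one_pCons)
 have dM: "det M ~= 0" using GL_one_sided_inverse[OF MN M N] by (auto simp: GL_iff_det)
 have MNc: "?c M * ?c N = im d" using c.mat_hom_mult[OF M N] MN by (simp add: c.mat_hom_one)
 have "?c M * char_poly_matrix N = [:0, 1:] \<cdot>\<^sub>m ?c M + (- 1) \<cdot>\<^sub>m im d"
 proof -
  have "char_poly_matrix N = [:0, 1:] \<cdot>\<^sub>m im d + (-1) \<cdot>\<^sub>m ?c N"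
   using N by (intro eq_matI) (auto simp: char_poly_matrix_def)
  thus ?thesis using M N MNc by (simp add: mat_distrib_left mat_smult_right mat_one_right)
 qed
 also have "... = (- 1) \<cdot>\<^sub>m (im d + map_mat (%a. [:0, - a:]) M)"
  using M by (intro eq_matI) auto
 finally have "det (?c M * char_poly_matrix N) = (-1) ^ d * reflect_poly (char_poly M)"
  using char_poly_reflect[OF M] M by simp
 moreover have "det (?c M * char_poly_matrix N) = [:det M:] * char_poly N"
  unfolding char_poly_def using M N by (subst det_mult[of _ d]) (auto simp: c.hom_det)
 ultimately have e: "smult (det M) (char_poly N) = (-1) ^ d * reflect_poly (char_poly M)" by simp
 have "char_poly N = smult (inverse (det M)) (smult (det M) (char_poly N))" using dM by simp
 also have "... = smult (inverse (det M)) ((-1) ^ d * reflect_poly (char_poly M))" unfolding e ..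
 also have "(-1) ^ d * reflect_poly (char_poly M) = smult ((-1) ^ d) (reflect_poly (char_poly M))"
  by (cases "even d") auto
 also have "smult (inverse (det M)) (smult ((-1) ^ d) (reflect_poly (char_poly M))) = conj_poly (char_poly M)"
  unfolding conj_poly_def coeff_char_poly_0[OF M] by (cases "even d") (auto simp: inverse_eq_divide)
 finally show ?thesis .
qed

text \<open>The matrix of multiplication by z on polynomials modulo \<open>ro\<close> in the basis
  1, z, z^2, ...; only its last column involves the coefficients of \<open>ro\<close>.\<close>

definition comp_mat :: "'a::field poly => 'a mat" where
 "comp_mat ro = mat (degree ro) (degree ro) (%(i, j). coeff (monom 1 (Suc j) mod ro) i)"

lemma comp_mat_dim [simp]: "dim_row (comp_mat ro) = degree ro" "dim_col (comp_mat ro) = degree ro"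
 by (auto simp: comp_mat_def)

lemma comp_mat_carrier: "comp_mat ro : mats (degree ro) (degree ro)"
 by (auto simp: comp_mat_def)

lemma monom_mod_small: "k < degree ro ==> monom 1 k mod ro = (monom 1 k :: 'a::field poly)"
 by (rule mod_poly_less) (simp add: degree_monom_eq)

lemma monom_mod_degree:
 fixes ro :: "'a::field poly"
 assumes "monic ro" and "degree ro > 0"
 shows "monom 1 (degree ro) mod ro = monom 1 (degree ro) - ro"
proof -
 have "degree (monom 1 (degree ro) - ro) < degree ro"
 proof (rule degree_lessI)
  show "\<forall>k\<ge>degree ro. coeff (monom 1 (degree ro) - ro) k = 0"
   using assms by (auto simp: coeff_eq_0)
 qed (use assms in simp)
 hence "(monom 1 (degree ro) - ro) mod ro = monom 1 (degree ro) - ro" by (rule mod_poly_less)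
 thus ?thesis by (simp add: poly_mod_diff_left)
qed

lemma char_poly_comp_mat:
 fixes ro :: "'a::field poly"
 assumes m: "monic ro"
 shows "char_poly (comp_mat ro) = ro"
proof (cases "degree ro = 0")
 case True
 hence "ro = 1" using m monic_degree_0 by blast
 moreover have "char_poly_matrix (comp_mat ro) : mats 0 0" using comp_mat_carrier[of ro] True by auto
 ultimately show ?thesis unfolding char_poly_def by (simp add: det_dim_zero)
next
 case False
 define d where "d = degree ro"
 have d: "d > 0" using False d_def by simp
 define L where "L = char_poly_matrix (comp_mat ro)"
 have L: "L : mats d d" unfolding L_def d_def by (rule char_poly_matrix_closed[OF comp_mat_carrier])
 have Lij: "L $$ (i, j) = (if i = j then [:0, 1:] else 0) - [: if j = d - 1 then - coeff ro i else if i = Suc j then 1 else 0 :]"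
  if "i < d" "j < d" for i j
 proof -
  have "coeff (monom 1 (Suc j) mod ro) i = (if j = d - 1 then - coeff ro i else if i = Suc j then 1 else 0)"
  proof (cases "j = d - 1")
   case True
   hence "Suc j = degree ro" using d d_def by simp
   thus ?thesis using True monom_mod_degree[OF m] that False d_def by simp
  next
   case False
   thus ?thesis using that d_def monom_mod_small[of "Suc j" ro] by auto
  qed
  thus ?thesis using that unfolding L_def d_def by (auto simp: char_poly_matrix_def comp_mat_def)
 qed
 \<comment> \<open>Multiplying by the row (1, z, z^2, ...) combines the rows of z - C so that all
   entries but the last telescope away and the last becomes \<open>ro\<close>. Laplace expansion
   along this row then leaves a triangular minor with -1 on the diagonal.\<close>
 define U where "U = mat d d (%(i, j). if i = 0 then monom 1 j else if i = j then 1 else (0 :: 'a poly))"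
 have U: "U : mats d d" unfolding U_def by simp
 have "upper_triangular U" unfolding U_def by (auto simp: upper_triangular_def)
 hence "det U = prod_list (diag_mat U)" using det_upper_triangular U by blast
 also have "... = 1" unfolding prod_list_diag_prod by (rule prod.neutral) (auto simp: U_def)
 finally have detU: "det U = 1" .
 have UL: "U * L : mats d d" using U L by simp
 have row0: "(U * L) $$ (0, j) = (if j = d - 1 then ro else 0)" if j: "j < d" for j
 proof -
  have "(U * L) $$ (0, j) = (\<Sum>k<d. monom 1 k * L $$ (k, j))"
   using j d L by (simp add: U_def scalar_prod_def lessThan_atLeast0)
  also have "... = (\<Sum>k<d. (if k = j then monom 1 (Suc j) else 0)
    - monom (if j = d - 1 then - coeff ro k else if k = Suc j then 1 else 0) k)"
   by (intro sum.cong refl) (auto simp: Lij j monom_Suc right_diff_distrib smult_monom)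
  also have "... = monom 1 (Suc j) - (\<Sum>k<d. monom (if j = d - 1 then - coeff ro k else if k = Suc j then 1 else 0) k)"
   using j by (simp add: sum_subtractf)
  also have "... = (if j = d - 1 then ro else 0)"
  proof (cases "j = d - 1")
   case True
   hence "Suc j = d" using d by simp
   have "ro = (\<Sum>k\<le>d. monom (coeff ro k) k)" using poly_as_sum_of_monoms[of ro] d_def by simp
   also have "... = (\<Sum>k<d. monom (coeff ro k) k) + monom 1 d" using m d_def by (simp add: lessThan_Suc_atMost[symmetric])
   finally have "ro = (\<Sum>k<d. monom (coeff ro k) k) + monom 1 d" .
   hence "monom 1 d + (\<Sum>k<d. monom (coeff ro k) k) = ro" by (simp only: add.commute)
   thus ?thesis using True \<open>Suc j = d\<close> by (simp add: minus_monom[symmetric] sum_negf)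
  next
   case False
   hence "Suc j < d" using j by simp
   hence "(\<Sum>k<d. monom (if k = Suc j then 1 else 0) k) = (monom 1 (Suc j) :: 'a poly)"
    by (subst sum.remove[of _ "Suc j"]) auto
   thus ?thesis using False by simp
  qed
  finally show ?thesis .
 qed
 have rows: "(U * L) $$ (i, j) = L $$ (i, j)" if "0 < i" "i < d" "j < d" for i j
 proof -
  have "row U i = unit_vec d i" using that unfolding U_def by (intro eq_vecI) (auto simp: unit_vec_def)
  thus ?thesis using that L U by simp
 qed
 define M where "M = mat_delete (U * L) 0 (d - 1)"
 have M: "M : mats (d - 1) (d - 1)" unfolding M_def using mat_delete_carrier[of "U * L" d d] UL by simp
 have Mij: "M $$ (i, j) = L $$ (Suc i, j)" if "i < d - 1" "j < d - 1" for i j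
  using that U L rows[of "Suc i" j] unfolding M_def by (simp add: mat_delete_def)
 have "upper_triangular M" using M by (auto simp: upper_triangular_def Mij Lij)
 hence "det M = prod_list (diag_mat M)" using det_upper_triangular M by blast
 also have "... = (\<Prod>i = 0..<d - 1. - 1)" unfolding prod_list_diag_prod
  by (rule prod.cong) (use M in "auto simp: Mij Lij one_pCons")
 finally have detM: "det M = (-1) ^ (d - 1)" by simp
 have "det (U * L) = (\<Sum>j<d. (U * L) $$ (0, j) * cofactor (U * L) 0 j)"
  by (rule laplace_expansion_row[OF UL]) (use d in simp)
 also have "... = (\<Sum>j<d. if j = d - 1 then ro * cofactor (U * L) 0 (d - 1) else 0)"
  by (intro sum.cong) (auto simp: row0)
 also have "... = ro * cofactor (U * L) 0 (d - 1)" using d by simp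
 also have "... = ro * ((-1) ^ (d - 1) * (-1) ^ (d - 1))" unfolding cofactor_def M_def[symmetric] detM by simp
 also have "... = ro" by (simp add: power_mult_distrib[symmetric])
 finally have "det U * det L = ro" using det_mult[OF U L] by simp
 thus ?thesis unfolding char_poly_def L_def[symmetric] detU by simp
qed

section \<open>Shift-invariant symmetric forms on polynomials\<close>

definition zform :: "('a::field poly => 'a poly => 'a) => bool" where
 "zform b \<longleftrightarrow> (\<forall>h k. b h k = b k h) & (\<forall>h h' k. b (h + h') k = b h k + b h' k)
  & (\<forall>c h k. b (smult c h) k = c * b h k) & (\<forall>h k. b (pCons 0 h) (pCons 0 k) = b h k)"

text \<open>The radical is required to be exactly the ideal of \<open>ch\<close>, so these are the
  nondegenerate shift-invariant forms on the quotient by \<open>ch\<close>.\<close>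

definition nforms :: "'a::field poly => ('a poly => 'a poly => 'a) set" where
 "nforms ch = {b. zform b & (\<forall>h. (\<forall>k. b h k = 0) \<longleftrightarrow> ch dvd h)}"

lemma zformD:
 assumes "zform b"
 shows "b h k = b k h" "b (h + h') k = b h k + b h' k" "b h (k + k') = b h k + b h k'"
  "b (smult c h) k = c * b h k" "b h (smult c k) = c * b h k" "b (pCons 0 h) (pCons 0 k) = b h k"
 using assms unfolding zform_def by metis+

lemma nformsD:
 assumes "b \<in> nforms ch"
 shows "zform b" "(\<forall>k. b h k = 0) \<longleftrightarrow> ch dvd h" "ch dvd h ==> b h k = 0" "ch dvd h ==> b k h = 0"
proof -
 show z: "zform b" and r: "(\<forall>k. b h k = 0) \<longleftrightarrow> ch dvd h" for h using assms by (auto simp: nforms_def)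
 show "ch dvd h ==> b h k = 0" using r by blast
 thus "ch dvd h ==> b k h = 0" using zformD(1)[OF z, of k h] by simp
qed

lemma nforms_mod:
 assumes "b \<in> nforms ch"
 shows "b (h mod ch) (k mod ch) = b h k"
proof -
 have "b (h mod ch) k' = b h k'" for h k'
 proof -
  have "b h k' = b (ch * (h div ch) + h mod ch) k'" by simp
  also have "... = b (ch * (h div ch)) k' + b (h mod ch) k'" by (rule zformD(2)[OF nformsD(1)[OF assms]])
  finally show ?thesis using nformsD(3)[OF assms, of "ch * (h div ch)" k'] by simp
 qed
 thus ?thesis using zformD(1)[OF nformsD(1)[OF assms]] by metis
qed

definition pairs :: "nat => 'a::field poly => ('a mat \<times> 'a mat) set" where
 "pairs n \<phi> = {(A, B). A : mats n n & B : GL n & B\<^sup>T = B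
  & bil B A A = B & char_poly A = \<phi>}"

lemma pairsD:
 assumes "(A, B) \<in> pairs n \<phi>"
 shows "A : mats n n" "B : GL n" "B : mats n n" "B\<^sup>T = B"
  "bil B A A = B" "char_poly A = \<phi>" "A : GL n"
proof -
 show 1: "A : mats n n" "B : GL n" "B\<^sup>T = B"
  "bil B A A = B" "char_poly A = \<phi>" using assms by (auto simp: pairs_def)
 show 2: "B : mats n n" using GL_carrier[OF 1(2)] .
 have "(A\<^sup>T * B) * A : GL n" using 1 2 by (simp add: mat_assoc)
 thus "A : GL n" by (rule GL_mult_cancel(2)) (use 1 2 in auto)
qed

definition bf :: "'a::field mat => 'a mat => 'a mat => 'a poly => 'a poly => 'a" where
 "bf A B v h k = ((pv A v h)\<^sup>T * (B * pv A v k)) $$ (0, 0)"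

text \<open>Invariance under multiplication of both arguments by z is the isometry property of
  \<open>A\<close>; symmetry is that of \<open>B\<close>.\<close>

lemma zform_bf:
 assumes AB: "(A, B) \<in> pairs n \<phi>" and v: "v : mats n 1"
 shows "zform (bf A B v)"
proof -
 note A = pairsD(1)[OF AB] and B = pairsD(3,4)[OF AB]
 note c = pv_carrier[OF A v]
 have "bf A B v h k = bf A B v k h" for h k
 proof -
  have "bf A B v h k = ((pv A v h)\<^sup>T * (B * pv A v k))\<^sup>T $$ (0, 0)"
   unfolding bf_def using c[of h] c[of k] by (subst index_transpose_mat) auto
  thus ?thesis unfolding gram_transpose[OF B(2,1) c c] bf_def .
 qed
 moreover have "bf A B v (h + h') k = bf A B v h k + bf A B v h' k" for h h' k
  unfolding bf_def pv_add[OF A v] using c[of h] c[of h'] c[of k] B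
  by (simp add: transpose_add_dim mat_distrib_right)
 moreover have "bf A B v (smult a h) k = a * bf A B v h k" for a h k
  unfolding bf_def pv_smult[OF A v] using c[of h] c[of k] B
  by (simp add: transpose_smult mat_smult_left)
 moreover have "bf A B v (pCons 0 h) (pCons 0 k) = bf A B v h k" for h k
 proof -
  have "(A * pv A v h)\<^sup>T * (B * (A * pv A v k)) = (pv A v h)\<^sup>T * (bil B A A * pv A v k)"
   using A B c[of h] c[of k] by (simp add: mat_ring)
  thus ?thesis unfolding bf_def pv_shift[OF A v] pairsD(5)[OF AB] by simp
 qed
 ultimately show ?thesis unfolding zform_def by blast
qed

definition gram :: "('a::field poly => 'a poly => 'a) => 'a poly => nat => 'a poly => nat => 'a mat" where
 "gram b s d t e = mat d e (%(i, j). b (s * monom 1 i) (t * monom 1 j))"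

lemma mult_entry_cols:
 fixes S T M :: "'a::field mat"
 assumes "S : mats n d" "T : mats n e" "i < d" "j < e"
  and "s : mats n 1" "t : mats n 1" "B : mats n n"
  and "!!k. k < n ==> s $$ (k, 0) = S $$ (k, i)" and "!!k. k < n ==> t $$ (k, 0) = T $$ (k, j)"
 shows "(bil B S T) $$ (i, j) = (bil B s t) $$ (0, 0)"
proof -
 have "col S i = col s 0" "col T j = col t 0" using assms by (auto intro!: eq_vecI)
 moreover from this have "col (B * T) j = col (B * t) 0" using assms
  by (intro eq_vecI) auto
 ultimately show ?thesis using assms by simp
qed

lemma gram_kr:
 assumes AB: "(A, B) \<in> pairs n \<phi>" and v: "v : mats n 1"
 shows "(kr A v s d)\<^sup>T * (B * kr A v t e) = gram (bf A B v) s d t e"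
proof (rule eq_matI)
 note A = pairsD(1)[OF AB] and B = pairsD(3)[OF AB]
 fix i j assume ij: "i < dim_row (gram (bf A B v) s d t e)" "j < dim_col (gram (bf A B v) s d t e)"
 hence ij': "i < d" "j < e" by (auto simp: gram_def)
 have "((kr A v s d)\<^sup>T * (B * kr A v t e)) $$ (i, j)
   = ((pv A v (s * monom 1 i))\<^sup>T * (B * pv A v (t * monom 1 j))) $$ (0, 0)"
  by (rule mult_entry_cols[OF kr_carrier[OF v] kr_carrier[OF v] ij' pv_carrier[OF A v] pv_carrier[OF A v] B])
   (use v ij' in "auto simp: kr_def")
 thus "((kr A v s d)\<^sup>T * (B * kr A v t e)) $$ (i, j) = gram (bf A B v) s d t e $$ (i, j)"
  using ij' by (simp add: gram_def bf_def)
qed (use v pairsD(3)[OF AB] in "auto simp: gram_def")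

lemma gram_mult_cvec:
 assumes b: "zform b" and p: "!!i. i >= e ==> coeff p i = 0" and i: "i < d"
 shows "(gram b s d t e * cvec e p) $$ (i, 0) = b (s * monom 1 i) (t * p)"
proof -
 have "b (s * monom 1 i) (t * p) = (\<Sum>j<e. coeff p j * b (s * monom 1 i) (t * monom 1 j))"
  by (rule linear_poly_sum[where F = "%p. b (s * monom 1 i) (t * p)"])
   (use p in "auto simp: distrib_left zformD[OF b]")
 also have "... = (gram b s d t e * cvec e p) $$ (i, 0)"
  using i by (auto simp: gram_def cvec_def scalar_prod_def lessThan_atLeast0 mult.commute intro!: sum.cong)
 finally show ?thesis by simp
qed

lemma cvec_gram_cvec:
 assumes b: "zform b" and p: "!!i. i >= e ==> coeff p i = 0" and q: "!!i. i >= d ==> coeff q i = 0"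
 shows "((cvec d q)\<^sup>T * (gram b 1 d 1 e * cvec e p)) $$ (0, 0) = b q p"
proof -
 have "b q p = (\<Sum>j<d. coeff q j * b (monom 1 j) p)"
  by (rule linear_poly_sum[where F = "%q. b q p"]) (use q in "auto simp: zformD[OF b]")
 also have "... = (\<Sum>j<d. coeff q j * (gram b 1 d 1 e * cvec e p) $$ (j, 0))"
  by (intro sum.cong refl) (use gram_mult_cvec[OF b p, where s = 1 and t = 1 and d = d] in auto)
 also have "... = ((cvec d q)\<^sup>T * (gram b 1 d 1 e * cvec e p)) $$ (0, 0)"
  by (auto simp: gram_def cvec_def scalar_prod_def lessThan_atLeast0 intro!: sum.cong)
 finally show ?thesis by simp
qed

lemma gram_carrier: "gram b s d t e : mats d e"
 by (auto simp: gram_def)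

text \<open>A kernel vector is a polynomial of degree below deg \<open>ch\<close> orthogonal to all
  monomials of such degree. Reducing the other argument modulo \<open>ch\<close>, it is orthogonal
  to everything, so \<open>ch\<close> divides it and it is zero.\<close>

lemma gram_GL:
 assumes b: "b \<in> nforms ch" and ch: "ch ~= 0"
 shows "gram b 1 (degree ch) 1 (degree ch) : GL (degree ch)"
proof (rule injective_GL[OF gram_carrier])
 let ?e = "degree ch" let ?G = "gram b 1 ?e 1 ?e"
 have G: "?G : mats ?e ?e" by (rule gram_carrier)
 have "c = zm ?e 1" if c: "c : mats ?e 1" "?G * c = zm ?e 1" for c
 proof -
  define p where "p = vpoly c"
  have p: "coeff p i = 0" if "i >= ?e" for i using that c unfolding p_def by (simp add: coeff_vpoly)
  have cp: "c = cvec ?e p" unfolding p_def using cvec_vpoly[OF c(1)] by simp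
  have z: "b (monom 1 i) p = 0" if "i < ?e" for i
   
  proof -
   have "(?G * cvec ?e p) $$ (i, 0) = b (1 * monom 1 i) (1 * p)"
    by (rule gram_mult_cvec[OF nformsD(1)[OF b] p that])
   thus ?thesis using c(2) that unfolding cp by simp
  qed
  have "b h p = 0" for h
  proof -
   have "b h p = b (h mod ch) (p mod ch)" using nforms_mod[OF b] by simp
   also have "... = b (h mod ch) p" using nforms_mod[OF b, of "h mod ch" p] nforms_mod[OF b, of "h mod ch" "p mod ch"]
    nforms_mod[OF b, of h p] by (cases "p = 0") (metis mod_mod_trivial nforms_mod[OF b])+
   also have "... = (\<Sum>j<?e. coeff (h mod ch) j * b (monom 1 j) p)"
   proof (rule linear_poly_sum[where F = "%q. b q p"])
    fix i assume "i >= ?e"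
    thus "coeff (h mod ch) i = 0" using ch degree_mod_less[of ch h] by (auto intro: coeff_eq_0)
   qed (auto simp: zformD[OF nformsD(1)[OF b]])
   finally show ?thesis using z by simp
  qed
  hence "ch dvd p" using nformsD(2)[OF b, of p] zformD(1)[OF nformsD(1)[OF b]] by metis
  hence "p = 0" using p by (metis ch coeff_0 dvd_imp_degree_le le_degree leading_coeff_0_iff linorder_not_less not_less)
  thus ?thesis unfolding cp by (simp add: cvec_0)
 qed
 thus "injective_mat ?G" unfolding injective_mat_def carrier_matD[OF G] by blast
qed

text \<open>Pairs \<open>(x, P)\<close> with \<open>x\<close> related to some \<open>y\<close> under
  \<open>P\<close> are counted twice: by \<open>x\<close>, each with \<open>h\<close> admissible
  \<open>P\<close>, and by \<open>(P, y)\<close>, which determines \<open>x\<close> and, for given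
  \<open>P\<close>, is determined by it. Transport of structure along a change of basis has this
  shape.\<close>

lemma double_count:
 assumes fin: "finite S" "finite T" "finite G"
  and h: "!!x. x \<in> S ==> card {P \<in> G. \<exists>y\<in>T. r P x y} = h"
  and ex: "!!P y. P \<in> G ==> y \<in> T ==> \<exists>x\<in>S. r P x y"
  and ux: "!!P x x' y. P \<in> G ==> y \<in> T ==> r P x y ==> r P x' y ==> x = x'"
  and uy: "!!P x y y'. P \<in> G ==> r P x y ==> r P x y' ==> y = y'"
 shows "card S * h = card G * card T"
proof -
 define U where "U = (SIGMA x:S. {P \<in> G. \<exists>y\<in>T. r P x y})"
 have "card U = card S * h" unfolding U_def using fin h by (subst card_SigmaI) auto
 moreover have "bij_betw (%(P, y). (THE x. x \<in> S & r P x y, P)) (G \<times> T) U"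
 proof -
  have the: "(THE x. x \<in> S & r P x y) \<in> S & r P (THE x. x \<in> S & r P x y) y" if "P \<in> G" "y \<in> T" for P y
   by (rule theI') (use ex[OF that] ux[OF that] in blast)
  show ?thesis
   unfolding bij_betw_def
  proof (intro conjI inj_onI)
   fix u w assume "u \<in> G \<times> T" "w \<in> G \<times> T"
    "(case u of (P, y) => (THE x. x \<in> S & r P x y, P)) = (case w of (P, y) => (THE x. x \<in> S & r P x y, P))"
   thus "u = w" using the uy by (auto split: prod.splits) (metis)
  next
   show "(%(P, y). (THE x. x \<in> S & r P x y, P)) ` (G \<times> T) = U"
   proof (intro equalityI subsetI)
    fix z assume "z \<in> (%(P, y). (THE x. x \<in> S & r P x y, P)) ` (G \<times> T)"
    thus "z \<in> U" using the unfolding U_def by auto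
   next
    fix z assume "z \<in> U"
    then obtain x P y where z: "z = (x, P)" "x \<in> S" "P \<in> G" "y \<in> T" "r P x y" unfolding U_def by auto
    hence "(THE x. x \<in> S & r P x y) = x" using the ux by blast
    thus "z \<in> (%(P, y). (THE x. x \<in> S & r P x y, P)) ` (G \<times> T)"
     using z by (intro image_eqI[of _ _ "(P, y)"]) auto
   qed
  qed
 qed
 ultimately show ?thesis using bij_betw_same_card by (fastforce simp: card_cartesian_product)
qed

lemma conj_gram:
 fixes B :: "'a::field mat"
 assumes "B : mats n n" "P : mats n n" "S : mats n s" "T : mats n t"
 shows "(P * S)\<^sup>T * (B * (P * T)) = S\<^sup>T * (bil B P P * T)"
 using assms by (simp add: mat_ring)

text \<open>The dual block \<open>Y\<close> of \<open>R\<close> makes the span of \<open>R\<close>,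
  \<open>W\<close>, \<open>Y\<close> nondegenerate, and \<open>Z\<close> is its orthogonal
  complement. The inequality between dimensions is part of the result because the block sizes of a
  type are only known to fit after this.\<close>

lemma isotropic_frame_extend:
 fixes B :: "'a::{field,finite} mat"
 assumes B: "B : GL n" "B\<^sup>T = B" and two: "(2::'a) ~= 0"
  and R: "R : mats n d" "injective_mat R" and W: "W : mats n e"
  and RR: "bil B R R = zm d d" and RW: "bil B R W = zm d e"
  and WW: "bil B W W : GL e"
 shows "d + e + d <= n & (\<exists>Z \<in> mats n (n - (d + e + d)). \<exists>Y \<in> mats n d.
  bil B R Z = zm d (n - (d + e + d)) & bil B R Y = im d
  & bil B W Z = zm e (n - (d + e + d)) & bil B W Y = zm e d
  & bil B Z Z : GL (n - (d + e + d)) & bil B Z Y = zm (n - (d + e + d)) d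
  & bil B Y Y = zm d d)"
proof -
 have Bc: "B : mats n n" using B GL_carrier by blast
 obtain Y where Y: "Y : mats n d" "bil B R Y = im d"
  "bil B W Y = zm e d" "bil B Y Y = zm d d"
  using dual_frame_exists[OF B two R W RR RW WW] by auto
 define U where "U = hc (hc R W) Y"
 have U: "U : mats n (d + e + d)" unfolding U_def by (rule hc_carrier[OF hc_carrier[OF R(1) W] Y(1)])
 define Q where "Q = bil B U U"
 have Q: "Q : mats (d + e + d) (d + e + d)" unfolding Q_def using U Bc by auto
 have UB: "bil B U T = vc (vc (bil B R T) (bil B W T)) (bil B Y T)"
  if "T : mats n t" for T t
  unfolding U_def hc_gram_left[OF Bc that hc_carrier[OF R(1) W] Y(1)] hc_gram_left[OF Bc that R(1) W] ..
 have "c = zm (d + e + d) 1" if c: "c : mats (d + e + d) 1" "Q * c = zm (d + e + d) 1" for c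
 proof -
  obtain r x y where 1: "r : mats d 1" "x : mats e 1" "y : mats d 1" "c = vc (vc r x) y"
   using vc3_split[OF c(1)] by auto
  note dims = R(1) W Y(1) 1(1-3)
  define t where "t = R * r + W * x + Y * y"
  have Uc: "U * c = t" unfolding U_def 1(4) t_def by (rule frame_mult[OF dims])
  have t: "t : mats n 1" unfolding t_def using dims by auto
  have "Q * c = bil B U t" unfolding Q_def Uc[symmetric] using U Bc c(1) by (simp add: mat_assoc)
  hence z: "vc (vc (bil B R t) (bil B W t)) (bil B Y t)
    = vc (vc (zm d 1) (zm e 1)) (zm d 1)"
   using c(2) UB[OF t] by (simp add: vc_zero)
  have z1: "vc (bil B R t) (bil B W t) = vc (zm d 1) (zm e 1)"
   "bil B Y t = zm d 1" using vc_eqD[OF z] R W Y t by auto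
  have z2: "bil B R t = zm d 1" "bil B W t = zm e 1"
   using vc_eqD[OF z1(1)] R W Y t by auto
  have YR: "bil B Y R = im d" using gram_swap[OF Y(2) B(2) Bc R(1) Y(1)] by simp
  have WR: "bil B W R = zm e d" using gram_swap[OF RW B(2) Bc R(1) W] by simp
  have YW: "bil B Y W = zm d e" using gram_swap[OF Y(3) B(2) Bc W Y(1)] by simp
  have "zm d d * r + zm d e * x + im d * y = zm d 1"
   using gram3[OF Bc R(1) dims RR RW Y(2)] z2 unfolding t_def by simp
  hence y: "y = zm d 1" using 1 by (simp add: mat_ring)
  have "im d * r + zm d e * x + zm d d * y = zm d 1"
   using gram3[OF Bc Y(1) dims YR YW Y(4)] z1 unfolding t_def by simp
  hence r: "r = zm d 1" using 1 by (simp add: mat_ring)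
  have "zm e d * r + bil B W W * x + zm e d * y = zm e 1"
   using gram3[OF Bc W dims WR refl Y(3)] z2 unfolding t_def by simp
  hence "bil B W W * x = zm e 1"
   using 1 W Bc by (simp add: mat_zero_left mat_add_zero_left mat_add_zero_right)
  hence "x = zm e 1" using injective_mat_vecD[OF GL_injective[OF WW] _ GL_carrier[OF WW]] 1 by simp
  thus ?thesis using r y 1 by (simp add: vc_zero)
 qed
 hence "injective_mat Q" unfolding injective_mat_def carrier_matD[OF Q] by blast
 hence QG: "bil B U U : GL (d + e + d)" using injective_GL[OF Q] unfolding Q_def by blast
 obtain Z where le: "d + e + d <= n" and Z: "Z : mats n (n - (d + e + d))" "hc U Z : GL n"
  "bil B U Z = zm (d + e + d) (n - (d + e + d))"
  using orthogonal_complement_frame[OF Bc U QG] by auto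
 define m where "m = n - (d + e + d)"
 note Z = Z[folded m_def]
 have ZZ: "bil B Z Z : GL m" by (rule complement_nondegenerate[OF B(1) Z(2) U Z(1,3)])
 have z: "vc (vc (bil B R Z) (bil B W Z)) (bil B Y Z)
    = vc (vc (zm d m) (zm e m)) (zm d m)" using UB[OF Z(1)] Z(3) by (simp add: vc_zero)
 have z1: "vc (bil B R Z) (bil B W Z) = vc (zm d m) (zm e m)"
  "bil B Y Z = zm d m" using vc_eqD[OF z] R W Y Z by auto
 have z2: "bil B R Z = zm d m" "bil B W Z = zm e m"
  using vc_eqD[OF z1(1)] R W Y Z by auto
 have z3: "bil B Z Y = zm m d" using gram_swap[OF z1(2) B(2) Bc Y(1) Z(1)] by simp
 show ?thesis unfolding m_def[symmetric] using le Z(1) Y z2 ZZ z3 by blast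
qed

definition fr :: "'a mat => 'a mat => 'a mat => 'a mat => 'a mat" where
 "fr R W Z Y = hc (hc R (hc W Z)) Y"

lemma mult_fr:
 assumes "P : mats k n" "R : mats n d" "W : mats n e" "Z : mats n m" "Y : mats n d'"
 shows "P * fr R W Z Y = fr (P * R) (P * W) (P * Z) (P * Y)"
 using assms by (simp add: fr_def mult_hc)

lemma fr_eqD:
 assumes "fr R W Z Y = fr R' W' Z' Y'"
  and "R : mats n d" "W : mats n e" "Z : mats n m" "Y : mats n d'"
  and "R' : mats n d" "W' : mats n e" "Z' : mats n m" "Y' : mats n d'"
 shows "R = R'" "W = W'" "Z = Z'" "Y = Y'"
proof -
 have 1: "hc R (hc W Z) = hc R' (hc W' Z')" "Y = Y'" using hc_eqD[OF assms(1)[unfolded fr_def]] assms(2-) by auto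
 have 2: "R = R'" "hc W Z = hc W' Z'" using hc_eqD[OF 1(1)] assms(2-) by auto
 have 3: "W = W'" "Z = Z'" using hc_eqD[OF 2(2)] assms(2-) by auto
 show "R = R'" "W = W'" "Z = Z'" "Y = Y'" using 1 2 3 by auto
qed

section \<open>Triples (A, B, v) of a fixed cyclic type\<close>

locale cyclic_base =
 fixes b :: "'a::{field,finite} poly => 'a poly => 'a" and ch ro \<phi> :: "'a poly" and n d e :: nat
 assumes two: "(2::'a) ~= 0" and b: "b \<in> nforms ch" and ch: "monic ch" "coeff ch 0 ~= 0"
  and ro: "monic ro" "coeff ro 0 ~= 0"
  and d: "d = degree ro" and e: "e = degree ch"
begin

definition G where "G = gram b 1 e 1 e"

lemma G: "G : GL e" "G : mats e e"
proof -
 have "ch ~= 0" using ch by auto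
 thus "G : GL e" unfolding G_def unfolding e by (rule gram_GL[OF b])
 show "G : mats e e" unfolding G_def by (rule gram_carrier)
qed

text \<open>Fixing \<open>b\<close> and the annihilator \<open>ch * ro\<close> fixes the isometry
  type of the cyclic space of \<open>v\<close>, of dimension \<open>d + e\<close>. Its radical, of
  dimension \<open>d\<close>, is generated by ch(A) v.\<close>

definition triples where
 "triples = {(A, B, v). (A, B) \<in> pairs n \<phi> & v : mats n 1 & bf A B v = b
  & (\<forall>h. pv A v h = zm n 1 \<longleftrightarrow> ch * ro dvd h)}"

lemma nz: "ch ~= 0" "ro ~= 0" "ch * ro ~= 0"
 using ch ro by auto

lemma triples_pairs:
 assumes "(A, B, v) \<in> triples"
 shows "(A, B) \<in> pairs n \<phi>" "v : mats n 1" "bf A B v = b" "pv A v h = zm n 1 \<longleftrightarrow> ch * ro dvd h"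
 using assms by (auto simp: triples_def)

text \<open>Multiples of \<open>ch\<close> lie in the radical of \<open>b\<close>, so the Krylov
  block started at \<open>ch\<close> is totally isotropic and orthogonal to the one started at 1. It
  is injective since ch p is annihilated only if \<open>ro\<close> divides p.\<close>

lemma triples_gram:
 assumes x: "(A, B, v) \<in> triples"
 shows "(kr A v ch d)\<^sup>T * (B * kr A v ch d) = zm d d"
  "(kr A v ch d)\<^sup>T * (B * kr A v 1 e) = zm d e"
  "(kr A v 1 e)\<^sup>T * (B * kr A v 1 e) = G"
  "injective_mat (kr A v ch d)"
proof -
 note AB = triples_pairs(1)[OF x] and v = triples_pairs(2)[OF x]
 note A = pairsD(1)[OF AB]
 note g = gram_kr[OF AB v, unfolded triples_pairs(3)[OF x]]
 show "(kr A v ch d)\<^sup>T * (B * kr A v ch d) = zm d d"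
  "(kr A v ch d)\<^sup>T * (B * kr A v 1 e) = zm d e"
  "(kr A v 1 e)\<^sup>T * (B * kr A v 1 e) = G"
  unfolding g G_def by (auto simp: gram_def intro!: eq_matI nformsD(3)[OF b])
 have "c = zm d 1" if c: "c : mats d 1" "kr A v ch d * c = zm n 1" for c
 proof -
  have cp: "c = cvec d (vpoly c)" using cvec_vpoly[OF c(1)] by simp
  have p: "!!i. i >= d ==> coeff (vpoly c) i = 0" using c by (simp add: coeff_vpoly)
  have "kr A v ch d * cvec d (vpoly c) = pv A v (ch * vpoly c)"
   by (rule kr_mult_cvec[OF A v]) (rule p)
  hence "pv A v (ch * vpoly c) = zm n 1" using c cp by simp
  hence "ch * ro dvd ch * vpoly c" using triples_pairs(4)[OF x] by simp
  hence "ro dvd vpoly c" using nz by simp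
  moreover have "vpoly c = 0 \<or> degree (vpoly c) < d" using p by (meson leading_coeff_0_iff not_less)
  ultimately have "vpoly c = 0" unfolding d using dvd_imp_degree_le[of ro "vpoly c"] by linarith
  thus ?thesis using cp by (simp add: cvec_0)
 qed
 thus "injective_mat (kr A v ch d)"
  unfolding injective_mat_def carrier_matD[OF kr_carrier[OF v]] by blast
qed

end

text \<open>The four blocks of the space: the radical \<open>R\<close> of the cyclic space, a
  nondegenerate complement \<open>W\<close> of it inside that space, an isotropic \<open>Y\<close>
  dual to \<open>R\<close>, and the remaining part \<open>Z\<close> of dimension
  \<open>m\<close>.\<close>

locale cyclic_type = cyclic_base b ch ro \<phi> n d e
 for b :: "'a::{field,finite} poly => 'a poly => 'a" and ch ro \<phi> :: "'a poly" and n d e :: nat +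
 fixes m :: nat
 assumes n: "n = d + (e + m) + d"
begin

definition E where "E k l = (mat n l (%(i, j). if i = k + j then 1 else 0) :: 'a mat)"

abbreviation "ER \<equiv> E 0 d"
abbreviation "EW \<equiv> E d e"
abbreviation "EZ \<equiv> E (d + e) m"
abbreviation "EY \<equiv> E (d + e + m) d"

lemma E_carrier: "E k l : mats n l" by (simp add: E_def)

lemma E_dim [simp]: "dim_row (E k l) = n" "dim_col (E k l) = l" by (auto simp: E_def)

lemma fr_E: "fr ER EW EZ EY = im n"
 unfolding fr_def hc_def E_def using n by (intro eq_matI) auto

lemma E_orth:
 assumes "k + l <= n" "k' + l' <= n"
 shows "(E k l)\<^sup>T * E k' l' = mat l l' (%(i, j). if k + i = k' + j then 1 else 0)"
proof (rule eq_matI)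
 fix i j assume ij: "i < dim_row (mat l l' (%(i, j). if k + i = k' + j then 1 else 0 :: 'a))"
  "j < dim_col (mat l l' (%(i, j). if k + i = k' + j then 1 else 0 :: 'a))"
 hence "((E k l)\<^sup>T * E k' l') $$ (i, j)
  = (\<Sum>t<n. (if t = k + i then 1 else 0) * (if t = k' + j then 1 else 0))"
  by (simp add: E_def scalar_prod_def lessThan_atLeast0)
 also have "... = (\<Sum>t<n. if t = k + i then if k + i = k' + j then 1 else 0 else 0)"
  by (intro sum.cong) auto
 also have "... = (if k + i = k' + j then 1 else 0)" using ij assms by simp
 finally show "((E k l)\<^sup>T * E k' l') $$ (i, j) = mat l l' (%(i, j). if k + i = k' + j then 1 else 0) $$ (i, j)"
  using ij by simp
qed auto

lemma E_orth_block:
 assumes "k + l <= n" "k' + l' <= n"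
 shows "k = k' ==> l = l' ==> (E k l)\<^sup>T * E k' l' = im l"
  and "k + l <= k' \<or> k' + l' <= k ==> (E k l)\<^sup>T * E k' l' = zm l l'"
 unfolding E_orth[OF assms] by (intro eq_matI; auto)+

lemma le_n: "0 + d <= n" "d + e <= n" "d + e + m <= n" "d + e + m + d <= n" "d + e + m <= d + e + m"
 unfolding n by auto

lemma E_one:
 "ER\<^sup>T * ER = im d" "EW\<^sup>T * EW = im e"
 "EZ\<^sup>T * EZ = im m" "EY\<^sup>T * EY = im d"
 by (rule E_orth_block(1)[OF _ _ refl refl]; use le_n in simp)+

lemma E_zero:
 "ER\<^sup>T * EW = zm d e" "ER\<^sup>T * EZ = zm d m" "ER\<^sup>T * EY = zm d d"
 "EW\<^sup>T * ER = zm e d" "EW\<^sup>T * EZ = zm e m" "EW\<^sup>T * EY = zm e d"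
 "EZ\<^sup>T * ER = zm m d" "EZ\<^sup>T * EW = zm m e" "EZ\<^sup>T * EY = zm m d"
 "EY\<^sup>T * ER = zm d d" "EY\<^sup>T * EW = zm d e" "EY\<^sup>T * EZ = zm d m"
 by (rule E_orth_block(2); use le_n in simp)+

text \<open>Coordinates of a residue class modulo \<open>ch * ro\<close>: dividing by
  \<open>ch\<close>, the quotient gives those along ch z^j and the remainder those along z^j. Placed
  in the standard blocks, they form the model \<open>K h\<close> of the vector h(A) v.\<close>

definition cR where "cR h = cvec d ((h mod (ch * ro)) div ch)"
definition cW where "cW h = cvec e ((h mod (ch * ro)) mod ch)"
definition K where "K h = ER * cR h + EW * cW h"

lemma c_carrier: "cR h : mats d 1" "cW h : mats e 1"
 by (auto simp: cR_def cW_def cvec_carrier)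

lemma c_dim [simp]: "dim_row (cR h) = d" "dim_col (cR h) = Suc 0" "dim_row (cW h) = e" "dim_col (cW h) = Suc 0"
 by (auto simp: cR_def cW_def)

lemma K_carrier: "K h : mats n 1"
 unfolding K_def using c_carrier E_carrier by auto

lemma div_bound:
 assumes "i >= d"
 shows "coeff ((h mod (ch * ro)) div ch) i = 0"
proof (rule ccontr)
 let ?r = "h mod (ch * ro)" let ?q = "?r div ch"
 assume c: "coeff ?q i ~= 0"
 hence q: "?q ~= 0" "i <= degree ?q" using le_degree by auto
 have r: "?r ~= 0" using q by auto
 hence "degree ?r < degree (ch * ro)" using degree_mod_less[OF nz(3), of h] by auto
 hence 1: "degree ?r < e + d" unfolding e d using nz by (simp add: degree_mult_eq)
 have "degree (?q * ch) <= degree ?r"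
 proof -
  have "?q * ch = ?r - ?r mod ch" by (simp add: minus_mod_eq_div_mult)
  moreover have "degree (?r - ?r mod ch) <= max (degree ?r) (degree (?r mod ch))" by (rule degree_diff_le_max)
  moreover have "degree (?r mod ch) <= degree ?r"
  proof (cases "degree ?r < degree ch")
   case True thus ?thesis by (simp add: mod_poly_less)
  next
   case False
   thus ?thesis using degree_mod_less[OF nz(1), of ?r] by auto
  qed
  ultimately show ?thesis by simp
 qed
 thus False using q nz 1 assms by (simp add: degree_mult_eq e)
qed

lemma mod_bound: "i >= e ==> coeff (h mod ch) i = 0"
 using degree_mod_less[OF nz(1), of h] unfolding e by (auto intro: coeff_eq_0)

lemma K_decomp: "h mod (ch * ro) = ch * ((h mod (ch * ro)) div ch) + (h mod (ch * ro)) mod ch"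
 by simp

lemma E_coords:
 assumes "r : mats d l" "w : mats e l"
 shows "ER\<^sup>T * (ER * r + EW * w) = r" "EW\<^sup>T * (ER * r + EW * w) = w"
  "EZ\<^sup>T * (ER * r + EW * w) = zm m l" "EY\<^sup>T * (ER * r + EW * w) = zm d l"
proof -
 have "(E k l')\<^sup>T * (ER * r + EW * w) = ((E k l')\<^sup>T * ER) * r + ((E k l')\<^sup>T * EW) * w"
  for k l' using assms by (simp add: mat_distrib_left mat_assoc)
 thus "ER\<^sup>T * (ER * r + EW * w) = r" "EW\<^sup>T * (ER * r + EW * w) = w"
  "EZ\<^sup>T * (ER * r + EW * w) = zm m l" "EY\<^sup>T * (ER * r + EW * w) = zm d l"
  using assms by (simp_all add: E_one E_zero mat_one_left mat_zero_left mat_add_zero_left mat_add_zero_right)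
qed

lemma K_eq_0_iff: "K h = zm n 1 \<longleftrightarrow> ch * ro dvd h"
proof
 assume "K h = zm n 1"
 hence "cR h = ER\<^sup>T * zm n 1" "cW h = EW\<^sup>T * zm n 1"
  using E_coords(1,2)[OF c_carrier(1)[of h] c_carrier(2)[of h]] unfolding K_def by simp_all
 hence "cR h = zm d 1" "cW h = zm e 1" by (simp_all add: mat_zero_right)
 hence "(h mod (ch * ro)) div ch = 0" "(h mod (ch * ro)) mod ch = 0"
  unfolding cR_def cW_def using cvec_eq_0D div_bound mod_bound by blast+
 hence "h mod (ch * ro) = 0" using K_decomp[of h] by simp
 thus "ch * ro dvd h" by (simp add: mod_eq_0_iff_dvd)
next
 assume "ch * ro dvd h"
 hence "h mod (ch * ro) = 0" by (simp add: mod_eq_0_iff_dvd)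
 thus "K h = zm n 1" unfolding K_def cR_def cW_def by (simp add: cvec_0 mat_zero_right mat_add_zero_right)
qed

lemma c_add: "cR (h + k) = cR h + cR k" "cW (h + k) = cW h + cW k"
 unfolding cR_def cW_def by (simp_all add: poly_mod_add_left poly_div_add_left cvec_add)

lemma c_smult: "cR (smult a h) = a \<cdot>\<^sub>m cR h" "cW (smult a h) = a \<cdot>\<^sub>m cW h"
 unfolding cR_def cW_def by (simp_all add: mod_smult_left div_smult_left cvec_smult)

lemma K_add: "K (h + k) = K h + K k"
 unfolding K_def c_add using c_carrier E_carrier
 by (simp add: mat_distrib_left) (intro eq_matI; simp)

lemma K_smult: "K (smult a h) = a \<cdot>\<^sub>m K h"
 unfolding K_def c_smult using c_carrier E_carrier
 by (simp add: mat_smult_right) (intro eq_matI; simp add: algebra_simps)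

lemma small_chi:
 assumes "!!i. i >= d ==> coeff p i = 0"
 shows "cR (ch * p) = cvec d p" "cW (ch * p) = zm e 1"
proof -
 have "(ch * p) mod (ch * ro) = ch * (p mod ro)" by (rule mult_mod_right[symmetric])
 also have "p mod ro = p"
 proof (cases "p = 0")
  case False
  hence "degree p < d" using assms by (meson leading_coeff_0_iff not_less)
  thus ?thesis unfolding d by (rule mod_poly_less)
 qed simp
 finally show "cR (ch * p) = cvec d p" "cW (ch * p) = zm e 1"
  unfolding cR_def cW_def using nz by (simp_all add: cvec_0)
qed

lemma small_W:
 assumes "!!i. i >= e ==> coeff p i = 0"
 shows "cR p = zm d 1" "cW p = cvec e p"
proof -
 have "p = 0 \<or> degree p < e" using assms by (meson leading_coeff_0_iff not_less)
 hence "p mod (ch * ro) = p & p div ch = 0 & p mod ch = p"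
  using nz unfolding e by (auto simp: mod_poly_less div_poly_less degree_mult_eq)
 thus "cR p = zm d 1" "cW p = cvec e p" unfolding cR_def cW_def by (auto simp: cvec_0)
qed

lemma K_small: 
 "(!!i. i >= d ==> coeff p i = 0) ==> K (ch * p) = ER * cvec d p"
 "(!!i. i >= e ==> coeff p i = 0) ==> K p = EW * cvec e p"
 unfolding K_def by (simp_all add: small_chi small_W mat_zero_right mat_add_zero_left mat_add_zero_right)

text \<open>\<open>R\<close> and \<open>Y\<close> are dual isotropic blocks, \<open>W\<close>
  carries the prescribed Gram matrix \<open>G\<close>, and \<open>Z\<close> is orthogonal to the
  other three with any nondegenerate form. Only pairings on and above the diagonal are listed;
  symmetry of \<open>B\<close> gives the others.\<close>

definition adapted where
 "adapted B R W Z Y \<longleftrightarrow> bil B R R = zm d d & bil B R W = zm d e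
  & bil B R Z = zm d m & bil B R Y = im d
  & bil B W W = G & bil B W Z = zm e m & bil B W Y = zm e d
  & bil B Z Z : GL m & bil B Z Y = zm m d
  & bil B Y Y = zm d d"

text \<open>Triples whose Krylov blocks are the first standard blocks and whose standard frame is
  adapted: the possible results of rewriting a triple in adapted coordinates.\<close>

definition normal_triples where
 "normal_triples = {(A, B, v). (A, B) \<in> pairs n \<phi> & v : mats n 1 & (\<forall>h. pv A v h = K h)
  & adapted B ER EW EZ EY}"

text \<open>\<open>P\<close> rewrites the first triple in new coordinates to give the second. The
  carrier conditions are included so that, for invertible \<open>P\<close>, each side determines the
  other.\<close>

definition rel where
 "rel P = (%(A, B, v) (A', B', v'). A : mats n n & B : mats n n & A' : mats n n
  & v' : mats n 1 & A * P = P * A' & B' = bil B P P & v = P * v')"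

lemma adapted_frame_GL:
 assumes B: "B : mats n n" "B\<^sup>T = B"
  and c: "R : mats n d" "W : mats n e" "Z : mats n m" "Y : mats n d"
  and a: "adapted B R W Z Y"
 shows "fr R W Z Y : GL n" "B : GL n"
proof -
 have N: "hc W Z : mats n (e + m)" using hc_carrier c by blast
 have NN: "(hc W Z)\<^sup>T * (B * hc W Z) : GL (e + m)"
  by (rule diag_gram_GL[OF B(2,1) c(2,3)]) (use a G in "auto simp: adapted_def")
 have RN: "R\<^sup>T * (B * hc W Z) = zm d (e + m)"
  unfolding hc_gram_right[OF B(1) c(1,2,3)] using a by (simp add: adapted_def hc_zero)
 have NY: "(hc W Z)\<^sup>T * (B * Y) = zm (e + m) d"
  unfolding hc_gram_left[OF B(1) c(4,2,3)] using a by (simp add: adapted_def vc_zero)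
 have RR: "bil B R R = zm d d" "bil B R Y = im d"
  using a by (auto simp: adapted_def)
 show "fr R W Z Y : GL n" "B : GL n"
  unfolding fr_def using frame_GL[OF B n c(1) N c(4) RR(1) RN NN RR(2) NY] by auto
qed

lemma adapted_conj:
 assumes "B : mats n n" "P : mats n n"
  and c: "R : mats n d" "W : mats n e" "Z : mats n m" "Y : mats n d"
 shows "adapted (bil B P P) R W Z Y \<longleftrightarrow> adapted B (P * R) (P * W) (P * Z) (P * Y)"
proof -
 have "S\<^sup>T * (bil B P P * T) = (P * S)\<^sup>T * (B * (P * T))"
  if "S : mats n s" "T : mats n t" for S T s t
  using conj_gram[OF assms(1,2) that] by simp
 note * = this[OF c(1) c(1)] this[OF c(1) c(2)] this[OF c(1) c(3)] this[OF c(1) c(4)]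
  this[OF c(2) c(2)] this[OF c(2) c(3)] this[OF c(2) c(4)] this[OF c(3) c(3)] this[OF c(3) c(4)] this[OF c(4) c(4)]
 show ?thesis unfolding adapted_def * ..
qed

lemma triples_pv:
 assumes x: "(A, B, v) \<in> triples"
 shows "pv A v h = kr A v ch d * cR h + kr A v 1 e * cW h"
proof -
 note A = pairsD(1)[OF triples_pairs(1)[OF x]] and v = triples_pairs(2)[OF x]
 let ?r = "h mod (ch * ro)"
 have "pv A v (h - ?r) = zm n 1" using triples_pairs(4)[OF x] by (simp add: minus_mod_eq_mult_div)
 hence "pv A v h = pv A v ?r"
  using pv_add[OF A v, of "h - ?r" ?r] pv_dim[OF A v] by (simp add: mat_add_zero_left)
 also have "... = pv A v (ch * (?r div ch)) + pv A v (1 * (?r mod ch))"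
  using pv_add[OF A v, of "ch * (?r div ch)" "?r mod ch"] by simp
 also have "pv A v (ch * (?r div ch)) = kr A v ch d * cR h"
  unfolding cR_def by (rule kr_mult_cvec[OF A v div_bound, symmetric])
 also have "pv A v (1 * (?r mod ch)) = kr A v 1 e * cW h"
  unfolding cW_def by (rule kr_mult_cvec[OF A v mod_bound, symmetric])
 finally show ?thesis .
qed

text \<open>Membership is independent of coordinates: \<open>A\<close> and \<open>A'\<close> are
  similar, while \<open>B\<close> and \<open>B'\<close> are congruent by the same
  \<open>P\<close>.\<close>

lemma rel_pairs:
 assumes P: "P : GL n" and r: "rel P (A, B, v) (A', B', v')"
 shows "(A, B) \<in> pairs n \<phi>' \<longleftrightarrow> (A', B') \<in> pairs n \<phi>'"
proof -
 obtain H where H: "H : GL n" "P * H = im n" "H * P = im n" using GL_inverse[OF P] by blast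
 have c: "A : mats n n" "B : mats n n" "A' : mats n n" "P : mats n n" "H : mats n n"
  and AP: "A * P = P * A'" and B': "B' = bil B P P"
  using r P H GL_carrier by (auto simp: rel_def)
 have "A = A * (P * H)" using H c by (simp add: mat_one_right)
 also have "... = A * P * H" using c by (simp add: mat_assoc)
 also have "... = P * A' * H" unfolding AP ..
 finally have "similar_mat A A'" using c H by (intro similar_matI[of A A' P H n]) auto
 hence cp: "char_poly A = char_poly A'" by (rule char_poly_similar)
 have PtG: "P\<^sup>T : GL n" using P GL_transpose by blast
 have BG: "B : GL n \<longleftrightarrow> B' : GL n"
 proof
  show "B : GL n ==> B' : GL n" unfolding B' by (intro GL_mult PtG P)
  assume "B' : GL n"
  hence "B * P : GL n" unfolding B' by (rule GL_mult_cancel(2)) (use c in auto)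
  thus "B : GL n" by (rule GL_mult_cancel(1)) (use c in auto)
 qed
 have inj: "bil U P P = bil V P P \<longleftrightarrow> U = V"
  if "U : mats n n" "V : mats n n" for U V
 proof
  assume "bil U P P = bil V P P"
  hence "U * P = V * P" by (rule GL_cancel_left[OF PtG]) (use that in auto)
  hence "U * P * H = V * P * H" by simp
  thus "U = V" using that c H by (simp add: mat_assoc mat_one_right)
 qed simp
 have tB: "B\<^sup>T = B \<longleftrightarrow> B'\<^sup>T = B'"
 proof -
  have "B'\<^sup>T = P\<^sup>T * (B\<^sup>T * P)" unfolding B' using c by (simp add: mat_ring)
  thus ?thesis using inj[of "B\<^sup>T" B] c unfolding B' by auto
 qed
 have iso: "bil B A A = B \<longleftrightarrow> bil B' A' A' = B'"
 proof -
  have "bil B' A' A' = (P * A')\<^sup>T * (B * (P * A'))"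
   unfolding B' using conj_gram[OF c(2,4,3,3)] by simp
  also have "... = P\<^sup>T * (bil B A A * P)"
   unfolding AP[symmetric] using conj_gram[OF c(2,1,4,4)] .
  finally show ?thesis using inj[of "bil B A A" B] c unfolding B' by auto
 qed
 show ?thesis unfolding pairs_def using c cp BG tB iso B' by auto
qed

text \<open>A change of coordinates whose columns are the Krylov blocks followed by an adapted
  completion sends the Krylov blocks to standard blocks. With the converse that follows, the
  admissible \<open>P\<close> for a triple are exactly its adapted frames.\<close>

lemma frame_normal:
 assumes x: "(A, B, v) \<in> triples" and P: "P : GL n" and r: "rel P (A, B, v) (A', B', v')"
  and Z: "Z : mats n m" and Y: "Y : mats n d"
  and Pf: "P = fr (kr A v ch d) (kr A v 1 e) Z Y" and a: "adapted B (kr A v ch d) (kr A v 1 e) Z Y"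
 shows "(A', B', v') \<in> normal_triples"
proof -
 note AB = triples_pairs(1)[OF x] and v = triples_pairs(2)[OF x]
 note A = pairsD(1)[OF AB]
 have c: "B : mats n n" "A' : mats n n" "v' : mats n 1"
  and AP: "A * P = P * A'" and B': "B' = bil B P P" and v': "v = P * v'"
  using r by (auto simp: rel_def)
 have Pc: "P : mats n n" using P GL_carrier by blast
 have "P * fr ER EW EZ EY = P" unfolding fr_E using Pc by (simp add: mat_one_right)
 hence "fr (P * ER) (P * EW) (P * EZ) (P * EY) = fr (kr A v ch d) (kr A v 1 e) Z Y"
  using mult_fr[OF Pc E_carrier E_carrier E_carrier E_carrier] Pf by simp
 note PE = fr_eqD[OF this mult_carrier_mat[OF Pc E_carrier] mult_carrier_mat[OF Pc E_carrier] mult_carrier_mat[OF Pc E_carrier]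
  mult_carrier_mat[OF Pc E_carrier] kr_carrier[OF v] kr_carrier[OF v] Z Y]
 have "adapted B' ER EW EZ EY"
  unfolding B' adapted_conj[OF c(1) Pc E_carrier E_carrier E_carrier E_carrier] PE by (rule a)
 moreover have "(A', B') \<in> pairs n \<phi>" using rel_pairs[OF P r] AB by blast
 moreover have "pv A' v' h = K h" for h
 proof -
  have "P * pv A' v' h = pv A v h" unfolding v' by (rule pv_intertwine[OF A c(2,3) Pc AP, symmetric])
  also have "... = P * ER * cR h + P * EW * cW h" unfolding PE by (rule triples_pv[OF x])
  also have "... = P * K h" unfolding K_def using Pc by (simp add: mat_distrib_left mat_assoc)
  finally show ?thesis by (rule GL_cancel_left[OF P]) (use pv_dim[OF c(2,3)] K_carrier in auto)
 qed
 ultimately show ?thesis unfolding normal_triples_def using c by auto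
qed

lemma normal_frame:
 assumes x: "(A, B, v) \<in> triples" and P: "P : GL n" and r: "rel P (A, B, v) (A', B', v')"
  and y: "(A', B', v') \<in> normal_triples"
 shows "P = fr (kr A v ch d) (kr A v 1 e) (P * EZ) (P * EY)"
  and "adapted B (kr A v ch d) (kr A v 1 e) (P * EZ) (P * EY)"
proof -
 note AB = triples_pairs(1)[OF x] and v = triples_pairs(2)[OF x]
 note A = pairsD(1)[OF AB]
 have c: "B : mats n n" "A' : mats n n" "v' : mats n 1"
  and AP: "A * P = P * A'" and B': "B' = bil B P P" and v': "v = P * v'"
  using r by (auto simp: rel_def)
 have Pc: "P : mats n n" using P GL_carrier by blast
 have pK: "pv A v h = P * K h" for h
  using pv_intertwine[OF A c(2,3) Pc AP, of h] y unfolding v' normal_triples_def by auto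
 have R: "P * ER = kr A v ch d"
 proof (rule mat_eq_by_cvec[OF mult_carrier_mat[OF Pc E_carrier] kr_carrier[OF v]])
  fix p :: "'a poly" assume p: "!!i. d <= i ==> coeff p i = 0"
  have Kp: "K (ch * p) = ER * cvec d p" by (rule K_small(1)) (rule p)
  have "kr A v ch d * cvec d p = pv A v (ch * p)" by (rule kr_mult_cvec[OF A v]) (rule p)
  also have "... = P * (ER * cvec d p)" unfolding pK Kp ..
  finally have "kr A v ch d * cvec d p = P * (ER * cvec d p)" .
  thus "P * ER * cvec d p = kr A v ch d * cvec d p" using Pc by (simp add: mat_assoc)
 qed
 have W: "P * EW = kr A v 1 e"
 proof (rule mat_eq_by_cvec[OF mult_carrier_mat[OF Pc E_carrier] kr_carrier[OF v]])
  fix p :: "'a poly" assume p: "!!i. e <= i ==> coeff p i = 0"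
  have Kp: "K p = EW * cvec e p" by (rule K_small(2)) (rule p)
  have "kr A v 1 e * cvec e p = pv A v (1 * p)" by (rule kr_mult_cvec[OF A v]) (rule p)
  also have "... = P * (EW * cvec e p)" unfolding mult_1 pK Kp ..
  finally have "kr A v 1 e * cvec e p = P * (EW * cvec e p)" .
  thus "P * EW * cvec e p = kr A v 1 e * cvec e p" using Pc by (simp add: mat_assoc)
 qed
 have "P = P * fr ER EW EZ EY" unfolding fr_E using Pc by (simp add: mat_one_right)
 also have "... = fr (P * ER) (P * EW) (P * EZ) (P * EY)"
  by (rule mult_fr[OF Pc E_carrier E_carrier E_carrier E_carrier])
 finally show "P = fr (kr A v ch d) (kr A v 1 e) (P * EZ) (P * EY)" unfolding R W .
 have "adapted B' ER EW EZ EY" using y by (auto simp: normal_triples_def)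
 thus "adapted B (kr A v ch d) (kr A v 1 e) (P * EZ) (P * EY)"
  unfolding B' adapted_conj[OF c(1) Pc E_carrier E_carrier E_carrier E_carrier] R W .
qed

end

lemma comp_mat_cvec:
 fixes ro :: "'a::field poly"
 assumes p: "!!i. i >= degree ro ==> coeff p i = 0"
 shows "comp_mat ro * cvec (degree ro) p = cvec (degree ro) (pCons 0 p mod ro)"
proof (rule eq_matI)
 fix i j assume ij: "i < dim_row (cvec (degree ro) (pCons 0 p mod ro))" "j < dim_col (cvec (degree ro) (pCons 0 p mod ro))"
 have "coeff (pCons 0 p mod ro) i = (\<Sum>j<degree ro. coeff p j * coeff (pCons 0 (monom 1 j) mod ro) i)"
 proof (rule linear_poly_sum[where F = "%p. coeff (pCons 0 p mod ro) i"])
  fix p q :: "'a poly" and c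
  have "pCons 0 (p + q) = pCons 0 p + pCons 0 q" by simp
  thus "coeff (pCons 0 (p + q) mod ro) i = coeff (pCons 0 p mod ro) i + coeff (pCons 0 q mod ro) i"
   by (simp only: poly_mod_add_left coeff_add)
  have "pCons 0 (smult c p) = smult c (pCons 0 p)" by simp
  thus "coeff (pCons 0 (smult c p) mod ro) i = c * coeff (pCons 0 p mod ro) i"
   by (simp only: mod_smult_left coeff_smult)
 qed (use p in auto)
 also have "... = (comp_mat ro * cvec (degree ro) p) $$ (i, 0)"
  using ij by (auto simp: comp_mat_def cvec_def scalar_prod_def lessThan_atLeast0 mult.commute monom_Suc intro!: sum.cong)
 finally show "(comp_mat ro * cvec (degree ro) p) $$ (i, j) = cvec (degree ro) (pCons 0 p mod ro) $$ (i, j)"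
  using ij by (simp add: cvec_def)
qed auto

lemma comp_mat_GL:
 fixes ro :: "'a::field poly"
 assumes "monic ro" and "coeff ro 0 ~= 0"
 shows "comp_mat ro : GL (degree ro)"
 using coeff_char_poly_0[OF comp_mat_carrier, of ro] assms by (auto simp: GL_iff_det char_poly_comp_mat comp_mat_carrier)

lemma vec_eq_by_cvec:
 fixes M M' :: "'a::field mat"
 assumes "M : mats d 1" "M' : mats d 1"
  and "!!p. (!!i. i >= d ==> coeff p i = 0) ==> ((cvec d p)\<^sup>T * M) $$ (0, 0) = ((cvec d p)\<^sup>T * M') $$ (0, 0)"
 shows "M = M'"
proof (rule eq_matI)
 fix i j assume ij: "i < dim_row M'" "j < dim_col M'"
 have e: "((cvec d (monom 1 i))\<^sup>T * N) $$ (0, 0) = N $$ (i, 0)" if "N : mats d 1" for N :: "'a mat"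
 proof -
  have "col (cvec d (monom 1 i)) 0 = (unit_vec d i :: 'a vec)" using ij assms
   by (intro eq_vecI) (auto simp: cvec_def unit_vec_def)
  moreover have "unit_vec d i \<bullet> col N 0 = col N 0 $ i"
   by (rule scalar_prod_left_unit) (use that ij assms in auto)
  ultimately show ?thesis using that ij assms by simp
 qed
 have "((cvec d (monom 1 i))\<^sup>T * M) $$ (0, 0) = ((cvec d (monom 1 i))\<^sup>T * M') $$ (0, 0)"
  by (rule assms(3)) (use ij assms in auto)
 thus "M $$ (i, j) = M' $$ (i, j)" using e[OF assms(1)] e[OF assms(2)] ij assms(2) by simp
qed (use assms in auto)

text \<open>Only the ten block pairings on and above the diagonal have to be compared; transposition
  supplies the rest.\<close>

lemma gram_fr_eq:
 fixes B B' :: "'a::field mat"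
 assumes B: "B : mats n n" "B\<^sup>T = B" and B': "B' : mats n n" "B'\<^sup>T = B'"
  and c: "R : mats n d" "W : mats n e" "Z : mats n m" "Y : mats n d"
  and c': "R' : mats n d" "W' : mats n e" "Z' : mats n m" "Y' : mats n d"
  and RR: "bil B R R = bil B' R' R'"
  and RW: "bil B R W = bil B' R' W'"
  and RZ: "bil B R Z = bil B' R' Z'"
  and RY: "bil B R Y = bil B' R' Y'"
  and WW: "bil B W W = bil B' W' W'"
  and WZ: "bil B W Z = bil B' W' Z'"
  and WY: "bil B W Y = bil B' W' Y'"
  and ZZ: "bil B Z Z = bil B' Z' Z'"
  and ZY: "bil B Z Y = bil B' Z' Y'"
  and YY: "bil B Y Y = bil B' Y' Y'"
 shows "(fr R W Z Y)\<^sup>T * (B * fr R W Z Y) = (fr R' W' Z' Y')\<^sup>T * (B' * fr R' W' Z' Y')"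
proof -
 have sw: "bil B T S = bil B' T' S'"
  if "S : mats n s" "T : mats n t" "S' : mats n s" "T' : mats n t"
   "bil B S T = bil B' S' T'" for S S' T T' s t
  using gram_transpose[OF B(2,1) that(1,2)] gram_transpose[OF B'(2,1) that(3,4)] that(5) by simp
 note N = hc_carrier[OF c(2,3)] and N' = hc_carrier[OF c'(2,3)]
 have NN: "(hc W Z)\<^sup>T * (B * hc W Z) = (hc W' Z')\<^sup>T * (B' * hc W' Z')"
  unfolding hc_gram[OF B(1) c(2,3)] hc_gram[OF B'(1) c'(2,3)] WW WZ ZZ sw[OF c(2,3) c'(2,3) WZ] ..
 have RN: "R\<^sup>T * (B * hc W Z) = R'\<^sup>T * (B' * hc W' Z')"
  unfolding hc_gram_right[OF B(1) c(1,2,3)] hc_gram_right[OF B'(1) c'(1,2,3)] RW RZ ..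
 have NY: "(hc W Z)\<^sup>T * (B * Y) = (hc W' Z')\<^sup>T * (B' * Y')"
  unfolding hc_gram_left[OF B(1) c(4,2,3)] hc_gram_left[OF B'(1) c'(4,2,3)] WY ZY ..
 note U = hc_carrier[OF c(1) N] and U' = hc_carrier[OF c'(1) N']
 have UU: "(hc R (hc W Z))\<^sup>T * (B * hc R (hc W Z)) = (hc R' (hc W' Z'))\<^sup>T * (B' * hc R' (hc W' Z'))"
  unfolding hc_gram[OF B(1) c(1) N] hc_gram[OF B'(1) c'(1) N'] RR RN NN sw[OF c(1) N c'(1) N' RN] ..
 have UY: "(hc R (hc W Z))\<^sup>T * (B * Y) = (hc R' (hc W' Z'))\<^sup>T * (B' * Y')"
  unfolding hc_gram_left[OF B(1) c(4,1) N] hc_gram_left[OF B'(1) c'(4,1) N'] RY NY ..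
 show ?thesis
  unfolding fr_def hc_gram[OF B(1) U c(4)] hc_gram[OF B'(1) U' c'(4)] UU UY YY sw[OF U c(4) U' c'(4) UY] ..
qed

context cyclic_type
begin

definition weight :: nat where
 "weight = card (mats d m :: 'a mat set) * card (skew d :: 'a mat set)"

text \<open>\<open>R\<close> and \<open>W\<close> are forced by the triple. Relative to one fixed
  complement block \<open>Z0\<close>, an adapted frame is an \<open>h\<close> in \<open>GL m\<close>
  together with a completion for this \<open>h\<close>, and the number of completions is the same
  for all \<open>h\<close>.\<close>

lemma card_frames:
 assumes x: "(A, B, v) \<in> triples"
 shows "card {P : GL n. \<exists>y\<in>normal_triples. rel P (A, B, v) y} = card (GL m :: 'a mat set) * weight"
proof -
 note AB = triples_pairs(1)[OF x] and v = triples_pairs(2)[OF x]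
 note A = pairsD(1)[OF AB] and B = pairsD(2,4)[OF AB] and Bc = pairsD(3)[OF AB]
 define R where "R = kr A v ch d"
 define W where "W = kr A v 1 e"
 have R: "R : mats n d" and W: "W : mats n e" unfolding R_def W_def using kr_carrier[OF v] by auto
 note g = triples_gram[OF x, folded R_def W_def]
 have WW: "bil B W W : GL e" using g(3) G by simp
 have nm: "n - (d + e + d) = m" using n by simp
 obtain Z0 Y0 where Z0: "Z0 : mats n m" "bil B R Z0 = zm d m"
   "bil B W Z0 = zm e m" "bil B Z0 Z0 : GL m"
  using isotropic_frame_extend[OF B two R g(4) W g(1,2) WW] unfolding nm by blast
 define U where "U = (\<Union>h\<in>GL m. completions n d e m B R W Z0 h)"
 have comp_adapted: "adapted B R W Z Y" and comp_c: "Z : mats n m" "Y : mats n d"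
  if h: "h : GL m" and ZY: "(Z, Y) \<in> completions n d e m B R W Z0 h" for h Z Y
 proof -
  show c: "Z : mats n m" "Y : mats n d" using ZY by (auto simp: completions_def)
  obtain a where a: "a : mats d m" "Z = R * a + Z0 * h" using ZY by (auto simp: completions_def)
  note cg = completion_gram[OF Bc B(2) R W Z0(1) g(1,2) Z0(2,3) a(1) GL_carrier[OF h], folded a(2)]
  have "bil B Z Z : GL m" unfolding cg(3) by (rule GL_mult[OF GL_transpose[OF h] GL_mult[OF Z0(4) h]])
  thus "adapted B R W Z Y" using cg g ZY unfolding adapted_def completions_def by auto
 qed
 have eq: "{P : GL n. \<exists>y\<in>normal_triples. rel P (A, B, v) y} = (%(Z, Y). fr R W Z Y) ` U"
 proof (intro equalityI subsetI)
  fix P assume "P \<in> {P : GL n. \<exists>y\<in>normal_triples. rel P (A, B, v) y}"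
  then obtain A' B' v' where P: "P : GL n" and y: "(A', B', v') \<in> normal_triples" "rel P (A, B, v) (A', B', v')" by auto
  have Pc: "P : mats n n" using P GL_carrier by blast
  define Z where "Z = P * EZ"
  define Y where "Y = P * EY"
  have Z: "Z : mats n m" and Y: "Y : mats n d" unfolding Z_def Y_def using Pc E_carrier by auto
  have Pf: "P = fr R W Z Y" unfolding R_def W_def Z_def Y_def by (rule normal_frame(1)[OF x P y(2,1)])
  have a: "adapted B R W Z Y" unfolding R_def W_def Z_def Y_def by (rule normal_frame(2)[OF x P y(2,1)])
  note az = a[unfolded adapted_def]
  have n': "n = d + (e + m) + d" by (rule n)
  obtain r h where rh: "r : mats d m" "h : mats m m" "Z = R * r + Z0 * h"
   using isotropic_perp[OF B two n' R g(4) W Z0(1) g(1,2) Z0(2) WW Z0(3,4) Z] az by auto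
  note cg = completion_gram[OF Bc B(2) R W Z0(1) g(1,2) Z0(2,3) rh(1,2), folded rh(3)]
  have "h\<^sup>T * (bil B Z0 Z0 * h) : GL m" using a cg(3) unfolding adapted_def by simp
  hence "h\<^sup>T : GL m" by (rule GL_mult_cancel(1)) (use rh Z0 Bc in auto)
  hence h: "h : GL m" using GL_transpose by fastforce
  have "(Z, Y) \<in> completions n d e m B R W Z0 h" unfolding completions_def using Z Y rh a by (auto simp: adapted_def)
  thus "P \<in> (%(Z, Y). fr R W Z Y) ` U" using h Pf unfolding U_def by (intro image_eqI[of _ _ "(Z, Y)"]) auto
 next
  fix P assume "P \<in> (%(Z, Y). fr R W Z Y) ` U"
  then obtain h Z Y where h: "h : GL m" and ZY: "(Z, Y) \<in> completions n d e m B R W Z0 h" and Pf: "P = fr R W Z Y"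
   unfolding U_def by auto
  note a = comp_adapted[OF h ZY] and c = comp_c[OF h ZY]
  have P: "P : GL n" unfolding Pf by (rule adapted_frame_GL(1)[OF Bc B(2) R W c a])
  then obtain H where H: "H : GL n" "P * H = im n" "H * P = im n" using GL_inverse[OF P] by blast
  have Pc: "P : mats n n" "H : mats n n" using P H GL_carrier by auto
  have r: "rel P (A, B, v) (H * (A * P), bil B P P, H * v)"
  proof -
   have PH: "P * (H * T) = T" if "T : mats n k" for T k
    using assoc_mult_mat[OF Pc that] H(2) that by (simp add: mat_one_left)
   have "H * (A * P) : mats n n" "H * v : mats n 1" using A Pc v by auto
   thus ?thesis unfolding rel_def prod.case
    using PH[of "A * P" n] PH[OF v] A Bc Pc by simp
  qed
  have "(H * (A * P), bil B P P, H * v) \<in> normal_triples"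
   by (rule frame_normal[OF x P r c]) (use Pf a in "auto simp: R_def W_def")
  thus "P \<in> {P : GL n. \<exists>y\<in>normal_triples. rel P (A, B, v) y}" using P r by (intro CollectI conjI bexI)
 qed
 have inj: "inj_on (%(Z, Y). fr R W Z Y) U"
 proof (rule inj_onI)
  fix p q assume pq: "p \<in> U" "q \<in> U" "(%(Z, Y). fr R W Z Y) p = (%(Z, Y). fr R W Z Y) q"
  obtain Z Y Z' Y' where e: "p = (Z, Y)" "q = (Z', Y')" by (cases p, cases q)
  obtain h h' where "h : GL m" "(Z, Y) \<in> completions n d e m B R W Z0 h"
   "h' : GL m" "(Z', Y') \<in> completions n d e m B R W Z0 h'" using pq(1,2) unfolding e U_def by auto
  hence "Z : mats n m" "Y : mats n d" "Z' : mats n m" "Y' : mats n d"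
   using comp_c by auto
  thus "p = q" using fr_eqD(3,4)[of R W Z Y R W Z' Y' n d e m d] pq(3) R W unfolding e by simp
 qed
 \<comment> \<open>Pairing \<open>Z\<close> with \<open>Z0\<close> removes the \<open>R\<close> part
   and recovers \<open>h\<close>, so different \<open>h\<close> share no completion.\<close>
 have disj: "completions n d e m B R W Z0 h \<inter> completions n d e m B R W Z0 h' = {}"
  if "h : GL m" "h' : GL m" "h ~= h'" for h h'
 proof (rule ccontr)
  assume "completions n d e m B R W Z0 h \<inter> completions n d e m B R W Z0 h' ~= {}"
  then obtain Z Y where ZY: "(Z, Y) \<in> completions n d e m B R W Z0 h" "(Z, Y) \<in> completions n d e m B R W Z0 h'"
   by auto
  obtain a where a1: "a : mats d m" "Z = R * a + Z0 * h" using ZY(1) unfolding completions_def by auto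
  obtain a' where a2: "a' : mats d m" "Z = R * a' + Z0 * h'" using ZY(2) unfolding completions_def by auto
  note a = a1(1) a2(1) a1(2) a2(2)
  have ZR: "bil B Z0 R = zm m d" using gram_swap[OF Z0(2) B(2) Bc R Z0(1)] by simp
  have "Z0\<^sup>T * (B * (R * a + Z0 * h)) = bil B Z0 Z0 * h"
   if "a : mats d m" "h : GL m" for a h
  proof -
   have "Z0\<^sup>T * (B * (R * a)) = zm m m"
    using mat_mult3_eqD[OF ZR, of a] that Z0 Bc R by (simp add: mat_zero_left)
   thus ?thesis using that Z0 Bc R GL_dim[OF that(2)] by (simp add: mat_distrib_left mat_add_zero_left mat_assoc)
  qed
  hence "bil B Z0 Z0 * h = bil B Z0 Z0 * h'" using a that(1,2) by metis
  hence "h = h'" by (rule GL_cancel_left[OF Z0(4)]) (use that GL_dim in auto)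
  thus False using that by simp
 qed
 have fin: "finite (completions n d e m B R W Z0 h)" for h
  by (rule finite_subset[of _ "mats n m \<times> mats n d"]) (auto simp: completions_def finite_carrier_mat)
 have finGL: "finite (GL m :: 'a mat set)" by (rule finite_subset[OF _ finite_carrier_mat[of m m]]) (auto dest: GL_carrier)
 have n': "n = d + (e + m) + d" by (rule n)
 have "card U = (\<Sum>h\<in>GL m. card (completions n d e m B R W Z0 h))"
  unfolding U_def using finGL fin disj by (intro card_UN_disjoint) auto
 also have "... = (\<Sum>h\<in>(GL m :: 'a mat set). weight)"
  unfolding weight_def
  by (intro sum.cong refl card_completions[OF B two n' R g(4) W Z0(1) g(1,2) Z0(2) WW Z0(3,4)])
 finally have "card U = card (GL m :: 'a mat set) * weight" by simp
 thus ?thesis unfolding eq card_image[OF inj] .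
qed

text \<open>The \<open>R\<close> coordinates are orthogonal to everything in the span of
  \<open>R\<close> and \<open>W\<close>, so only the remainders modulo \<open>ch\<close> contribute;
  on these \<open>b\<close> is read off from \<open>G\<close>.\<close>

lemma K_gram:
 assumes B: "B : mats n n" "B\<^sup>T = B" and a: "adapted B ER EW EZ EY"
 shows "((K h)\<^sup>T * (B * K k)) $$ (0, 0) = b h k"
proof -
 note c = c_carrier[of h] c_carrier[of k]
 have WR: "bil B EW ER = zm e d"
  using gram_swap[OF _ B(2,1) E_carrier[of 0 d] E_carrier[of d e]] a unfolding adapted_def by fastforce
 have RR: "bil B ER ER = zm d d" "bil B ER EW = zm d e" "bil B EW EW = G"
  using a by (auto simp: adapted_def)
 have 1: "ER\<^sup>T * (B * K k) = zm d 1"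
  using mat_mult3_eqD[OF RR(1), of "cR k"] mat_mult3_eqD[OF RR(2), of "cW k"] B c unfolding K_def
  by (simp add: mat_distrib_left mat_zero_left mat_add_zero_left)
 have 2: "EW\<^sup>T * (B * K k) = G * cW k"
  using mat_mult3_eqD[OF WR, of "cR k"] mat_mult3_eqD[OF RR(3), of "cW k"] B c G(2) unfolding K_def
  by (simp add: mat_distrib_left mat_zero_left mat_add_zero_left)
 have "(K h)\<^sup>T = (cR h)\<^sup>T * ER\<^sup>T + (cW h)\<^sup>T * EW\<^sup>T"
  unfolding K_def using c by (simp add: transpose_add_dim mat_transpose_mult)
 hence "(K h)\<^sup>T * (B * K k) = (cR h)\<^sup>T * (ER\<^sup>T * (B * K k))
   + (cW h)\<^sup>T * (EW\<^sup>T * (B * K k))"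
  using B c K_carrier[of k] by (simp add: mat_distrib_right mat_assoc)
 also have "... = (cW h)\<^sup>T * (G * cW k)" unfolding 1 2 using c G(2)
  by (simp add: mat_zero_right mat_add_zero_left)
 finally have e: "(K h)\<^sup>T * (B * K k) = (cW h)\<^sup>T * (G * cW k)" .
 have mm: "h mod (ch * ro) mod ch = h mod ch" for h by (rule mod_mod_cancel) simp
 have "((cW h)\<^sup>T * (G * cW k)) $$ (0, 0) = b (h mod ch) (k mod ch)"
  unfolding cW_def G_def mm by (rule cvec_gram_cvec[OF nformsD(1)[OF b]]; rule mod_bound)
 thus ?thesis unfolding e nforms_mod[OF b] .
qed

lemma normal_to_triple:
 assumes P: "P : GL n" and y: "y \<in> normal_triples"
 shows "\<exists>x\<in>triples. rel P x y"
proof -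
 obtain A' B' v' where ye: "y = (A', B', v')" by (cases y)
 have AB: "(A', B') \<in> pairs n \<phi>" and v': "v' : mats n 1" and K: "!!h. pv A' v' h = K h"
  and a: "adapted B' ER EW EZ EY" using y unfolding ye normal_triples_def by auto
 note A' = pairsD(1)[OF AB] and B' = pairsD(3,4)[OF AB]
 obtain H where H: "H : GL n" "P * H = im n" "H * P = im n" using GL_inverse[OF P] by blast
 have c: "P : mats n n" "H : mats n n" using P H GL_carrier by auto
 have HP: "H * (P * T) = T" if "dim_row T = n" for T
  using that c H by (simp add: mat_assoc[symmetric] mat_one_left)
 define A where "A = P * (A' * H)"
 define B where "B = bil B' H H"
 define v where "v = P * v'"
 have Ac: "A : mats n n" "B : mats n n" "v : mats n 1"
  unfolding A_def B_def v_def using c A' B' v' by auto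
 have AP: "A * P = P * A'" unfolding A_def using c A' H(3) by (simp add: mat_assoc mat_one_right)
 have tPH: "P\<^sup>T * H\<^sup>T = im n"
  using c H(3) by (simp add: mat_transpose_mult[symmetric])
 have BP: "B' = bil B P P" unfolding B_def using c B' H(3) tPH
  by (simp add: mat_assoc mat_one_right) (simp add: mat_assoc[symmetric] mat_one_left)
 have r: "rel P (A, B, v) (A', B', v')" unfolding rel_def using Ac A' v' AP BP v_def by auto
 have ABp: "(A, B) \<in> pairs n \<phi>" using rel_pairs[OF P r] AB by blast
 have pv: "pv A v h = P * K h" for h unfolding v_def K[symmetric] by (rule pv_intertwine[OF Ac(1) A' v' c(1) AP])
 have "bf A B v h k = b h k" for h k
 proof -
  have "(P * K h)\<^sup>T * (B * (P * K k)) = (K h)\<^sup>T * (B' * K k)"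
   unfolding BP by (rule conj_gram[OF Ac(2) c(1) K_carrier K_carrier])
  thus ?thesis unfolding bf_def pv using K_gram[OF B' a] by simp
 qed
 moreover have "pv A v h = zm n 1 \<longleftrightarrow> ch * ro dvd h" for h
 proof -
  have "P * K h = zm n 1 \<longleftrightarrow> K h = zm n 1"
   using injective_mat_vecD[OF GL_injective[OF P] _ c(1) K_carrier] c(1) by (auto simp: mat_zero_right)
  thus ?thesis unfolding pv K_eq_0_iff .
 qed
 ultimately have "(A, B, v) \<in> triples" unfolding triples_def using ABp Ac by auto
 thus ?thesis using r ye by blast
qed

lemma finite_triples: "finite triples" "finite normal_triples"
 by (rule finite_subset[of _ "mats n n \<times> mats n n \<times> mats n 1"];
   auto simp: triples_def normal_triples_def finite_carrier_mat dest: pairsD)+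

text \<open>Every triple has the same number of adapted frames, and every invertible
  \<open>P\<close> with a normal triple produces exactly one triple.\<close>

lemma card_triples: "card triples * (card (GL m :: 'a mat set) * weight) = card (GL n :: 'a mat set) * card normal_triples"
proof (rule double_count[OF finite_triples, where r = rel])
 show "finite (GL n :: 'a mat set)" by (rule finite_subset[OF _ finite_carrier_mat[of n n]]) (auto dest: GL_carrier)
 show "card {P : GL n. \<exists>y\<in>normal_triples. rel P x y} = card (GL m :: 'a mat set) * weight" if "x \<in> triples" for x
  using card_frames that by (cases x) auto
 show "\<exists>x\<in>triples. rel P x y" if "P : GL n" "y \<in> normal_triples" for P y
  using normal_to_triple that by blast
next
 fix P x x' y assume P: "P : GL n" and r: "rel P x y" "rel P x' y"
 obtain A B v A2 B2 v2 A' B' v' where e: "x = (A, B, v)" "x' = (A2, B2, v2)" "y = (A', B', v')"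
  by (cases x, cases x', cases y)
 note r = r[unfolded e rel_def prod.case]
 have t: "P\<^sup>T : GL n" using P GL_transpose by blast
 obtain H where H: "H : GL n" "P * H = im n" using GL_inverse[OF P] by blast
 have c: "P : mats n n" "H : mats n n" using P H GL_carrier by auto
 have cancel: "S = T" if "S * P = T * P" "S : mats n n" "T : mats n n" for S T
 proof -
  have "S = S * P * H" using that(2) c H by (simp add: mat_assoc mat_one_right)
  also have "... = T * P * H" unfolding that(1) ..
  also have "... = T" using that(3) c H by (simp add: mat_assoc mat_one_right)
  finally show ?thesis .
 qed
 have "bil B P P = bil B2 P P" using r by simp
 hence "B * P = B2 * P" by (rule GL_cancel_left[OF t]) (use r in auto)
 hence "B = B2" using r cancel by blast
 moreover have "A * P = A2 * P" using r by simp
 hence "A = A2" using r cancel by blast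
 ultimately show "x = x'" using r e by simp
next
 fix P x y y' assume P: "P : GL n" and r: "rel P x y" "rel P x y'"
 obtain A B v A2 B2 v2 A' B' v' where e: "x = (A, B, v)" "y' = (A2, B2, v2)" "y = (A', B', v')"
  by (cases x, cases y, cases y')
 note r = r[unfolded e rel_def prod.case]
 have c: "P : mats n n" using P GL_carrier by auto
 have "P * A' = P * A2" using r by simp
 hence "A' = A2" by (rule GL_cancel_left[OF P]) (use r in auto)
 moreover have "P * v' = P * v2" using r by simp
 hence "v' = v2" by (rule GL_cancel_left[OF P]) (use r in auto)
 ultimately show "y = y'" using r e by simp
qed

end

section \<open>Normal triples: multiplication by z in standard coordinates\<close>

lemma hc_add:
 fixes A B C D :: "'a::monoid_add mat"
 assumes "A : mats n a" "B : mats n b" "C : mats n a" "D : mats n b"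
 shows "hc A B + hc C D = hc (A + C) (B + D)"
 using assms by (intro eq_matI) (auto simp: hc_def)

context cyclic_type
begin

text \<open>In the basis ch z^j, z^j of the quotient by \<open>ch * ro\<close>, multiplication by z
  is block triangular: the companion matrices of \<open>ro\<close> and \<open>ch\<close> on the
  diagonal, and \<open>Fm\<close> for the overflow of z^e into the multiples of \<open>ch\<close>.
  \<open>KR\<close> and \<open>KW\<close> are the images of the two standard blocks.\<close>

definition Fm where "Fm = mat d e (%(i, j). coeff ((monom 1 (Suc j) mod (ch * ro)) div ch) i)"
definition Cr where "Cr = comp_mat ro"
definition Cc where "Cc = comp_mat ch"
definition KR where "KR = ER * Cr"
definition KW where "KW = ER * Fm + EW * Cc"

lemma Fm: "Fm : mats d e" by (simp add: Fm_def)
lemma Cro: "Cr : mats d d" "Cr : GL d" "char_poly Cr = ro"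
 using comp_mat_carrier[of ro] comp_mat_GL[OF ro] char_poly_comp_mat[OF ro(1)] unfolding Cr_def d by auto
lemma Cch: "Cc : mats e e" "char_poly Cc = ch"
 using comp_mat_carrier[of ch] char_poly_comp_mat[OF ch(1)] unfolding Cc_def e by auto

lemma KRW: "KR : mats n d" "KW : mats n e"
 unfolding KR_def KW_def using Fm Cro Cch by (auto intro!: carrier_matI)

lemma K_shift1:
 assumes p: "!!i. i >= d ==> coeff p i = 0"
 shows "K (pCons 0 (ch * p)) = KR * cvec d p"
proof -
 have eq: "pCons 0 (ch * p) mod (ch * ro) = ch * (pCons 0 p mod ro)"
  using mult_mod_right[of ch "pCons 0 p" ro] by simp
 have R: "cR (pCons 0 (ch * p)) = cvec d (pCons 0 p mod ro)" unfolding cR_def eq using nz by simp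
 have W: "cW (pCons 0 (ch * p)) = zm e 1" unfolding cW_def eq by (simp add: cvec_0)
 have c: "Cr * cvec d p = cvec d (pCons 0 p mod ro)"
  unfolding Cr_def d by (rule comp_mat_cvec) (use p d in auto)
 show ?thesis unfolding K_def R W KR_def c[symmetric] using Cro(1)
  by (simp add: mat_assoc mat_zero_right mat_add_zero_right)
qed

lemma K_shift2:
 assumes p: "!!i. i >= e ==> coeff p i = 0"
 shows "K (pCons 0 p) = KW * cvec e p"
proof -
 have R: "cR (pCons 0 p) = Fm * cvec e p"
 proof (rule eq_matI)
  fix i j assume ij: "i < dim_row (Fm * cvec e p)" "j < dim_col (Fm * cvec e p)"
  hence i: "i < d" and j: "j = 0" using Fm by auto
  have "coeff ((pCons 0 p mod (ch * ro)) div ch) i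
    = (\<Sum>j<e. coeff p j * coeff ((pCons 0 (monom 1 j) mod (ch * ro)) div ch) i)"
  proof (rule linear_poly_sum[where F = "%p. coeff ((pCons 0 p mod (ch * ro)) div ch) i"])
   fix p q :: "'a poly" and c
   have "pCons 0 (p + q) = pCons 0 p + pCons 0 q" by simp
   thus "coeff ((pCons 0 (p + q) mod (ch * ro)) div ch) i
     = coeff ((pCons 0 p mod (ch * ro)) div ch) i + coeff ((pCons 0 q mod (ch * ro)) div ch) i"
    by (simp only: poly_mod_add_left poly_div_add_left coeff_add)
   have "pCons 0 (smult c p) = smult c (pCons 0 p)" by simp
   thus "coeff ((pCons 0 (smult c p) mod (ch * ro)) div ch) i = c * coeff ((pCons 0 p mod (ch * ro)) div ch) i"
    by (simp only: mod_smult_left div_smult_left coeff_smult)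
  qed (use p in auto)
  also have "... = (Fm * cvec e p) $$ (i, 0)"
   using i by (auto simp: Fm_def cvec_def scalar_prod_def lessThan_atLeast0 mult.commute monom_Suc intro!: sum.cong)
  finally show "cR (pCons 0 p) $$ (i, j) = (Fm * cvec e p) $$ (i, j)"
   using i j by (simp add: cR_def cvec_def)
 qed (use Fm in auto)
 have mm: "pCons 0 p mod (ch * ro) mod ch = pCons 0 p mod ch" by (rule mod_mod_cancel) simp
 have W: "cW (pCons 0 p) = Cc * cvec e p"
  unfolding cW_def mm Cc_def unfolding e by (rule comp_mat_cvec[symmetric]) (use p e in auto)
 show ?thesis unfolding K_def R W KW_def using Fm Cch
  by (simp add: mat_assoc mat_distrib_right)
qed

lemma K_shift: "K (pCons 0 h) = KR * cR h + KW * cW h"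
proof -
 let ?r = "h mod (ch * ro)"
 let ?p = "?r div ch" and ?q = "?r mod ch"
 have "pCons 0 h = [:0, 1:] * h" "pCons 0 ?r = [:0, 1:] * ?r" by simp_all
 hence m: "pCons 0 h mod (ch * ro) = pCons 0 ?r mod (ch * ro)" by (metis mod_mult_right_eq)
 have "?r = ch * ?p + ?q" by simp
 hence s: "pCons 0 ?r = pCons 0 (ch * ?p) + pCons 0 ?q" by (metis add_pCons add_0)
 have "K (pCons 0 h) = K (pCons 0 ?r)" unfolding K_def cR_def cW_def m ..
 also have "... = K (pCons 0 (ch * ?p)) + K (pCons 0 ?q)" unfolding s K_add ..
 also have "K (pCons 0 (ch * ?p)) = KR * cR h" unfolding cR_def by (rule K_shift1) (rule div_bound)
 also have "K (pCons 0 ?q) = KW * cW h" unfolding cW_def by (rule K_shift2) (rule mod_bound)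
 finally show ?thesis .
qed

text \<open>The infinitely many conditions on h(A) v amount to prescribing \<open>v\<close> and the
  first \<open>d + e\<close> columns of \<open>A\<close>, because \<open>K\<close> turns
  multiplication by z into these columns.\<close>

lemma normal_iff:
 assumes A: "A : mats n n" and v: "v : mats n 1"
 shows "(\<forall>h. pv A v h = K h) \<longleftrightarrow> v = K 1 & A * ER = KR & A * EW = KW"
proof
 assume *: "\<forall>h. pv A v h = K h"
 have AK: "A * K h = K (pCons 0 h)" for h using * pv_shift[OF A v, of h] by simp
 have "A * ER = KR"
 proof (rule mat_eq_by_cvec[OF mult_carrier_mat[OF A E_carrier] KRW(1)])
  fix p :: "'a poly" assume p: "!!i. d <= i ==> coeff p i = 0"
  have k: "K (ch * p) = ER * cvec d p" by (rule K_small(1)) (rule p)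
  have "A * ER * cvec d p = A * K (ch * p)" unfolding k using A by (simp add: mat_assoc)
  also have "... = KR * cvec d p" unfolding AK by (rule K_shift1) (rule p)
  finally show "A * ER * cvec d p = KR * cvec d p" .
 qed
 moreover have "A * EW = KW"
 proof (rule mat_eq_by_cvec[OF mult_carrier_mat[OF A E_carrier] KRW(2)])
  fix p :: "'a poly" assume p: "!!i. e <= i ==> coeff p i = 0"
  have k: "K p = EW * cvec e p" by (rule K_small(2)) (rule p)
  have "A * EW * cvec e p = A * K p" unfolding k using A by (simp add: mat_assoc)
  also have "... = KW * cvec e p" unfolding AK by (rule K_shift2) (rule p)
  finally show "A * EW * cvec e p = KW * cvec e p" .
 qed
 moreover have "v = K 1" using * pv_one[OF A v] by simp
 ultimately show "v = K 1 & A * ER = KR & A * EW = KW" by blast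
next
 assume *: "v = K 1 & A * ER = KR & A * EW = KW"
 have AK: "A * K h = K (pCons 0 h)" for h
 proof -
  have "A * K h = A * ER * cR h + A * EW * cW h"
   unfolding K_def using A by (simp add: mat_distrib_left mat_assoc)
  thus ?thesis unfolding K_shift using * by simp
 qed
 show "\<forall>h. pv A v h = K h"
 proof
  fix h show "pv A v h = K h"
  proof (induction h rule: pCons_induct)
   case 0
   show ?case using K_eq_0_iff[of 0] pv_0[OF A v] by simp
  next
   case (pCons c h)
   have "K (pCons c h) = K (smult c 1 + pCons 0 h)" by (simp add: one_pCons)
   thus ?case unfolding pv_pCons[OF A v] pCons.IH AK K_add K_smult using * by simp
  qed
 qed
qed

text \<open>\<open>KR\<close> spans the same space as \<open>ER\<close>, since \<open>Cr\<close> is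
  invertible, and hence inherits its isotropy. That \<open>KW\<close> has the Gram matrix
  \<open>G\<close> again is the shift invariance of \<open>b\<close>.\<close>

lemma K_frame_gram:
 assumes B: "B : mats n n" "B\<^sup>T = B" and a: "adapted B ER EW EZ EY"
 shows "bil B KR KR = zm d d" "bil B KR KW = zm d e"
  "bil B KW KW = G" "bil B KR EZ = zm d m" "bil B KW EZ = zm e m"
  "bil B KR EY = (Cr)\<^sup>T" "injective_mat KR"
proof -
 note z = a[unfolded adapted_def]
 have tKR: "KR\<^sup>T = (Cr)\<^sup>T * ER\<^sup>T"
  unfolding KR_def using Cro(1) by (simp add: mat_transpose_mult)
 have tKW: "KW\<^sup>T = Fm\<^sup>T * ER\<^sup>T + (Cc)\<^sup>T * EW\<^sup>T"
  unfolding KW_def using Cch Fm by (simp add: mat_transpose_mult transpose_add_dim)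
 have RR: "bil B ER KR = zm d d"
  unfolding KR_def using mat_mult3_eqD[of "ER\<^sup>T" B ER _ "Cr"] z Cro(1) B by (simp add: mat_zero_left)
 have RW: "bil B ER KW = zm d e"
  unfolding KW_def using mat_mult3_eqD[of "ER\<^sup>T" B ER _ Fm] mat_mult3_eqD[of "ER\<^sup>T" B EW _ "Cc"]
   z Cch Fm B by (simp add: mat_distrib_left mat_zero_left mat_add_zero_left)
 show 1: "bil B KR KR = zm d d" "bil B KR KW = zm d e"
  "bil B KR EZ = zm d m" "bil B KR EY = (Cr)\<^sup>T"
  unfolding tKR using RR RW z Cro(1) B KRW by (simp_all add: mat_assoc mat_zero_right mat_one_right)
 show "bil B KW EZ = zm e m"
  unfolding tKW using z Cch Fm B by (simp add: mat_distrib_right mat_assoc mat_zero_right mat_add_zero_left)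
 show "bil B KW KW = G"
 proof (rule mat_eq_by_cvec[OF _ G(2)])
  show c: "bil B KW KW : mats e e" using KRW B by auto
  fix q :: "'a poly" assume q: "!!i. e <= i ==> coeff q i = 0"
  show "bil B KW KW * cvec e q = G * cvec e q"
  proof (rule vec_eq_by_cvec)
   show "bil B KW KW * cvec e q : mats e 1" "G * cvec e q : mats e 1"
    using c G(2) cvec_carrier[of e q] by auto
   fix p :: "'a poly" assume p: "!!i. e <= i ==> coeff p i = 0"
   have kp: "K (pCons 0 p) = KW * cvec e p" by (rule K_shift2) (rule p)
   have kq: "K (pCons 0 q) = KW * cvec e q" by (rule K_shift2) (rule q)
   have "(cvec e p)\<^sup>T * (bil B KW KW * cvec e q)
    = (K (pCons 0 p))\<^sup>T * (B * K (pCons 0 q))"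
    unfolding kp kq using KRW B by (simp add: mat_transpose_mult mat_assoc)
   hence "((cvec e p)\<^sup>T * (bil B KW KW * cvec e q)) $$ (0, 0) = b (pCons 0 p) (pCons 0 q)"
    using K_gram[OF B a] by simp
   also have "... = b p q" by (rule zformD(6)[OF nformsD(1)[OF b]])
   also have "... = ((cvec e p)\<^sup>T * (G * cvec e q)) $$ (0, 0)"
    unfolding G_def by (rule cvec_gram_cvec[OF nformsD(1)[OF b], symmetric]) (rule q, assumption, rule p, assumption)
   finally show "((cvec e p)\<^sup>T * (bil B KW KW * cvec e q)) $$ (0, 0)
    = ((cvec e p)\<^sup>T * (G * cvec e q)) $$ (0, 0)" .
  qed
 qed
 have "ER\<^sup>T * KR = Cr" unfolding KR_def using Cro(1)
  by (simp add: mat_assoc[symmetric] E_one mat_one_left)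
 hence "injective_mat (ER\<^sup>T * KR)" using GL_injective[OF Cro(2)] by simp
 thus "injective_mat KR" by (rule injective_mat_left_factor) (use KRW in simp)
qed

text \<open>In the order \<open>ER\<close>, \<open>EW\<close>, \<open>EZ\<close>, \<open>EY\<close>
  the matrix is block upper triangular with diagonal blocks \<open>Cr\<close>, \<open>Cc\<close>,
  \<open>h\<close> and a block \<open>T\<close> on the dual of the radical.\<close>

lemma char_poly_normal:
 assumes B: "B : mats n n" "B\<^sup>T = B" and a: "adapted B ER EW EZ EY"
  and rh: "r : mats d m" "h : mats m m" and Z: "Z = KR * r + EZ * h"
  and Y: "Y : mats n d" and KY: "bil B KR Y = im d"
 shows "char_poly (fr KR KW Z Y) = ro * (ch * char_poly h) * conj_poly ro"
proof -
 define N where "N = hc EW EZ"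
 have N: "N : mats n (e + m)" unfolding N_def by (rule hc_carrier[OF E_carrier E_carrier])
 have U: "hc ER N : mats n (d + (e + m))" by (rule hc_carrier[OF E_carrier N])
 have one: "hc (hc ER N) EY = im n" using fr_E unfolding fr_def N_def .
 have "Y : mats (d + (e + m) + d) d" using Y unfolding n[symmetric] .
 then obtain M T where MT: "M : mats (d + (e + m)) d" "T : mats d d" "Y = vc M T"
  using vc_split by blast
 have "Y = hc (hc ER N) EY * vc M T" unfolding one unfolding MT(3)[symmetric] using Y by (simp add: mat_one_left)
 also have "... = hc ER N * M + EY * T" by (rule hc_mult_vc) (use U MT E_carrier N in auto)
 finally have YM: "Y = hc ER N * M + EY * T" .
 note z = a[unfolded adapted_def]
 have RU: "ER\<^sup>T * (B * hc ER N) = zm d (d + (e + m))"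
  unfolding hc_gram_right[OF B(1) E_carrier E_carrier N]
  unfolding N_def hc_gram_right[OF B(1) E_carrier E_carrier E_carrier]
  using z by (simp add: hc_zero)
 have "bil B ER Y = T"
  unfolding YM using mat_mult3_eqD[OF RU, of M] mat_mult3_eqD[of "ER\<^sup>T" B EY "im d" T] z B U MT(1,2) N
  by (simp add: mat_distrib_left mat_zero_left mat_add_zero_left mat_one_left)
 moreover have "bil B KR Y = (Cr)\<^sup>T * (bil B ER Y)"
  unfolding KR_def using Cro(1) B Y by (simp add: mat_transpose_mult mat_assoc)
 ultimately have CT: "(Cr)\<^sup>T * T = im d" using KY by simp
 \<comment> \<open>The image \<open>Y\<close> of \<open>EY\<close> pairs with the image
   \<open>KR\<close> of \<open>ER\<close> as the identity, which reads
   \<open>(Cr)\<^sup>T * T = im d\<close>: on the dual block the action is the inverse transpose of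
   the action on the radical.\<close>
 have "char_poly T = conj_poly (char_poly ((Cr)\<^sup>T))"
  by (rule char_poly_inverse[OF _ MT(2) CT]) (use Cro(1) in simp)
 hence cT: "char_poly T = conj_poly ro" using Cro(1,3) by simp
 define M22 where "M22 = four_block_mat (Cc) (zm e m) (zm m e) h"
 define M12 where "M12 = hc Fm (Cr * r)"
 define M11 where "M11 = four_block_mat (Cr) M12 (zm (e + m) d) M22"
 define M4 where "M4 = four_block_mat M11 M (zm d (d + (e + m))) T"
 have M22: "M22 : mats (e + m) (e + m)" unfolding M22_def using Cch rh by auto
 have M12: "M12 : mats d (e + m)" unfolding M12_def using Fm Cro(1) rh by (intro hc_carrier) auto
 have M11: "M11 : mats (d + (e + m)) (d + (e + m))" unfolding M11_def using Cro(1) M12 M22 by auto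
 have M4: "M4 : mats n n" unfolding M4_def n using M11 MT by auto
 have NM: "N * M22 = hc (EW * Cc) (EZ * h)"
  unfolding N_def M22_def using Cch rh
  by (subst hc_mult_four_block[OF E_carrier E_carrier Cch(1) zero_carrier_mat zero_carrier_mat rh(2)])
   (simp add: mat_zero_right mat_add_zero_left mat_add_zero_right)
 have "ER * M12 + N * M22 = hc (ER * Fm) (ER * (Cr * r)) + hc (EW * Cc) (EZ * h)"
  unfolding NM M12_def using Fm Cro(1) rh by (simp add: mult_hc)
 also have "... = hc (ER * Fm + EW * Cc) (ER * (Cr * r) + EZ * h)"
  by (rule hc_add[of _ n e _ m]) (use E_carrier Fm Cro(1) Cch rh in auto)
 also have "... = hc KW Z" unfolding KW_def Z KR_def using Cro(1) rh by (simp add: mat_assoc)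
 finally have W: "ER * M12 + N * M22 = hc KW Z" .
 have "hc ER N * M11 = hc (ER * Cr + N * zm (e + m) d) (ER * M12 + N * M22)"
  unfolding M11_def by (rule hc_mult_four_block[OF E_carrier N Cro(1) M12 zero_carrier_mat M22])
 also have "... = hc KR (hc KW Z)" unfolding W KR_def using Cro(1) N by (simp add: mat_zero_right mat_add_zero_right)
 finally have U11: "hc ER N * M11 = hc KR (hc KW Z)" .
 have "M4 = hc (hc ER N) EY * M4" unfolding one using M4 by (simp add: mat_one_left)
 also have "... = hc (hc ER N * M11 + EY * zm d (d + (e + m))) (hc ER N * M + EY * T)"
  unfolding M4_def by (rule hc_mult_four_block[OF U E_carrier M11 MT(1) zero_carrier_mat MT(2)])
 also have "... = fr KR KW Z Y"
  unfolding U11 YM[symmetric] fr_def using KRW rh Z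
  by (simp add: mat_zero_right) (subst mat_add_zero_right; simp)
 finally have "char_poly (fr KR KW Z Y) = char_poly M4" by simp
 also have "... = char_poly M11 * char_poly T" unfolding M4_def by (rule char_poly_four_block_upper[OF M11 MT(1,2)])
 also have "char_poly M11 = char_poly (Cr) * char_poly M22" unfolding M11_def
  by (rule char_poly_four_block_upper[OF Cro(1) M12 M22])
 also have "char_poly M22 = char_poly (Cc) * char_poly h" unfolding M22_def
  by (rule char_poly_four_block_upper[OF Cch(1) zero_carrier_mat rh(2)])
 finally show ?thesis by (simp add: cT Cro(3) Cch(2))
qed

text \<open>The form for which the standard blocks are adapted and \<open>EZ\<close> has Gram matrix
  \<open>B2\<close>, written as a sum of one term for each pairing of coordinate blocks; it is
  determined by these data.\<close>

definition std_form where
 "std_form B2 = ER * EY\<^sup>T + EY * ER\<^sup>T + EW * (G * EW\<^sup>T) + EZ * (B2 * EZ\<^sup>T)"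

lemma G_sym: "G\<^sup>T = G"
 by (rule eq_matI) (auto simp: G_def gram_def zformD(1)[OF nformsD(1)[OF b]])

lemma std_form:
 assumes B2: "B2 : GL m" "B2\<^sup>T = B2"
 shows "std_form B2 : mats n n" "(std_form B2)\<^sup>T = std_form B2"
  "adapted (std_form B2) ER EW EZ EY" "EZ\<^sup>T * (std_form B2 * EZ) = B2"
proof -
 note Bc = GL_carrier[OF B2(1)] and Gc = G(2)
 show c: "std_form B2 : mats n n" unfolding std_form_def using E_carrier Bc Gc by (auto intro!: carrier_matI)
 have t: "(std_form B2)\<^sup>T = EY * ER\<^sup>T + ER * EY\<^sup>T + EW * (G * EW\<^sup>T) + EZ * (B2 * EZ\<^sup>T)"
  unfolding std_form_def using Bc Gc by (simp add: transpose_add_dim mat_transpose_mult G_sym B2(2) mat_assoc)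
 show "(std_form B2)\<^sup>T = std_form B2" unfolding t unfolding std_form_def
  by (subst comm_add_mat[of "EY * ER\<^sup>T" n n]) auto
 have S: "std_form B2 * T = ER * (EY\<^sup>T * T) + EY * (ER\<^sup>T * T) + EW * (G * (EW\<^sup>T * T)) + EZ * (B2 * (EZ\<^sup>T * T))"
  if "dim_row T = n" for T
  unfolding std_form_def using Bc Gc that by (simp add: mat_distrib_right mat_assoc)
 have SE: "std_form B2 * ER = EY" "std_form B2 * EW = EW * G" "std_form B2 * EZ = EZ * B2" "std_form B2 * EY = ER"
  using Bc Gc by (simp_all add: S E_one E_zero mat_zero_right mat_one_right mat_add_zero_left mat_add_zero_right)
 show "EZ\<^sup>T * (std_form B2 * EZ) = B2"
  unfolding SE using Bc by (simp add: mat_assoc[symmetric] E_one mat_one_left)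
 show "adapted (std_form B2) ER EW EZ EY"
  unfolding adapted_def SE using Bc Gc B2
  by (simp add: mat_assoc[symmetric] E_one E_zero mat_one_left mat_zero_left)
qed

lemma std_form_unique:
 assumes B: "B : mats n n" "B\<^sup>T = B" and a: "adapted B ER EW EZ EY"
 shows "B = std_form (bil B EZ EZ)"
proof -
 define B2 where "B2 = bil B EZ EZ"
 note z = a[unfolded adapted_def, folded B2_def]
 have B2: "B2 : GL m" "B2\<^sup>T = B2"
  using z gram_transpose[OF B(2,1) E_carrier E_carrier] unfolding B2_def by auto
 note s = std_form[OF B2]
 note z' = s(3)[unfolded adapted_def]
 have "(fr ER EW EZ EY)\<^sup>T * (B * fr ER EW EZ EY) = (fr ER EW EZ EY)\<^sup>T * (std_form B2 * fr ER EW EZ EY)"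
  by (rule gram_fr_eq[OF B s(1,2) E_carrier E_carrier E_carrier E_carrier E_carrier E_carrier E_carrier E_carrier])
   (use z z' s(4) B2_def in auto)
 thus ?thesis unfolding fr_E B2_def[symmetric] using B s by (simp add: mat_one_left mat_one_right)
qed

text \<open>The isometry and form induced on the orthogonal complement of the cyclic space modulo
  the radical. This is the smaller space to which the recursion passes.\<close>

definition inner where
 "inner = {(A2, B2). \<exists>\<phi>2. (A2, B2) \<in> pairs m \<phi>2 & ro * (ch * \<phi>2) * conj_poly ro = \<phi>}"

text \<open>In a normal triple, \<open>v\<close> is forced, \<open>B\<close> is forced by its
  restriction to \<open>EZ\<close>, and the first columns of \<open>A\<close> are \<open>KR\<close>,
  \<open>KW\<close>. The remaining columns are a completion of these, with \<open>h\<close> equal to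
  the induced map \<open>A2\<close>, so each inner pair extends in \<open>weight\<close>
  ways.\<close>

lemma card_normal_triples: "card normal_triples = card inner * weight"
proof -
 define D where "D = (SIGMA p:inner. completions n d e m (std_form (snd p)) KR KW EZ (fst p))"
 define g where "g = (%((A2 :: 'a mat, B2), (Z, Y)). (fr KR KW Z Y, std_form B2, K 1))"
 have n': "n = d + (e + m) + d" by (rule n)
 have Dp: "adapted (std_form B2) ER EW EZ EY & std_form B2 : mats n n & (std_form B2)\<^sup>T = std_form B2
   & EZ\<^sup>T * (std_form B2 * EZ) = B2 & A2 : GL m & A2 : mats m m & B2 : GL m & B2 : mats m m
   & std_form B2 : GL n"
  if i: "(A2, B2) \<in> inner" for A2 B2
 proof -
  obtain \<phi>2 where p: "(A2, B2) \<in> pairs m \<phi>2" using i unfolding inner_def by auto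
  note s = std_form[OF pairsD(2,4)[OF p]]
  show ?thesis using s pairsD[OF p] adapted_frame_GL(2)[OF s(1,2) E_carrier E_carrier E_carrier E_carrier s(3)] by auto
 qed
 have cD: "card (completions n d e m (std_form B2) KR KW EZ A2) = weight" if "(A2, B2) \<in> inner" for A2 B2
 proof -
  note D = Dp[OF that]
  have Bc: "std_form B2 : mats n n" "(std_form B2)\<^sup>T = std_form B2"
   "adapted (std_form B2) ER EW EZ EY" using D by auto
  note k = K_frame_gram[OF Bc]
  show ?thesis unfolding weight_def
   by (rule card_completions[OF _ Bc(2) two n' KRW(1) k(7) KRW(2) E_carrier k(1,2,4) _ k(5)]) (use D k(3) G in auto)
 qed
 have bij: "bij_betw g D normal_triples"
  unfolding bij_betw_def
 proof (intro conjI)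
  show "inj_on g D"
  proof (rule inj_onI)
   fix s t :: "('a mat \<times> 'a mat) \<times> 'a mat \<times> 'a mat" assume st: "s \<in> D" "t \<in> D" "g s = g t"
   obtain A2 B2 Z Y A2' B2' Z' Y' :: "'a mat" where e: "s = ((A2, B2), (Z, Y))" "t = ((A2', B2'), (Z', Y'))"
    by (cases s, cases t) auto
   have i: "(A2, B2) \<in> inner" "(A2', B2') \<in> inner" and c: "(Z, Y) \<in> completions n d e m (std_form B2) KR KW EZ A2"
    "(Z', Y') \<in> completions n d e m (std_form B2') KR KW EZ A2'" using st unfolding e D_def by auto
   have eq: "fr KR KW Z Y = fr KR KW Z' Y'" "std_form B2 = std_form B2'" using st(3) unfolding e g_def by auto
   have BB: "B2 = B2'" using Dp[OF i(1)] Dp[OF i(2)] eq(2) by metis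
   have cc: "Z : mats n m" "Y : mats n d" "Z' : mats n m" "Y' : mats n d"
    using c unfolding completions_def by auto
   have ZY: "Z = Z'" "Y = Y'" using fr_eqD(3,4)[OF eq(1) KRW cc(1,2) KRW cc(3,4)] by auto
   note D = Dp[OF i(1)] and D' = Dp[OF i(2)]
   have Bc: "std_form B2 : mats n n" "(std_form B2)\<^sup>T = std_form B2"
    "adapted (std_form B2) ER EW EZ EY" using D by auto
   have ZK: "EZ\<^sup>T * (std_form B2 * KR) = zm m d"
    using gram_swap[OF K_frame_gram(4)[OF Bc] Bc(2,1) KRW(1) E_carrier] by simp
   \<comment> \<open>Pairing the third column block with \<open>EZ\<close> recovers
     \<open>B2 * A2\<close>, hence \<open>A2\<close>, which makes the parametrization
     injective.\<close>
   have ext: "EZ\<^sup>T * (std_form B2 * (KR * r + EZ * h)) = B2 * h"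
    if "r : mats d m" "h : mats m m" for r h
   proof -
    have zz: "EZ\<^sup>T * (std_form B2 * EZ) = B2" "B2 : mats m m" using D by auto
    show ?thesis
     using mat_mult3_eqD[OF ZK, of r] mat_mult3_eqD[OF zz(1), of h] carrier_matD[OF Bc(1)] zz(2) that KRW
     by (simp add: mat_distrib_left mat_zero_left mat_add_zero_left)
   qed
   obtain r where r: "r : mats d m" "Z = KR * r + EZ * A2" using c(1) unfolding completions_def by auto
   obtain r' where r': "r' : mats d m" "Z' = KR * r' + EZ * A2'" using c(2) unfolding completions_def by auto
   have "B2 * A2 = B2 * A2'" using ext[OF r(1)] ext[OF r'(1)] r(2) r'(2) ZY D D' by metis
   hence "A2 = A2'" by (rule GL_cancel_left[rotated]) (use D D' in auto)
   thus "s = t" using BB ZY e by simp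
  qed
  show "g ` D = normal_triples"
  proof (intro equalityI subsetI)
   fix y assume "y \<in> g ` D"
   then obtain A2 B2 Z Y where i: "(A2, B2) \<in> inner" and c: "(Z, Y) \<in> completions n d e m (std_form B2) KR KW EZ A2"
    and y: "y = (fr KR KW Z Y, std_form B2, K 1)" unfolding D_def g_def by auto
   note D = Dp[OF i]
   define B where "B = std_form B2"
   have Bc: "B : mats n n" "B\<^sup>T = B" "adapted B ER EW EZ EY" "B : GL n"
    "bil B EZ EZ = B2" using D unfolding B_def by auto
   note k = K_frame_gram[OF Bc(1-3)]
   have cc: "Z : mats n m" "Y : mats n d"
    and kk: "bil B KR Y = im d" "bil B KW Y = zm e d" "bil B Z Y = zm m d"
     "bil B Y Y = zm d d" using c unfolding completions_def B_def by auto
   obtain r where r: "r : mats d m" "Z = KR * r + EZ * A2" using c unfolding completions_def by auto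
   have A2: "A2 : mats m m" using D by auto
   note cg = completion_gram[OF Bc(1,2) KRW E_carrier k(1,2,4,5) r(1) A2, folded r(2)]
   obtain \<phi>2 where p: "(A2, B2) \<in> pairs m \<phi>2" "ro * (ch * \<phi>2) * conj_poly ro = \<phi>" using i unfolding inner_def by auto
   define A where "A = fr KR KW Z Y"
   have A: "A : mats n n" unfolding A_def fr_def n
    by (rule hc_carrier[OF hc_carrier[OF _ hc_carrier]]) (use KRW cc n in auto)
   have "A * fr ER EW EZ EY = A" unfolding fr_E using A by (simp add: mat_one_right)
   hence "fr (A * ER) (A * EW) (A * EZ) (A * EY) = fr KR KW Z Y"
    using mult_fr[OF A E_carrier E_carrier E_carrier E_carrier] A_def by simp
   note AE = fr_eqD[OF this mult_carrier_mat[OF A E_carrier] mult_carrier_mat[OF A E_carrier] mult_carrier_mat[OF A E_carrier]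
    mult_carrier_mat[OF A E_carrier] KRW cc]
   note z = Bc(3)[unfolded adapted_def]
   \<comment> \<open>\<open>A\<close> is an isometry as soon as its columns have the same Gram
     matrix as the standard frame. The \<open>Z\<close> block contributes
     \<open>bil B2 A2 A2\<close>, which is \<open>B2\<close> since \<open>A2\<close> is an
     isometry.\<close>
   have "(fr KR KW Z Y)\<^sup>T * (B * fr KR KW Z Y) = (fr ER EW EZ EY)\<^sup>T * (B * fr ER EW EZ EY)"
    by (rule gram_fr_eq[OF Bc(1,2) Bc(1,2) KRW cc E_carrier E_carrier E_carrier E_carrier])
     (use z k kk cg Bc(5) pairsD(5)[OF p(1)] in auto)
   hence iso: "bil B A A = B"
    unfolding fr_E A_def[symmetric] using Bc by (simp add: mat_one_left mat_one_right)
   have "char_poly A = \<phi>" unfolding A_def char_poly_normal[OF Bc(1-3) r(1) A2 r(2) cc(2) kk(1)] pairsD(6)[OF p(1)] p(2) ..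
   hence "(A, B) \<in> pairs n \<phi>" unfolding pairs_def using A Bc iso by auto
   moreover have "\<forall>h. pv A (K 1) h = K h" using normal_iff[OF A K_carrier] AE by blast
   ultimately show "y \<in> normal_triples" unfolding y A_def[symmetric] B_def[symmetric] normal_triples_def
    using Bc K_carrier by auto
  next
   fix y assume "y \<in> normal_triples"
   then obtain A B v where y: "y = (A, B, v)" and AB: "(A, B) \<in> pairs n \<phi>" and v: "v : mats n 1"
    and K: "\<forall>h. pv A v h = K h" and a: "adapted B ER EW EZ EY" unfolding normal_triples_def by auto
   note A = pairsD(1)[OF AB] and B = pairsD(3,4)[OF AB]
   have AE: "v = K 1" "A * ER = KR" "A * EW = KW" using K normal_iff[OF A v] by auto
   define Z where "Z = A * EZ"
   define Y where "Y = A * EY"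
   have Z: "Z : mats n m" and Y: "Y : mats n d" unfolding Z_def Y_def using A E_carrier by auto
   have Af: "A = fr KR KW Z Y"
   proof -
    have "A = A * fr ER EW EZ EY" unfolding fr_E using A by (simp add: mat_one_right)
    also have "... = fr (A * ER) (A * EW) (A * EZ) (A * EY)"
     by (rule mult_fr[OF A E_carrier E_carrier E_carrier E_carrier])
    finally show ?thesis unfolding AE Z_def Y_def .
   qed
   define B2 where "B2 = bil B EZ EZ"
   have Bst: "B = std_form B2" unfolding B2_def by (rule std_form_unique[OF B a])
   note z = a[unfolded adapted_def, folded B2_def]
   have B2: "B2 : GL m" "B2\<^sup>T = B2"
    using z gram_transpose[OF B(2,1) E_carrier E_carrier] unfolding B2_def by auto
   have iso: "(A * S)\<^sup>T * (B * (A * T)) = bil B S T"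
    if "S : mats n s" "T : mats n t" for S T s t
    using conj_gram[OF B(1) A that] pairsD(5)[OF AB] by simp
   note k = K_frame_gram[OF B a]
   have g1: "bil B KR Z = zm d m" "bil B KW Z = zm e m"
    "bil B Z Z = B2"
    "bil B KR Y = im d" "bil B KW Y = zm e d" "bil B Z Y = zm m d"
    "bil B Y Y = zm d d"
    unfolding AE(2,3)[symmetric] Z_def Y_def iso[OF E_carrier E_carrier] using z B2_def by auto
   have WW: "bil B KW KW : GL e" using k(3) G by simp
   have ZZ: "bil B EZ EZ : GL m" using B2 B2_def by simp
   \<comment> \<open>The image of \<open>EZ\<close> is orthogonal to the images \<open>KR\<close>,
     \<open>KW\<close> of \<open>ER\<close>, \<open>EW\<close>, so it lies in the span of
     \<open>KR\<close> and \<open>EZ\<close>; its \<open>EZ\<close> coordinates are the induced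
     map.\<close>
   obtain r h where rh: "r : mats d m" "h : mats m m" "Z = KR * r + EZ * h"
    using isotropic_perp[OF pairsD(2)[OF AB] B(2) two n' KRW(1) k(7) KRW(2) E_carrier k(1,2,4) WW k(5) ZZ Z g1(1,2)] by blast
   note cg = completion_gram[OF B KRW E_carrier k(1,2,4,5) rh(1,2), folded rh(3)]
   have "bil B2 h h = B2" using cg(3) g1(3) B2_def by simp
   hence p: "(h, B2) \<in> pairs m (char_poly h)" unfolding pairs_def using rh B2 by auto
   have "ro * (ch * char_poly h) * conj_poly ro = \<phi>"
    using char_poly_normal[OF B a rh Y g1(4)] pairsD(6)[OF AB] Af by simp
   hence i: "(h, B2) \<in> inner" unfolding inner_def using p by auto
   have "(Z, Y) \<in> completions n d e m (std_form B2) KR KW EZ h"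
    unfolding completions_def Bst[symmetric] using Z Y rh g1 by auto
   hence "((h, B2), (Z, Y)) \<in> D" unfolding D_def using i by auto
   moreover have "y = g ((h, B2), (Z, Y))" unfolding g_def y using Af Bst AE by simp
   ultimately show "y \<in> g ` D" by blast
  qed
 qed
 have fin: "finite inner" by (rule finite_subset[of _ "mats m m \<times> mats m m"])
  (auto simp: inner_def finite_carrier_mat dest: pairsD)
 have finc: "finite (completions n d e m B R W Z0 h)" for B R W Z0 h :: "'a mat"
  by (rule finite_subset[of _ "mats n m \<times> mats n d"]) (auto simp: completions_def finite_carrier_mat)
 have "card normal_triples = card D" using bij_betw_same_card[OF bij] by simp
 also have "... = (\<Sum>p\<in>inner. card (completions n d e m (std_form (snd p)) KR KW EZ (fst p)))"
  unfolding D_def using fin finc by (intro card_SigmaI) auto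
 also have "... = (\<Sum>p\<in>inner. weight)" by (intro sum.cong refl) (auto intro: cD)
 finally show ?thesis by simp
qed

lemma weight_pos: "weight > 0"
proof -
 have "zm d m \<in> (mats d m :: 'a mat set)" "zm d d \<in> (skew d :: 'a mat set)"
  by (auto simp: skew_def intro!: eq_matI)
 moreover have "finite (skew d :: 'a mat set)"
  by (rule finite_subset[OF _ finite_carrier_mat[of d d]]) (auto simp: skew_def)
 ultimately show ?thesis unfolding weight_def using finite_carrier_mat[of d m, where 'a = 'a] by (auto simp: card_gt_0_iff)
qed

text \<open>The factor \<open>weight\<close> entered once through the adapted frames of a triple and
  once through the normal triples over an inner pair, and it is positive, so it cancels.\<close>

theorem card_triples_inner: "card triples * card (GL m :: 'a mat set) = card (GL n :: 'a mat set) * card inner"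
 using card_triples card_normal_triples weight_pos by auto

end

section \<open>Annihilators, radicals and the recursion for the mass\<close>

lemma poly_ideal_generator:
 fixes J :: "'a::field poly set"
 assumes add: "!!p q. p \<in> J ==> q \<in> J ==> p + q \<in> J" and mult: "!!p q. q \<in> J ==> p * q \<in> J"
  and h: "h \<in> J" "h ~= 0"
 obtains g where "monic g" "!!p. p \<in> J \<longleftrightarrow> g dvd p"
proof -
 define P where "P k \<longleftrightarrow> (\<exists>g\<in>J. g ~= 0 & degree g = k)" for k
 have "P (degree h)" using h by (auto simp: P_def)
 hence "P (Least P)" by (rule LeastI)
 then obtain g0 where g0: "g0 \<in> J" "g0 ~= 0" "degree g0 = Least P" by (auto simp: P_def)
 define g where "g = smult (inverse (lead_coeff g0)) g0"
 have gJ: "g \<in> J" using mult[OF g0(1), of "[:inverse (lead_coeff g0):]"] by (simp add: g_def)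
 have lc: "lead_coeff g0 ~= 0" using g0(2) by simp
 have m: "monic g" unfolding g_def lead_coeff_smult using lc by simp
 have dg: "degree g = Least P" unfolding g_def degree_smult_eq using lc g0(3) by simp
 have gnz: "g ~= 0" using m by auto
 have "g dvd p" if "p \<in> J" for p
 proof (rule ccontr)
  assume "\<not> g dvd p"
  hence nz: "p mod g ~= 0" by (simp add: mod_eq_0_iff_dvd)
  have "p + (- (p div g)) * g = p mod g" by (simp add: minus_div_mult_eq_mod)
  hence "p mod g \<in> J" using add[OF that mult[OF gJ, of "- (p div g)"]] by simp
  hence "P (degree (p mod g))" using nz by (auto simp: P_def)
  hence "degree g <= degree (p mod g)" unfolding dg by (rule Least_le)
  moreover have "degree (p mod g) < degree g" using degree_mod_less[OF gnz, of p] nz by simp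
  ultimately show False by simp
 qed
 moreover have "p \<in> J" if gp: "g dvd p" for p
 proof -
  obtain s where "p = g * s" using gp by (elim dvdE)
  thus ?thesis using mult[OF gJ, of s] by (simp add: mult.commute)
 qed
 ultimately have "p \<in> J \<longleftrightarrow> g dvd p" for p by blast
 thus ?thesis by (rule that[OF m])
qed

lemma infinite_poly: "infinite (UNIV :: 'a::field poly set)"
proof
 assume "finite (UNIV :: 'a poly set)"
 moreover have "inj (%k. monom (1::'a) k)" by (rule injI) (metis degree_monom_eq zero_neq_one)
 ultimately have "finite (UNIV :: nat set)" by (metis finite_imageD finite_subset subset_UNIV)
 thus False by simp
qed

text \<open>There are infinitely many polynomials and finitely many vectors, so some nonzero
  polynomial annihilates \<open>v\<close>. The generator has nonzero constant term, since a factor z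
  could be removed by inverting \<open>A\<close>.\<close>

lemma annihilator_generator:
 fixes A v :: "'a::{field,finite} mat"
 assumes A: "A : GL n" and v: "v : mats n 1"
 obtains ps where "monic ps" "coeff ps 0 ~= 0" "!!h. pv A v h = zm n 1 \<longleftrightarrow> ps dvd h"
proof -
 have Ac: "A : mats n n" using A GL_carrier by blast
 define J where "J = {h. pv A v h = zm n 1}"
 have "\<not> inj (pv A v)"
 proof
  assume "inj (pv A v)"
  moreover have "range (pv A v) \<subseteq> mats n 1" using pv_carrier[OF Ac v] by auto
  ultimately show False using infinite_poly[where 'a = 'a] finite_carrier_mat[of n 1, where 'a = 'a]
   by (metis finite_imageD finite_subset)
 qed
 then obtain p q where pq: "p ~= q" "pv A v p = pv A v q" by (auto simp: inj_def)
 have "pv A v (p - q) = zm n 1" using pq pv_diff[OF Ac v, of p q] pv_dim[OF Ac v] by (simp add: mat_self_diff)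
 hence h: "p - q \<in> J" "p - q ~= 0" using pq by (auto simp: J_def)
 have "pv A (zm n 1) s = zm n 1" for s
 proof (induction s rule: pCons_induct)
  case 0 thus ?case by (simp add: pv_0[OF Ac])
 next
  case (pCons a s)
  show ?case unfolding pv_pCons[OF Ac zero_carrier_mat] pCons.IH using Ac by (simp add: mat_zero_right mat_add_zero_left)
 qed
 hence mult: "p * q \<in> J" if "q \<in> J" for p q using that pv_mult[OF Ac v, of p q] by (simp add: J_def)
 have add: "p + q \<in> J" if "p \<in> J" "q \<in> J" for p q
  using that pv_add[OF Ac v, of p q] by (simp add: J_def mat_add_zero_left)
 obtain ps where ps: "monic ps" "!!p. p \<in> J \<longleftrightarrow> ps dvd p" using poly_ideal_generator[OF add mult h] by blast
 have "coeff ps 0 ~= 0"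
 proof
  assume "coeff ps 0 = 0"
  then obtain s where s: "ps = pCons 0 s" by (cases ps) auto
  hence "s ~= 0" using ps(1) by auto
  have "A * pv A v s = zm n 1" using ps(2)[of ps] pv_shift[OF Ac v, of s] s by (simp add: J_def)
  hence "pv A v s = zm n 1" using injective_mat_vecD[OF GL_injective[OF A] _ Ac pv_carrier[OF Ac v]] by simp
  hence "ps dvd s" using ps(2)[of s] by (simp add: J_def)
  thus False using dvd_imp_degree_le[of ps s] \<open>s ~= 0\<close> s by simp
 qed
 thus ?thesis using that[of ps] ps by (simp add: J_def)
qed

text \<open>The point is that the radical is closed under multiplication by z. To show b(z h, k) =
  0, subtract from k the multiple of \<open>ps\<close> that cancels its constant term; this is
  possible because ps(0) is nonzero, and then z divides both arguments.\<close>

lemma zform_radical_generator: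
 fixes b :: "'a::field poly => 'a poly => 'a"
 assumes b: "zform b" and ps: "coeff ps 0 ~= 0" "!!s k. b (ps * s) k = 0"
 obtains ch where "monic ch" "b \<in> nforms ch" "ch dvd ps"
proof -
 define J where "J = {h. \<forall>k. b h k = 0}"
 have shift: "pCons 0 h \<in> J" if h: "h \<in> J" for h
 proof -
  have "b (pCons 0 h) k = 0" for k
  proof -
   define s where "s = ps * [:coeff k 0 / coeff ps 0:]"
   have "coeff (k - s) 0 = 0" using ps(1) by (simp add: s_def coeff_mult_0)
   then obtain k' where k': "k - s = pCons 0 k'" by (cases "k - s") auto
   have "b (pCons 0 h) (k - s + s) = b (pCons 0 h) (pCons 0 k') + b (pCons 0 h) s"
    unfolding k' by (rule zformD(3)[OF b])
   moreover have "b (pCons 0 h) (pCons 0 k') = 0" using h zformD(6)[OF b] by (simp add: J_def)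
   moreover have "b (pCons 0 h) s = b s (pCons 0 h)" by (rule zformD(1)[OF b])
   moreover have "b s (pCons 0 h) = 0" unfolding s_def by (rule ps(2))
   ultimately show ?thesis by simp
  qed
  thus ?thesis by (simp add: J_def)
 qed
 have add: "p + q \<in> J" if "p \<in> J" "q \<in> J" for p q using that by (simp add: J_def zformD[OF b])
 have mult: "p * q \<in> J" if q: "q \<in> J" for p q
 proof (induction p rule: pCons_induct)
  case 0
  have "b 0 k = 0" for k using zformD(4)[OF b, of 0 0 k] by simp
  thus ?case by (simp add: J_def)
 next
  case (pCons a p)
  have "smult a q \<in> J" using q by (simp add: J_def zformD[OF b])
  thus ?case using add shift[OF pCons.IH] by simp
 qed
 have "ps \<in> J" "ps ~= 0" using ps(1) ps(2)[of 1] by (auto simp: J_def)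
 then obtain ch where ch: "monic ch" "!!p. p \<in> J \<longleftrightarrow> ch dvd p" using poly_ideal_generator[OF add mult] by blast
 have "b \<in> nforms ch" unfolding nforms_def using b ch(2) by (auto simp: J_def)
 moreover have "ch dvd ps" using \<open>ps \<in> J\<close> ch(2) by simp
 ultimately show ?thesis using that ch by blast
qed

text \<open>Both arguments can be reduced modulo \<open>ch\<close>, so a form is determined by one
  Gram matrix over a finite field.\<close>

lemma finite_nforms:
 fixes ch :: "'a::{field,finite} poly"
 assumes "ch ~= 0"
 shows "finite (nforms ch)"
proof -
 let ?e = "degree ch"
 have "inj_on (%b. gram b 1 ?e 1 ?e) (nforms ch)"
 proof (rule inj_onI)
  fix b b' assume b: "b \<in> nforms ch" "b' \<in> nforms ch" and eq: "gram b 1 ?e 1 ?e = gram b' 1 ?e 1 ?e"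
  have small: "coeff (h mod ch) i = 0" if "i >= ?e" for h i
   using degree_mod_less[OF assms, of h] that by (auto intro: coeff_eq_0)
  have "b h k = b' h k" for h k
  proof -
   have "b (h mod ch) (k mod ch) = ((cvec ?e (h mod ch))\<^sup>T * (gram b 1 ?e 1 ?e * cvec ?e (k mod ch))) $$ (0, 0)"
    by (rule cvec_gram_cvec[OF nformsD(1)[OF b(1)], symmetric]) (auto intro: small)
   also have "... = b' (h mod ch) (k mod ch)"
    unfolding eq by (rule cvec_gram_cvec[OF nformsD(1)[OF b(2)]]) (auto intro: small)
   finally show ?thesis unfolding nforms_mod[OF b(1)] nforms_mod[OF b(2)] .
  qed
  thus "b = b'" by blast
 qed
 moreover have "finite ((%b. gram b 1 ?e 1 ?e) ` nforms ch)"
  by (rule finite_subset[OF _ finite_carrier_mat[of ?e ?e]]) (auto simp: gram_carrier)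
 ultimately show ?thesis by (rule finite_imageD[rotated])
qed

definition mass :: "'a::{field,finite} poly => real" where
 "mass \<phi> = real (card (pairs (degree \<phi>) \<phi>)) / real (card (GL (degree \<phi>) :: 'a mat set))"

definition split_pairs :: "'a::field poly => ('a poly \<times> 'a poly) set" where
 "split_pairs \<phi> = {(ch, ro). monic ch & monic ro & ch * (ro * conj_poly ro) dvd \<phi>}"

lemma finite_bounded_degree: "finite {p :: 'a::{field,finite} poly. degree p <= n}"
proof -
 have "inj_on (cvec (Suc n)) {p :: 'a poly. degree p <= n}"
 proof (rule inj_onI)
  fix p q :: "'a poly" assume pq: "p \<in> {p. degree p <= n}" "q \<in> {p. degree p <= n}" "cvec (Suc n) p = cvec (Suc n) q"
  have v: "vpoly (cvec (Suc n) r) = r" if "degree r <= n" for r :: "'a poly"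
   by (rule vpoly_cvec) (use that in "auto intro: coeff_eq_0")
  have "p = vpoly (cvec (Suc n) p)" using v pq(1) by simp
  also have "... = q" unfolding pq(3) using v pq(2) by simp
  finally show "p = q" .
 qed
 moreover have "finite (cvec (Suc n) ` {p :: 'a poly. degree p <= n})"
  by (rule finite_subset[OF _ finite_carrier_mat[of "Suc n" 1]]) (auto simp: cvec_carrier)
 ultimately show ?thesis by (rule finite_imageD[rotated])
qed

lemma finite_split_pairs:
 fixes \<phi> :: "'a::{field,finite} poly"
 assumes "\<phi> ~= 0"
 shows "finite (split_pairs \<phi>)"
proof (rule finite_subset)
 show "split_pairs \<phi> \<subseteq> {p. degree p <= degree \<phi>} \<times> {p. degree p <= degree \<phi>}"
 proof
  fix p assume p: "p \<in> split_pairs \<phi>"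
  obtain ch ro where e: "p = (ch, ro)" by (cases p)
  have d: "ch * (ro * conj_poly ro) dvd \<phi>" using p unfolding e split_pairs_def by auto
  have "ch dvd \<phi>" "ro dvd \<phi>" using dvd_mult_left[OF d] dvd_mult_left[OF dvd_mult_right[OF d]] by auto
  thus "p \<in> {p. degree p <= degree \<phi>} \<times> {p. degree p <= degree \<phi>}"
   unfolding e using assms dvd_imp_degree_le by auto
 qed
qed (auto intro: finite_bounded_degree)

lemma card_GL_pos: "card (GL n :: 'a::{field,finite} mat set) > 0"
proof -
 have "finite (GL n :: 'a mat set)" by (rule finite_subset[OF _ finite_carrier_mat[of n n]]) (auto dest: GL_carrier)
 thus ?thesis using GL_one[of n, where 'a = 'a] by (auto simp: card_gt_0_iff)
qed

lemma degree_conj_poly: "coeff ro 0 ~= 0 ==> degree (conj_poly ro) = degree ro"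
 by (simp add: conj_poly_def)

lemma monic_conj_poly: "coeff ro 0 ~= 0 ==> monic (conj_poly ro)"
 by (simp add: conj_poly_def coeff_reflect_poly)

text \<open>Up to the factor |GL_n|, the left side counts all triples with all q^n vectors, and the
  right side sorts them by type. The summand for \<open>ch = ro = 1\<close> comes from
  \<open>v = 0\<close> and is the mass of \<phi> itself.\<close>

theorem mass_recursion:
 fixes \<phi> :: "'a::{field,finite} poly"
 assumes two: "(2::'a) ~= 0" and \<phi>: "monic \<phi>" "coeff \<phi> 0 ~= 0"
 shows "real CARD('a) ^ degree \<phi> * mass \<phi>
  = (\<Sum>(ch, ro)\<in>split_pairs \<phi>. real (card (nforms ch)) * mass (\<phi> div (ch * (ro * conj_poly ro))))"
proof -
 define n where "n = degree \<phi>"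
 define S where "S = pairs n \<phi> \<times> (mats n 1 :: 'a mat set)"
 define T where "T = (%((ch, ro), b). cyclic_base.triples b ch ro \<phi> n)"
 define f where "f = (%(A, B, v). ((A, B), v) :: ('a mat \<times> 'a mat) \<times> 'a mat)"
 define Ind where "Ind = (SIGMA p:split_pairs \<phi>. nforms (fst p))"
 have nz0: "\<phi> ~= 0" using \<phi> by auto
 have c0: "coeff ch 0 ~= 0" "coeff ro 0 ~= 0" "monic ch" "monic ro" "b \<in> nforms ch"
  "ch * (ro * conj_poly ro) dvd \<phi>"
  if "((ch, ro), b) \<in> Ind" for ch ro b
 proof -
  show d: "ch * (ro * conj_poly ro) dvd \<phi>" "monic ch" "monic ro" "b \<in> nforms ch"
   using that by (auto simp: Ind_def split_pairs_def)
  then obtain s where "\<phi> = ch * (ro * conj_poly ro) * s" by (elim dvdE)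
  thus "coeff ch 0 ~= 0" "coeff ro 0 ~= 0" using \<phi>(2) by (auto simp: coeff_mult_0)
 qed
 have card_T: "real (card (T i)) = real (card (GL n :: 'a mat set)) * mass (\<phi> div (fst (fst i) * (snd (fst i) * conj_poly (snd (fst i)))))"
  and T_cover: "True"
  if "i \<in> Ind" for i
 proof -
  obtain ch ro b where i: "i = ((ch, ro), b)" by (cases i) auto
  note c = c0[OF that[unfolded i]]
  define d where "d = degree ro"
  define e where "e = degree ch"
  define \<phi>2 where "\<phi>2 = \<phi> div (ch * (ro * conj_poly ro))"
  define m where "m = degree \<phi>2"
  have f: "\<phi> = ch * (ro * conj_poly ro) * \<phi>2" unfolding \<phi>2_def using c(6) by simp
  have nz2: "ch ~= 0" "ro ~= 0" "conj_poly ro ~= 0" "\<phi>2 ~= 0" using f nz0 by auto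
  have n: "n = d + (e + m) + d"
   unfolding n_def m_def d_def e_def by (subst f) (use nz2 c degree_conj_poly[of ro] in "simp add: degree_mult_eq")
  interpret cyclic_type b ch ro \<phi> n d e m
   by unfold_locales (use c two n in "auto simp: d_def e_def")
  \<comment> \<open>The factor \<open>ch * (ro * conj_poly ro)\<close> cancels, so the
    characteristic polynomial of an inner pair is forced to be the quotient.\<close>
  have "(A, B) \<in> inner \<longleftrightarrow> (A, B) \<in> pairs m \<phi>2" for A B
  proof
   assume "(A, B) \<in> inner"
   then obtain \<phi>3 where "(A, B) \<in> pairs m \<phi>3" "ro * (ch * \<phi>3) * conj_poly ro = \<phi>" unfolding inner_def by auto
   moreover from this(2) have "ch * (ro * conj_poly ro) * \<phi>3 = ch * (ro * conj_poly ro) * \<phi>2"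
    using f by (simp add: mult_ac)
   ultimately show "(A, B) \<in> pairs m \<phi>2" using nz2 by simp
  next
   assume "(A, B) \<in> pairs m \<phi>2"
   moreover have "ro * (ch * \<phi>2) * conj_poly ro = \<phi>" using f by (simp add: mult_ac)
   ultimately show "(A, B) \<in> inner" unfolding inner_def by auto
  qed
  hence inner: "inner = pairs m \<phi>2" by auto
  have "real (card triples) * real (card (GL m :: 'a mat set)) = real (card (GL n :: 'a mat set)) * real (card (pairs m \<phi>2))"
   using card_triples_inner unfolding inner by (metis of_nat_mult)
  hence "real (card triples) = real (card (GL n :: 'a mat set)) * mass \<phi>2"
   unfolding mass_def m_def[symmetric] using card_GL_pos[of m, where 'a = 'a] by (simp add: field_simps)
  thus "real (card (T i)) = real (card (GL n :: 'a mat set)) * mass (\<phi> div (fst (fst i) * (snd (fst i) * conj_poly (snd (fst i)))))"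
   unfolding T_def i by (simp add: \<phi>2_def)
 qed auto
 have T_iff: "(A, B, v) \<in> T ((ch, ro), b) \<longleftrightarrow> (A, B) \<in> pairs n \<phi> & v : mats n 1 & bf A B v = b
  & (\<forall>h. pv A v h = zm n 1 \<longleftrightarrow> ch * ro dvd h)" if "((ch, ro), b) \<in> Ind" for ch ro b A B v
 proof -
  note c = c0[OF that]
  interpret cyclic_base b ch ro \<phi> n "degree ro" "degree ch" by unfold_locales (use c two in auto)
  show ?thesis unfolding T_def by (simp add: triples_def)
 qed
 have cover: "\<exists>i\<in>Ind. (A, B, v) \<in> T i" if AB: "(A, B) \<in> pairs n \<phi>" and v: "v : mats n 1" for A B v
 proof -
  note A = pairsD(1)[OF AB] and B = pairsD(2,4)[OF AB]
  obtain ps where ps: "monic ps" "coeff ps 0 ~= 0" "!!h. pv A v h = zm n 1 \<longleftrightarrow> ps dvd h"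
   using annihilator_generator[OF pairsD(7)[OF AB] v] by blast
  define b where "b = bf A B v"
  have b: "zform b" unfolding b_def by (rule zform_bf[OF AB v])
  have "b (ps * s) k = 0" for s k
  proof -
   have "pv A v (ps * s) = zm n 1" using ps(3) by simp
   thus ?thesis unfolding b_def bf_def using pv_dim[OF A v] pairsD(3)[OF AB] by (simp add: mat_zero_left)
  qed
  then obtain ch where chi: "monic ch" "b \<in> nforms ch" "ch dvd ps" using zform_radical_generator[OF b ps(2)] by blast
  obtain ro where rho: "ps = ch * ro" using chi(3) by (elim dvdE)
  have c: "monic ro" "coeff ch 0 ~= 0" "coeff ro 0 ~= 0" using ps chi(1) rho by (auto simp: lead_coeff_mult coeff_mult_0)
  define d where "d = degree ro"
  define e where "e = degree ch"
  have "d + e + d <= n"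
  proof -
   interpret cyclic_base b ch ro \<phi> n d e by unfold_locales (use c two chi in "auto simp: d_def e_def")
   have t: "(A, B, v) \<in> triples" unfolding triples_def using AB v b_def ps(3) rho by auto
   note g = triples_gram[OF t]
   have "(kr A v 1 e)\<^sup>T * (B * kr A v 1 e) : GL e" using g(3) G by simp
   thus ?thesis
    using isotropic_frame_extend[OF B two kr_carrier[OF v] g(4) kr_carrier[OF v] g(1,2)] by blast
  qed
  moreover define m where "m = n - (d + e + d)"
  ultimately have n: "n = d + (e + m) + d" by simp
  interpret cyclic_type b ch ro \<phi> n d e m by unfold_locales (use c two chi n in "auto simp: d_def e_def")
  have t: "(A, B, v) \<in> triples" unfolding triples_def using AB v b_def ps(3) rho by auto
  \<comment> \<open>That \<phi> is divisible by ch ro times the conjugate of \<open>ro\<close> is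
    extracted from the count: one triple makes the number of inner pairs positive, and any inner
    pair exhibits the factorization.\<close>
  have "triples ~= {}" using t by auto
  hence "card triples > 0" using finite_triples by (simp add: card_gt_0_iff)
  hence "card triples * card (GL m :: 'a mat set) > 0" using card_GL_pos[of m, where 'a = 'a] by simp
  hence "card inner > 0" unfolding card_triples_inner by simp
  hence "inner ~= {}" by auto
  then obtain \<phi>2 where "ro * (ch * \<phi>2) * conj_poly ro = \<phi>" unfolding inner_def by auto
  hence "\<phi> = ch * (ro * conj_poly ro) * \<phi>2" by (simp add: mult_ac)
  hence "((ch, ro), b) \<in> Ind" unfolding Ind_def split_pairs_def using chi c by auto
  moreover have "(A, B, v) \<in> T ((ch, ro), b)" unfolding T_def using t by simp
  ultimately show ?thesis by blast
 qed
 \<comment> \<open>A triple determines its type: \<open>b\<close> is the form induced by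
   \<open>v\<close>, \<open>ch\<close> the monic generator of its radical, and
   \<open>ch * ro\<close> that of the annihilator of \<open>v\<close>.\<close>
 have disj: "T i \<inter> T j = {}" if "i \<in> Ind" "j \<in> Ind" "i ~= j" for i j
 proof (rule ccontr)
  assume "T i \<inter> T j ~= {}"
  then obtain A B v where x: "(A, B, v) \<in> T i" "(A, B, v) \<in> T j" by auto
  obtain ch ro b ch' ro' b' where i: "i = ((ch, ro), b)" "j = ((ch', ro'), b')" by (cases i, cases j) auto
  note c = c0[OF that(1)[unfolded i]] and c' = c0[OF that(2)[unfolded i]]
  note t = T_iff[OF that(1)[unfolded i], THEN iffD1, OF x(1)[unfolded i]]
  note t' = T_iff[OF that(2)[unfolded i], THEN iffD1, OF x(2)[unfolded i]]
  have bb: "b = b'" using t t' by simp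
  have uniq: "p = q" if "monic p" "monic q" "!!h. p dvd h \<longleftrightarrow> q dvd h" for p q :: "'a poly"
   using that by (metis dvd_refl poly_dvd_antisym)
  have "ch = ch'" using uniq[OF c(3) c'(3)] nformsD(2)[OF c(5)] nformsD(2)[OF c'(5)] bb by metis
  moreover have "ch * ro = ch' * ro'" using t t' c c' by (intro uniq) (auto simp: lead_coeff_mult)
  ultimately show False using that(3) i bb c(3) by auto
 qed
 have finI: "finite Ind" unfolding Ind_def
  by (intro finite_SigmaI finite_split_pairs nz0 finite_nforms) (auto simp: split_pairs_def)
 have finT: "finite (T i)" if "i \<in> Ind" for i
 proof -
  obtain ch ro b where i: "i = ((ch, ro), b)" by (cases i) auto
  have "T i \<subseteq> mats n n \<times> mats n n \<times> mats n 1"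
   using T_iff[OF that[unfolded i]] unfolding i by (auto dest: pairsD)
  thus ?thesis by (rule finite_subset) (auto simp: finite_carrier_mat)
 qed
 have U: "(\<Union>i\<in>Ind. T i) = {(A, B, v). (A, B) \<in> pairs n \<phi> & v : mats n 1}"
 proof (intro equalityI subsetI)
  fix x assume "x \<in> (\<Union>i\<in>Ind. T i)"
  then obtain ch ro b where "((ch, ro), b) \<in> Ind" "x \<in> T ((ch, ro), b)" by auto
  thus "x \<in> {(A, B, v). (A, B) \<in> pairs n \<phi> & v : mats n 1}" using T_iff by (cases x) auto
 qed (use cover in auto)
 have "bij_betw f {(A, B, v). (A, B) \<in> pairs n \<phi> & v : mats n 1} S"
  unfolding f_def S_def by (rule bij_betwI[where g = "%((A, B), v). (A, B, v)"]) auto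
 hence "card (\<Union>i\<in>Ind. T i) = card S" unfolding U by (rule bij_betw_same_card)
 also have "card S = card (pairs n \<phi>) * CARD('a) ^ n" unfolding S_def by (simp add: card_cartesian_product card_carrier_mat)
 also have "card (\<Union>i\<in>Ind. T i) = (\<Sum>i\<in>Ind. card (T i))" using finI finT disj by (intro card_UN_disjoint) auto
 finally have e: "(\<Sum>i\<in>Ind. card (T i)) = card (pairs n \<phi>) * CARD('a) ^ n" .
 have "real (card (pairs n \<phi>)) * real CARD('a) ^ n = real (\<Sum>i\<in>Ind. card (T i))" unfolding e by simp
 also have "... = (\<Sum>i\<in>Ind. real (card (T i)))" by simp
 also have "... = real (card (GL n :: 'a mat set)) * (\<Sum>i\<in>Ind. mass (\<phi> div (fst (fst i) * (snd (fst i) * conj_poly (snd (fst i))))))"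
  unfolding sum_distrib_left by (rule sum.cong) (auto simp: card_T)
 also have "(\<Sum>i\<in>Ind. mass (\<phi> div (fst (fst i) * (snd (fst i) * conj_poly (snd (fst i))))))
  = (\<Sum>p\<in>split_pairs \<phi>. \<Sum>b\<in>nforms (fst p). mass (\<phi> div (fst p * (snd p * conj_poly (snd p)))))"
 proof -
  have "\<forall>p\<in>split_pairs \<phi>. finite (nforms (fst p))"
   by (auto simp: split_pairs_def intro!: finite_nforms)
  thus ?thesis unfolding Ind_def using finite_split_pairs[OF nz0] by (subst sum.Sigma) (auto simp: split_beta)
 qed
 finally show ?thesis
  unfolding mass_def[of \<phi>] n_def[symmetric] using card_GL_pos[of n, where 'a = 'a]
  by (simp add: field_simps split_beta)
qed

section \<open>The number of shift-invariant forms: a symmetric Toeplitz system\<close>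

lemma card_triangular:
 fixes R :: "nat => (nat => 'a::{zero,finite}) => bool"
 assumes dep: "!!t c c'. (!!k. k <= t ==> c k = c' k) ==> R t c = R t c'"
  and ex1: "!!t c. s <= t ==> t < N ==> \<exists>!x. R t (c(t := x))"
 shows "card {c. (\<forall>k\<ge>N. c k = 0) & (\<forall>t. s <= t & t < N \<longrightarrow> R t c)} = CARD('a) ^ min N s"
 using ex1
proof (induction N)
 case 0
 have "{c. (\<forall>k\<ge>0. c k = 0) & (\<forall>t. s <= t & t < 0 \<longrightarrow> R t c)} = {%_. 0}" by auto
 thus ?case by simp
next
 case (Suc N)
 define S where "S N = {c. (\<forall>k\<ge>N. c k = 0) & (\<forall>t. s <= t & t < N \<longrightarrow> R t c)}" for N
 have IH: "card (S N) = CARD('a) ^ min N s" unfolding S_def using Suc by simp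
 have up: "R t (c(N := x)) = R t c" if "t < N" for t c x by (rule dep) (use that in auto)
 \<comment> \<open>The admissible values of the next entry: all field elements before index
   \<open>s\<close>, exactly one from \<open>s\<close> on.\<close>
 define V where "V c = (if N < s then UNIV else {x. R N (c(N := x))})" for c
 have "bij_betw (%(c, x). c(N := x)) (Sigma (S N) V) (S (Suc N))"
  unfolding bij_betw_def
 proof (intro conjI)
  show "inj_on (%(c, x). c(N := x)) (Sigma (S N) V)"
  proof (rule inj_onI)
   fix p q assume pq: "p \<in> Sigma (S N) V" "q \<in> Sigma (S N) V" "(%(c, x). c(N := x)) p = (%(c, x). c(N := x)) q"
   obtain c x c' x' where e: "p = (c, x)" "q = (c', x')" by (cases p, cases q)
   have eq: "c(N := x) = c'(N := x')" using pq(3) e by simp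
   have "c k = c' k" for k using fun_cong[OF eq, of k] pq(1,2) by (cases "k = N") (auto simp: e S_def)
   thus "p = q" using fun_cong[OF eq, of N] e by auto
  qed
  show "(%(c, x). c(N := x)) ` Sigma (S N) V = S (Suc N)"
  proof (intro equalityI subsetI)
   fix y assume "y \<in> (%(c, x). c(N := x)) ` Sigma (S N) V"
   then obtain c x where c: "c \<in> S N" "x \<in> V c" "y = c(N := x)" by auto
   have "R t y" if "s <= t" "t < Suc N" for t
    using c that up[of t c x] by (cases "t = N") (auto simp: S_def V_def)
   thus "y \<in> S (Suc N)" using c by (auto simp: S_def)
  next
   fix y assume y: "y \<in> S (Suc N)"
   define c where "c = y(N := 0)"
   have yc: "y = c(N := y N)" by (simp add: c_def)
   have "c k = 0" if "k >= N" for k using y that by (cases "k = N") (auto simp: S_def c_def)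
   moreover have "R t c" if "s <= t" "t < N" for t using y that up[of t y 0] by (auto simp: S_def c_def)
   ultimately have "c \<in> S N" by (auto simp: S_def)
   moreover have "y N \<in> V c" using y yc by (auto simp: S_def V_def)
   ultimately show "y \<in> (%(c, x). c(N := x)) ` Sigma (S N) V" using yc by (intro image_eqI[of _ _ "(c, y N)"]) auto
  qed
 qed
 hence "card (S (Suc N)) = card (Sigma (S N) V)" by (simp add: bij_betw_same_card)
 also have "... = (\<Sum>c\<in>S N. card (V c))"
 proof (rule card_SigmaI)
  show "finite (S N)"
  proof (rule ccontr)
   assume "infinite (S N)"
   thus False using IH by simp
  qed
 qed auto
 also have "... = (\<Sum>c\<in>S N. if N < s then CARD('a) else 1)"
 proof (rule sum.cong[OF refl])
  fix c assume "c \<in> S N"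
  show "card (V c) = (if N < s then CARD('a) else 1)"
  proof (cases "N < s")
   case False
   hence "\<exists>!x. R N (c(N := x))" by (intro Suc.prems) auto
   then obtain x where x: "R N (c(N := x))" "\<forall>y. R N (c(N := y)) \<longrightarrow> y = x" by (rule ex1E)
   have "V c = {y. R N (c(N := y))}" using False by (simp add: V_def)
   also have "... = {x}" using x by blast
   finally have "V c = {x}" .
   thus ?thesis using False by simp
  qed (simp add: V_def)
 qed
 also have "... = CARD('a) ^ min (Suc N) s" by (cases "N < s") (simp_all add: IH min_absorb1 min_absorb2)
 finally show ?case unfolding S_def .
qed

definition zforms_over :: "'a::field poly => ('a poly => 'a poly => 'a) set" where
 "zforms_over ps = {b. zform b & (\<forall>s k. b (ps * s) k = 0)}"

definition dst :: "nat => nat => nat" where "dst i j = (i - j) + (j - i)"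

lemma zform_monom: 
 assumes "zform b"
 shows "b (monom 1 i * h) (monom 1 i * k) = b h k"
proof (induction i)
 case (Suc i)
 have "monom 1 (Suc i) * h = pCons 0 (monom 1 i * h)" for h :: "'a poly" by (simp add: monom_Suc)
 thus ?case using Suc zformD(6)[OF assms] by simp
qed simp

text \<open>Shift invariance makes the Gram matrix on monomials Toeplitz and symmetry makes it
  depend on the distance of the exponents only, so a form is a sequence c_k = b(1, z^k).\<close>

lemma zform_monoms:
 assumes "zform b"
 shows "b (monom 1 i) (monom 1 j) = b 1 (monom 1 (dst i j))"
proof -
 have 1: "b (monom 1 i) (monom 1 j) = b 1 (monom 1 (j - i))" if "i <= j" for i j
  using zform_monom[OF assms, of i 1 "monom 1 (j - i)"] that by (simp add: mult_monom)
 show ?thesis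
 proof (cases "i <= j")
  case True
  thus ?thesis using 1[OF True] by (simp add: dst_def)
 next
  case False
  hence "b (monom 1 j) (monom 1 i) = b 1 (monom 1 (i - j))" using 1[of j i] by simp
  thus ?thesis using zformD(1)[OF assms, of "monom 1 i"] False by (simp add: dst_def)
 qed
qed

text \<open>The unknowns are c_0, ..., c_D with D the degree of \<open>ps\<close>, and equation m
  says b(ps, z^m) = 0. Values beyond D are set to 0 so that distinct functions are distinct
  solutions.\<close>

definition toeplitz_solutions :: "'a::field poly => (nat => 'a) set" where
 "toeplitz_solutions ps = {c. (\<forall>k\<ge>Suc (degree ps). c k = 0)
  & (\<forall>m\<le>degree ps. (\<Sum>i\<le>degree ps. coeff ps i * c (dst i m)) = 0)}"

lemma zforms_over_nonzero_const:
 assumes "b \<in> zforms_over ps"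
 shows "b (h mod ps) (k mod ps) = b h k"
proof -
 have z: "zform b" and r: "b (ps * s) k = 0" for s k using assms by (auto simp: zforms_over_def)
 have 1: "b (h mod ps) k = b h k" for h k
 proof -
  have "b h k = b (ps * (h div ps) + h mod ps) k" by simp
  also have "... = b (ps * (h div ps)) k + b (h mod ps) k" by (rule zformD(2)[OF z])
  finally show ?thesis using r by simp
 qed
 show ?thesis using 1[of h "k mod ps"] 1[of k h] zformD(1)[OF z] by metis
qed

lemma sum_le_coeff_linear:
 fixes b :: "'a::field poly => 'a"
 assumes "!!p q. b (p + q) = b p + b q" and "!!c p. b (smult c p) = c * b p" and "degree p <= D"
 shows "b p = (\<Sum>i\<le>D. coeff p i * b (monom 1 i))"
proof -
 have "coeff p i = 0" if "Suc D <= i" for i by (rule coeff_eq_0) (use assms(3) that in simp)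
 thus ?thesis using linear_poly_sum[where F = b and d = "Suc D", OF assms(1,2)] by (simp add: lessThan_Suc_atMost)
qed

text \<open>A form with \<open>ps\<close> in its radical is determined by its values on monomials up
  to degree D, since both arguments may be reduced modulo \<open>ps\<close>. Conversely a solution
  defines a form on remainders, and the work lies in its shift invariance.\<close>

lemma card_zforms_over_toeplitz:
 fixes ps :: "'a::{field,finite} poly"
 assumes ps: "monic ps"
 shows "card (zforms_over ps) = card (toeplitz_solutions ps)"
proof -
 define D where "D = degree ps"
 define f where "f b k = (if k <= D then b 1 (monom 1 k) else 0)" for b :: "'a poly => 'a poly => 'a" and k
 have "bij_betw f (zforms_over ps) (toeplitz_solutions ps)"
  unfolding bij_betw_def
 proof (intro conjI)
  show "inj_on f (zforms_over ps)"
  proof (rule inj_onI)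
   fix b b' assume b: "b \<in> zforms_over ps" "b' \<in> zforms_over ps" and eq: "f b = f b'"
   have z: "zform b" "zform b'" using b by (auto simp: zforms_over_def)
   have m: "b (monom 1 i) (monom 1 j) = b' (monom 1 i) (monom 1 j)" if "i <= D" "j <= D" for i j
   proof -
    have "dst i j <= D" using that by (auto simp: dst_def)
    thus ?thesis using fun_cong[OF eq, of "dst i j"]
     unfolding zform_monoms[OF z(1)] zform_monoms[OF z(2)] by (simp add: f_def)
   qed
   have small: "b h k = b' h k" if "degree h <= D" "degree k <= D" for h k
   proof -
    have e: "b h k = (\<Sum>i\<le>D. coeff h i * (\<Sum>j\<le>D. coeff k j * b (monom 1 i) (monom 1 j)))" if "zform b" for b
    proof -
     have "b h k = (\<Sum>i\<le>D. coeff h i * b (monom 1 i) k)"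
      by (rule sum_le_coeff_linear[where b = "%h. b h k"]) (auto simp: zformD[OF that] \<open>degree h <= D\<close>)
     moreover have "b p k = (\<Sum>j\<le>D. coeff k j * b p (monom 1 j))" for p
      by (rule sum_le_coeff_linear[where b = "%k. b p k"]) (auto simp: zformD[OF that] \<open>degree k <= D\<close>)
     ultimately show ?thesis by simp
    qed
    show ?thesis unfolding e[OF z(1)] e[OF z(2)] using m by (intro sum.cong refl arg_cong2[where f = "(*)"]) auto
   qed
   have dm: "degree (h mod ps) <= D" for h
   proof -
    have "ps ~= 0" using ps by auto
    thus ?thesis using degree_mod_less[of ps h] unfolding D_def by auto
   qed
   have "b h k = b' h k" for h k
    using small[OF dm dm, of h k] zforms_over_nonzero_const[OF b(1), of h k] zforms_over_nonzero_const[OF b(2), of h k] by simp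
   thus "b = b'" by blast
  qed
  show "f ` zforms_over ps = toeplitz_solutions ps"
  proof (intro equalityI subsetI)
   fix c assume "c \<in> f ` zforms_over ps"
   then obtain b where b: "b \<in> zforms_over ps" and c: "c = f b" by auto
   have z: "zform b" and r: "!!s k. b (ps * s) k = 0" using b by (auto simp: zforms_over_def)
   have "(\<Sum>i\<le>D. coeff ps i * c (dst i m)) = 0" if "m <= D" for m
   proof -
    have "(\<Sum>i\<le>D. coeff ps i * c (dst i m)) = (\<Sum>i\<le>D. coeff ps i * b (monom 1 i) (monom 1 m))"
     using that by (intro sum.cong refl) (auto simp: c f_def zform_monoms[OF z] dst_def)
    also have "... = b ps (monom 1 m)"
     by (rule sum_le_coeff_linear[where b = "%h. b h (monom 1 m)", symmetric]) (auto simp: zformD[OF z] D_def)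
    finally show ?thesis using r[of 1] by simp
   qed
   thus "c \<in> toeplitz_solutions ps" unfolding toeplitz_solutions_def D_def[symmetric] by (auto simp: c f_def)
  next
   fix c assume "c \<in> toeplitz_solutions ps"
   hence c0: "!!k. k >= Suc D ==> c k = 0" and c: "!!m. m <= D ==> (\<Sum>i\<le>D. coeff ps i * c (dst i m)) = 0"
    unfolding toeplitz_solutions_def D_def by auto
   \<comment> \<open>\<open>b0\<close> uses coefficients up to index D inclusive, so
     \<open>ps\<close> itself is a legitimate argument and the Toeplitz system says that
     \<open>b0\<close> annihilates it.\<close>
   define b0 where "b0 h k = (\<Sum>i\<le>D. \<Sum>j\<le>D. coeff h i * coeff k j * c (dst i j))" for h k
   define b where "b h k = b0 (h mod ps) (k mod ps)" for h k
   have dsym: "dst i j = dst j i" for i j by (simp add: dst_def)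
   have sym: "b0 h k = b0 k h" for h k
   proof -
    have "b0 h k = (\<Sum>j\<le>D. \<Sum>i\<le>D. coeff h i * coeff k j * c (dst i j))" unfolding b0_def by (rule sum.swap)
    also have "... = b0 k h" unfolding b0_def by (intro sum.cong refl) (simp add: dsym mult_ac)
    finally show ?thesis .
   qed
   have add: "b0 (h + h') k = b0 h k + b0 h' k" for h h' k
    unfolding b0_def by (simp add: algebra_simps sum.distrib)
   have sm: "b0 (smult a h) k = a * b0 h k" for a h k
    unfolding b0_def by (simp add: sum_distrib_left mult_ac)
   have psi: "b0 ps k = 0" for k
   proof -
    have "b0 ps k = (\<Sum>j\<le>D. \<Sum>i\<le>D. coeff ps i * coeff k j * c (dst i j))" unfolding b0_def by (rule sum.swap)
    also have "... = (\<Sum>j\<le>D. coeff k j * (\<Sum>i\<le>D. coeff ps i * c (dst i j)))"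
     by (simp add: sum_distrib_left mult_ac)
    also have "... = 0" using c by simp
    finally show ?thesis .
   qed
   have nz: "ps ~= 0" using ps by auto
   have shift0: "b0 (pCons 0 r) (pCons 0 r') = b0 r r'" if "!!i. i >= D ==> coeff r i = 0" "!!i. i >= D ==> coeff r' i = 0" for r r'
   proof (cases D)
    case 0
    thus ?thesis using that by (simp add: b0_def)
   next
    case (Suc E)
    have dS: "dst (Suc i) (Suc j) = dst i j" for i j by (simp add: dst_def)
    have "b0 (pCons 0 r) (pCons 0 r') = (\<Sum>i\<le>E. \<Sum>j\<le>E. coeff r i * coeff r' j * c (dst i j))"
     unfolding b0_def Suc by (simp add: sum.atMost_Suc_shift dS del: sum.atMost_Suc)
    also have "... = b0 r r'" unfolding b0_def Suc using that Suc by simp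
    finally show ?thesis .
   qed
   have mb: "coeff (h mod ps) i = 0" if "i >= D" for h i
    using degree_mod_less[OF nz, of h] that unfolding D_def by (auto intro: coeff_eq_0)
   \<comment> \<open>Reducing z times a remainder costs one scalar multiple of \<open>ps\<close>,
     which \<open>b0\<close> does not see. Thus shift invariance on remainders, evident from
     distances, carries over to \<open>b\<close>.\<close>
   have mc: "\<exists>a. pCons 0 h mod ps = pCons 0 (h mod ps) - smult a ps" for h
   proof -
    have "pCons 0 h = [:0, 1:] * h" "pCons 0 (h mod ps) = [:0, 1:] * (h mod ps)" by simp_all
    moreover have "([:0, 1:] * (h mod ps)) mod ps = ([:0, 1:] * h) mod ps" by (rule mod_mult_right_eq)
    ultimately have m: "pCons 0 h mod ps = pCons 0 (h mod ps) mod ps" by (simp only:)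
    let ?r = "pCons 0 (h mod ps)" let ?a = "coeff ?r D"
    show ?thesis
    proof (cases "D = 0")
     case True
     hence "ps = 1" using monic_degree_0[OF ps] by (simp add: D_def)
     thus ?thesis by (intro exI[of _ 0]) simp
    next
     case False
     have "degree (?r - smult ?a ps) < D"
     proof (rule degree_lessI)
      show "\<forall>k\<ge>D. coeff (?r - smult ?a ps) k = 0"
      proof (intro allI impI)
       fix k assume k: "k >= D"
       show "coeff (?r - smult ?a ps) k = 0"
       proof (cases "k = D")
        case True
        thus ?thesis using ps D_def by simp
       next
        case False
        hence "coeff ps k = 0" using k D_def by (intro coeff_eq_0) simp
        moreover have "coeff ?r k = 0" using False k mb[of "k - 1" h] by (cases k) auto
        ultimately show ?thesis by simp
       qed
      qed
     qed (use False in simp)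
     hence "(?r - smult ?a ps) mod ps = ?r - smult ?a ps" unfolding D_def by (rule mod_poly_less)
     moreover have "(?r - smult ?a ps) mod ps = ?r mod ps" by (simp add: poly_mod_diff_left mod_smult_left)
     ultimately show ?thesis unfolding m by metis
    qed
   qed
   have sub: "b0 (h - smult a ps) k = b0 h k" for h a k
    using add[of "h - smult a ps" "smult a ps" k] sm[of a ps k] psi by simp
   have sub2: "b0 k (h - smult a ps) = b0 k h" for h a k using sub sym by metis
   have "zform b"
    unfolding zform_def
   proof (intro conjI allI)
    fix h k
    obtain a a' where a: "pCons 0 h mod ps = pCons 0 (h mod ps) - smult a ps" "pCons 0 k mod ps = pCons 0 (k mod ps) - smult a' ps"
     using mc by metis
    show "b (pCons 0 h) (pCons 0 k) = b h k" unfolding b_def a sub sub2 by (rule shift0) (auto intro: mb)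
    show "b h k = b k h" unfolding b_def by (rule sym)
    show "b (h + h') k = b h k + b h' k" for h' unfolding b_def poly_mod_add_left by (rule add)
    show "b (smult x h) k = x * b h k" for x unfolding b_def mod_smult_left by (rule sm)
   qed
   moreover have "b (ps * s) k = 0" for s k using sm[of 0 0 "k mod ps"] by (simp add: b_def)
   ultimately have "b \<in> zforms_over ps" by (auto simp: zforms_over_def)
   moreover have "f b = c"
   proof
    fix k
    show "f b k = c k"
    proof (cases "k <= D")
     case False
     thus ?thesis using c0[of k] by (simp add: f_def)
    next
     case True
     have one: "b0 1 h = (\<Sum>j\<le>D. coeff h j * c j)" for h
     proof -
      have "b0 1 h = (\<Sum>i\<le>D. if i = 0 then (\<Sum>j\<le>D. coeff h j * c j) else 0)"
       unfolding b0_def by (intro sum.cong refl) (auto simp: dst_def)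
      thus ?thesis by simp
     qed
     have mon: "b0 1 (monom 1 k) = c k" if "k <= D" for k
     proof -
      have "b0 1 (monom 1 k) = (\<Sum>j\<le>D. if j = k then c k else 0)" unfolding one by (intro sum.cong refl) auto
      thus ?thesis using that by simp
     qed
     show ?thesis
     proof (cases "D = 0")
      case True
      hence "ps = 1" using monic_degree_0[OF ps] by (simp add: D_def)
      moreover have "c 0 = 0" using c[of 0] True \<open>ps = 1\<close> by (simp add: dst_def)
      ultimately show ?thesis using True \<open>k <= D\<close> sm[of 0 0 0] by (simp add: f_def b_def)
     next
      case False
      hence m1: "1 mod ps = 1" using D_def by (intro mod_poly_less) simp
      have "b 1 (monom 1 k) = c k"
      proof (cases "k = D")
       case True
       have e: "monom 1 k mod ps = monom 1 k - smult 1 ps"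
        using monom_mod_degree[OF ps] False True D_def by simp
       show ?thesis unfolding b_def m1 e sub2 using mon True by simp
      next
       case False
       hence "monom 1 k mod ps = monom 1 k" using \<open>k <= D\<close> D_def by (intro monom_mod_small) simp
       thus ?thesis unfolding b_def m1 using mon \<open>k <= D\<close> by simp
      qed
      thus ?thesis using True by (simp add: f_def)
     qed
    qed
   qed
   ultimately show "c \<in> f ` zforms_over ps" by blast
  qed
 qed
 thus ?thesis by (rule bij_betw_same_card)
qed

text \<open>The dimension of the space of shift-invariant forms with a self-conjugate
  \<open>ps\<close> in the radical: half the degree, with the excess governed by the sign
  ps(0).\<close>

definition form_dim :: "'a::field poly => nat" where
 "form_dim ps = (if odd (degree ps) then (degree ps + 1) div 2
  else if coeff ps 0 = 1 then degree ps div 2 else degree ps div 2 + 1)"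

text \<open>A monic self-conjugate polynomial is palindromic up to a sign, and the sign is its
  constant term.\<close>

lemma self_conj_coeff:
 assumes "conj_poly ps = ps" and "monic ps" and "i <= degree ps"
 shows "coeff ps (degree ps - i) = coeff ps 0 * coeff ps i" "coeff ps 0 * coeff ps 0 = 1"
proof -
 have nz: "coeff ps 0 ~= 0"
 proof
  assume "coeff ps 0 = 0"
  hence "conj_poly ps = 0" by (simp add: conj_poly_def)
  thus False using assms by auto
 qed
 have *: "coeff ps 0 * coeff ps i = coeff ps (degree ps - i)" if "i <= degree ps" for i
 proof -
  have "coeff ps i = inverse (coeff ps 0) * coeff ps (degree ps - i)"
   using arg_cong[OF assms(1), of "%p. coeff p i"] that by (simp add: conj_poly_def coeff_reflect_poly)
  thus ?thesis using nz by (metis mult.assoc mult_1 right_inverse)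
 qed
 show "coeff ps (degree ps - i) = coeff ps 0 * coeff ps i" using *[OF assms(3)] by simp
 show "coeff ps 0 * coeff ps 0 = 1" using *[of 0] assms(2) by simp
qed

text \<open>By palindromy, equations m and D - m agree up to the sign \<epsilon>, so about half of
  them remain. Equation D - t for t >= s involves no entry beyond c_t and c_t with a nonzero
  coefficient, so it determines c_t from the earlier entries and leaves the first \<open>s\<close>
  entries free.\<close>

lemma card_toeplitz_solutions:
 fixes ps :: "'a::{field,finite} poly"
 assumes two: "(2::'a) ~= 0" and sc: "conj_poly ps = ps" and ps: "monic ps"
 shows "card (toeplitz_solutions ps) = CARD('a) ^ form_dim ps"
proof -
 define D where "D = degree ps"
 define \<epsilon> where "\<epsilon> = coeff ps 0"
 have ee: "\<epsilon> * \<epsilon> = 1" and sym: "!!i. i <= D ==> coeff ps (D - i) = \<epsilon> * coeff ps i"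
  using self_conj_coeff[OF sc ps] unfolding D_def \<epsilon>_def by auto
 have e1: "\<epsilon> = 1 \<or> \<epsilon> = -1" using ee by (metis square_eq_1_iff)
 have pm: "(1::'a) ~= -1" using two by (metis add_eq_0_iff one_add_one)
 define L where "L m c = (\<Sum>i\<le>D. coeff ps i * c (dst i m))" for m and c :: "nat => 'a"
 have dD: "dst (D - i) (D - m) = dst i m" if "i <= D" "m <= D" for i m
  using that by (simp add: dst_def)
 have Lsym: "L (D - m) c = \<epsilon> * L m c" if "m <= D" for m c
 proof -
  have "L (D - m) c = (\<Sum>i\<le>D. coeff ps (D - i) * c (dst (D - i) (D - m)))"
   unfolding L_def by (rule sum.nat_diff_reindex[of "%i. coeff ps i * c (dst i (D - m))" "Suc D", simplified lessThan_Suc_atMost, symmetric, simplified])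
  also have "... = (\<Sum>i\<le>D. \<epsilon> * (coeff ps i * c (dst i m)))"
   by (intro sum.cong refl) (use that in "auto simp: sym dD")
  finally show ?thesis by (simp add: L_def sum_distrib_left)
 qed
 show ?thesis
 proof (cases "D = 0")
  case True
  hence "ps = 1" using monic_degree_0[OF ps] by (simp add: D_def)
  hence "toeplitz_solutions ps = {%_. 0}"
   unfolding toeplitz_solutions_def
   by (intro Set.set_eqI) (auto simp: dst_def fun_eq_iff Suc_le_eq, metis gr0I)
  thus ?thesis using \<open>ps = 1\<close> by (simp add: form_dim_def)
 next
  case D0: False
  define s where "s = form_dim ps"
  have s: "s <= Suc D" "D <= 2 * s" "2 * s <= D + 2" "\<epsilon> = 1 ==> even D ==> 2 * s = D" "\<epsilon> ~= 1 ==> D < 2 * s"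
   unfolding s_def form_dim_def D_def[symmetric] \<epsilon>_def[symmetric] by (auto elim!: evenE oddE)
  \<comment> \<open>The coefficient of c_t in equation D - t. The index i = D always contributes the
    leading coefficient 1; if 2 t = D, the index i = 0 has the same distance and contributes
    \<epsilon>.\<close>
  define a where "a t = (if 2 * t = D then 1 + \<epsilon> else (1::'a))" for t
  have a: "a t ~= 0" if "s <= t" for t
  proof (cases "2 * t = D")
   case True
   hence "2 * s = D" using that s(2) by simp
   hence "\<epsilon> = 1" using s(5) by fastforce
   thus ?thesis using two unfolding a_def by (simp add: True)
  qed (simp add: a_def)
  have Lt: "L (D - t) (c(t := x)) = a t * x + L (D - t) (c(t := 0))" if "s <= t" "t <= D" for t c x
  proof -
   have "coeff ps i * (c(t := x)) (dst i (D - t)) = (if i = D then x else 0) + (if i = 0 & 2 * t = D then \<epsilon> * x else 0)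
     + coeff ps i * (c(t := 0)) (dst i (D - t))" if "i <= D" for i
   proof -
    have "dst i (D - t) = t \<longleftrightarrow> i = D \<or> (i = 0 & 2 * t = D)"
     using \<open>t <= D\<close> \<open>i <= D\<close> \<open>s <= t\<close> s(2) by (auto simp: dst_def)
    moreover have "coeff ps D = 1" using ps D_def by simp
    ultimately show ?thesis using D0 by (auto simp: \<epsilon>_def)
   qed
   hence "L (D - t) (c(t := x)) = (\<Sum>i\<le>D. (if i = D then x else 0) + (if i = 0 & 2 * t = D then \<epsilon> * x else 0)
     + coeff ps i * (c(t := 0)) (dst i (D - t)))"
    unfolding L_def by (intro sum.cong refl) auto
   also have "... = x + (if 2 * t = D then \<epsilon> * x else 0) + L (D - t) (c(t := 0))"
   proof -
    have "(\<Sum>i\<le>D. if i = 0 & 2 * t = D then \<epsilon> * x else 0) = (if 2 * t = D then \<epsilon> * x else 0)"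
     by (cases "2 * t = D") auto
    thus ?thesis by (simp add: sum.distrib L_def)
   qed
   also have "x + (if 2 * t = D then \<epsilon> * x else 0) = a t * x" by (simp add: a_def distrib_right)
   finally show ?thesis .
  qed
  define Q where "Q t c \<longleftrightarrow> (s <= t & t <= D \<longrightarrow> L (D - t) c = 0)" for t c
  have "card {c. (\<forall>k\<ge>Suc D. c k = 0) & (\<forall>t. s <= t & t < Suc D \<longrightarrow> Q t c)} = CARD('a) ^ min (Suc D) s"
  proof (rule card_triangular)
   fix t and c c' :: "nat => 'a" assume eq: "!!k. k <= t ==> c k = c' k"
   have "L (D - t) c = L (D - t) c'" if "s <= t" "t <= D"
    unfolding L_def
   proof (intro sum.cong refl arg_cong2[where f = "(*)"] eq)
    fix i assume "i \<in> {..D}"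
    thus "dst i (D - t) <= t" using that s(2) by (auto simp: dst_def)
   qed
   thus "Q t c = Q t c'" by (auto simp: Q_def)
  next
   fix t and c :: "nat => 'a" assume t: "s <= t" "t < Suc D"
   have "Q t (c(t := x)) \<longleftrightarrow> x = - L (D - t) (c(t := 0)) / a t" for x
    proof -
    have "Q t (c(t := x)) \<longleftrightarrow> a t * x + L (D - t) (c(t := 0)) = 0"
     using t Lt[of t c x] unfolding Q_def by simp
    also have "... \<longleftrightarrow> a t * x = - L (D - t) (c(t := 0))" by (rule eq_neg_iff_add_eq_0[symmetric])
    finally show ?thesis using a[OF t(1)] by (metis nonzero_mult_div_cancel_left nonzero_divide_eq_eq mult.commute)
   qed
   thus "\<exists>!x. Q t (c(t := x))" by simp
  qed
  moreover have "{c. (\<forall>k\<ge>Suc D. c k = 0) & (\<forall>t. s <= t & t < Suc D \<longrightarrow> Q t c)} = toeplitz_solutions ps"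
  proof (intro equalityI subsetI)
   fix c assume "c \<in> toeplitz_solutions ps"
   thus "c \<in> {c. (\<forall>k\<ge>Suc D. c k = 0) & (\<forall>t. s <= t & t < Suc D \<longrightarrow> Q t c)}"
    unfolding toeplitz_solutions_def Q_def L_def D_def by auto
  next
   fix c assume c: "c \<in> {c. (\<forall>k\<ge>Suc D. c k = 0) & (\<forall>t. s <= t & t < Suc D \<longrightarrow> Q t c)}"
   hence z: "L (D - t) c = 0" if "s <= t" "t <= D" for t using that by (auto simp: Q_def)
   have "L m c = 0" if m: "m <= D" for m
   proof -
    consider "s <= D - m" | "s <= m" | "D - m < s" "m < s" by linarith
    thus ?thesis
    proof cases
     case 1
     thus ?thesis using z[of "D - m"] m by simp
    next
     case 2
     thus ?thesis using z[of m] Lsym[of "D - m" c] m by simp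
    next
     case 3
     \<comment> \<open>Only the middle equation can be missed by both halves. In that case
       \<epsilon> = -1, and the equation says that an expression equal to its own negative vanishes,
       which is automatic; hence the extra free entry.\<close>
     hence "D = 2 * m" "2 * s ~= D" using s(3) m by auto
     hence "\<epsilon> = -1" using s(4) e1 by auto
     hence "L m c = - L m c" using Lsym[OF m, of c] \<open>D = 2 * m\<close> by simp
     hence "2 * L m c = 0" by (metis add.right_inverse mult_2)
     thus ?thesis using two by simp
    qed
   qed
   thus "c \<in> toeplitz_solutions ps" using c unfolding toeplitz_solutions_def L_def D_def by auto
  qed
  ultimately show ?thesis using s(1) by (simp add: min_absorb2 s_def)
 qed
qed

theorem card_zforms_over:
 fixes ps :: "'a::{field,finite} poly"
 assumes "(2::'a) ~= 0" and "conj_poly ps = ps" and "monic ps"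
 shows "card (zforms_over ps) = CARD('a) ^ form_dim ps"
 unfolding card_zforms_over_toeplitz[OF assms(3)] by (rule card_toeplitz_solutions[OF assms])

text \<open>Moving \<open>ch\<close> across the form by shift invariance turns it into its
  reflection: b(ch h, z^D) = b(h, reflected ch) with D the degree of \<open>ch\<close>. So the
  reflection lies in the radical, and equal degrees leave no room but a scalar.\<close>

lemma nforms_self_conj:
 fixes ch :: "'a::field poly"
 assumes b: "b \<in> nforms ch" and ch: "monic ch" "coeff ch 0 ~= 0"
 shows "conj_poly ch = ch"
proof -
 define D where "D = degree ch"
 note z = nformsD(1)[OF b]
 have "b h (reflect_poly ch) = 0" for h
 proof -
  have "b (ch * h) (monom 1 D) = (\<Sum>i\<le>D. coeff ch i * b (monom 1 i * h) (monom 1 D))"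
   by (rule sum_le_coeff_linear[where b = "%p. b (p * h) (monom 1 D)"])
    (auto simp: zformD[OF z] D_def distrib_right)
  also have "... = (\<Sum>i\<le>D. coeff ch i * b h (monom 1 (D - i)))"
  proof (intro sum.cong refl arg_cong2[where f = "(*)"])
   fix i assume "i \<in> {..D}"
   thus "b (monom 1 i * h) (monom 1 D) = b h (monom 1 (D - i))"
    using zform_monom[OF z, of i h "monom 1 (D - i)"] by (simp add: mult_monom)
  qed
  also have "... = (\<Sum>i\<le>D. coeff ch (D - i) * b h (monom 1 i))"
   by (rule sum.reindex_bij_witness[of _ "%i. D - i" "%i. D - i"]) auto
  also have "... = (\<Sum>i\<le>D. coeff (reflect_poly ch) i * b h (monom 1 i))"
   by (intro sum.cong refl) (auto simp: coeff_reflect_poly D_def)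
  also have "... = b h (reflect_poly ch)"
   by (rule sum_le_coeff_linear[where b = "%p. b h p", symmetric]) (use ch in "auto simp: zformD[OF z] D_def")
  finally show ?thesis using nformsD(3)[OF b, of "ch * h"] by simp
 qed
 hence "ch dvd reflect_poly ch" using nformsD(2)[OF b, of "reflect_poly ch"] zformD(1)[OF z] by metis
 hence d: "ch dvd conj_poly ch" unfolding conj_poly_def by (rule dvd_smult)
 have m: "monic (conj_poly ch)" and deg: "degree (conj_poly ch) = degree ch"
  using monic_conj_poly degree_conj_poly ch(2) by auto
 obtain s where s: "conj_poly ch = ch * s" using d by (elim dvdE)
 have ms: "monic s" using m s ch(1) by (simp add: lead_coeff_mult)
 have "ch ~= 0" "s ~= 0" using ch(1) ms by auto
 hence "degree s = 0" using deg s by (simp add: degree_mult_eq)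
 hence "s = 1" using ms monic_degree_0 by blast
 thus ?thesis using s by simp
qed

text \<open>A form with \<open>ps\<close> in its radical has a radical generated by one monic
  divisor of \<open>ps\<close>; sorting by this divisor turns the dimension count into a
  sum.\<close>

theorem sum_card_nforms:
 fixes ps :: "'a::{field,finite} poly"
 assumes "(2::'a) ~= 0" and "conj_poly ps = ps" and ps: "monic ps"
 shows "(\<Sum>ch | monic ch & ch dvd ps. card (nforms ch)) = CARD('a) ^ form_dim ps"
proof -
 have c0: "coeff ps 0 ~= 0" using self_conj_coeff(2)[OF assms(2,3), of 0] by auto
 have nz: "ps ~= 0" using ps by auto
 have "zforms_over ps = (\<Union>ch\<in>{ch. monic ch & ch dvd ps}. nforms ch)"
 proof (intro equalityI subsetI)
  fix b assume "b \<in> zforms_over ps"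
  hence "zform b" "!!s k. b (ps * s) k = 0" by (auto simp: zforms_over_def)
  then obtain ch where "monic ch" "b \<in> nforms ch" "ch dvd ps" using zform_radical_generator[OF _ c0] by blast
  thus "b \<in> (\<Union>ch\<in>{ch. monic ch & ch dvd ps}. nforms ch)" by blast
 next
  fix b assume "b \<in> (\<Union>ch\<in>{ch. monic ch & ch dvd ps}. nforms ch)"
  then obtain ch where b: "b \<in> nforms ch" "ch dvd ps" by auto
  have "b (ps * s) k = 0" for s k by (rule nformsD(3)[OF b(1)]) (use b(2) in simp)
  thus "b \<in> zforms_over ps" using nformsD(1)[OF b(1)] by (auto simp: zforms_over_def)
 qed
 also have "card ... = (\<Sum>ch | monic ch & ch dvd ps. card (nforms ch))"
 proof (rule card_UN_disjoint)
  show "finite {ch. monic ch & ch dvd ps}"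
   by (rule finite_subset[OF _ finite_bounded_degree[of "degree ps"]]) (use nz in "auto intro: dvd_imp_degree_le")
  show "\<forall>ch\<in>{ch. monic ch & ch dvd ps}. finite (nforms ch)"
   by (auto intro!: finite_nforms)
  show "\<forall>ch\<in>{ch. monic ch & ch dvd ps}. \<forall>ch'\<in>{ch. monic ch & ch dvd ps}. ch ~= ch' \<longrightarrow> nforms ch \<inter> nforms ch' = {}"
  proof (intro ballI impI)
   fix ch ch' assume c: "ch \<in> {ch. monic ch & ch dvd ps}" "ch' \<in> {ch. monic ch & ch dvd ps}" "ch ~= ch'"
   show "nforms ch \<inter> nforms ch' = {}"
   proof (rule ccontr)
    assume "nforms ch \<inter> nforms ch' ~= {}"
    then obtain b where "b \<in> nforms ch" "b \<in> nforms ch'" by auto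
    hence "ch dvd h \<longleftrightarrow> ch' dvd h" for h using nformsD(2) by metis
    from this[of ch] this[of "ch'"] have "ch dvd ch'" "ch' dvd ch" by simp_all
    hence "ch = ch'" by (intro poly_dvd_antisym) (use c in auto)
    thus False using c(3) by simp
   qed
  qed
 qed
 finally show ?thesis using card_zforms_over[OF assms] by simp
qed

section \<open>Coprime and self-conjugate polynomials\<close>

definition bez :: "'a::field poly => 'a poly => bool" where
 "bez p q \<longleftrightarrow> (\<exists>u v. u * p + v * q = 1)"

lemma bez_sym: "bez p q ==> bez q p"
 unfolding bez_def by (metis add.commute)

lemma bez_dvd_mult:
 assumes "bez p q" and "p dvd q * r"
 shows "p dvd r"
proof -
 obtain u v where uv: "u * p + v * q = 1" using assms(1) by (auto simp: bez_def)
 have "r = (u * p + v * q) * r" unfolding uv by simp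
 also have "... = p * (u * r) + v * (q * r)" by (simp add: algebra_simps)
 finally have e: "r = p * (u * r) + v * (q * r)" .
 show ?thesis by (subst e, rule dvd_add) (use assms(2) in auto)
qed

lemma bez_divisors:
 assumes "bez p q" and "p' dvd p" and "q' dvd q"
 shows "bez p' q'"
proof -
 obtain u v where uv: "u * p + v * q = 1" using assms(1) by (auto simp: bez_def)
 obtain s t where st: "p = p' * s" "q = q' * t" using assms(2,3) by (auto elim!: dvdE)
 have "(u * s) * p' + (v * t) * q' = 1" using uv by (simp add: st algebra_simps)
 thus ?thesis unfolding bez_def by blast
qed

lemma bez_mult:
 assumes "bez p q" and "bez p r"
 shows "bez p (q * r)"
proof -
 obtain u v u' v' where uv: "u * p + v * q = 1" "u' * p + v' * r = 1" using assms by (auto simp: bez_def)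
 have "(u + v * q * u') * p + (v * v') * (q * r) = u * p + v * q * (u' * p + v' * r)"
  by (simp add: algebra_simps)
 also have "... = 1" unfolding uv by (simp add: uv)
 finally show ?thesis unfolding bez_def by blast
qed

lemma bez_one: "bez p 1"
 unfolding bez_def by (intro exI[of _ 0] exI[of _ 1]) simp

lemma bez_power: "bez p q ==> bez p (q ^ k)"
 by (induction k) (auto intro: bez_one bez_mult)

lemma bez_prod: "finite S ==> (!!i. i \<in> S ==> bez p (h i)) ==> bez p (\<Prod>i\<in>S. h i)"
 by (induction S rule: finite_induct) (auto intro: bez_one bez_mult)

lemma bez_irreducible:
 fixes p q :: "'a::field poly"
 assumes p: "monic p" "irreducible p" and "\<not> p dvd q"
 shows "bez p q"
proof -
 define J where "J = {u * p + v * q |u v. True}"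
 have "p \<in> J" unfolding J_def by (intro CollectI exI[of _ 1] exI[of _ 0]) simp
 have "q \<in> J" unfolding J_def by (intro CollectI exI[of _ 0] exI[of _ 1]) simp
 have a: "x + y \<in> J" if xy: "x \<in> J" "y \<in> J" for x y
 proof -
  obtain u v u' v' where "x = u * p + v * q" "y = u' * p + v' * q" using xy by (auto simp: J_def)
  hence "x + y = (u + u') * p + (v + v') * q" by (simp add: algebra_simps)
  thus ?thesis unfolding J_def by blast
 qed
 have m: "c * y \<in> J" if y: "y \<in> J" for c y
 proof -
  obtain u v where "y = u * p + v * q" using y by (auto simp: J_def)
  hence "c * y = (c * u) * p + (c * v) * q" by (simp add: algebra_simps)
  thus ?thesis unfolding J_def by blast
 qed
 have "p ~= 0" using p by auto
 obtain g where g: "monic g" "!!x. x \<in> J \<longleftrightarrow> g dvd x"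
  using poly_ideal_generator[of J p] a m \<open>p \<in> J\<close> \<open>p ~= 0\<close> by metis
 have gp: "g dvd p" and gq: "g dvd q" using g(2) \<open>p \<in> J\<close> \<open>q \<in> J\<close> by auto
 have "g dvd 1"
 proof (rule ccontr)
  assume ng: "\<not> g dvd 1"
  obtain s where s: "p = g * s" using gp by (elim dvdE)
  hence "s dvd 1" using irreducibleD[OF p(2) s] ng by auto
  hence "p dvd g" unfolding s by (metis dvd_mult_unit_iff dvd_refl mult.commute)
  thus False using gq assms(3) dvd_trans by blast
 qed
 hence "1 \<in> J" using g(2) by simp
 thus ?thesis by (auto simp: J_def bez_def)
qed

lemma monic_dvd_antisym:
 fixes p q :: "'a::field poly"
 shows "monic p ==> monic q ==> p dvd q ==> q dvd p ==> p = q"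
 by (rule poly_dvd_antisym) auto

lemma monic_cofactor:
 fixes p q :: "'a::field poly"
 shows "monic (p * q) ==> monic p ==> monic q"
 by (simp add: lead_coeff_mult)

text \<open>The first part is the monic generator g of the ideal of \<open>d\<close> and
  \<open>p\<close>, that is, their greatest common divisor. The cofactor of \<open>d\<close> is
  coprime to p / g and therefore divides \<open>q\<close>.\<close>

lemma bez_split_divisor:
 fixes p q d :: "'a::field poly"
 assumes pq: "bez p q" and m: "monic p" "monic q" "monic d" and d: "d dvd p * q"
 obtains d1 d2 where "monic d1" "monic d2" "d1 dvd p" "d2 dvd q" "d = d1 * d2"
proof -
 define J where "J = {u * d + v * p |u v. True}"
 have a: "x + y \<in> J" if xy: "x \<in> J" "y \<in> J" for x y
 proof -
  obtain u v u' v' where "x = u * d + v * p" "y = u' * d + v' * p" using xy by (auto simp: J_def)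
  hence "x + y = (u + u') * d + (v + v') * p" by (simp add: algebra_simps)
  thus ?thesis unfolding J_def by blast
 qed
 have mu: "c * y \<in> J" if y: "y \<in> J" for c y
 proof -
  obtain u v where "y = u * d + v * p" using y by (auto simp: J_def)
  hence "c * y = (c * u) * d + (c * v) * p" by (simp add: algebra_simps)
  thus ?thesis unfolding J_def by blast
 qed
 have dJ: "d \<in> J" unfolding J_def by (intro CollectI exI[of _ 1] exI[of _ 0]) simp
 have pJ: "p \<in> J" unfolding J_def by (intro CollectI exI[of _ 0] exI[of _ 1]) simp
 have "p ~= 0" using m by auto
 obtain g where g: "monic g" "!!x. x \<in> J \<longleftrightarrow> g dvd x"
  using poly_ideal_generator[of J p] a mu pJ \<open>p ~= 0\<close> by metis
 have gnz: "g ~= 0" using g(1) by auto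
 obtain d2 where d2: "d = g * d2" using g(2)[of d] dJ unfolding dvd_def by auto
 obtain p' where p': "p = g * p'" using g(2)[of p] pJ unfolding dvd_def by auto
 obtain u v where "g = u * d + v * p" using g(2)[of g] by (auto simp: J_def)
 hence "g * 1 = g * (u * d2 + v * p')" unfolding d2 p' by (simp add: algebra_simps)
 hence "bez d2 p'" using gnz unfolding bez_def by (metis mult_left_cancel)
 moreover have "d2 dvd p' * q" using d gnz unfolding d2 p' by (simp add: mult.assoc)
 ultimately have "d2 dvd q" by (rule bez_dvd_mult)
 moreover have "monic d2" using m(3) g(1) unfolding d2 by (rule monic_cofactor)
 ultimately show thesis using that[of g d2] g(1) p' d2 by simp
qed

lemma bez_factor_unique:
 fixes p q :: "'a::field poly"
 assumes pq: "bez p q" and m: "monic a" "monic b" "monic c" "monic d"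
  and dv: "a dvd p" "c dvd p" "b dvd q" "d dvd q" and eq: "a * b = c * d"
 shows "a = c & b = d"
proof -
 have "a dvd d * c" using eq by (metis dvd_triv_left mult.commute)
 hence 1: "a dvd c" by (rule bez_dvd_mult[OF bez_divisors[OF pq dv(1,4)]])
 have "c dvd b * a" using eq by (metis dvd_triv_left mult.commute)
 hence 2: "c dvd a" by (rule bez_dvd_mult[OF bez_divisors[OF pq dv(2,3)]])
 have "a = c" using m 1 2 by (intro monic_dvd_antisym)
 moreover have "a ~= 0" using m by auto
 ultimately show ?thesis using eq by simp
qed

lemma coeff_0_dvd: 
 fixes p q :: "'a::field poly"
 shows "p dvd q ==> coeff q 0 ~= 0 ==> coeff p 0 ~= 0"
 by (auto elim!: dvdE simp: coeff_mult)

lemma conj_poly_mult: "conj_poly (p * q) = conj_poly p * conj_poly q"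
 by (simp add: conj_poly_def reflect_poly_mult coeff_mult mult.commute)

lemma conj_poly_one [simp]: "conj_poly 1 = 1"
 by (simp add: conj_poly_def)

lemma conj_poly_power: "conj_poly (p ^ k) = conj_poly p ^ k"
 by (induction k) (simp_all add: conj_poly_mult)

lemma conj_poly_conj_poly:
 fixes p :: "'a::field poly"
 shows "monic p ==> coeff p 0 ~= 0 ==> conj_poly (conj_poly p) = p"
 by (simp add: conj_poly_def reflect_poly_smult coeff_reflect_poly)

lemma conj_poly_dvd: "p dvd q ==> conj_poly p dvd conj_poly q"
 by (auto elim!: dvdE simp: conj_poly_mult)

lemma conj_poly_eq_self_nonzero: "conj_poly p = p ==> monic p ==> coeff p 0 ~= 0"
 using self_conj_coeff(2)[of p 0] by auto

lemma conj_poly_cofactor: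
 fixes p q :: "'a::field poly"
 assumes "conj_poly (p * q) = p * q" "conj_poly p = p" "p ~= 0"
 shows "conj_poly q = q"
 using assms by (simp add: conj_poly_mult)

lemma conj_poly_norm:
 fixes p :: "'a::field poly"
 assumes "monic p" "coeff p 0 ~= 0"
 shows "conj_poly (p * conj_poly p) = p * conj_poly p"
 using assms by (simp add: conj_poly_mult conj_poly_conj_poly mult.commute)

text \<open>Conjugation maps divisors of \<open>p\<close> to divisors of \<open>p\<close> and
  likewise for \<open>q\<close>, so uniqueness of the splitting applies to the conjugated
  factors.\<close>

lemma self_conj_split:
 fixes p q :: "'a::field poly"
 assumes pq: "bez p q" and sc: "conj_poly p = p" "conj_poly q = q"
  and m: "monic p" "monic q" "monic a" "monic b" and dv: "a dvd p" "b dvd q"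
  and ab: "conj_poly (a * b) = a * b"
 shows "conj_poly a = a & conj_poly b = b"
proof (rule bez_factor_unique[OF pq])
 have "coeff a 0 ~= 0" "coeff b 0 ~= 0"
  using coeff_0_dvd dv conj_poly_eq_self_nonzero sc m by blast+
 thus "monic (conj_poly a)" "monic (conj_poly b)" by (auto intro: monic_conj_poly)
 show "conj_poly a dvd p" "conj_poly b dvd q" using dv sc conj_poly_dvd by metis+
qed (use assms in "auto simp: conj_poly_mult")

text \<open>At 1 and -1 reflection does not move the argument. Hence a constant term other than 1
  forces the root 1, and one other than (-1)^deg forces the root -1.\<close>

lemma self_conj_poly_pm1:
 fixes p :: "'a::field poly"
 assumes "conj_poly p = p" "monic p"
 shows "coeff p 0 * poly p 1 = poly p 1" "coeff p 0 * poly p (-1) = (-1) ^ degree p * poly p (-1)"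
proof -
 have nz: "coeff p 0 ~= 0" using conj_poly_eq_self_nonzero assms by blast
 have r: "reflect_poly p = smult (coeff p 0) p" using assms nz by (simp add: conj_poly_def) (metis mult.commute right_inverse smult_1_left smult_smult)
 have "poly (reflect_poly p) 1 = poly p 1" using poly_reflect_poly_nz[of 1 p] by simp
 thus "coeff p 0 * poly p 1 = poly p 1" unfolding r by simp
 have "inverse (-1::'a) = -1" by simp
 hence "poly (reflect_poly p) (-1) = (-1) ^ degree p * poly p (-1)" using poly_reflect_poly_nz[of "-1" p] by simp
 thus "coeff p 0 * poly p (-1) = (-1) ^ degree p * poly p (-1)" unfolding r by simp
qed

lemma bez_common_root: "bez p q ==> poly p x = 0 ==> poly q x ~= 0"
proof
 assume "bez p q" and z: "poly p x = 0" "poly q x = 0"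
 then obtain u v where "u * p + v * q = 1" by (auto simp: bez_def)
 hence "poly (u * p + v * q) x = poly 1 x" by simp
 thus False using z by simp
qed

text \<open>The case distinction becomes two independent defects, of which the first can occur only
  at the root 1 and the second only at the root -1.\<close>

lemma form_dim_double:
 fixes p :: "'a::field poly"
 assumes "(2::'a) ~= 0" "conj_poly p = p" "monic p"
 shows "2 * form_dim p = degree p + (if coeff p 0 = 1 then 0 else 1)
  + (if coeff p 0 = (-1) ^ degree p then 0 else 1)"
proof -
 have "coeff p 0 = 1 \<or> coeff p 0 = -1" using self_conj_coeff(2)[OF assms(2,3), of 0] by (metis square_eq_1_iff zero_le)
 moreover have "(1::'a) ~= -1" "(-1::'a) ~= 1" using assms(1) by (metis add_eq_0_iff one_add_one)+
 ultimately show ?thesis by (auto simp: form_dim_def elim!: evenE oddE)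
qed

text \<open>Coprime polynomials share neither the root 1 nor the root -1, so each defect occurs in
  at most one factor and the defects add like the degrees.\<close>

lemma form_dim_mult:
 fixes p q :: "'a::field poly"
 assumes two: "(2::'a) ~= 0" and p: "conj_poly p = p" "monic p" and q: "conj_poly q = q" "monic q"
  and pq: "bez p q"
 shows "form_dim (p * q) = form_dim p + form_dim q"
proof -
 let ?d = "coeff p 0" and ?e = "coeff q 0"
 have pm: "(1::'a) ~= -1" "(-1::'a) ~= 1" using two by (metis add_eq_0_iff one_add_one)+
 have d: "?d = 1 \<or> ?d = -1" using self_conj_coeff(2)[OF p, of 0] by (metis square_eq_1_iff zero_le)
 have e: "?e = 1 \<or> ?e = -1" using self_conj_coeff(2)[OF q, of 0] by (metis square_eq_1_iff zero_le)
 have 1: "?d = 1 \<or> ?e = 1"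
  using self_conj_poly_pm1(1)[OF p] self_conj_poly_pm1(1)[OF q] bez_common_root[OF pq, of 1] by auto
 have 2: "?d = (-1) ^ degree p \<or> ?e = (-1) ^ degree q"
  using self_conj_poly_pm1(2)[OF p] self_conj_poly_pm1(2)[OF q] bez_common_root[OF pq, of "-1"] by auto
 have nz: "p ~= 0" "q ~= 0" using p q by auto
 have deg: "degree (p * q) = degree p + degree q" using nz by (rule degree_mult_eq)
 have c: "coeff (p * q) 0 = ?d * ?e" by (simp add: coeff_mult)
 have sc: "conj_poly (p * q) = p * q" using p q by (simp add: conj_poly_mult)
 have m: "monic (p * q)" using p q by (simp add: lead_coeff_mult)
 have "2 * form_dim (p * q) = 2 * form_dim p + 2 * form_dim q"
  unfolding form_dim_double[OF two sc m] form_dim_double[OF two p] form_dim_double[OF two q] deg c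
  using d e 1 2 pm by (cases "even (degree p)"; cases "even (degree q)") auto
 thus ?thesis by simp
qed

section \<open>Multiplicativity of the form counts and of the mass\<close>

definition divisors :: "'a::field poly => 'a poly set" where
 "divisors p = {d. monic d & d dvd p}"

lemma finite_divisors:
 fixes p :: "'a::{field,finite} poly"
 shows "p ~= 0 ==> finite (divisors p)"
 unfolding divisors_def
 by (rule finite_subset[OF _ finite_bounded_degree[of "degree p"]]) (auto intro: dvd_imp_degree_le)

lemma monic_proper_dvd_degree:
 fixes p q :: "'a::field poly"
 assumes "monic p" "monic q" "p dvd q" "p ~= q"
 shows "degree p < degree q"
proof -
 obtain s where s: "q = p * s" using assms(3) unfolding dvd_def by auto
 hence ms: "monic s" using assms(1,2) monic_cofactor by blast
 have "s ~= 1" using assms(4) s by auto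
 hence "degree s > 0" using monic_degree_0[OF ms] by simp
 moreover have "degree q = degree p + degree s" unfolding s by (rule degree_mult_eq) (use assms(1) ms in auto)
 ultimately show ?thesis by simp
qed

lemma bij_betw_divisors:
 fixes p q :: "'a::field poly"
 assumes pq: "bez p q" and m: "monic p" "monic q"
 shows "bij_betw (%(a, b). a * b) (divisors p \<times> divisors q) (divisors (p * q))"
 unfolding bij_betw_def
proof (intro conjI equalityI subsetI)
 show "inj_on (%(a, b). a * b) (divisors p \<times> divisors q)"
 proof (rule inj_onI)
  fix x y assume xy: "x \<in> divisors p \<times> divisors q" "y \<in> divisors p \<times> divisors q"
   and eq: "(%(a, b). a * b) x = (%(a, b). a * b) y"
  obtain a b c d where e: "x = (a, b)" "y = (c, d)" by (cases x, cases y)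
  have "a = c & b = d" by (rule bez_factor_unique[OF pq]) (use xy eq in "auto simp: divisors_def e")
  thus "x = y" by (simp add: e)
 qed
next
 fix d assume "d \<in> (%(a, b). a * b) ` (divisors p \<times> divisors q)"
 thus "d \<in> divisors (p * q)" by (auto simp: divisors_def lead_coeff_mult intro: mult_dvd_mono)
next
 fix d assume "d \<in> divisors (p * q)"
 hence "monic d" "d dvd p * q" by (auto simp: divisors_def)
 then obtain a b where "monic a" "monic b" "a dvd p" "b dvd q" "d = a * b"
  using bez_split_divisor[OF pq m] by metis
 thus "d \<in> (%(a, b). a * b) ` (divisors p \<times> divisors q)" by (force simp: divisors_def)
qed

lemma card_nforms_not_self_conj:
 fixes ch :: "'a::field poly"
 shows "monic ch ==> coeff ch 0 ~= 0 ==> conj_poly ch ~= ch ==> card (nforms ch) = 0"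
 using nforms_self_conj[of _ ch] by (cases "nforms ch = {}") auto

lemma card_nforms_mult_aux:
 fixes p q a b :: "'a::{field,finite} poly"
 assumes pq: "bez p q" and p: "conj_poly p = p" "monic p" and q: "conj_poly q = q" "monic q"
  and a: "a \<in> divisors p" and b: "b \<in> divisors q"
  and self: "conj_poly a = a ==> conj_poly b = b ==> card (nforms (a * b)) = card (nforms a) * card (nforms b)"
 shows "card (nforms (a * b)) = card (nforms a) * card (nforms b)"
proof (cases "conj_poly a = a & conj_poly b = b")
 case False
 have ab: "monic a" "monic b" "a dvd p" "b dvd q" using a b by (auto simp: divisors_def)
 have nz: "coeff a 0 ~= 0" "coeff b 0 ~= 0"
  using coeff_0_dvd ab conj_poly_eq_self_nonzero p q by blast+
 have nsc: "conj_poly (a * b) ~= a * b"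
  using self_conj_split[OF pq p(1) q(1) p(2) q(2) ab] False by argo
 hence "card (nforms (a * b)) = 0"
  by (intro card_nforms_not_self_conj[OF _ _ nsc]) (use ab nz in "auto simp: lead_coeff_mult coeff_mult_0")
 moreover have "card (nforms a) = 0 \<or> card (nforms b) = 0"
  using False card_nforms_not_self_conj[OF ab(1) nz(1)] card_nforms_not_self_conj[OF ab(2) nz(2)] by argo
 ultimately show ?thesis by auto
qed (use self in blast)

text \<open>By additivity of \<open>form_dim\<close>, the sums over all divisors of p q and over
  pairs of divisors agree. By induction on the degree all terms except the top one agree, so the top
  ones do too.\<close>

lemma card_nforms_mult:
 fixes p q :: "'a::{field,finite} poly"
 assumes two: "(2::'a) ~= 0" and "bez p q" "conj_poly p = p" "monic p" "conj_poly q = q" "monic q"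
 shows "card (nforms (p * q)) = card (nforms p) * card (nforms q)"
 using assms(2-)
proof (induction "degree (p * q)" arbitrary: p q rule: less_induct)
 case less
 note pq = less.prems(1) and p = less.prems(2,3) and q = less.prems(4,5)
 let ?S = "divisors p \<times> divisors q"
 let ?G = "%(a, b). card (nforms (a * b :: 'a poly))" and ?H = "%(a, b). card (nforms (a :: 'a poly)) * card (nforms (b :: 'a poly))"
 have nz: "p ~= 0" "q ~= 0" using p q by auto
 have fin: "finite ?S" using finite_divisors nz by blast
 have m: "monic (p * q)" and sc: "conj_poly (p * q) = p * q"
  using p q by (auto simp: lead_coeff_mult conj_poly_mult)
 have "sum ?G ?S = (\<Sum>d\<in>divisors (p * q). card (nforms d))"
  using sum.reindex_bij_betw[OF bij_betw_divisors[OF pq p(2) q(2)], of "%d. card (nforms d)"]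
  by (simp add: case_prod_unfold)
 also have "... = CARD('a) ^ form_dim (p * q)"
  unfolding divisors_def by (rule sum_card_nforms[OF two sc m])
 also have "... = CARD('a) ^ form_dim p * CARD('a) ^ form_dim q"
  unfolding form_dim_mult[OF two p q pq] by (rule power_add)
 also have "... = sum ?H ?S"
  unfolding sum_card_nforms[OF two p, symmetric] sum_card_nforms[OF two q, symmetric] divisors_def
  by (simp only: sum_product sum.cartesian_product)
 finally have eq: "sum ?G ?S = sum ?H ?S" .
 have "sum ?G (?S - {(p, q)}) = sum ?H (?S - {(p, q)})"
 proof (intro sum.cong refl)
  fix x assume "x \<in> ?S - {(p, q)}"
  then obtain a b where x: "x = (a, b)" and ab: "a \<in> divisors p" "b \<in> divisors q" "(a, b) ~= (p, q)" by auto
  hence d: "monic a" "monic b" "a dvd p" "b dvd q" by (auto simp: divisors_def)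
  show "?G x = ?H x" unfolding x prod.case
  proof (rule card_nforms_mult_aux[OF pq p q ab(1,2)])
   assume s: "conj_poly a = a" "conj_poly b = b"
   have "a * b ~= p * q" using bez_factor_unique[OF pq d(1,2) p(2) q(2) d(3) _ d(4)] ab(3) by auto
   hence "degree (a * b) < degree (p * q)"
    by (intro monic_proper_dvd_degree) (use d p q in "auto simp: lead_coeff_mult intro: mult_dvd_mono")
   thus "card (nforms (a * b)) = card (nforms a) * card (nforms b)"
    using less.hyps[of a b] bez_divisors[OF pq d(3,4)] s d by simp
  qed
 qed
 moreover have "(p, q) \<in> ?S" using p q by (simp add: divisors_def)
 ultimately show ?case using eq sum.remove[OF fin, of "(p, q)" ?G] sum.remove[OF fin, of "(p, q)" ?H] by simp
qed

text \<open>Since \<open>p\<close> is self-conjugate, \<open>r\<close> dividing \<open>p\<close>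
  makes its conjugate divide \<open>p\<close> and so coprime to \<open>q\<close>. Thus the
  divisibility condition on the products separates into one for each factor.\<close>

lemma bij_betw_split_pairs:
 fixes p q :: "'a::field poly"
 assumes pq: "bez p q" and p: "conj_poly p = p" "monic p" and q: "conj_poly q = q" "monic q"
 shows "bij_betw (%((c, r), (c', r')). (c * c', r * r')) (split_pairs p \<times> split_pairs q) (split_pairs (p * q))"
 unfolding bij_betw_def
proof (intro conjI equalityI subsetI)
 have dv: "c dvd s" "r dvd s" if "(c, r) \<in> split_pairs s" for c r s :: "'a poly"
  using that unfolding split_pairs_def by (auto dest: dvd_mult_left dvd_mult_right)
 show "inj_on (%((c, r), (c', r')). (c * c', r * r')) (split_pairs p \<times> split_pairs q)"
 proof (rule inj_onI, clarify)
  fix c r c' r' e s e' s'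
  assume 1: "(c, r) \<in> split_pairs p" "(c', r') \<in> split_pairs q" "(e, s) \<in> split_pairs p" "(e', s') \<in> split_pairs q"
   and eq: "c * c' = e * e'" "r * r' = s * s'"
  have m: "monic c" "monic r" "monic c'" "monic r'" "monic e" "monic s" "monic e'" "monic s'"
   using 1 by (auto simp: split_pairs_def)
  show "(c, r) = (e, s) & (c', r') = (e', s')"
   using bez_factor_unique[OF pq m(1,3,5,7) dv(1)[OF 1(1)] dv(1)[OF 1(3)] dv(1)[OF 1(2)] dv(1)[OF 1(4)] eq(1)]
    bez_factor_unique[OF pq m(2,4,6,8) dv(2)[OF 1(1)] dv(2)[OF 1(3)] dv(2)[OF 1(2)] dv(2)[OF 1(4)] eq(2)] by simp
 qed
next
 fix d assume "d \<in> (%((c, r), (c', r')). (c * c', r * r')) ` (split_pairs p \<times> split_pairs q)"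
 then obtain c r c' r' where d: "d = (c * c', r * r')" "(c, r) \<in> split_pairs p" "(c', r') \<in> split_pairs q" by auto
 have e: "c * c' * (r * r' * conj_poly (r * r')) = (c * (r * conj_poly r)) * (c' * (r' * conj_poly r'))"
  by (simp add: conj_poly_mult algebra_simps)
 show "d \<in> split_pairs (p * q)"
  using d(2,3) unfolding d(1) split_pairs_def mem_Collect_eq prod.case e by (auto simp: lead_coeff_mult intro: mult_dvd_mono)
next
 have key: "c * (r * conj_poly r) dvd s"
  if st: "bez s t" and s: "conj_poly s = s" and c: "c dvd s" and r: "r dvd s"
   and z: "(c * (r * conj_poly r)) * z dvd s * t" for c r s t z :: "'a poly"
 proof (rule bez_dvd_mult)
  have "conj_poly r dvd s" using conj_poly_dvd[OF r] s by simp
  hence "bez t c" "bez t r" "bez t (conj_poly r)" using bez_divisors[OF bez_sym[OF st] dvd_refl] c r by auto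
  thus "bez (c * (r * conj_poly r)) t" by (intro bez_sym[of t] bez_mult)
  show "c * (r * conj_poly r) dvd t * s" using dvd_mult_left[OF z] by (simp add: mult.commute)
 qed
 fix d assume d: "d \<in> split_pairs (p * q)"
 obtain c r where cr: "d = (c, r)" by (cases d)
 have m: "monic c" "monic r" and dvd: "c * (r * conj_poly r) dvd p * q" using d by (auto simp: cr split_pairs_def)
 have cd: "c dvd p * q" and rd: "r dvd p * q" using dvd by (auto dest: dvd_mult_left dvd_mult_right)
 obtain c1 c2 where c: "monic c1" "monic c2" "c1 dvd p" "c2 dvd q" "c = c1 * c2"
  using bez_split_divisor[OF pq p(2) q(2) m(1) cd] by metis
 obtain r1 r2 where r: "monic r1" "monic r2" "r1 dvd p" "r2 dvd q" "r = r1 * r2"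
  using bez_split_divisor[OF pq p(2) q(2) m(2) rd] by metis
 have e: "c * (r * conj_poly r) = (c1 * (r1 * conj_poly r1)) * (c2 * (r2 * conj_poly r2))"
  unfolding c(5) r(5) by (simp add: conj_poly_mult algebra_simps)
 have 1: "c1 * (r1 * conj_poly r1) dvd p" by (rule key[OF pq p(1) c(3) r(3)]) (use dvd e in simp)
 have 2: "c2 * (r2 * conj_poly r2) dvd q"
  by (rule key[OF bez_sym[OF pq] q(1) c(4) r(4)]) (use dvd e in "simp add: mult.commute")
 have "((c1, r1), (c2, r2)) \<in> split_pairs p \<times> split_pairs q" using 1 2 c r by (simp add: split_pairs_def)
 thus "d \<in> (%((c, r), (c', r')). (c * c', r * r')) ` (split_pairs p \<times> split_pairs q)"
  unfolding cr c(5) r(5) by force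
qed

lemma mass_one [simp]: "mass (1 :: 'a::{field,finite} poly) = 1"
proof -
 have "M = N" if "M : mats 0 0" "N : mats 0 0" for M N :: "'a mat" using that by (intro eq_matI) auto
 hence 1: "M = im 0" if "M : mats 0 0" for M :: "'a mat" using that one_carrier_mat by blast
 have G: "GL 0 = {im 0 :: 'a mat}" using GL_one[of 0, where 'a = 'a] by (auto dest: GL_carrier 1)
 have "pairs 0 1 = {(im 0 :: 'a mat, im 0 :: 'a mat)}"
 proof (intro equalityI subsetI)
  fix x :: "'a mat \<times> 'a mat" assume x: "x \<in> pairs 0 1"
  obtain A B where AB: "x = (A, B)" by (cases x)
  show "x \<in> {(im 0, im 0)}" 
   using 1[OF pairsD(1)[OF x[unfolded AB]]] 1[OF pairsD(3)[OF x[unfolded AB]]] by (simp add: AB)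
 next
  fix x :: "'a mat \<times> 'a mat" assume "x \<in> {(im 0, im 0)}"
  moreover have "char_poly (im 0 :: 'a mat) = 1" by (simp add: char_poly_def char_poly_matrix_def det_dim_zero)
  ultimately show "x \<in> pairs 0 1" by (auto simp: pairs_def GL_one)
 qed
 thus ?thesis by (simp add: mass_def G)
qed

lemma card_nforms_one: "card (nforms (1 :: 'a::{field,finite} poly)) = 1"
proof -
 have "nforms (1 :: 'a poly) = {%_ _. 0}"
 proof (intro equalityI subsetI)
  fix b :: "'a poly => 'a poly => 'a" assume b: "b \<in> nforms 1"
  have "b h k = 0" for h k by (rule nformsD(3)[OF b]) simp
  thus "b \<in> {%_ _. 0}" by (simp add: fun_eq_iff)
 next
  fix b :: "'a poly => 'a poly => 'a" assume "b \<in> {%_ _. 0}"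
  thus "b \<in> nforms 1" by (simp add: nforms_def zform_def)
 qed
 thus ?thesis by simp
qed

lemma split_pairs_quotient:
 fixes p :: "'a::field poly"
 assumes p: "conj_poly p = p" "monic p" and cr: "(c, r) \<in> split_pairs p" and c: "conj_poly c = c"
 shows "p = (c * (r * conj_poly r)) * (p div (c * (r * conj_poly r)))" "monic (p div (c * (r * conj_poly r)))"
  "conj_poly (p div (c * (r * conj_poly r))) = p div (c * (r * conj_poly r))"
proof -
 have m: "monic c" "monic r" and d: "c * (r * conj_poly r) dvd p" using cr by (auto simp: split_pairs_def)
 have "r dvd p" using d by (auto dest: dvd_mult_left dvd_mult_right)
 hence nz: "coeff r 0 ~= 0" using coeff_0_dvd conj_poly_eq_self_nonzero[OF p] by blast
 let ?x = "c * (r * conj_poly r)"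
 have mx: "monic ?x" using m monic_conj_poly[OF nz] by (simp add: lead_coeff_mult)
 show e: "p = ?x * (p div ?x)" using d by simp
 show "monic (p div ?x)" by (rule monic_cofactor[OF _ mx]) (simp only: e[symmetric] p)
 have scx: "conj_poly ?x = ?x" using c conj_poly_norm[OF m(2) nz] by (simp only: conj_poly_mult[of c])
 show "conj_poly (p div ?x) = p div ?x"
 proof (rule conj_poly_cofactor[OF _ scx])
  show "conj_poly (?x * (p div ?x)) = ?x * (p div ?x)" by (simp only: e[symmetric] p)
  show "?x ~= 0" using mx by (metis leading_coeff_0_iff zero_neq_one)
 qed
qed

text \<open>Both the mass of p q and the product of the masses satisfy the same recursion over pairs
  of split pairs. By induction the terms other than the trivial one agree, and the trivial term is
  moved to the left.\<close>

theorem mass_mult: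
 fixes p q :: "'a::{field,finite} poly"
 assumes two: "(2::'a) ~= 0" and "bez p q" "conj_poly p = p" "monic p" "conj_poly q = q" "monic q"
 shows "mass (p * q) = mass p * mass q"
 using assms(2-)
proof (induction "degree (p * q)" arbitrary: p q rule: less_induct)
 case less
 note pq = less.prems(1) and p = less.prems(2,3) and q = less.prems(4,5)
 have nz: "p ~= 0" "q ~= 0" using p q by auto
 have deg: "degree (p * q) = degree p + degree q" using nz by (rule degree_mult_eq)
 have m: "monic (p * q)" and sc: "conj_poly (p * q) = p * q"
  using p q by (auto simp: lead_coeff_mult conj_poly_mult)
 show ?case
 proof (cases "degree (p * q) = 0")
  case True
  hence "p = 1" "q = 1" using deg monic_degree_0[OF p(2)] monic_degree_0[OF q(2)] by auto
  thus ?thesis by simp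
 next
  case False
  let ?S = "split_pairs p \<times> split_pairs q"
  define N where "N = (%(c, r). c * (r * conj_poly r) :: 'a poly)"
  define G where "G x y = real (card (nforms (fst x * fst y))) * mass (p * q div (N (fst x * fst y, snd x * snd y)))" for x y :: "'a poly \<times> 'a poly"
  define H where "H x y = (real (card (nforms (fst x))) * mass (p div N x)) * (real (card (nforms (fst y))) * mass (q div N y))" for x y :: "'a poly \<times> 'a poly"
  have fin: "finite ?S" using finite_split_pairs nz by blast
  let ?o = "((1, 1), (1, 1)) :: ('a poly \<times> 'a poly) \<times> ('a poly \<times> 'a poly)"
  have o: "?o \<in> ?S" by (simp add: split_pairs_def)
  have 1: "real CARD('a) ^ degree (p * q) * mass (p * q) = (\<Sum>(x, y)\<in>?S. G x y)"
   unfolding mass_recursion[OF two m conj_poly_eq_self_nonzero[OF sc m]]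
   by (subst sum.reindex_bij_betw[OF bij_betw_split_pairs[OF pq p q], symmetric])
    (auto simp: G_def N_def intro!: sum.cong)
  have "real CARD('a) ^ degree (p * q) * (mass p * mass q)
   = (real CARD('a) ^ degree p * mass p) * (real CARD('a) ^ degree q * mass q)"
   unfolding deg by (simp add: power_add)
  also have "... = (\<Sum>(x, y)\<in>?S. H x y)"
   unfolding mass_recursion[OF two p(2) conj_poly_eq_self_nonzero[OF p]] mass_recursion[OF two q(2) conj_poly_eq_self_nonzero[OF q]]
    sum_product sum.cartesian_product
   by (auto simp: H_def N_def intro!: sum.cong)
  finally have 2: "real CARD('a) ^ degree (p * q) * (mass p * mass q) = (\<Sum>(x, y)\<in>?S. H x y)" .
  have "(\<Sum>(x, y)\<in>?S - {?o}. G x y) = (\<Sum>(x, y)\<in>?S - {?o}. H x y)"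
  proof (intro sum.cong refl)
   fix x assume "x \<in> ?S - {?o}"
   then obtain c r c' r' where x: "x = ((c, r), (c', r'))" and cr: "(c, r) \<in> split_pairs p" "(c', r') \<in> split_pairs q" "((c, r), c', r') ~= ?o" by auto
   have cm: "monic c" "monic c'" "monic r" "monic r'" using cr by (auto simp: split_pairs_def)
   have cd: "c dvd p" "c' dvd q" "r dvd p" "r' dvd q" using cr unfolding split_pairs_def by (auto dest: dvd_mult_left dvd_mult_right)
   hence rnz: "coeff r 0 ~= 0" "coeff r' 0 ~= 0" "coeff c 0 ~= 0" "coeff c' 0 ~= 0"
    using coeff_0_dvd conj_poly_eq_self_nonzero p q by blast+
   have b: "card (nforms (c * c')) = card (nforms c) * card (nforms c')"
   proof (rule card_nforms_mult_aux[OF pq p q])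
    show "c \<in> divisors p" "c' \<in> divisors q" using cm cd by (auto simp: divisors_def)
    show "card (nforms (c * c')) = card (nforms c) * card (nforms c')" if "conj_poly c = c" "conj_poly c' = c'"
     by (rule card_nforms_mult[OF two bez_divisors[OF pq]]) (use that cm cd in auto)
   qed
   have "G (c, r) (c', r') = H (c, r) (c', r')"
   proof (cases "conj_poly c = c & conj_poly c' = c'")
    case False
    hence "card (nforms c) = 0 \<or> card (nforms c') = 0"
     using card_nforms_not_self_conj[OF cm(1) rnz(3)] card_nforms_not_self_conj[OF cm(2) rnz(4)] by argo
    thus ?thesis unfolding G_def H_def using b by auto
   next
    case True
    let ?s = "p div N (c, r)" and ?t = "q div N (c', r')"
    have s: "p = N (c, r) * ?s" "monic ?s" "conj_poly ?s = ?s"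
     using split_pairs_quotient[OF p cr(1)] True by (simp_all only: N_def prod.case)
    have t: "q = N (c', r') * ?t" "monic ?t" "conj_poly ?t = ?t"
     using split_pairs_quotient[OF q cr(2)] True by (simp_all only: N_def prod.case)
    have N: "N (c * c', r * r') = N (c, r) * N (c', r')"
     by (simp add: N_def conj_poly_mult algebra_simps)
    have mN: "monic (N (c, r))" "monic (N (c', r'))" unfolding N_def using cm monic_conj_poly rnz by (auto simp: lead_coeff_mult)
    hence mN': "monic (N (c * c', r * r'))" and Nnz: "N (c * c', r * r') ~= 0" unfolding N by (auto simp: lead_coeff_mult)
    have fac: "p * q = N (c * c', r * r') * (?s * ?t)"
    proof -
     have "p * q = (N (c, r) * ?s) * (N (c', r') * ?t)" using s(1) t(1) by simp
     thus ?thesis unfolding N by (simp only: mult.assoc mult.left_commute)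
    qed
    hence quot: "p * q div N (c * c', r * r') = ?s * ?t"
     using nonzero_mult_div_cancel_left[OF Nnz, of "?s * ?t"] by simp
    have "degree (N (c * c', r * r')) ~= 0"
    proof
     assume "degree (N (c * c', r * r')) = 0"
     hence "degree (c * c') + (degree (r * r') + degree (conj_poly (r * r'))) = 0"
      unfolding N_def prod.case using cm rnz monic_conj_poly[of "r * r'"]
      by (subst (asm) degree_mult_eq, force, force simp: coeff_mult, subst (asm) (2) degree_mult_eq) (auto simp: coeff_mult_0)
     hence "degree c = 0" "degree c' = 0" "degree r = 0" "degree r' = 0"
      using cm by (auto simp: degree_mult_eq_0)
     hence "c = 1" "c' = 1" "r = 1" "r' = 1"
      using monic_degree_0[OF cm(1)] monic_degree_0[OF cm(2)] monic_degree_0[OF cm(3)] monic_degree_0[OF cm(4)] by auto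
     thus False using cr(3) by simp
    qed
    moreover have "degree (p * q) = degree (N (c * c', r * r')) + degree (?s * ?t)"
     unfolding fac by (rule degree_mult_eq) (use Nnz s t in auto)
    ultimately have lt: "degree (?s * ?t) < degree (p * q)" by linarith
    have "bez ?s ?t" by (rule bez_divisors[OF pq]) (use s(1) t(1) dvd_triv_right in metis)+
    hence "mass (?s * ?t) = mass ?s * mass ?t" using less.hyps[OF lt] s t by blast
    thus ?thesis unfolding G_def H_def fst_conv snd_conv quot b by simp
   qed
   thus "(case x of (x, y) => G x y) = (case x of (x, y) => H x y)" unfolding x by simp
  qed
  \<comment> \<open>Removing the summand at \<open>?o\<close>, which reproduces the unknown on each
    side, leaves the factor q^deg - 1, nonzero in positive degree.\<close>
  hence "(\<Sum>(x, y)\<in>?S. G x y) - G (1, 1) (1, 1) = (\<Sum>(x, y)\<in>?S. H x y) - H (1, 1) (1, 1)"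
   using sum.remove[OF fin o, of "%(x, y). G x y"] sum.remove[OF fin o, of "%(x, y). H x y"] by simp
  moreover have "G (1, 1) (1, 1) = mass (p * q)" "H (1, 1) (1, 1) = mass p * mass q"
   by (simp_all add: G_def H_def N_def card_nforms_one)
  ultimately have "real CARD('a) ^ degree (p * q) * mass (p * q) - mass (p * q)
    = real CARD('a) ^ degree (p * q) * (mass p * mass q) - mass p * mass q"
   unfolding 1 2 by simp
  hence "(real CARD('a) ^ degree (p * q) - 1) * (mass (p * q) - mass p * mass q) = 0" by (simp add: algebra_simps)
  moreover have "CARD('a) > 1" using card_mono[of UNIV "{0, 1 :: 'a}"] by simp
  hence "real CARD('a) ^ degree (p * q) > 1" using False by (intro one_less_power) auto
  ultimately show ?thesis by simp
 qed
qed

section \<open>Power series for the masses of powers of one factor\<close>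

lemma power_eq_iff_degree:
 fixes p :: "'a::field poly"
 assumes "monic p" "degree p > 0"
 shows "p ^ i = p ^ k \<longleftrightarrow> i = k"
proof
 assume e: "p ^ i = p ^ k"
 have "degree (p ^ i) = degree (p ^ k)" unfolding e ..
 moreover have "p ~= 0" using assms by auto
 ultimately show "i = k" using assms(2) by (simp add: degree_power_eq)
qed simp

text \<open>\<open>P\<close> is a self-conjugate irreducible or the product of a conjugate pair;
  hypothesis \<open>H\<close> is the one property these cases share. It makes \<open>ch\<close> and
  the norm of \<open>ro\<close> powers of \<open>P\<close>, so the recursion becomes a threefold
  convolution in which \<open>w\<close> counts the \<open>ro\<close> of given norm.\<close>

theorem mass_power_recursion:
 fixes P :: "'a::{field,finite} poly"
 assumes two: "(2::'a) ~= 0" and P: "conj_poly P = P" "monic P" "degree P > 0"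
  and H: "!!ch k. monic ch ==> ch dvd P ^ k ==> conj_poly ch = ch ==> \<exists>i. ch = P ^ i"
  and w: "!!k. w k = real (card {ro. monic ro & ro * conj_poly ro = P ^ k})"
 shows "Abs_fps (%k. real CARD('a) ^ (degree P * k) * mass (P ^ k))
  = Abs_fps (%k. real (card (nforms (P ^ k)))) * (Abs_fps w * Abs_fps (%k. mass (P ^ k)))"
  and "Abs_fps (%k. real (card (nforms (P ^ k)))) * Abs_fps (%_. 1)
  = Abs_fps (%k. real CARD('a) ^ form_dim (P ^ k))"
proof -
 have Pnz: "P ~= 0" using P by auto
 have degP: "degree (P ^ k) = k * degree P" for k using Pnz by (simp add: degree_power_eq)
 have mP: "monic (P ^ k)" and cP: "conj_poly (P ^ k) = P ^ k" for k
  using P by (auto simp: monic_power conj_poly_power)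
 have zP: "coeff (P ^ k) 0 ~= 0" for k by (rule conj_poly_eq_self_nonzero[OF cP mP])
 have pd: "P ^ i dvd P ^ k \<longleftrightarrow> i <= k" for i k
 proof
  assume "P ^ i dvd P ^ k"
  hence "degree (P ^ i) <= degree (P ^ k)" by (rule dvd_imp_degree_le) (use Pnz in auto)
  thus "i <= k" using P(3) by (simp add: degP)
 qed (rule le_imp_power_dvd)
 define R where "R k = {ro. monic ro & ro * conj_poly ro = P ^ k}" for k
 have finR: "finite (R k)" for k
 proof (rule finite_subset[OF _ finite_divisors[of "P ^ k"]])
  show "R k \<subseteq> divisors (P ^ k)" by (auto simp: R_def divisors_def) (metis dvd_triv_left)
 qed (use Pnz in simp)
 show "Abs_fps (%k. real CARD('a) ^ (degree P * k) * mass (P ^ k))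
  = Abs_fps (%k. real (card (nforms (P ^ k)))) * (Abs_fps w * Abs_fps (%k. mass (P ^ k)))" (is "?L = ?R")
 proof (rule fps_ext)
  fix j
  let ?G = "%(ch, ro). real (card (nforms ch)) * mass (P ^ j div (ch * (ro * conj_poly ro)))"
  define S where "S = {(ch, ro). (ch, ro) \<in> split_pairs (P ^ j) & conj_poly ch = ch}"
  define Z where "Z = Sigma {0..j} (%i. Sigma {0..j - i} R)"
  have bij: "bij_betw (%(i, k, ro). (P ^ i, ro)) Z S"
   unfolding bij_betw_def
  proof (intro conjI equalityI subsetI)
   show "inj_on (%(i, k, ro). (P ^ i, ro)) Z"
   proof (rule inj_onI)
    fix x y assume xy: "x \<in> Z" "y \<in> Z" and eq: "(%(i, k, ro). (P ^ i, ro)) x = (%(i, k, ro). (P ^ i, ro)) y"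
    obtain i k ro i' k' ro' where e: "x = (i, k, ro)" "y = (i', k', ro')" by (cases x, cases y)
    have 1: "P ^ i = P ^ i'" "ro = ro'" using eq by (auto simp: e)
    hence "P ^ k = P ^ k'" using xy by (auto simp: Z_def R_def e)
    thus "x = y" using 1 power_eq_iff_degree[OF P(2,3)] by (simp add: e)
   qed
  next
   fix x assume "x \<in> (%(i, k, ro). (P ^ i, ro)) ` Z"
   then obtain i k ro where x: "x = (P ^ i, ro)" "i <= j" "k <= j - i" "ro \<in> R k" by (auto simp: Z_def)
   have "P ^ i * P ^ k dvd P ^ j" using pd[of "i + k" j] x by (simp add: power_add)
   thus "x \<in> S" using x mP cP by (auto simp: S_def split_pairs_def R_def)
  next
   fix x assume "x \<in> S"
   then obtain ch ro where x: "x = (ch, ro)" and m: "monic ch" "monic ro" and sc: "conj_poly ch = ch"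
    and d: "ch * (ro * conj_poly ro) dvd P ^ j" by (auto simp: S_def split_pairs_def)
   have "ch dvd P ^ j" and d2: "ro * conj_poly ro dvd P ^ j" using d by (auto dest: dvd_mult_left dvd_mult_right)
   then obtain i where i: "ch = P ^ i" using H[OF m(1) _ sc] by blast
   have "ro dvd P ^ j" using d2 by (auto dest: dvd_mult_left)
   hence nz: "coeff ro 0 ~= 0" using coeff_0_dvd zP by blast
   have "monic (ro * conj_poly ro)" using m monic_conj_poly[OF nz] by (simp add: lead_coeff_mult)
   then obtain k where k: "ro * conj_poly ro = P ^ k" using H[OF _ d2] conj_poly_norm[OF m(2) nz] by blast
   have "P ^ (i + k) dvd P ^ j" using d by (simp add: i k power_add)
   hence "i + k <= j" unfolding pd .
   hence "(i, k, ro) \<in> Z" using m k by (simp add: Z_def R_def)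
   thus "x \<in> (%(i, k, ro). (P ^ i, ro)) ` Z" by (force simp: x i)
  qed
  have "fps_nth ?L j = real CARD('a) ^ degree (P ^ j) * mass (P ^ j)" by (simp add: degP mult.commute)
  also have "... = sum ?G (split_pairs (P ^ j))" by (rule mass_recursion[OF two mP zP])
  \<comment> \<open>A \<open>ch\<close> that is not self-conjugate carries no form, so only powers
    of \<open>P\<close> remain for \<open>ch\<close>.\<close>
  also have "... = sum ?G S"
  proof (rule sum.mono_neutral_right)
   show "\<forall>x\<in>split_pairs (P ^ j) - S. ?G x = 0"
   proof
    fix x assume xS: "x \<in> split_pairs (P ^ j) - S"
    obtain ch ro where x: "x = (ch, ro)" by (cases x)
    have c: "monic ch" "ch dvd P ^ j" "conj_poly ch ~= ch"
     using xS unfolding x by (auto simp: S_def split_pairs_def dest: dvd_mult_left)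
    have "coeff ch 0 ~= 0" by (rule coeff_0_dvd[OF c(2) zP])
    thus "?G x = 0" unfolding x using card_nforms_not_self_conj[OF c(1) _ c(3)] by simp
   qed
  qed (use Pnz in "auto simp: S_def intro: finite_split_pairs")
  also have "... = (\<Sum>(i, k, ro)\<in>Z. ?G (P ^ i, ro))"
   by (subst sum.reindex_bij_betw[OF bij, symmetric]) (auto intro!: sum.cong)
  also have "... = (\<Sum>i\<in>{0..j}. \<Sum>k\<in>{0..j - i}. \<Sum>ro\<in>R k. ?G (P ^ i, ro))"
   unfolding Z_def using finR by (simp add: sum.Sigma case_prod_unfold)
  also have "... = (\<Sum>i\<in>{0..j}. \<Sum>k\<in>{0..j - i}. real (card (nforms (P ^ i))) * (w k * mass (P ^ (j - i - k))))"
  proof (intro sum.cong refl)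
   fix i k assume ik: "i \<in> {0..j}" "k \<in> {0..j - i}"
   have "?G (P ^ i, ro) = real (card (nforms (P ^ i))) * mass (P ^ (j - i - k))" if "ro \<in> R k" for ro
   proof -
    have e: "ro * conj_poly ro = P ^ k" using that by (simp add: R_def)
    have "P ^ j = (P ^ i * P ^ k) * P ^ (j - i - k)" using ik by (simp flip: power_add)
    hence "P ^ j div (P ^ i * P ^ k) = P ^ (j - i - k)" using Pnz by (metis nonzero_mult_div_cancel_left no_zero_divisors power_not_zero)
    thus ?thesis by (simp add: e)
   qed
   thus "(\<Sum>ro\<in>R k. ?G (P ^ i, ro)) = real (card (nforms (P ^ i))) * (w k * mass (P ^ (j - i - k)))"
    unfolding w R_def[symmetric] by (simp only: sum.cong sum_constant) simp
  qed
  also have "... = fps_nth ?R j" by (simp add: fps_mult_nth sum_distrib_left)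
  finally show "fps_nth ?L j = fps_nth ?R j" .
 qed
 show "Abs_fps (%k. real (card (nforms (P ^ k)))) * Abs_fps (%_. 1)
  = Abs_fps (%k. real CARD('a) ^ form_dim (P ^ k))" (is "?L = ?R")
 proof (rule fps_ext)
  fix j
  have inj: "inj_on (%i. P ^ i) {0..j}" by (rule inj_onI) (simp add: power_eq_iff_degree[OF P(2,3)])
  have "fps_nth ?R j = real (\<Sum>ch\<in>divisors (P ^ j). card (nforms ch))"
   using sum_card_nforms[OF two cP mP, of j] by (simp add: divisors_def)
  also have "(\<Sum>ch\<in>divisors (P ^ j). card (nforms ch)) = (\<Sum>ch\<in>(%i. P ^ i) ` {0..j}. card (nforms ch))"
  proof (rule sum.mono_neutral_right)
   show "(%i. P ^ i) ` {0..j} \<subseteq> divisors (P ^ j)" using mP pd by (auto simp: divisors_def)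
   show "\<forall>ch\<in>divisors (P ^ j) - (%i. P ^ i) ` {0..j}. card (nforms ch) = 0"
   proof
    fix ch assume c: "ch \<in> divisors (P ^ j) - (%i. P ^ i) ` {0..j}"
    have m: "monic ch" "ch dvd P ^ j" using c by (auto simp: divisors_def)
    have "conj_poly ch ~= ch"
    proof
     assume "conj_poly ch = ch"
     then obtain i where i: "ch = P ^ i" using H[OF m] by blast
     hence "i <= j" using m(2) pd by simp
     thus False using c i by auto
    qed
    thus "card (nforms ch) = 0" by (rule card_nforms_not_self_conj[OF m(1) coeff_0_dvd[OF m(2) zP]])
   qed
  qed (use Pnz in "auto intro: finite_divisors")
  also have "... = (\<Sum>i\<in>{0..j}. card (nforms (P ^ i)))" by (simp add: sum.reindex[OF inj])
  finally show "fps_nth ?L j = fps_nth ?R j" by (simp add: fps_mult_nth)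
 qed
qed

lemma fps_ones: "Abs_fps (%_. 1 :: real) * (1 - fps_X) = 1"
 by (rule fps_ext) (simp add: right_diff_distrib)

lemma fps_geometric: "Abs_fps (%k. Q ^ k :: real) * (1 - fps_const Q * fps_X) = 1"
proof (rule fps_ext)
 fix n
 have e: "Abs_fps (%k. Q ^ k) * (1 - fps_const Q * fps_X) = Abs_fps (%k. Q ^ k) - fps_const Q * (Abs_fps (%k. Q ^ k) * fps_X)"
  by (simp add: algebra_simps)
 show "fps_nth (Abs_fps (%k. Q ^ k) * (1 - fps_const Q * fps_X)) n = fps_nth 1 n"
  unfolding e by (cases n) auto
qed

lemma fps_evens: "Abs_fps (%k. if even k then 1 else 0 :: real) * (1 - fps_X ^ 2) = 1"
proof (rule fps_ext)
 fix n :: nat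
 have "n < 2 \<or> (\<exists>k. n = Suc (Suc k))" by presburger
 thus "fps_nth (Abs_fps (%k. if even k then 1 else 0 :: real) * (1 - fps_X ^ 2)) n = fps_nth 1 n"
  by (auto simp: right_diff_distrib fps_X_power_mult_right_nth less_2_cases_iff)
qed

lemma fps_succs: "Abs_fps (%k. real (k + 1)) * ((1 - fps_X) * (1 - fps_const 1 * fps_X)) = 1"
proof -
 have "Abs_fps (%k. real (k + 1)) * (1 - fps_X) = Abs_fps (%_. 1)"
  by (rule fps_ext) (auto simp: right_diff_distrib)
 thus ?thesis using fps_ones by (simp flip: mult.assoc)
qed

lemma fps_difference_of_squares: "(1 - fps_X) * (1 - fps_const (-1 :: real) * fps_X) = 1 - fps_X ^ 2"
 by (simp add: algebra_simps power2_eq_square flip: fps_const_neg)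

text \<open>If the dimension of the space of forms grows linearly, the series of the form counts is
  the rational function (1 - X) / (1 - Q X).\<close>

lemma nforms_series_geometric:
 assumes "b * Abs_fps (%_. 1) = Abs_fps (%k. Q ^ k :: real)"
 shows "b * (1 - fps_const Q * fps_X) = 1 - fps_X"
proof -
 have "b * (1 - fps_const Q * fps_X) = (b * Abs_fps (%_. 1)) * (1 - fps_const Q * fps_X) * (1 - fps_X)"
  using fps_ones by (simp add: mult_ac)
 thus ?thesis by (simp only: assms fps_geometric mult_1_left)
qed

text \<open>Cancelling 1 - X leaves (1 - Q X)(1 - s X) S = N, where S has the coefficients Q^(2 k)
  N_k: a second-order recursion. With s = 1 its solution belongs to the general linear groups, with
  s = -1 to the unitary groups.\<close>

lemma geometric_sequence:
 fixes N :: "nat => real"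
 assumes rec: "Abs_fps (%k. Q ^ (2 * k) * N k) = b * (w * Abs_fps N)"
  and b: "b * (1 - fps_const Q * fps_X) = 1 - fps_X"
  and w: "w * ((1 - fps_X) * (1 - fps_const s * fps_X)) = 1" and Q: "Q > 1" and s: "s = 1 \<or> s = -1"
 shows "N (Suc k) * (Q ^ Suc k - s ^ Suc k) = Q ^ k * N k"
proof -
 define r where "r k = Q ^ (2 * k) * N k" for k
 define S where "S = Abs_fps r"
 have nz: "1 - fps_X ~= (0 :: real fps)"
 proof
  assume z: "1 - fps_X = (0 :: real fps)"
  have "fps_nth (1 - fps_X :: real fps) 0 = 0" unfolding z by simp
  thus False by simp
 qed
 have "(1 - fps_X) * (S * ((1 - fps_const Q * fps_X) * (1 - fps_const s * fps_X)))
  = (b * (1 - fps_const Q * fps_X)) * (w * ((1 - fps_X) * (1 - fps_const s * fps_X))) * Abs_fps N"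
  unfolding S_def r_def rec by (simp only: mult_ac)
 also have "... = (1 - fps_X) * Abs_fps N" unfolding b w by simp
 finally have "S * ((1 - fps_const Q * fps_X) * (1 - fps_const s * fps_X)) = Abs_fps N" by (rule iffD1[OF mult_left_cancel[OF nz]])
 moreover have "S * ((1 - fps_const Q * fps_X) * (1 - fps_const s * fps_X))
  = S - fps_const Q * (S * fps_X) - fps_const s * (S * fps_X) + fps_const Q * (fps_const s * (S * fps_X ^ 2))"
  by (simp add: algebra_simps power2_eq_square)
 ultimately have E: "S - fps_const Q * (S * fps_X) - fps_const s * (S * fps_X) + fps_const Q * (fps_const s * (S * fps_X ^ 2)) = Abs_fps N" by simp
 show ?thesis
 proof (induction k)
  case 0
  have "r 1 - Q * r 0 - s * r 0 = N 1" using arg_cong[OF E, of "%f. fps_nth f 1"] by (simp add: S_def fps_X_power_mult_right_nth)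
  hence "(Q + s) * (N 1 * (Q - s) - N 0) = 0" using s by (auto simp: r_def algebra_simps power2_eq_square)
  thus ?case using Q s by auto
 next
  case (Suc i)
  define y e A B C where "y = Q ^ i" and "e = s ^ i" and "A = N (Suc (Suc i))" and "B = N (Suc i)" and "C = N i"
  have y: "y >= 1" using Q by (simp add: y_def)
  have ss: "s * s - 1 = 0" using s by auto
  have ee: "e * e - 1 = 0" unfolding e_def using s by (auto simp flip: power_mult_distrib)
  have 1: "B * (Q * y - s * e) - y * C = 0" using Suc by (simp add: y_def e_def B_def C_def)
  have "r (Suc (Suc i)) - Q * r (Suc i) - s * r (Suc i) + Q * (s * r i) = A"
   using arg_cong[OF E, of "%f. fps_nth f (Suc (Suc i))"] by (simp add: A_def S_def fps_X_power_mult_right_nth)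
  moreover have "r (Suc (Suc i)) = Q ^ 4 * y ^ 2 * A" "r (Suc i) = Q ^ 2 * y ^ 2 * B" "r i = y ^ 2 * C"
   by (simp_all add: r_def y_def A_def B_def C_def mult_2 power_add eval_nat_numeral mult_ac)
  ultimately have h: "Q ^ 4 * y ^ 2 * A - Q * (Q ^ 2 * y ^ 2 * B) - s * (Q ^ 2 * y ^ 2 * B) + Q * (s * (y ^ 2 * C)) - A = 0"
   by (simp only: diff_self)
  \<comment> \<open>A polynomial identity writing the goal, multiplied by
    \<open>Q ^ 2 * y + e\<close>, as a combination of the second-order relation, the induction
    hypothesis and the relations e e = 1 and s s = 1. The extra factor arises from Q^4 y^2 - 1 =
    (Q^2 y + e)(Q^2 y - e) and is positive.\<close>
  have "(Q ^ 2 * y + e) * (A * (Q ^ 2 * y - e) - Q * y * B)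
   = (Q ^ 4 * y ^ 2 * A - Q * (Q ^ 2 * y ^ 2 * B) - s * (Q ^ 2 * y ^ 2 * B) + Q * (s * (y ^ 2 * C)) - A)
    + Q * s * y * (B * (Q * y - s * e) - y * C) - A * (e * e - 1) + e * Q * y * B * (s * s - 1)"
   by (simp add: field_simps eval_nat_numeral)
  hence "(Q ^ 2 * y + e) * (A * (Q ^ 2 * y - e) - Q * y * B) = 0" by (simp only: h 1 ss ee mult_zero_right add_0 diff_self)
  moreover have "Q ^ 2 * y + e ~= 0"
  proof -
   have "Q ^ 2 > 1" using Q by (rule one_less_power) simp
   moreover have "Q ^ 2 * 1 <= Q ^ 2 * y" using y Q by (intro mult_left_mono) auto
   moreover have "e >= -1" unfolding e_def using s by (cases "even i") auto
   ultimately show ?thesis by linarith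
  qed
  ultimately have "A * (Q ^ 2 * y - e) = Q * y * B" by (simp only: mult_eq_0_iff simp_thms right_minus_eq)
  moreover have "s ^ Suc (Suc i) = e" using s by (auto simp: e_def)
  ultimately show ?case by (simp add: A_def B_def y_def power2_eq_square mult_ac)
 qed
qed

text \<open>Here the form dimension is k/2 rounded up, which makes the first series (1 + Q X)(1 - X)
  / (1 - Q X^2).\<close>

lemma symplectic_sequence:
 fixes N :: "nat => real"
 assumes rec: "Abs_fps (%k. Q ^ k * N k) = b * (w * Abs_fps N)"
  and b: "b * Abs_fps (%_. 1) = Abs_fps (%k. Q ^ ((k + 1) div 2))" and w: "w * (1 - fps_X ^ 2) = 1" and Q: "Q > 1"
 shows "N (2 * l + 1) = N (2 * l)" and "N (2 * l + 2) * (Q ^ (2 * l + 2) - 1) = Q ^ (2 * l + 1) * N (2 * l)"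
proof -
 have B: "Abs_fps (%k. Q ^ ((k + 1) div 2)) * (1 - fps_const Q * fps_X ^ 2) = 1 + fps_const Q * fps_X"
 proof (rule fps_ext)
  fix n :: nat
  have e: "Abs_fps (%k. Q ^ ((k + 1) div 2)) * (1 - fps_const Q * fps_X ^ 2)
   = Abs_fps (%k. Q ^ ((k + 1) div 2)) - fps_const Q * (Abs_fps (%k. Q ^ ((k + 1) div 2)) * fps_X ^ 2)"
   by (simp add: algebra_simps)
  consider "n = 0" | "n = 1" | k where "n = Suc (Suc k)" by (metis One_nat_def old.nat.exhaust)
  thus "fps_nth (Abs_fps (%k. Q ^ ((k + 1) div 2)) * (1 - fps_const Q * fps_X ^ 2)) n = fps_nth (1 + fps_const Q * fps_X) n"
   unfolding e by cases (auto simp: fps_X_power_mult_right_nth)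
 qed
 have "b * (1 - fps_const Q * fps_X ^ 2) = (b * Abs_fps (%_. 1)) * (1 - fps_const Q * fps_X ^ 2) * (1 - fps_X)"
  using fps_ones by (simp add: mult_ac)
 hence b': "b * (1 - fps_const Q * fps_X ^ 2) = (1 + fps_const Q * fps_X) * (1 - fps_X)" by (simp only: b B)
 \<comment> \<open>The factor 1 + Q X in the series of the forms suggests dividing N by 1 + X:
   replacing X by Q X then gives N the same factor, and both cancel. What remains relates only
   indices of equal parity, so the odd coefficients of G vanish and N takes equal values at 2 l and
   2 l + 1.\<close>
 define G where "G = Abs_fps N * Abs_fps (%k. (-1) ^ k)"
 define g where "g = fps_nth G"
 define H where "H = Abs_fps (%k. Q ^ k * g k)"
 have "Abs_fps (%k. (-1 :: real) ^ k) * (1 + fps_X) = 1" using fps_geometric[of "-1"] by (simp flip: fps_const_neg)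
 hence N: "Abs_fps N = G * (1 + fps_X)" unfolding G_def by (simp add: mult.assoc)
 have N0: "N 0 = g 0" and NS: "N (Suc k) = g (Suc k) + g k" for k
  using arg_cong[OF N, of "%f. fps_nth f 0"] arg_cong[OF N, of "%f. fps_nth f (Suc k)"] by (simp_all add: g_def distrib_left)
 have S: "Abs_fps (%k. Q ^ k * N k) = H * (1 + fps_const Q * fps_X)"
 proof (rule fps_ext)
  fix n
  have e: "H * (1 + fps_const Q * fps_X) = H + fps_const Q * (H * fps_X)" by (simp add: algebra_simps)
  show "fps_nth (Abs_fps (%k. Q ^ k * N k)) n = fps_nth (H * (1 + fps_const Q * fps_X)) n"
   unfolding e by (cases n) (simp_all add: N0 NS H_def algebra_simps)
 qed
 define T where "T = (1 + fps_const Q * fps_X) * ((1 - fps_X) * (1 + fps_X))"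
 have "fps_nth T 0 = 1" by (simp add: T_def)
 hence T: "T ~= 0" by auto
 have x2: "(1 - fps_X) * (1 + fps_X) = (1 - fps_X ^ 2 :: real fps)" by (simp add: algebra_simps power2_eq_square)
 have "T * (H * (1 - fps_const Q * fps_X ^ 2)) = Abs_fps (%k. Q ^ k * N k) * ((1 - fps_const Q * fps_X ^ 2) * (1 - fps_X ^ 2))"
  unfolding S T_def x2 by (simp only: mult_ac)
 also have "... = (b * (1 - fps_const Q * fps_X ^ 2)) * (w * (1 - fps_X ^ 2)) * Abs_fps N" unfolding rec by (simp only: mult_ac)
 also have "... = T * G" unfolding b' w N T_def by (simp only: mult_ac mult_1_left)
 finally have "H * (1 - fps_const Q * fps_X ^ 2) = G" by (rule iffD1[OF mult_left_cancel[OF T]])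
 hence E: "H - fps_const Q * (H * fps_X ^ 2) = G" by (simp add: algebra_simps)
 have "Q * g 1 = g 1" using arg_cong[OF E, of "%f. fps_nth f 1"] by (simp add: H_def g_def fps_X_power_mult_right_nth)
 hence g1: "g 1 = 0" using Q by simp
 have g2: "g (k + 2) * (Q ^ (k + 2) - 1) = Q ^ (k + 1) * g k" for k
 proof -
  have "Q ^ (k + 2) * g (k + 2) - Q * (Q ^ k * g k) = g (k + 2)"
   using arg_cong[OF E, of "%f. fps_nth f (Suc (Suc k))"] by (simp add: H_def g_def fps_X_power_mult_right_nth)
  thus ?thesis by (simp add: algebra_simps)
 qed
 have odd: "g (2 * l + 1) = 0" for l
 proof (induction l)
  case (Suc l)
  have "Q ^ (2 * l + 3) > 1" using Q by (rule one_less_power) simp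
  thus ?case using g2[of "2 * l + 1"] Suc by (simp add: eval_nat_numeral)
 qed (use g1 in simp)
 have N2: "N (2 * l) = g (2 * l)" for l
  using N0 NS odd[of "l - 1"] by (cases l) (simp_all add: numeral_2_eq_2)
 show "N (2 * l + 1) = N (2 * l)" using NS[of "2 * l"] N2 odd[of l] by simp
 show "N (2 * l + 2) * (Q ^ (2 * l + 2) - 1) = Q ^ (2 * l + 1) * N (2 * l)"
  using g2[of "2 * l"] N2[of l] N2[of "l + 1"] by simp
qed

section \<open>Masses of powers of an irreducible or of a conjugate pair\<close>

lemma dvd_irreducible_power:
 fixes f :: "'a::field poly"
 assumes f: "monic f" "irreducible f"
 shows "monic ch ==> ch dvd f ^ k ==> \<exists>i\<le>k. ch = f ^ i"
proof (induction k arbitrary: ch)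
 case 0
 thus ?case using monic_dvd_antisym[of ch 1] by simp
next
 case (Suc k)
 show ?case
 proof (cases "f dvd ch")
  case True
  then obtain s where s: "ch = f * s" by (elim dvdE)
  have "monic s" using monic_cofactor[of f s] Suc.prems(1) f(1) s by simp
  moreover have "s dvd f ^ k" using Suc.prems(2) f(1) unfolding s by auto
  ultimately obtain i where "i <= k" "s = f ^ i" using Suc.IH by blast
  thus ?thesis by (intro exI[of _ "Suc i"]) (simp add: s)
 next
  case False
  have "ch dvd f * f ^ k" using Suc.prems(2) by simp
  hence "ch dvd f ^ k" by (rule bez_dvd_mult[OF bez_sym[OF bez_irreducible[OF f False]]])
  thus ?thesis using Suc.IH[OF Suc.prems(1)] le_SucI by blast
 qed
qed

lemma irreducible_degree_pos:
 fixes f :: "'a::field poly"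
 assumes "monic f" "irreducible f"
 shows "degree f > 0"
proof (rule ccontr)
 assume "\<not> degree f > 0"
 hence "f = 1" using monic_degree_0[OF assms(1)] by simp
 thus False using assms(2) by simp
qed

lemma irreducible_root:
 fixes f :: "'a::field poly"
 assumes "monic f" "irreducible f" "poly f c = 0"
 shows "f = [:- c, 1:]"
proof -
 have "[:- c, 1:] dvd f ^ 1" using assms(3) by (simp add: poly_eq_0_iff_dvd)
 then obtain i where "i <= 1" and i: "[:- c, 1:] = f ^ i" using dvd_irreducible_power[OF assms(1,2), of "[:- c, 1:]" 1] by auto
 hence "i = 0 \<or> i = 1" by auto
 thus ?thesis using i by (auto simp: one_pCons)
qed

text \<open>Conjugation is multiplicative and preserves degrees when constant terms are nonzero, and
  twice applied to g it gives g back, so a factorization of the conjugate yields one of g.\<close>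

lemma irreducible_conj_poly:
 fixes g :: "'a::field poly"
 assumes g: "monic g" "irreducible g" "coeff g 0 ~= 0"
 shows "irreducible (conj_poly g)"
proof (rule irreducibleI)
 have m: "monic (conj_poly g)" using g by (intro monic_conj_poly)
 thus nz: "conj_poly g ~= 0" by auto
 have d: "degree (conj_poly g) = degree g" using g by (intro degree_conj_poly)
 show "\<not> conj_poly g dvd 1" using irreducible_degree_pos[OF g(1,2)] d by (simp add: is_unit_iff_degree nz)
 fix a b assume ab: "conj_poly g = a * b"
 have nz': "coeff a 0 ~= 0" "coeff b 0 ~= 0"
 proof -
  have "coeff (conj_poly g) 0 ~= 0" using g by (simp add: conj_poly_def)
  thus "coeff a 0 ~= 0" "coeff b 0 ~= 0" unfolding ab by (auto simp: coeff_mult_0)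
 qed
 have "g = conj_poly a * conj_poly b" using ab conj_poly_conj_poly[OF g(1,3)] by (simp add: conj_poly_mult)
 from irreducibleD[OF g(2) this] have "conj_poly a dvd 1 \<or> conj_poly b dvd 1" .
 moreover have u: "p dvd 1" if "conj_poly p dvd 1" "coeff p 0 ~= 0" for p :: "'a poly"
 proof -
  have "p ~= 0" using that(2) by auto
  moreover have "conj_poly p ~= 0" using that(1) by auto
  ultimately show ?thesis using that degree_conj_poly[OF that(2)] by (simp add: is_unit_iff_degree)
 qed
 ultimately show "a dvd 1 \<or> b dvd 1" using nz' by blast
qed

lemma CARD_field_gt_1: "CARD('a::{field,finite}) > 1"
 using card_mono[of UNIV "{0, 1 :: 'a}"] by simp

lemma coeff_0_power: "coeff (p ^ k) 0 = coeff p 0 ^ k"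
 by (induction k) (simp_all add: coeff_mult_0)

text \<open>A divisor of a power of f is a power of f and has the square of itself as norm, so the
  series of norm counts is 1 / (1 - X^2).\<close>

lemma self_conj_norms_of_irreducible:
 fixes f :: "'a::field poly"
 assumes f: "monic f" "irreducible f" "conj_poly f = f"
 shows "real (card {ro. monic ro & ro * conj_poly ro = f ^ k}) = (if even k then 1 else 0)"
proof -
 have pos: "degree f > 0" using irreducible_degree_pos f by blast
 have *: "k = 2 * i & ro = f ^ i" if "monic ro" "ro * conj_poly ro = f ^ k" "ro = f ^ i" for ro i
 proof -
  have "f ^ (i + i) = f ^ k" using that f(3) by (simp add: conj_poly_power power_add)
  thus ?thesis using that(3) power_eq_iff_degree[OF f(1) pos] by simp
 qed
 have "{ro. monic ro & ro * conj_poly ro = f ^ k} = (if even k then {f ^ (k div 2)} else {})"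
 proof (intro equalityI subsetI)
  fix ro assume r: "ro \<in> {ro. monic ro & ro * conj_poly ro = f ^ k}"
  hence "ro dvd f ^ k" by (metis (mono_tags, lifting) dvd_triv_left mem_Collect_eq)
  then obtain i where "ro = f ^ i" using dvd_irreducible_power[OF f(1,2)] r by blast
  thus "ro \<in> (if even k then {f ^ (k div 2)} else {})" using *[of ro i] r by auto
 next
  fix ro assume "ro \<in> (if even k then {f ^ (k div 2)} else {})"
  hence "even k" "ro = f ^ (k div 2)" by (auto split: if_splits)
  thus "ro \<in> {ro. monic ro & ro * conj_poly ro = f ^ k}"
   using f by (auto simp: conj_poly_power monic_power simp flip: power_add mult_2 elim!: evenE)
 qed
 thus ?thesis by simp
qed

text \<open>Neither 1 nor -1 is a root of f, so both sign conditions hold: f(0) = 1 and the degree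
  is even. Hence the form dimension is exactly half the degree for every power, and the norm series
  1 / (1 - X^2) is the case s = -1.\<close>

theorem mass_self_conj_power:
 fixes f :: "'a::{field,finite} poly"
 assumes two: "(2::'a) ~= 0" and f: "monic f" "irreducible f" "conj_poly f = f" "f ~= [:-1, 1:]" "f ~= [:1, 1:]"
 defines "Q \<equiv> real CARD('a) ^ (degree f div 2)"
 shows "even (degree f)" "mass (f ^ Suc k) * (Q ^ Suc k - (-1) ^ Suc k) = Q ^ k * mass (f ^ k)"
proof -
 have pos: "degree f > 0" using irreducible_degree_pos f by blast
 have r: "poly f 1 ~= 0" "poly f (-1) ~= 0" using irreducible_root[OF f(1,2), of 1] irreducible_root[OF f(1,2), of "-1"] f(4,5) by auto
 have c: "coeff f 0 = 1" using self_conj_poly_pm1(1)[OF f(3,1)] r by simp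
 have "(-1) ^ degree f = (1::'a)" using self_conj_poly_pm1(2)[OF f(3,1)] r c by simp
 moreover have "(-1::'a) ~= 1" using two by (metis add_eq_0_iff one_add_one)
 ultimately show ev: "even (degree f)" by (cases "even (degree f)") auto
 have Q: "Q > 1" unfolding Q_def using CARD_field_gt_1[where 'a = 'a] ev pos by (intro one_less_power) (auto elim!: evenE)
 have w: "real (card {ro. monic ro & ro * conj_poly ro = f ^ k}) = (if even k then 1 else 0)" for k
  by (rule self_conj_norms_of_irreducible[OF f(1-3)])
 have H: "\<exists>i. ch = f ^ i" if "monic ch" "ch dvd f ^ k" for ch k using dvd_irreducible_power[OF f(1,2) that] by blast
 have fd: "form_dim (f ^ k) = degree f div 2 * k" for k
 proof -
  have "2 * form_dim (f ^ k) = k * degree f"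
   using f c ev by (subst form_dim_double[OF two]) (auto simp: conj_poly_power monic_power coeff_0_power degree_power_eq)
  moreover have "k * degree f = 2 * (degree f div 2 * k)" using ev by simp
  ultimately show ?thesis by linarith
 qed
 note R = mass_power_recursion[OF two f(3,1) pos H w[symmetric]]
 have q2: "real CARD('a) ^ (degree f * k) = Q ^ (2 * k)" for k unfolding Q_def using ev by (simp flip: power_mult) (metis dvd_mult_div_cancel mult.assoc mult.commute)
 have R2: "Abs_fps (%k. real (card (nforms (f ^ k)))) * Abs_fps (%_. 1) = Abs_fps (%k. Q ^ k)"
  using R(2) unfolding fd power_mult Q_def .
 show "mass (f ^ Suc k) * (Q ^ Suc k - (-1) ^ Suc k) = Q ^ k * mass (f ^ k)"
  by (rule geometric_sequence[OF R(1)[unfolded q2] nforms_series_geometric[OF R2] fps_evens[folded fps_difference_of_squares] Q disjI2[OF refl]])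
qed

text \<open>Divisors of powers of g h, with h the conjugate of g, are g^x h^y, and conjugation swaps
  the exponents. The norm depends on x + y only, so the k-th power is the norm of k + 1 polynomials
  and the norm series 1 / (1 - X)^2 is the case s = 1.\<close>

theorem mass_conj_pair_power:
 fixes g :: "'a::{field,finite} poly"
 assumes two: "(2::'a) ~= 0" and g: "monic g" "irreducible g" "coeff g 0 ~= 0" "conj_poly g ~= g"
 defines "Q \<equiv> real CARD('a) ^ degree g"
 shows "mass ((g * conj_poly g) ^ Suc k) * (Q ^ Suc k - 1) = Q ^ k * mass ((g * conj_poly g) ^ k)"
proof -
 define h where "h = conj_poly g"
 have h: "monic h" "irreducible h" "coeff h 0 ~= 0" "conj_poly h = g" "degree h = degree g" and hg: "conj_poly g = h"
  using irreducible_conj_poly[OF g(1-3)] monic_conj_poly[OF g(3)] conj_poly_conj_poly[OF g(1,3)] degree_conj_poly[OF g(3)] g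
  by (auto simp: h_def conj_poly_def)
 have pos: "degree g > 0" "degree h > 0" using irreducible_degree_pos g h by auto
 have nd: "\<not> g dvd h"
 proof
  assume "g dvd h"
  moreover have "g ~= h" using g(4) hg by simp
  ultimately have "degree g < degree h" using monic_proper_dvd_degree g(1) h(1) by blast
  thus False using h(5) by simp
 qed
 have bz: "bez (g ^ i) (h ^ k)" for i k
  using bez_power[OF bez_sym[OF bez_power[OF bez_irreducible[OF g(1,2) nd], of k]], of i] by (rule bez_sym)
 have split: "\<exists>x y. x <= k & y <= k & ch = g ^ x * h ^ y" if c: "monic ch" "ch dvd (g * h) ^ k" for ch k
 proof -
  have "ch dvd g ^ k * h ^ k" using c(2) by (simp add: power_mult_distrib)
  moreover have "monic (g ^ k)" "monic (h ^ k)" using g(1) h(1) by (auto intro: monic_power)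
  ultimately obtain a b where "monic a" "monic b" "a dvd g ^ k" "b dvd h ^ k" "ch = a * b"
   using bez_split_divisor[OF bz _ _ c(1)] by blast
  thus ?thesis using dvd_irreducible_power[OF g(1,2)] dvd_irreducible_power[OF h(1,2)] by metis
 qed
 have uniq: "x = x' & y = y'" if eq: "g ^ x * h ^ y = g ^ x' * h ^ y'" for x y x' y'
 proof -
  have "g ^ x = g ^ x' & h ^ y = h ^ y'"
   by (rule bez_factor_unique[OF bz[of "max x x'" "max y y'"]])
    (use g(1) h(1) eq in "auto intro: monic_power le_imp_power_dvd")
  thus ?thesis using power_eq_iff_degree[OF g(1) pos(1)] power_eq_iff_degree[OF h(1) pos(2)] by blast
 qed
 have cj: "conj_poly (g ^ x * h ^ y) = g ^ y * h ^ x" for x y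
  by (simp add: conj_poly_mult conj_poly_power hg h(4) mult.commute)
 have gh: "conj_poly (g * h) = g * h" "monic (g * h)"
  using g(1) h(1) hg h(4) by (auto simp: conj_poly_mult lead_coeff_mult mult.commute)
 have deg: "degree (g * h) = 2 * degree g" using g(1) h(1,5) by (subst degree_mult_eq) auto
 have H: "\<exists>i. ch = (g * h) ^ i" if ch: "monic ch" "ch dvd (g * h) ^ k" "conj_poly ch = ch" for ch k
 proof -
  obtain x y where xy: "ch = g ^ x * h ^ y" using split[OF ch(1,2)] by blast
  hence "x = y" using ch(3) cj uniq by metis
  thus ?thesis using xy by (auto simp: power_mult_distrib)
 qed
 have w: "real (card {ro. monic ro & ro * conj_poly ro = (g * h) ^ k}) = real (k + 1)" for k
 proof -
  have "{ro. monic ro & ro * conj_poly ro = (g * h) ^ k} = (%x. g ^ x * h ^ (k - x)) ` {..k}"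
  proof (intro equalityI subsetI)
   fix ro assume r: "ro \<in> {ro. monic ro & ro * conj_poly ro = (g * h) ^ k}"
   hence rd: "ro dvd (g * h) ^ k" by (metis (mono_tags, lifting) dvd_triv_left mem_Collect_eq)
   obtain x y where xy: "ro = g ^ x * h ^ y" using split[OF _ rd] r by blast
   have "ro * conj_poly ro = g ^ (x + y) * h ^ (x + y)" unfolding xy cj by (simp add: power_add mult_ac)
   hence "g ^ (x + y) * h ^ (x + y) = g ^ k * h ^ k" using r by (simp add: power_mult_distrib)
   hence "x + y = k" using uniq by blast
   thus "ro \<in> (%x. g ^ x * h ^ (k - x)) ` {..k}" using xy by (intro image_eqI[of _ _ x]) auto
  next
   fix ro assume "ro \<in> (%x. g ^ x * h ^ (k - x)) ` {..k}"
   then obtain x where x: "x <= k" and r: "ro = g ^ x * h ^ (k - x)" by auto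
   have "ro * conj_poly ro = (g ^ x * g ^ (k - x)) * (h ^ (k - x) * h ^ x)" unfolding r cj by (simp add: mult_ac)
   also have "... = (g * h) ^ k" using x by (simp add: power_mult_distrib flip: power_add)
   finally show "ro \<in> {ro. monic ro & ro * conj_poly ro = (g * h) ^ k}"
    using g(1) h(1) r by (simp add: lead_coeff_mult lead_coeff_power)
  qed
  moreover have "inj_on (%x. g ^ x * h ^ (k - x)) {..k}" by (rule inj_onI) (use uniq in blast)
  ultimately show ?thesis by (simp add: card_image)
 qed
 have Q: "Q > 1" unfolding Q_def using CARD_field_gt_1[where 'a = 'a] pos by (intro one_less_power) auto
 \<comment> \<open>The constant terms of a polynomial and its monic reciprocal are inverse to each
   other, so no sign defect arises.\<close>
 have c: "coeff (g * h) 0 = 1" using g by (simp add: coeff_mult_0 h_def conj_poly_def)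
 have nz: "g * h ~= 0" using gh by auto
 have fd: "form_dim ((g * h) ^ k) = degree g * k" for k
 proof -
  have "degree ((g * h) ^ k) = k * (2 * degree g)" using nz by (simp add: degree_power_eq deg)
  moreover have "conj_poly ((g * h) ^ k) = (g * h) ^ k" "monic ((g * h) ^ k)" "coeff ((g * h) ^ k) 0 = 1"
   using gh c by (simp_all only: conj_poly_power monic_power coeff_0_power power_one)
  ultimately have "2 * form_dim ((g * h) ^ k) = k * (2 * degree g)"
   by (subst form_dim_double[OF two]) (auto simp: power_mult mult.left_commute[of k])
  thus ?thesis by simp
 qed
 have pos2: "degree (g * h) > 0" using pos deg by simp
 note R = mass_power_recursion[OF two gh pos2 H w[symmetric]]
 have q2: "real CARD('a) ^ (degree (g * h) * k) = Q ^ (2 * k)" for k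
  unfolding Q_def deg by (simp add: mult_ac flip: power_mult)
 have R2: "Abs_fps (%k. real (card (nforms ((g * h) ^ k)))) * Abs_fps (%_. 1) = Abs_fps (%k. Q ^ k)"
  using R(2) unfolding fd power_mult Q_def .
 have "mass ((g * h) ^ Suc k) * (Q ^ Suc k - 1) = Q ^ k * mass ((g * h) ^ k)"
  by (rule geometric_sequence[OF R(1)[unfolded q2] nforms_series_geometric[OF R2] fps_succs Q disjI1[OF refl], where k = k, unfolded power_one])
 thus ?thesis by (simp only: hg)
qed

text \<open>The root 1 or -1 produces one defect exactly for odd powers, so the form dimension is
  rounded up. The norm series is again 1 / (1 - X^2).\<close>

theorem mass_linear_power:
 fixes c :: "'a::{field,finite}"
 assumes two: "(2::'a) ~= 0" and c: "c = 1 \<or> c = -1"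
 defines "q \<equiv> real CARD('a)"
 shows "mass ([:c, 1:] ^ (2 * l + 1)) = mass ([:c, 1:] ^ (2 * l))"
  and "mass ([:c, 1:] ^ (2 * l + 2)) * (q ^ (2 * l + 2) - 1) = q ^ (2 * l + 1) * mass ([:c, 1:] ^ (2 * l))"
proof -
 let ?f = "[:c, 1:]"
 have f: "monic ?f" "conj_poly ?f = ?f" "degree ?f > 0" using c by (auto simp: conj_poly_def reflect_poly_def)
 have irr: "irreducible ?f" by (rule irreducible_linear_field_poly) simp
 have H: "\<exists>i. ch = ?f ^ i" if "monic ch" "ch dvd ?f ^ k" for ch k
  using dvd_irreducible_power[OF f(1) irr that] by blast
 have fd: "form_dim (?f ^ k) = (k + 1) div 2" for k
 proof -
  have "degree (?f ^ k) = k" by (simp add: degree_power_eq)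
  moreover have "coeff (?f ^ k) 0 = c ^ k" by (simp add: coeff_0_power)
  moreover have "c ^ k = 1" if "even k" using that c by auto
  ultimately show ?thesis by (auto simp: form_dim_def)
 qed
 note R = mass_power_recursion[OF two f(2,1,3) H self_conj_norms_of_irreducible[OF f(1) irr f(2), symmetric]]
 have q: "q > 1" unfolding q_def using CARD_field_gt_1[where 'a = 'a] by simp
 have R1: "Abs_fps (%k. q ^ k * mass (?f ^ k)) = Abs_fps (%k. real (card (nforms (?f ^ k)))) * (Abs_fps (%k. if even k then 1 else 0) * Abs_fps (%k. mass (?f ^ k)))"
  using R(1) by (simp add: q_def)
 have R2: "Abs_fps (%k. real (card (nforms (?f ^ k)))) * Abs_fps (%_. 1) = Abs_fps (%k. q ^ ((k + 1) div 2))"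
  using R(2) unfolding fd q_def .
 show "mass (?f ^ (2 * l + 1)) = mass (?f ^ (2 * l))"
  "mass (?f ^ (2 * l + 2)) * (q ^ (2 * l + 2) - 1) = q ^ (2 * l + 1) * mass (?f ^ (2 * l))"
  by (fact symplectic_sequence[OF R1 R2 fps_evens q])+
qed

section \<open>Orbit counting and isometry groups\<close>

lemma card_fibers:
 assumes "finite G" and "!!g. g \<in> G ==> card {x \<in> G. f x = f g} = h"
 shows "card G = card (f ` G) * h"
proof -
 have "card G = (\<Sum>y\<in>f ` G. \<Sum>x | x \<in> G & f x = y. 1)"
  using sum.image_gen[OF assms(1), of "%_. 1::nat" f] by simp
 also have "... = (\<Sum>y\<in>f ` G. h)" by (intro sum.cong refl) (use assms(2) in auto)
 finally show ?thesis by simp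
qed

lemma finite_GL: "finite (GL n :: 'a::{field,finite} mat set)"
 by (rule finite_subset[OF _ finite_carrier_mat[of n n]]) (auto dest: GL_carrier)

lemma isometry_iff:
 assumes "B : mats n n"
 shows "A : isometry_group n B \<longleftrightarrow> A : GL n & bil B A A = B"
proof -
 have "A\<^sup>T * B * A = bil B A A" if "A : GL n"
  using assms GL_dim[OF that] by (simp add: mat_ring)
 thus ?thesis by (auto simp: isometry_group_def)
qed

text \<open>The point \<open>e\<close> may have several columns, so orbits of frames are covered as
  well as orbits of vectors. Closure under products suffices here: left multiplication by a member
  of the finite set \<open>G\<close> is injective, hence onto.\<close>

lemma card_orbit_stabilizer:
 fixes G :: "'k::field mat set"
 assumes G: "G \<subseteq> GL n" "finite G" "!!A D. A \<in> G ==> D \<in> G ==> A * D \<in> G" and e: "dim_row e = n"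
 shows "card G = card ((%A. A * e) ` G) * card {A \<in> G. A * e = e}"
proof (rule card_fibers[OF G(2)])
 fix g assume g: "g \<in> G"
 have d: "dim_row A = n" "dim_col A = n" if "A \<in> G" for A using that G(1) GL_dim by blast+
 have inj: "inj_on (%A. g * A) G"
 proof (rule inj_onI)
  fix A D assume AD: "A \<in> G" "D \<in> G" "g * A = g * D"
  show "A = D" by (rule GL_cancel_left[OF _ AD(3)]) (use g G(1) d AD in auto)
 qed
 have surj: "(%A. g * A) ` G = G"
  by (rule endo_inj_surj[OF G(2) _ inj]) (use G(3) g in auto)
 have as: "g * A * e = g * (A * e)" if "A \<in> G" for A using d[OF g] d[OF that] e by (intro mat_assoc) auto
 have "(%A. g * A) ` {A \<in> G. A * e = e} = {x \<in> G. x * e = g * e}"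
 proof (intro equalityI subsetI)
  fix x assume "x \<in> (%A. g * A) ` {A \<in> G. A * e = e}"
  thus "x \<in> {x \<in> G. x * e = g * e}" using as G(3) g by auto
 next
  fix x assume x: "x \<in> {x \<in> G. x * e = g * e}"
  then obtain A where A: "A \<in> G" "x = g * A" using surj by auto
  have "g * (A * e) = g * e" using x as[OF A(1)] A(2) by simp
  hence "A * e = e" by (rule GL_cancel_left[rotated]) (use g G(1) d A e in auto)
  thus "x \<in> (%A. g * A) ` {A \<in> G. A * e = e}" using A by blast
 qed
 thus "card {x \<in> G. x * e = g * e} = card {A \<in> G. A * e = e}"
  using card_image[OF inj_on_subset[OF inj], of "{A \<in> G. A * e = e}"] by auto
qed

lemma isometry_mult:
 assumes B: "B : mats n n" and A: "A : isometry_group n B" "A' : isometry_group n B"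
 shows "A * A' : isometry_group n B"
proof -
 have 1: "A : GL n" "bil B A A = B" "A' : GL n" "bil B A' A' = B"
  using A B by (auto simp: isometry_iff)
 have "(A * A')\<^sup>T * (B * (A * A')) = A'\<^sup>T * ((bil B A A) * A')"
  using B GL_dim[OF 1(1)] GL_dim[OF 1(3)] by (simp add: mat_ring)
 thus ?thesis using 1 B by (simp add: isometry_iff GL_mult)
qed

lemma finite_isometry_group: "finite (isometry_group n B :: 'a::{field,finite} mat set)"
 by (rule finite_subset[OF _ finite_GL[of n]]) (auto simp: isometry_group_def)

lemma GL_inverse_cancel:
 assumes "P : GL n" "R : GL n" "P * R = im n" "R * P = im n" "dim_row M = n"
 shows "P * (R * M) = M" "R * (P * M) = M" "P\<^sup>T * (R\<^sup>T * M) = M" "R\<^sup>T * (P\<^sup>T * M) = M"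
proof -
 note d = GL_dim[OF assms(1)] GL_dim[OF assms(2)]
 have "P\<^sup>T * R\<^sup>T = (R * P)\<^sup>T" "R\<^sup>T * P\<^sup>T = (P * R)\<^sup>T"
  using d by (simp_all add: mat_ring)
 hence "P\<^sup>T * R\<^sup>T = im n" "R\<^sup>T * P\<^sup>T = im n" by (simp_all add: assms)
 thus "P * (R * M) = M" "R * (P * M) = M" "P\<^sup>T * (R\<^sup>T * M) = M" "R\<^sup>T * (P\<^sup>T * M) = M"
  using d assms(3-5) by (simp_all add: mat_one_left flip: mat_assoc)
qed

text \<open>Conjugation by \<open>P\<close> preserves characteristic polynomials. The predicate
  \<open>S\<close> covers the order of the group and the number of its elements with a given
  characteristic polynomial in one statement.\<close>

lemma isometry_congruence_card_le:
 fixes B :: "'a::{field,finite} mat"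
 assumes B: "B : mats n n" and P: "P : GL n"
 shows "card {A : isometry_group n B. S (char_poly A)} <= card {A : isometry_group n (bil B P P). S (char_poly A)}"
proof -
 obtain R where R: "R : GL n" "P * R = im n" "R * P = im n" using GL_inverse[OF P] by metis
 note R = R GL_inverse_cancel[OF P R]
 note d = GL_dim[OF P] GL_dim[OF R(1)]
 have dB: "dim_row B = n" "dim_col B = n" using B by auto
 show ?thesis
 proof (rule card_inj_on_le[of "%A. R * (A * P)"])
  show "inj_on (%A. R * (A * P)) {A : isometry_group n B. S (char_poly A)}"
  proof (rule inj_on_inverseI[of _ "%A. P * (A * R)"])
   fix A assume "A \<in> {A : isometry_group n B. S (char_poly A)}"
   hence "dim_row A = n" "dim_col A = n" by (auto simp: isometry_group_def dest: GL_dim)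
   thus "P * (R * (A * P) * R) = A" using d R by (simp add: mat_ring)
  qed
  show "(%A. R * (A * P)) ` {A : isometry_group n B. S (char_poly A)} \<subseteq> {A : isometry_group n (bil B P P). S (char_poly A)}"
  proof clarify
   fix A assume A: "A : isometry_group n B" "S (char_poly A)"
   have A': "A : GL n" "bil B A A = B" using A B by (auto simp: isometry_iff)
   note dA = GL_dim[OF A'(1)]
   have "(R * (A * P))\<^sup>T * ((bil B P P) * (R * (A * P))) = P\<^sup>T * ((bil B A A) * P)"
    using d dA dB R by (simp add: mat_ring)
   moreover have "R * (A * P) : GL n" using A' P R(1) by (intro GL_mult)
   ultimately have "R * (A * P) : isometry_group n (bil B P P)"
    using A'(2) B GL_carrier[OF P] by (subst isometry_iff) auto
   moreover have "similar_mat (R * (A * P)) A" unfolding similar_mat_def similar_mat_wit_def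
    by (intro exI[of _ R] exI[of _ P]) (use d dA R in "auto simp: mat_ring Let_def intro!: carrier_matI")
   ultimately show "R * (A * P) : isometry_group n (bil B P P) & S (char_poly (R * (A * P)))"
    using A(2) char_poly_similar by metis
  qed
 qed (use finite_isometry_group finite_subset[of "{A : isometry_group n (bil B P P). S (char_poly A)}"] in blast)
qed

lemma isometry_congruence_card:
 fixes B :: "'a::{field,finite} mat"
 assumes B: "B : mats n n" and P: "P : GL n"
 shows "card {A : isometry_group n (bil B P P). S (char_poly A)} = card {A : isometry_group n B. S (char_poly A)}"
proof (rule antisym[OF _ isometry_congruence_card_le[OF B P]])
 obtain R where R: "R : GL n" "P * R = im n" "R * P = im n" using GL_inverse[OF P] by metis
 have e: "R\<^sup>T * ((bil B P P) * R) = B"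
  using B GL_dim[OF P] GL_dim[OF R(1)] R(2) GL_inverse_cancel(4)[OF P R] by (simp add: mat_ring)
 have c: "bil B P P : mats n n" using B GL_carrier[OF P] by auto
 show "card {A : isometry_group n (bil B P P). S (char_poly A)} <= card {A : isometry_group n B. S (char_poly A)}"
  using isometry_congruence_card_le[OF c R(1), of S] unfolding e .
qed

text \<open>The matrices sending \<open>B\<close> to the same congruent form make up a coset of the
  isometry group of \<open>B\<close>.\<close>

lemma card_congruence_class:
 fixes B :: "'a::{field,finite} mat"
 assumes B: "B : mats n n"
 shows "card (GL n :: 'a mat set) = card ((%P. bil B P P) ` GL n) * card (isometry_group n B)"
proof (rule card_fibers[OF finite_GL])
 fix P :: "'a mat" assume P: "P : GL n"
 obtain R where R: "R : GL n" "P * R = im n" "R * P = im n" using GL_inverse[OF P] by metis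
 note t = GL_inverse_cancel(4)[OF P R]
 note d = GL_dim[OF P] GL_dim[OF R(1)]
 have dB: "dim_row B = n" "dim_col B = n" using B by auto
 show "card {x : GL n. bil B x x = bil B P P} = card (isometry_group n B)"
 proof (rule bij_betw_same_card[OF bij_betw_byWitness[of _ "%A. A * P" "%A. A * R"]])
  show "\<forall>A\<in>{x \<in> GL n. bil B x x = bil B P P}. A * R * P = A"
   using d R by (auto simp: mat_ring dest: GL_dim)
  show "\<forall>A\<in>isometry_group n B. A * P * R = A"
   using d R by (auto simp: mat_ring isometry_group_def dest: GL_dim)
  have e: "(A * M)\<^sup>T * (B * (A * M)) = M\<^sup>T * ((bil B A A) * M)"
   if "A : GL n" "M : GL n" for A M using GL_dim[OF that(1)] GL_dim[OF that(2)] dB by (simp add: mat_ring)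
  show "(%A. A * P) ` isometry_group n B \<subseteq> {x : GL n. bil B x x = bil B P P}"
   using B P e[OF _ P] by (auto simp: isometry_iff GL_mult)
  have "R\<^sup>T * (bil B P P * R) = B" using d dB R(2) by (simp add: mat_ring t)
  thus "(%A. A * R) ` {x : GL n. bil B x x = bil B P P} \<subseteq> isometry_group n B"
   using B R(1) e[OF _ R(1)] by (auto simp: isometry_iff GL_mult)
 qed
qed

lemma smult_mat_eq_0: "s ~= 0 ==> s \<cdot>\<^sub>m M = zm n m ==> M = zm n m" for s :: "'a::field"
proof (rule eq_matI)
 assume s: "s ~= 0" and M: "s \<cdot>\<^sub>m M = zm n m"
 have "dim_row (s \<cdot>\<^sub>m M) = n" "dim_col (s \<cdot>\<^sub>m M) = m" unfolding M by auto
 thus d: "dim_row M = dim_row (zm n m)" "dim_col M = dim_col (zm n m)" by auto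
 fix i k assume "i < dim_row (zm n m :: 'a mat)" "k < dim_col (zm n m :: 'a mat)"
 hence ik: "i < n" "k < m" by auto
 have "(s \<cdot>\<^sub>m M) $$ (i, k) = 0" unfolding M using ik by simp
 thus "M $$ (i, k) = zm n m $$ (i, k)" using s ik d by simp
qed

lemma scaled_gram:
 fixes B :: "'a::field mat"
 assumes "B\<^sup>T = s \<cdot>\<^sub>m B" "B : mats n n" "S : mats n k" "T : mats n l"
 shows "(bil B S T)\<^sup>T = s \<cdot>\<^sub>m (bil B T S)"
proof -
 have "(bil B S T)\<^sup>T = T\<^sup>T * (B\<^sup>T * S)"
  using assms(2-) by (simp add: mat_ring)
 thus ?thesis unfolding assms(1) using assms(2-) by (simp add: mat_ring)
qed

text \<open>The form may be symmetric (\<open>s = 1\<close>) or skew-symmetric (\<open>s = -1\<close>).\<close>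

lemma nondegenerate_complement:
 fixes B :: "'a::{field,finite} mat"
 assumes B: "B : GL n" "B\<^sup>T = s \<cdot>\<^sub>m B" "s ~= 0" and U: "U : mats n u"
  and G: "bil B U U : GL u"
 obtains Z where "u <= n" "Z : mats n (n - u)" "hc U Z : GL n"
  "bil B U Z = zm u (n - u)" "bil B Z U = zm (n - u) u"
  "bil B Z Z : GL (n - u)" "(bil B Z Z)\<^sup>T = s \<cdot>\<^sub>m (bil B Z Z)"
proof -
 note Bc = GL_carrier[OF B(1)]
 obtain Z where u: "u <= n" and Z: "Z : mats n (n - u)" "hc U Z : GL n" "bil B U Z = zm u (n - u)"
  using orthogonal_complement_frame[OF Bc U G] by blast
 have "s \<cdot>\<^sub>m (bil B Z U) = (zm u (n - u))\<^sup>T"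
  using scaled_gram[OF B(2) Bc U Z(1)] Z(3) by simp
 hence "s \<cdot>\<^sub>m (bil B Z U) = zm (n - u) u" by simp
 hence ZU: "bil B Z U = zm (n - u) u" by (rule smult_mat_eq_0[OF B(3)])
 have ZZ: "bil B Z Z : GL (n - u)" by (rule complement_nondegenerate[OF B(1) Z(2) U Z(1,3)])
 have t: "(bil B Z Z)\<^sup>T = s \<cdot>\<^sub>m (bil B Z Z)"
  by (rule scaled_gram[OF B(2) Bc Z(1) Z(1)])
 show thesis by (rule that[of Z]) (fact u Z ZU ZZ t)+
qed

text \<open>A substitute for Witt's extension theorem: matched blocks \<open>U\<close>,
  \<open>U'\<close> and congruent complements are glued. The frame \<open>U\<close>,
  \<open>Z * h\<close> has the Gram matrix that \<open>B'\<close> has on \<open>U'\<close>,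
  \<open>Z'\<close>, and \<open>P\<close> maps one frame to the other.\<close>

lemma congruence_extend:
 fixes B B' :: "'a::field mat"
 assumes B: "B : mats n n" and B': "B' : GL n"
  and U: "U : mats n u" and Z: "Z : mats n m"
  and o: "bil B U Z = zm u m" "bil B Z U = zm m u"
  and U': "U' : mats n u" and Z': "Z' : mats n m" and T': "hc U' Z' : GL n"
  and o': "bil B' U' Z' = zm u m" "bil B' Z' U' = zm m u"
  and G: "bil B U U = bil B' U' U'"
  and h: "h : mats m m" "h\<^sup>T * ((bil B Z Z) * h) = bil B' Z' Z'"
  and n: "n = u + m"
 obtains P where "P : GL n" "bil B P P = B'" "P * U' = U" "P * Z' = Z * h"
proof -
 note B'c = GL_carrier[OF B']
 define T where "T = hc U (Z * h)"
 have Zh: "Z * h : mats n m" using Z h by auto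
 have Tc: "T : mats n n" unfolding T_def n by (rule hc_carrier) (use U Zh n in auto)
 have d: "dim_row U = n" "dim_col U = u" "dim_row Z = n" "dim_col Z = m" "dim_row h = m" "dim_col h = m" "dim_row B = n" "dim_col B = n"
  using U Z h B by auto
 have "U\<^sup>T * (B * (Z * h)) = (bil B U Z) * h" using d by (simp add: mat_ring)
 hence 1: "U\<^sup>T * (B * (Z * h)) = zm u m" unfolding o using d by (simp add: mat_ring)
 have "(Z * h)\<^sup>T * (B * U) = h\<^sup>T * (bil B Z U)" using d by (simp add: mat_ring)
 hence 2: "(Z * h)\<^sup>T * (B * U) = zm m u" unfolding o using d by (simp add: mat_ring)
 have 3: "(Z * h)\<^sup>T * (B * (Z * h)) = h\<^sup>T * ((bil B Z Z) * h)" using d by (simp add: mat_ring)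
 have TT: "bil B T T = (hc U' Z')\<^sup>T * (B' * hc U' Z')"
  unfolding T_def hc_gram[OF B U Zh] hc_gram[OF B'c U' Z'] 1 2 3 h(2) G o' ..
 have "(hc U' Z')\<^sup>T * (B' * hc U' Z') : GL n" using B' T' by (intro GL_mult GL_transpose)
 hence "bil B T T : GL n" using TT by simp
 hence "B * T : GL n" by (rule GL_mult_cancel(2)) (use Tc B in auto)
 hence TG: "T : GL n" by (rule GL_mult_cancel(2)) (use Tc B in auto)
 obtain R where R: "R : GL n" "hc U' Z' * R = im n" "R * hc U' Z' = im n" using GL_inverse[OF T'] by metis
 define P where "P = T * R"
 have PG: "P : GL n" unfolding P_def using TG R by (intro GL_mult)
 note dT = GL_dim[OF TG] and dR = GL_dim[OF R(1)] and dT' = GL_dim[OF T'] and dB' = GL_dim[OF B']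
 have "P * hc U' Z' = T" unfolding P_def using dT dR dT' R(3) by (simp add: mat_assoc mat_one_right)
 hence "hc (P * U') (P * Z') = hc U (Z * h)"
  unfolding T_def using U' Z' GL_dim[OF PG] by (subst mult_hc[symmetric]) auto
 note PU = hc_eqD[OF this]
 have PU: "P * U' = U" "P * Z' = Z * h"
  by (rule PU; use U U' Z Z' h GL_dim[OF PG] in simp)+
 have "bil B P P = R\<^sup>T * ((bil B T T) * R)"
  unfolding P_def using dT dR d by (simp add: mat_assoc mat_transpose_mult)
 also have "... = (hc U' Z' * R)\<^sup>T * (B' * (hc U' Z' * R))"
  unfolding TT using dR dB' dT' by (simp add: mat_assoc mat_transpose_mult)
 also have "... = B'" unfolding R(2) using dB' by (simp add: mat_ring)
 finally show thesis using that PG PU by blast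
qed

section \<open>Skew-symmetric forms and the orders of the symplectic groups\<close>

definition hyp2 :: "'a::field mat" where
 "hyp2 = mat 2 2 (%(i, j). if i = 0 & j = 1 then 1 else if i = 1 & j = 0 then - 1 else 0)"

lemma scalar_mat_eq_iff:
 "M : mats 1 1 ==> N : mats 1 1 ==> M = N \<longleftrightarrow> M $$ (0, 0) = N $$ (0, 0)"
 by (auto intro!: eq_matI)

lemma skew_self_pairing:
 fixes B :: "'a::field mat"
 assumes two: "(2::'a) ~= 0" and B: "B : mats n n" "B\<^sup>T = (-1) \<cdot>\<^sub>m B" and u: "u : mats n 1"
 shows "bil B u u = zm 1 1"
proof -
 let ?c = "bil B u u"
 have c: "?c : mats 1 1" using u B by auto
 have d: "dim_row ?c = 1" "dim_col ?c = 1" using c by (fast dest: carrier_matD)+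
 have "transpose_mat ?c $$ (0, 0) = ?c $$ (0, 0)" by (rule index_transpose_mat(1)) (use d in auto)
 moreover have "transpose_mat ?c = (-1) \<cdot>\<^sub>m ?c" by (rule scaled_gram[OF B(2,1) u u])
 moreover have "((-1) \<cdot>\<^sub>m ?c) $$ (0, 0) = (-1) * ?c $$ (0, 0)" by (rule index_smult_mat(1)) (use d in auto)
 ultimately have "?c $$ (0, 0) = - (?c $$ (0, 0))" by (simp only: mult_minus1)
 hence "2 * ?c $$ (0, 0) = 0" unfolding mult_2 by (metis add.right_inverse)
 hence "?c $$ (0, 0) = 0" using two by (simp only: mult_eq_0_iff) simp
 thus ?thesis using c by (subst scalar_mat_eq_iff) auto
qed

lemma hyp2_iff:
 fixes B :: "'a::field mat"
 assumes two: "(2::'a) ~= 0" and B: "B : mats n n" "B\<^sup>T = (-1) \<cdot>\<^sub>m B"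
  and u: "u : mats n 1" and w: "w : mats n 1"
 shows "(hc u w)\<^sup>T * (B * hc u w) = hyp2 \<longleftrightarrow> bil B u w = im 1"
proof -
 let ?c = "bil B u w"
 have c: "?c : mats 1 1" using u w B by auto
 have wu: "bil B w u = (-1) \<cdot>\<^sub>m ?c"
 proof -
  have "dim_row ?c = 1" "dim_col ?c = 1" using c by (fast dest: carrier_matD)+
  hence "transpose_mat ?c $$ (0, 0) = ?c $$ (0, 0)" by (intro index_transpose_mat(1)) auto
  hence "transpose_mat ?c = ?c" using c scalar_mat_eq_iff[of "transpose_mat ?c" ?c] transpose_carrier_mat by blast
  moreover have "transpose_mat ?c = (-1) \<cdot>\<^sub>m (bil B w u)" by (rule scaled_gram[OF B(2,1) u w])
  ultimately have "(-1) \<cdot>\<^sub>m ?c = (-1) \<cdot>\<^sub>m ((-1) \<cdot>\<^sub>m (bil B w u))" by simp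
  also have "... = bil B w u" by (intro eq_matI) auto
  finally show ?thesis by simp
 qed
 have e: "(hc u w)\<^sup>T * (B * hc u w) = vc (hc (zm 1 1) ?c) (hc ((-1) \<cdot>\<^sub>m ?c) (zm 1 1))"
  unfolding hc_gram[OF B(1) u w] wu skew_self_pairing[OF two B u] skew_self_pairing[OF two B w] ..
 have d: "dim_row ?c = 1" "dim_col ?c = 1" using c by auto
 have ent: "vc (hc (zm 1 1) ?c) (hc ((-1) \<cdot>\<^sub>m ?c) (zm 1 1)) $$ (0, 1) = ?c $$ (0, 0)"
  using d by (simp add: vc_def hc_def)
 show ?thesis
 proof
  assume "(hc u w)\<^sup>T * (B * hc u w) = hyp2"
  hence "?c $$ (0, 0) = (hyp2 :: 'a mat) $$ (0, 1)" using ent e by simp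
  thus "?c = im 1" using c by (subst scalar_mat_eq_iff) (auto simp: hyp2_def)
 next
  assume 1: "?c = im 1"
  show "(hc u w)\<^sup>T * (B * hc u w) = hyp2"
   unfolding e 1 by (rule eq_matI) (auto simp: hyp2_def vc_def hc_def less_2_cases_iff)
 qed
qed

lemma hyp2_GL: "(hyp2 :: 'a::field mat) : GL 2"
proof -
 have c: "(hyp2 :: 'a mat) : mats 2 2" by (simp add: hyp2_def)
 have "hyp2 * ((-1) \<cdot>\<^sub>m hyp2) = (im 2 :: 'a mat)"
  by (rule eq_matI) (auto simp: hyp2_def scalar_prod_def numeral_2_eq_2 less_Suc_eq)
 thus ?thesis by (rule GL_one_sided_inverse) (use c in auto)
qed

text \<open>A nonzero functional takes every value, and its fibres are translates of each other. The
  factor on the left avoids the exponent n - 1.\<close>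

lemma linear_equation_count:
 fixes r :: "'a::{field,finite} mat"
 assumes r: "r : mats 1 n" "r ~= zm 1 n"
 shows "card {w : mats n 1. r * w = im 1} * CARD('a) = CARD('a) ^ n"
proof -
 define f where "f w = (r * w) $$ (0, 0)" for w
 have fin: "finite (mats n 1 :: 'a mat set)" by (rule finite_carrier_mat)
 have add: "f (w + w') = f w + f w'" "f (w - w') = f w - f w'" "f (c \<cdot>\<^sub>m w) = c * f w" if "w : mats n 1" "w' : mats n 1" for w w' c
  using that r unfolding f_def by (auto simp: mat_ring)
 have "\<exists>i<n. r $$ (0, i) ~= 0"
 proof (rule ccontr)
  assume "\<not> (\<exists>i<n. r $$ (0, i) ~= 0)"
  hence "r = zm 1 n" using r(1) by (intro eq_matI) auto
  thus False using r(2) by simp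
 qed
 then obtain i where i: "i < n" "r $$ (0, i) ~= 0" by blast
 define e where "e = mat n 1 (%(k, _). if k = i then inverse (r $$ (0, i)) else 0)"
 have e: "e : mats n 1" by (simp add: e_def)
 have "f e = (\<Sum>k = 0..<n. r $$ (0, k) * (if k = i then inverse (r $$ (0, i)) else 0))"
  unfolding f_def e_def using r(1) by (simp add: scalar_prod_def)
 also have "... = (\<Sum>k = 0..<n. if k = i then 1 else 0)" using i by (intro sum.cong) auto
 also have "... = 1" using i by simp
 finally have fe: "f e = 1" .
 have range: "f ` mats n 1 = UNIV"
 proof -
  have "c \<in> f ` mats n 1" for c
   using add(3)[OF e e, of c] fe e by (intro image_eqI[of _ _ "c \<cdot>\<^sub>m e"]) auto
  thus ?thesis by blast
 qed
 have fib: "card {x : mats n 1. f x = f g} = card {w : mats n 1. f w = 1}" if g: "g : mats n 1" for g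
 proof -
  have ge: "g - e : mats n 1" "f (g - e) = f g - 1" using g e add(2)[OF g e] fe by auto
  show ?thesis
 proof (rule bij_betw_same_card[OF bij_betw_byWitness[of _ "%x. x + (g - e)" "%x. x - (g - e)"]])
  show "\<forall>a\<in>{x \<in> mats n 1. f x = f g}. a - (g - e) + (g - e) = a"
   "\<forall>a\<in>{w \<in> mats n 1. f w = 1}. a + (g - e) - (g - e) = a"
   using g e by (auto intro!: eq_matI)
  show "(%x. x - (g - e)) ` {x : mats n 1. f x = f g} \<subseteq> {w : mats n 1. f w = 1}"
   "(%x. x + (g - e)) ` {w : mats n 1. f w = 1} \<subseteq> {x : mats n 1. f x = f g}"
   using ge minus_carrier_mat[OF ge(1)] by (auto simp: add(1,2)[OF _ ge(1)])
 qed
 qed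
 have "card (mats n 1 :: 'a mat set) = CARD('a) * card {w : mats n 1. f w = 1}"
  using card_fibers[OF fin fib] unfolding range by simp
 moreover have "{w : mats n 1. f w = 1} = {w : mats n 1. r * w = im 1}"
  using r(1) unfolding f_def by (intro Collect_cong conj_cong refl) (subst scalar_mat_eq_iff, auto)
 ultimately show ?thesis using card_carrier_mat[of n 1, where 'a = 'a] by (simp add: mult.commute)
qed

definition hyp_pairs :: "'a::field mat => nat => 'a mat set" where
 "hyp_pairs B n = {U : mats n 2. bil B U U = hyp2}"

text \<open>The first vector is any nonzero one; the second solves a nontrivial linear equation. No
  condition on self-pairings arises because they vanish for skew forms in odd
  characteristic.\<close>

lemma card_hyp_pairs:
 fixes B :: "'a::{field,finite} mat"
 assumes two: "(2::'a) ~= 0" and B: "B : GL n" "B\<^sup>T = (-1) \<cdot>\<^sub>m B"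
 shows "card (hyp_pairs B n) * CARD('a) = (CARD('a) ^ n - 1) * CARD('a) ^ n"
proof -
 note Bc = GL_carrier[OF B(1)]
 let ?E = "mats n 1 - {zm n 1} :: 'a mat set"
 let ?S = "Sigma ?E (%u. {w : mats n 1. u\<^sup>T * B * w = im 1})"
 have as: "u\<^sup>T * B * w = bil B u w" if "u : mats n 1" "w : mats n 1" for u w
  using that Bc by (intro mat_assoc) auto
 have "bij_betw (%(u, w). hc u w) ?S (hyp_pairs B n)"
  unfolding bij_betw_def
 proof (intro conjI equalityI subsetI)
  show "inj_on (%(u, w). hc u w) ?S"
  proof (rule inj_onI)
   fix x y assume xy: "x \<in> ?S" "y \<in> ?S" and eq: "(%(u, w). hc u w) x = (%(u, w). hc u w) y"
   obtain u w u' w' where e: "x = (u, w)" "y = (u', w')" by (cases x, cases y)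
   have "hc u w = hc u' w'" using eq by (simp add: e)
   note h = hc_eqD[OF this]
   have "u = u'" by (rule h(1)) (use xy in "auto simp: e")
   moreover have "w = w'" by (rule h(2)) (use xy in "auto simp: e")
   ultimately show "x = y" by (simp add: e)
  qed
 next
  fix U assume "U \<in> (%(u, w). hc u w) ` ?S"
  then obtain u w where U: "U = hc u w" and uw: "u : mats n 1" "w : mats n 1" "u\<^sup>T * B * w = im 1" by auto
  have "bil B u w = im 1" using uw as by simp
  moreover have "U : mats n 2" unfolding U using hc_carrier[OF uw(1,2)] by (simp add: numeral_2_eq_2)
  ultimately show "U \<in> hyp_pairs B n" using hyp2_iff[OF two Bc B(2) uw(1,2)] by (simp add: hyp_pairs_def U)
 next
  fix U assume "U \<in> hyp_pairs B n"
  hence U: "U : mats n (1 + 1)" "bil B U U = hyp2" by (auto simp: hyp_pairs_def numeral_2_eq_2)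
  obtain u w where uw: "u : mats n 1" "w : mats n 1" "U = hc u w" using hc_split[OF U(1)] by metis
  have 1: "bil B u w = im 1" using hyp2_iff[OF two Bc B(2) uw(1,2)] U uw by simp
  have "u ~= zm n 1"
  proof
   assume "u = zm n 1"
   hence "bil B u w = zm 1 1" using uw Bc by simp
   hence "(im 1 :: 'a mat) $$ (0, 0) = zm 1 1 $$ (0, 0)" using 1 by simp
   thus False by simp
  qed
  hence "(u, w) \<in> ?S" using uw 1 as by simp
  thus "U \<in> (%(u, w). hc u w) ` ?S" using uw(3) by force
 qed
 from bij_betw_same_card[OF this] have "card (hyp_pairs B n) = (\<Sum>u\<in>?E. card {w : mats n 1. u\<^sup>T * B * w = im 1})"
  by (simp add: card_SigmaI finite_carrier_mat)
 hence "card (hyp_pairs B n) * CARD('a) = (\<Sum>u\<in>?E. card {w : mats n 1. u\<^sup>T * B * w = im 1} * CARD('a))"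
  by (simp add: sum_distrib_right)
 also have "... = (\<Sum>u\<in>?E. CARD('a) ^ n)"
 proof (intro sum.cong refl linear_equation_count)
  fix u :: "'a mat" assume u: "u \<in> ?E"
  thus "u\<^sup>T * B : mats 1 n" using Bc by auto
  show "u\<^sup>T * B ~= zm 1 n"
  proof
   assume "u\<^sup>T * B = zm 1 n"
   hence "(u\<^sup>T * B)\<^sup>T = zm n 1" by simp
   moreover have "(u\<^sup>T * B)\<^sup>T = B\<^sup>T * u"
    using u Bc by (subst mat_transpose_mult) (auto dest: carrier_matD)
   ultimately have "B\<^sup>T * u = zm n 1" by simp
   hence "B\<^sup>T * u = B\<^sup>T * zm n 1" using Bc by (simp add: mat_ring)
   hence "u = zm n 1" by (rule GL_cancel_left[OF GL_transpose[OF B(1)]]) (use u in auto)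
   thus False using u by simp
  qed
 qed
 also have "... = (CARD('a) ^ n - 1) * CARD('a) ^ n"
  using card_carrier_mat[of n 1, where 'a = 'a] by (simp add: card_Diff_singleton)
 finally show ?thesis .
qed

lemma hyp_pair_exists:
 fixes B :: "'a::{field,finite} mat"
 assumes two: "(2::'a) ~= 0" and B: "B : GL n" "B\<^sup>T = (-1) \<cdot>\<^sub>m B" and n: "n > 0"
 shows "hyp_pairs B n ~= {}"
proof
 assume "hyp_pairs B n = {}"
 hence "(CARD('a) ^ n - 1) * CARD('a) ^ n = 0" using card_hyp_pairs[OF assms(1-3)] by simp
 moreover have "CARD('a) ^ n > 1" using CARD_field_gt_1[where 'a = 'a] n by (intro one_less_power)
 ultimately show False by simp
qed

text \<open>Split off a hyperbolic plane on both sides; the orthogonal complements are nondegenerate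
  skew forms of smaller dimension and the two congruences glue.\<close>

lemma skew_congruent:
 fixes B B' :: "'a::{field,finite} mat"
 assumes two: "(2::'a) ~= 0"
 shows "B : GL n ==> B\<^sup>T = (-1) \<cdot>\<^sub>m B ==> B' : GL n ==> B'\<^sup>T = (-1) \<cdot>\<^sub>m B'
  ==> \<exists>P\<in>GL n. bil B P P = B'"
proof (induction n arbitrary: B B' rule: less_induct)
 case (less n)
 show ?case
 proof (cases "n = 0")
  case True
  have "(im 0)\<^sup>T * (B * im 0) = B'"
   using less.prems(1,3) True by (intro eq_matI) (auto dest: GL_dim)
  thus ?thesis using GL_one True by blast
 next
  case False
  obtain U where U: "U : mats n 2" "bil B U U = hyp2"
   using hyp_pair_exists[OF two less.prems(1,2)] False by (auto simp: hyp_pairs_def)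
  obtain U' where U': "U' : mats n 2" "bil B' U' U' = hyp2"
   using hyp_pair_exists[OF two less.prems(3,4)] False by (auto simp: hyp_pairs_def)
  have s: "(-1::'a) ~= 0" by simp
  obtain Z where Z: "2 <= n" "Z : mats n (n - 2)" "hc U Z : GL n"
   "bil B U Z = zm 2 (n - 2)" "bil B Z U = zm (n - 2) 2"
   "bil B Z Z : GL (n - 2)" "(bil B Z Z)\<^sup>T = (-1) \<cdot>\<^sub>m (bil B Z Z)"
   using nondegenerate_complement[OF less.prems(1,2) s U(1)] U(2) hyp2_GL by metis
  obtain Z' where Z': "2 <= n" "Z' : mats n (n - 2)" "hc U' Z' : GL n"
   "bil B' U' Z' = zm 2 (n - 2)" "bil B' Z' U' = zm (n - 2) 2"
   "bil B' Z' Z' : GL (n - 2)" "(bil B' Z' Z')\<^sup>T = (-1) \<cdot>\<^sub>m (bil B' Z' Z')"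
   using nondegenerate_complement[OF less.prems(3,4) s U'(1)] U'(2) hyp2_GL by metis
  have "n - 2 < n" using Z(1) by simp
  from less.IH[OF this Z(6,7) Z'(6,7)] obtain h where h: "h : GL (n - 2)" "h\<^sup>T * ((bil B Z Z) * h) = bil B' Z' Z'"
   by blast
  have G: "bil B U U = bil B' U' U'" using U U' by simp
  have nn: "n = 2 + (n - 2)" using Z(1) by simp
  obtain P where "P : GL n" "bil B P P = B'" "P * U' = U" "P * Z' = Z * h"
   by (rule congruence_extend[OF GL_carrier[OF less.prems(1)] less.prems(3) U(1) Z(2,4,5) U'(1) Z'(2-5) G GL_carrier[OF h(1)] h(2) nn])
  thus ?thesis by blast
 qed
qed

text \<open>An isometry fixing the nondegenerate block \<open>U\<close> preserves its orthogonal
  complement, so it is determined by an isometry of that complement, and each of these extends by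
  the identity on \<open>U\<close>.\<close>

lemma card_isometry_stabilizer:
 fixes B :: "'a::field mat"
 assumes B: "B : GL n" and U: "U : mats n u" and Z: "Z : mats n m" and T: "hc U Z : GL n"
  and o: "bil B U Z = zm u m" "bil B Z U = zm m u"
  and G: "bil B U U : GL u" and n: "n = u + m"
 shows "card {A : isometry_group n B. A * U = U} = card (isometry_group m (bil B Z Z))"
proof -
 note Bc = GL_carrier[OF B]
 let ?C = "bil B Z Z"
 have Cc: "?C : mats m m" using Z Bc by auto
 have d: "dim_row U = n" "dim_col U = u" "dim_row Z = n" "dim_col Z = m" "dim_row B = n" "dim_col B = n"
  using U Z Bc by auto
 have ex: "\<exists>h. h : isometry_group m ?C & A * Z = Z * h" if A: "A : isometry_group n B" "A * U = U" for A
 proof -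
  have A': "A : GL n" "bil B A A = B" using A Bc by (auto simp: isometry_iff)
  note dA = GL_dim[OF A'(1)]
  obtain R where R: "R : GL n" "hc U Z * R = im n" using GL_inverse[OF T] by metis
  have "R * (A * Z) : mats (u + m) m" using GL_dim[OF R(1)] dA d n by auto
  then obtain r h where rh: "r : mats u m" "h : mats m m" "R * (A * Z) = vc r h"
   using vc_split by metis
  have "A * Z = hc U Z * (R * (A * Z))" using R GL_dim[OF R(1)] GL_dim[OF T] dA d by (simp add: mat_one_left flip: mat_assoc)
  also have "... = U * r + Z * h" unfolding rh(3) using rh d by (intro hc_mult_vc) auto
  finally have AZ: "A * Z = U * r + Z * h" .
  \<comment> \<open>Since \<open>A\<close> fixes \<open>U\<close>, the image of \<open>Z\<close>
    remains orthogonal to \<open>U\<close>; this kills the coordinate \<open>r\<close> along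
    \<open>U\<close>.\<close>
  have "U\<^sup>T * (B * (A * Z)) = (A * U)\<^sup>T * (B * (A * Z))" using A(2) by simp
  also have "... = U\<^sup>T * ((bil B A A) * Z)" using d dA by (simp add: mat_ring)
  also have "... = zm u m" using A'(2) o(1) by simp
  finally have "U\<^sup>T * (B * (U * r + Z * h)) = zm u m" unfolding AZ .
  moreover define G0 where "G0 = bil B U U"
  have "U\<^sup>T * (B * (U * r + Z * h)) = G0 * r + (bil B U Z) * h"
   unfolding G0_def using d rh by (simp add: mat_ring)
  moreover have "dim_row G0 = u" "dim_col G0 = u" unfolding G0_def using d by auto
  ultimately have "G0 * r = G0 * zm u m"
   unfolding o(1) using rh by (simp add: mat_ring)
  hence "r = zm u m" by (rule GL_cancel_left[OF G[folded G0_def]]) (use rh in auto)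
  hence AZ: "A * Z = Z * h" using AZ rh d by (simp add: mat_ring)
  have "h\<^sup>T * (?C * h) = (Z * h)\<^sup>T * (B * (Z * h))" using d rh by (simp add: mat_ring)
  also have "... = Z\<^sup>T * ((bil B A A) * Z)" unfolding AZ[symmetric] using d dA by (simp add: mat_ring)
  finally have hC: "h\<^sup>T * (?C * h) = ?C" using A'(2) by simp
  have "?C : GL m" by (rule complement_nondegenerate[OF B T U Z o(1)])
  hence "h\<^sup>T * (?C * h) : GL m" using hC by simp
  hence "?C * h : GL m" by (rule GL_mult_cancel(2)) (use rh Cc in auto)
  hence "h : GL m" by (rule GL_mult_cancel(2)) (use rh Cc in auto)
  thus ?thesis using hC AZ Cc by (auto simp: isometry_iff)
 qed
 have inj: "A = A'" if "A * U = A' * U" "A * Z = A' * Z" "A : GL n" "A' : GL n" for A A'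
 proof -
  have e: "A * hc U Z = A' * hc U Z" using that d GL_dim[OF that(3)] GL_dim[OF that(4)] by (simp add: mult_hc)
  obtain R where R: "R : GL n" "hc U Z * R = im n" using GL_inverse[OF T] by metis
  have "A * hc U Z * R = A' * hc U Z * R" unfolding e ..
  thus ?thesis using R GL_dim[OF R(1)] GL_dim[OF T] GL_dim[OF that(3)] GL_dim[OF that(4)] by (simp add: mat_assoc mat_one_right)
 qed
 have injZ: "h = h'" if "Z * h = Z * h'" "h : mats m m" "h' : mats m m" for h h'
 proof -
  have "?C * h = Z\<^sup>T * (B * (Z * h))" using d that by (simp add: mat_ring)
  also have "... = ?C * h'" unfolding that(1) using d that by (simp add: mat_ring)
  finally have e: "?C * h = ?C * h'" .
  show ?thesis by (rule GL_cancel_left[OF complement_nondegenerate[OF B T U Z o(1)] e]) (use that in auto)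
 qed
 define f where "f A = (SOME h. h : isometry_group m ?C & A * Z = Z * h)" for A
 have f: "f A : isometry_group m ?C" "A * Z = Z * f A" if "A : isometry_group n B" "A * U = U" for A
  using someI_ex[OF ex[OF that]] unfolding f_def by auto
 have "bij_betw f {A : isometry_group n B. A * U = U} (isometry_group m ?C)"
  unfolding bij_betw_def
 proof (intro conjI equalityI subsetI)
  show "inj_on f {A : isometry_group n B. A * U = U}"
  proof (rule inj_onI)
   fix A A' assume A: "A \<in> {A : isometry_group n B. A * U = U}" "A' \<in> {A : isometry_group n B. A * U = U}" and e: "f A = f A'"
   show "A = A'" by (rule inj) (use A f[of A] f[of A'] e in "auto simp: isometry_group_def")
  qed
 next
  fix h assume "h \<in> f ` {A : isometry_group n B. A * U = U}"
  thus "h : isometry_group m ?C" using f by auto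
 next
  fix h assume h: "h : isometry_group m ?C"
  hence h': "h : GL m" "h\<^sup>T * (?C * h) = ?C" using Cc by (auto simp: isometry_iff)
  obtain P where P: "P : GL n" "bil B P P = B" "P * U = U" "P * Z = Z * h"
   by (rule congruence_extend[OF Bc B U Z o U Z T o refl GL_carrier[OF h'(1)] h'(2) n])
  hence PI: "P : isometry_group n B" using Bc by (simp add: isometry_iff)
  have hc: "h : mats m m" "f P : mats m m"
   using GL_carrier h f(1)[OF PI P(3)] by (auto simp: isometry_group_def)
  have "h = f P" by (rule injZ) (use f(2)[OF PI P(3)] P(4) hc in auto)
  thus "h \<in> f ` {A : isometry_group n B. A * U = U}" using PI P(3) by blast
 qed
 thus ?thesis by (rule bij_betw_same_card)
qed

text \<open>The group is transitive on hyperbolic pairs, since complements of two such pairs are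
  congruent, and the stabilizer is the isometry group in dimension n - 2. The comparison with an
  arbitrary \<open>C\<close> is needed because the complement found is not in standard form.\<close>

lemma card_isometry_skew:
 fixes B C :: "'a::{field,finite} mat"
 assumes two: "(2::'a) ~= 0" and B: "B : GL n" "B\<^sup>T = (-1) \<cdot>\<^sub>m B" and n: "n > 0"
  and C: "C : GL (n - 2)" "C\<^sup>T = (-1) \<cdot>\<^sub>m C"
 shows "card (isometry_group n B) * CARD('a) = (CARD('a) ^ n - 1) * CARD('a) ^ n * card (isometry_group (n - 2) C)"
proof -
 note Bc = GL_carrier[OF B(1)]
 have s: "(-1::'a) ~= 0" by simp
 obtain U where U: "U \<in> hyp_pairs B n" using hyp_pair_exists[OF two B n] by blast
 have compl: "\<exists>Z. 2 <= n & Z : mats n (n - 2) & hc V Z : GL n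
   & bil B V Z = zm 2 (n - 2) & bil B Z V = zm (n - 2) 2
   & bil B Z Z : GL (n - 2) & (bil B Z Z)\<^sup>T = (-1) \<cdot>\<^sub>m (bil B Z Z)"
  if V: "V \<in> hyp_pairs B n" for V
 proof -
  have V: "V : mats n 2" "bil B V V : GL 2" using V hyp2_GL by (auto simp: hyp_pairs_def)
  show ?thesis by (rule nondegenerate_complement[OF B s V]) blast
 qed
 obtain Z where Z: "2 <= n" "Z : mats n (n - 2)" "hc U Z : GL n"
   "bil B U Z = zm 2 (n - 2)" "bil B Z U = zm (n - 2) 2"
   "bil B Z Z : GL (n - 2)" "(bil B Z Z)\<^sup>T = (-1) \<cdot>\<^sub>m (bil B Z Z)"
  using compl[OF U] by blast
 have Uc: "U : mats n 2" and Ug: "bil B U U = hyp2" using U by (auto simp: hyp_pairs_def)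
 have nn: "n = 2 + (n - 2)" using Z(1) by simp
 have GU: "bil B U U : GL 2" using Ug hyp2_GL by simp
 have img: "(%A. A * U) ` isometry_group n B = hyp_pairs B n"
 proof (intro equalityI subsetI)
  fix V assume "V \<in> (%A. A * U) ` isometry_group n B"
  then obtain A where A: "V = A * U" "A : GL n" "bil B A A = B" using Bc by (auto simp: isometry_iff)
  have "bil B V V = U\<^sup>T * ((bil B A A) * U)"
   unfolding A(1) using GL_dim[OF A(2)] Bc Uc by (simp add: mat_ring)
  thus "V \<in> hyp_pairs B n" using A Ug Uc GL_carrier[OF A(2)] by (simp add: hyp_pairs_def)
 next
  fix V assume V: "V \<in> hyp_pairs B n"
  hence Vc: "V : mats n 2" and Vg: "bil B V V = hyp2" by (auto simp: hyp_pairs_def)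
  obtain Y where Y: "2 <= n" "Y : mats n (n - 2)" "hc V Y : GL n"
   "bil B V Y = zm 2 (n - 2)" "bil B Y V = zm (n - 2) 2"
   "bil B Y Y : GL (n - 2)" "(bil B Y Y)\<^sup>T = (-1) \<cdot>\<^sub>m (bil B Y Y)"
   using compl[OF V] by blast
  obtain h where h: "h : GL (n - 2)" "h\<^sup>T * ((bil B Y Y) * h) = bil B Z Z"
   using skew_congruent[OF two Y(6,7) Z(6,7)] by blast
  have G: "bil B V V = bil B U U" using Ug Vg by simp
  obtain P where "P : GL n" "bil B P P = B" "P * U = V"
   by (rule congruence_extend[OF Bc B(1) Vc Y(2,4,5) Uc Z(2-5) G GL_carrier[OF h(1)] h(2) nn])
  thus "V \<in> (%A. A * U) ` isometry_group n B" using Bc by (force simp: isometry_iff)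
 qed
 have "card (isometry_group n B) = card (hyp_pairs B n) * card {A : isometry_group n B. A * U = U}"
  unfolding img[symmetric]
  by (rule card_orbit_stabilizer[OF _ finite_isometry_group isometry_mult[OF Bc]])
   (use Uc in "auto simp: isometry_group_def")
 moreover have "card {A : isometry_group n B. A * U = U} = card (isometry_group (n - 2) (bil B Z Z))"
  by (rule card_isometry_stabilizer[OF B(1) Uc Z(2-5) GU nn])
 moreover have "card (isometry_group (n - 2) C) = card (isometry_group (n - 2) (bil B Z Z))"
 proof -
  obtain P where P: "P : GL (n - 2)" "P\<^sup>T * ((bil B Z Z) * P) = C"
   using skew_congruent[OF two Z(6,7) C] by blast
  show ?thesis using isometry_congruence_card[OF GL_carrier[OF Z(6)] P(1), of "%_. True"] unfolding P(2) by simp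
 qed
 ultimately have "card (isometry_group n B) * CARD('a) = (card (hyp_pairs B n) * CARD('a)) * card (isometry_group (n - 2) C)"
  by simp
 thus ?thesis unfolding card_hyp_pairs[OF two B] .
qed

definition sympl :: "nat => 'a::field mat" where
 "sympl l = four_block_mat (zm l l) (im l) (- im l) (zm l l)"

lemma sympl_GL: "(sympl l :: 'a::field mat) : GL (2 * l)" and sympl_skew: "(sympl l :: 'a mat)\<^sup>T = (-1) \<cdot>\<^sub>m sympl l"
proof -
 have c: "(sympl l :: 'a mat) : mats (2 * l) (2 * l)"
  using four_block_carrier_mat[of "zm l l :: 'a mat" l l "zm l l" l l "im l" "- im l"] by (simp add: sympl_def mult_2)
 have "sympl l * ((-1) \<cdot>\<^sub>m sympl l) = (-1) \<cdot>\<^sub>m (sympl l * sympl l :: 'a mat)" using c by (intro mult_smult_distrib)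
 also have "sympl l * sympl l = four_block_mat (- im l :: 'a mat) (zm l l) (zm l l) (- im l)"
  unfolding sympl_def by (subst mult_four_block_mat[of _ l l _ l _ l _ _ l _ l]) auto
 also have "(-1) \<cdot>\<^sub>m ... = (im (2 * l) :: 'a mat)" by (rule eq_matI) auto
 finally show "(sympl l :: 'a mat) : GL (2 * l)" by (rule GL_one_sided_inverse) (use c in auto)
 show "(sympl l :: 'a mat)\<^sup>T = (-1) \<cdot>\<^sub>m sympl l"
  unfolding sympl_def by (rule eq_matI) auto
qed

lemma card_Sp_0: "card (Sp 0 :: 'a::field mat set) = 1"
proof -
 have "(Sp 0 :: 'a mat set) = {im 0}"
 proof (intro equalityI subsetI)
  fix A :: "'a mat" assume "A \<in> Sp 0"
  hence "A : mats 0 0" by (auto simp: Sp_def isometry_group_def dest: GL_carrier)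
  thus "A \<in> {im 0}" by (auto intro!: eq_matI)
 next
  fix A :: "'a mat" assume "A \<in> {im 0}"
  hence "A = im 0" by simp
  moreover have "(im 0)\<^sup>T * (sympl 0 * im 0) = (sympl 0 :: 'a mat)"
   by (rule eq_matI) (auto simp: sympl_def)
  moreover have "(sympl 0 :: 'a mat) : mats 0 0" by (rule carrier_matI) (auto simp: sympl_def)
  ultimately show "A \<in> Sp 0" using GL_one[of 0, where 'a = 'a] by (simp add: Sp_def isometry_iff flip: sympl_def)
 qed
 thus ?thesis by simp
qed

lemma card_Sp_step:
 assumes two: "(2::'a::{field,finite}) ~= 0"
 shows "real (card (Sp (2 * l + 2) :: 'a mat set))
  = (real CARD('a) ^ (2 * l + 2) - 1) * real CARD('a) ^ (2 * l + 1) * real (card (Sp (2 * l) :: 'a mat set))"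
proof -
 let ?q = "CARD('a)"
 have S: "Sp (2 * k) = isometry_group (2 * k) (sympl k :: 'a mat)" for k by (simp add: Sp_def sympl_def)
 have S1: "Sp (2 * l + 2) = isometry_group (2 * l + 2) (sympl (Suc l) :: 'a mat)" using S[of "Suc l"] by simp
 have C: "(sympl l :: 'a mat) : GL (2 * Suc l - 2)" using sympl_GL[of l, where 'a = 'a] by simp
 have "card (isometry_group (2 * Suc l) (sympl (Suc l) :: 'a mat)) * ?q
  = (?q ^ (2 * Suc l) - 1) * ?q ^ (2 * Suc l) * card (isometry_group (2 * Suc l - 2) (sympl l :: 'a mat))"
  by (rule card_isometry_skew[OF two sympl_GL sympl_skew _ C sympl_skew]) simp
 moreover have "2 * Suc l - 2 = 2 * l" "2 * Suc l = 2 * l + 2" by simp_all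
 ultimately have "card (Sp (2 * l + 2) :: 'a mat set) * ?q = (?q ^ (2 * l + 2) - 1) * ?q ^ (2 * l + 2) * card (Sp (2 * l) :: 'a mat set)"
  by (simp only: S[of l] S1)
 hence "card (Sp (2 * l + 2) :: 'a mat set) * ?q = (?q ^ (2 * l + 2) - 1) * ?q ^ (2 * l + 1) * card (Sp (2 * l) :: 'a mat set) * ?q"
  by (simp add: mult_ac)
 hence "card (Sp (2 * l + 2) :: 'a mat set) = (?q ^ (2 * l + 2) - 1) * ?q ^ (2 * l + 1) * card (Sp (2 * l) :: 'a mat set)"
  by simp
 moreover have "?q ^ (2 * l + 2) >= 1" by simp
 ultimately show ?thesis by (simp add: of_nat_diff)
qed

section \<open>The two congruence classes of nondegenerate symmetric forms\<close>

lemma card_nonzero_squares: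
 assumes two: "(2::'a::{field,finite}) ~= 0"
 shows "CARD('a) - 1 = card ((%x :: 'a. x\<^sup>2) ` (UNIV - {0})) * 2"
proof -
 have "card {x \<in> UNIV - {0}. x\<^sup>2 = g\<^sup>2} = 2" if g: "g \<in> UNIV - {0}" for g :: 'a
 proof -
  have "{x \<in> UNIV - {0}. x\<^sup>2 = g\<^sup>2} = {g, - g}" using g by (auto simp: power2_eq_iff)
  moreover have "g ~= - g"
  proof
   assume "g = - g"
   hence "2 * g = 0" unfolding mult_2 by (metis add.right_inverse)
   thus False using two g by simp
  qed
  ultimately show ?thesis by simp
 qed
 from card_fibers[OF _ this] show ?thesis by (simp add: card_Diff_singleton)
qed

text \<open>Pigeonhole: there are (q + 1) / 2 squares including 0, so the values a x^2 and the
  values 1 - b y^2 cannot be disjoint.\<close>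

lemma two_squares_represent_one:
 fixes a b :: "'a::{field,finite}"
 assumes two: "(2::'a) ~= 0" and ab: "a ~= 0" "b ~= 0"
 shows "\<exists>x y. a * x\<^sup>2 + b * y\<^sup>2 = 1"
proof (rule ccontr)
 assume no: "\<not> ?thesis"
 define S where "S = insert 0 ((%x :: 'a. x\<^sup>2) ` (UNIV - {0}))"
 have S: "\<exists>x. s = x\<^sup>2" if "s \<in> S" for s using that unfolding S_def by (auto intro: exI[of _ 0])
 have "card S = card ((%x :: 'a. x\<^sup>2) ` (UNIV - {0})) + 1" unfolding S_def by (subst card_insert_disjoint) auto
 hence cS: "2 * card S = CARD('a) + 1" using card_nonzero_squares[OF two] CARD_field_gt_1[where 'a = 'a] by linarith
 have "card ((*) a ` S) = card S" "card ((%z. 1 - b * z) ` S) = card S"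
  using ab by (auto intro!: card_image inj_onI)
 moreover have "(*) a ` S \<inter> (%z. 1 - b * z) ` S = {}"
 proof (rule ccontr)
  assume "(*) a ` S \<inter> (%z. 1 - b * z) ` S ~= {}"
  then obtain s t where st: "s \<in> S" "t \<in> S" "a * s = 1 - b * t" by auto
  then obtain x y where "s = x\<^sup>2" "t = y\<^sup>2" using S by blast
  hence "a * x\<^sup>2 + b * y\<^sup>2 = 1" using st(3) by simp
  thus False using no by blast
 qed
 ultimately have "card ((*) a ` S \<union> (%z. 1 - b * z) ` S) = 2 * card S" by (simp add: card_Un_disjoint)
 moreover have "card ((*) a ` S \<union> (%z. 1 - b * z) ` S) <= CARD('a)" by (rule card_mono) auto
 ultimately show False using cS by simp
qed

text \<open>Multiples of nonzero squares by a nonsquare are nonsquares, and there are as many of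
  them as there are nonsquares; so every nonsquare is such a multiple.\<close>

lemma nonsquare_mult_nonsquare:
 fixes x y :: "'a::{field,finite}"
 assumes two: "(2::'a) ~= 0" and x: "\<nexists>t. x = t\<^sup>2" and y: "\<nexists>t. y = t\<^sup>2"
 shows "\<exists>t. x * y = t\<^sup>2"
proof -
 define S where "S = (%x :: 'a. x\<^sup>2) ` (UNIV - {0})"
 have nz: "x ~= 0" "y ~= 0" using x y by (metis zero_power2)+
 have sub: "(*) x ` S \<subseteq> UNIV - {0} - S"
 proof
  fix z assume "z \<in> (*) x ` S"
  then obtain s where s: "s ~= 0" "z = x * s\<^sup>2" by (auto simp: S_def)
  have "z \<notin> S"
  proof
   assume "z \<in> S"
   then obtain t where "z = t\<^sup>2" by (auto simp: S_def)
   hence "x = (t / s)\<^sup>2" using s by (simp add: power_divide field_simps)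
   thus False using x by blast
  qed
  thus "z \<in> UNIV - {0} - S" using s nz by auto
 qed
 have "card (UNIV - {0} - S) = CARD('a) - 1 - card S" unfolding S_def by (subst card_Diff_subset) (auto simp: card_Diff_singleton)
 hence "card (UNIV - {0} - S) = card S" using card_nonzero_squares[OF two] unfolding S_def[symmetric] by simp
 moreover have "card ((*) x ` S) = card S" using nz by (auto intro!: card_image inj_onI)
 ultimately have "(*) x ` S = UNIV - {0} - S" using sub by (intro card_subset_eq) auto
 moreover have "y \<in> UNIV - {0} - S" using nz y by (auto simp: S_def)
 ultimately have "y \<in> (*) x ` S" by simp
 then obtain s where "y = x * s\<^sup>2" by (auto simp: S_def)
 hence "x * y = (x * s)\<^sup>2" by (simp add: power2_eq_square)
 thus ?thesis by blast
qed

definition pairing :: "'a::field mat => 'a mat => 'a mat => 'a" where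
 "pairing B u w = (bil B u w) $$ (0, 0)"

lemma pairing_lincomb:
 fixes B :: "'a::field mat"
 assumes B: "B : mats n n" "B\<^sup>T = B" and u: "u : mats n 1" "w : mats n 1"
 shows "pairing B (x \<cdot>\<^sub>m u + y \<cdot>\<^sub>m w) (x \<cdot>\<^sub>m u + y \<cdot>\<^sub>m w)
  = x\<^sup>2 * pairing B u u + 2 * (x * y * pairing B u w) + y\<^sup>2 * pairing B w w"
proof -
 have d: "dim_row u = n" "dim_col u = 1" "dim_row w = n" "dim_col w = 1" "dim_row B = n" "dim_col B = n" using u B by auto
 have "bil B w u = (bil B u w)\<^sup>T"
  using gram_transpose[OF B(2,1) u] by simp
 hence wu: "(bil B w u) $$ (0, 0) = pairing B u w"
  unfolding pairing_def using d by (simp only: index_transpose_mat index_mult_mat transpose_mat_def) auto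
 have "(x \<cdot>\<^sub>m u + y \<cdot>\<^sub>m w)\<^sup>T * (B * (x \<cdot>\<^sub>m u + y \<cdot>\<^sub>m w))
  = (x \<cdot>\<^sub>m (x \<cdot>\<^sub>m (bil B u u)) + x \<cdot>\<^sub>m (y \<cdot>\<^sub>m (bil B w u)))
  + (y \<cdot>\<^sub>m (x \<cdot>\<^sub>m (bil B u w)) + y \<cdot>\<^sub>m (y \<cdot>\<^sub>m (bil B w w)))" (is "_ = ?R")
 proof -
  have sd: "c \<cdot>\<^sub>m (M + N) = c \<cdot>\<^sub>m M + c \<cdot>\<^sub>m N" if "M : mats 1 1" "N : mats 1 1" for c and M N :: "'a mat"
   using that by (intro eq_matI) (auto simp: distrib_left)
  have "(x \<cdot>\<^sub>m u + y \<cdot>\<^sub>m w)\<^sup>T * (B * (x \<cdot>\<^sub>m u + y \<cdot>\<^sub>m w))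
   = x \<cdot>\<^sub>m (x \<cdot>\<^sub>m (bil B u u) + y \<cdot>\<^sub>m (bil B w u))
    + y \<cdot>\<^sub>m (x \<cdot>\<^sub>m (bil B u w) + y \<cdot>\<^sub>m (bil B w w))"
   using d by (simp add: mat_ring)
  also have "... = ?R" using u B by (subst (1 2) sd) auto
  finally show ?thesis .
 qed
 hence "pairing B (x \<cdot>\<^sub>m u + y \<cdot>\<^sub>m w) (x \<cdot>\<^sub>m u + y \<cdot>\<^sub>m w) = ?R $$ (0, 0)" by (simp only: pairing_def)
 also have "... = x * (x * pairing B u u) + x * (y * (bil B w u) $$ (0, 0)) + (y * (x * pairing B u w) + y * (y * pairing B w w))"
  using d by (simp add: pairing_def)
 finally show ?thesis unfolding wu by (simp add: algebra_simps power2_eq_square)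
qed

text \<open>Polarization: if all self-pairings vanished, then so would twice every pairing. Yet for
  any nonzero \<open>u\<close>, here the vector of ones, some \<open>w\<close> has pairing 1 with
  it.\<close>

lemma anisotropic_vector_exists:
 fixes B :: "'a::{field,finite} mat"
 assumes two: "(2::'a) ~= 0" and B: "B : GL n" "B\<^sup>T = B" and n: "n >= 1"
 shows "\<exists>v\<in>mats n 1. pairing B v v ~= 0"
proof (rule ccontr)
 assume "\<not> ?thesis"
 hence z: "pairing B v v = 0" if "v : mats n 1" for v using that by blast
 note Bc = GL_carrier[OF B(1)]
 define u :: "'a mat" where "u = mat n 1 (%_. 1)"
 have u: "u : mats n 1" by (simp add: u_def)
 have "u\<^sup>T * B ~= zm 1 n"
 proof
  assume "u\<^sup>T * B = zm 1 n"
  hence "(u\<^sup>T * B)\<^sup>T = zm n 1" by simp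
  moreover have "(u\<^sup>T * B)\<^sup>T = B * u"
   using u Bc B(2) by (subst mat_transpose_mult) (auto dest: carrier_matD)
  ultimately have "B * u = B * zm n 1" using Bc by (simp add: mat_ring)
  hence "u = zm n 1" by (rule GL_cancel_left[OF B(1)]) (use u in auto)
  hence "u $$ (0, 0) = zm n 1 $$ (0, 0)" by simp
  thus False using n by (simp add: u_def)
 qed
 moreover have rc: "u\<^sup>T * B : mats 1 n" using u Bc by auto
 ultimately have "card {w : mats n 1. u\<^sup>T * B * w = im 1} * CARD('a) = CARD('a) ^ n" by (intro linear_equation_count)
 hence "{w : mats n 1. u\<^sup>T * B * w = im 1} ~= {}" by (metis card.empty mult_0 power_not_zero zero_less_card_finite less_irrefl)
 then obtain w where w: "w : mats n 1" "u\<^sup>T * B * w = im 1" by blast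
 hence "bil B u w = im 1" using u Bc by (subst mat_assoc[symmetric]) auto
 hence "pairing B u w = 1" by (simp add: pairing_def)
 moreover have "1 \<cdot>\<^sub>m u + 1 \<cdot>\<^sub>m w : mats n 1" using u w by auto
 ultimately have "2 * (1::'a) = 0"
  using pairing_lincomb[OF Bc B(2) u w(1), of 1 1] z u w(1) by simp
 thus False using two by simp
qed

lemma pairing_one_iff:
 assumes "B : mats n n" "u : mats n 1"
 shows "bil B u u = im 1 \<longleftrightarrow> pairing B u u = 1"
 using assms by (subst scalar_mat_eq_iff) (auto simp: pairing_def)

lemma one_by_one_GL: "M : mats 1 1 ==> M : GL 1 \<longleftrightarrow> M $$ (0, 0) ~= 0"
 by (simp add: GL_iff_det det_single)

text \<open>Two orthogonal anisotropic vectors, one in the complement of the other, span a diagonal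
  binary form, and such a form represents 1.\<close>

lemma sym_represents_one:
 fixes B :: "'a::{field,finite} mat"
 assumes two: "(2::'a) ~= 0" and B: "B : GL n" "B\<^sup>T = B" and n: "n >= 2"
 shows "\<exists>u\<in>mats n 1. bil B u u = im 1"
proof -
 note Bc = GL_carrier[OF B(1)]
 obtain v where v: "v : mats n 1" "pairing B v v ~= 0" using anisotropic_vector_exists[OF two B] n by auto
 have G: "bil B v v : GL 1"
  by (subst one_by_one_GL) (use v Bc in "auto simp: pairing_def")
 have B1: "B\<^sup>T = 1 \<cdot>\<^sub>m B" unfolding B(2) by (rule eq_matI) auto
 obtain Z where Z: "1 <= n" "Z : mats n (n - 1)" "hc v Z : GL n"
  "bil B v Z = zm 1 (n - 1)" "bil B Z v = zm (n - 1) 1"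
  "bil B Z Z : GL (n - 1)" "(bil B Z Z)\<^sup>T = 1 \<cdot>\<^sub>m (bil B Z Z)"
  by (rule nondegenerate_complement[OF B(1) B1 one_neq_zero v(1) G])
 have "(bil B Z Z)\<^sup>T = bil B Z Z" using gram_transpose[OF B(2) Bc Z(2,2)] .
 moreover have n1: "n - 1 >= 1" using n by simp
 ultimately obtain c where c: "c : mats (n - 1) 1" "pairing (bil B Z Z) c c ~= 0"
  using anisotropic_vector_exists[OF two Z(6) _ n1] by blast
 have w: "Z * c : mats n 1" using Z(2) c(1) by auto
 have "(Z * c)\<^sup>T * (B * (Z * c)) = c\<^sup>T * ((bil B Z Z) * c)"
  using Z(2) c(1) Bc by (simp add: mat_ring)
 hence ww: "pairing B (Z * c) (Z * c) ~= 0" using c(2) by (simp add: pairing_def)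
 have "v\<^sup>T * (B * (Z * c)) = (bil B v Z) * c" using v(1) Z(2) c(1) Bc by (simp add: mat_ring)
 also have "... = zm 1 1" unfolding Z(4) using c(1) by (simp add: mat_ring)
 finally have vw: "pairing B v (Z * c) = 0" by (simp add: pairing_def)
 obtain x y where xy: "pairing B v v * x\<^sup>2 + pairing B (Z * c) (Z * c) * y\<^sup>2 = 1"
  using two_squares_represent_one[OF two v(2) ww] by blast
 let ?u = "x \<cdot>\<^sub>m v + y \<cdot>\<^sub>m (Z * c)"
 have u: "?u : mats n 1" using v(1) w by auto
 have "pairing B ?u ?u = 1" unfolding pairing_lincomb[OF Bc B(2) v(1) w] vw using xy by (simp add: mult.commute)
 hence "transpose_mat ?u * (B * ?u) = im 1" using pairing_one_iff[OF Bc u] by simp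
 thus ?thesis using u by blast
qed

lemma det_transpose_mult: 
 fixes B P :: "'a::field mat"
 assumes "B : mats n n" "P : mats n n"
 shows "det (bil B P P) = (det P)\<^sup>2 * det B"
proof -
 have "det (bil B P P) = det (P\<^sup>T) * (det B * det P)"
  using assms by (subst det_mult[of _ n]) (auto simp: det_mult)
 thus ?thesis using det_transpose[OF assms(2)] by (simp add: power2_eq_square)
qed

lemma det_diag_blocks:
 fixes C :: "'a::field mat"
 assumes "A : mats u u" "C : mats m m"
 shows "det (vc (hc A (zm u m)) (hc (zm m u) C)) = det A * det C"
 using assms by (subst four_block_hc_vc[symmetric]) (auto intro!: det_four_block_mat_lower_left_zero)

text \<open>Split off a vector of norm 1 on both sides and compare complements. Their determinants
  again differ by a square, because a change of basis multiplies a Gram determinant by a square; in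
  dimension one the square root is the congruence.\<close>

theorem sym_congruent:
 fixes B B' :: "'a::{field,finite} mat"
 assumes two: "(2::'a) ~= 0"
 shows "n >= 1 ==> B : GL n ==> B\<^sup>T = B ==> B' : GL n ==> B'\<^sup>T = B'
  ==> det B' = x\<^sup>2 * det B ==> \<exists>P\<in>GL n. bil B P P = B'"
proof (induction n arbitrary: B B' x rule: less_induct)
 case (less n)
 note Bc = GL_carrier[OF less.prems(2)] and B'c = GL_carrier[OF less.prems(4)]
 show ?case
 proof (cases "n = 1")
  case True
  have nz: "det B' ~= 0" using less.prems(4) by (simp add: GL_iff_det)
  define P where "P = mat 1 1 (%_. x)"
  have P: "P : mats 1 1" "P $$ (0, 0) = x" by (auto simp: P_def)
  have "x ~= 0" using nz less.prems(6) by auto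
  hence PG: "P : GL n" using one_by_one_GL[OF P(1)] P True by simp
  have B1: "B : mats 1 1" "B' : mats 1 1" using Bc B'c True by auto
  have "det (bil B P P) = det B'"
   unfolding det_transpose_mult[OF B1(1) P(1)] less.prems(6) using P by (simp add: det_single)
  moreover have c: "bil B P P : mats 1 1" using P B1 by auto
  ultimately have "bil B P P = B'"
   using scalar_mat_eq_iff[OF c B1(2)] det_single[OF c] det_single[OF B1(2)] by metis
  thus ?thesis using PG by blast
 next
  case False
  hence n2: "n >= 2" using less.prems(1) by simp
  obtain U where U: "U : mats n 1" "bil B U U = im 1"
   using sym_represents_one[OF two less.prems(2,3) n2] by blast
  obtain U' where U': "U' : mats n 1" "bil B' U' U' = im 1"
   using sym_represents_one[OF two less.prems(4,5) n2] by blast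
  have s1: "B\<^sup>T = 1 \<cdot>\<^sub>m B" "B'\<^sup>T = 1 \<cdot>\<^sub>m B'" unfolding less.prems by (rule eq_matI; auto)+
  have G1: "bil B U U : GL 1" "bil B' U' U' : GL 1"
   unfolding U(2) U'(2) by (rule GL_one)+
  obtain Z where Z: "1 <= n" "Z : mats n (n - 1)" "hc U Z : GL n"
   "bil B U Z = zm 1 (n - 1)" "bil B Z U = zm (n - 1) 1"
   "bil B Z Z : GL (n - 1)"
   by (rule nondegenerate_complement[OF less.prems(2) s1(1) one_neq_zero U(1) G1(1)])
  obtain Z' where Z': "1 <= n" "Z' : mats n (n - 1)" "hc U' Z' : GL n"
   "bil B' U' Z' = zm 1 (n - 1)" "bil B' Z' U' = zm (n - 1) 1"
   "bil B' Z' Z' : GL (n - 1)"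
   by (rule nondegenerate_complement[OF less.prems(4) s1(2) one_neq_zero U'(1) G1(2)])
  have D: "det (bil B Z Z) = (det (hc U Z))\<^sup>2 * det B"
   using det_transpose_mult[OF Bc GL_carrier[OF Z(3)]] unfolding hc_gram[OF Bc U(1) Z(2)] Z(4,5) U(2)
   using det_diag_blocks[OF one_carrier_mat GL_carrier[OF Z(6)], of 1] by simp
  have D': "det (bil B' Z' Z') = (det (hc U' Z'))\<^sup>2 * det B'"
   using det_transpose_mult[OF B'c GL_carrier[OF Z'(3)]] unfolding hc_gram[OF B'c U'(1) Z'(2)] Z'(4,5) U'(2)
   using det_diag_blocks[OF one_carrier_mat GL_carrier[OF Z'(6)], of 1] by simp
  have "det (hc U Z) ~= 0" using Z(3) by (simp add: GL_iff_det)
  hence DD: "det (bil B' Z' Z') = (x * det (hc U' Z') / det (hc U Z))\<^sup>2 * det (bil B Z Z)"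
   unfolding D D' less.prems(6) by (simp add: power_divide power_mult_distrib)
  have "n - 1 < n" "n - 1 >= 1" using n2 by auto
  from less.IH[OF this Z(6) gram_transpose[OF less.prems(3) Bc Z(2,2)] Z'(6) gram_transpose[OF less.prems(5) B'c Z'(2,2)] DD]
  obtain h where h: "h : GL (n - 1)" "h\<^sup>T * ((bil B Z Z) * h) = bil B' Z' Z'"
   by blast
  have G: "bil B U U = bil B' U' U'" using U U' by simp
  have nn: "n = 1 + (n - 1)" using n2 by simp
  obtain P where "P : GL n" "bil B P P = B'"
   by (rule congruence_extend[OF Bc less.prems(4) U(1) Z(2,4,5) U'(1) Z'(2-5) G GL_carrier[OF h(1)] h(2) nn])
  thus ?thesis by blast
 qed
qed

lemma card_pairs_sum:
 fixes \<phi> :: "'a::{field,finite} poly"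
 shows "card (pairs n \<phi>) = (\<Sum>B | B : GL n & B\<^sup>T = B. card {A : isometry_group n B. char_poly A = \<phi>})"
proof -
 let ?S = "{B :: 'a mat. B : GL n & B\<^sup>T = B}"
 let ?T = "Sigma ?S (%B. {A : isometry_group n B. char_poly A = \<phi>})"
 have "bij_betw prod.swap ?T (pairs n \<phi>)"
  unfolding bij_betw_def
 proof (intro conjI equalityI subsetI)
  show "inj_on prod.swap ?T" by (rule inj_onI) (metis swap_swap)
 next
  fix x assume "x \<in> prod.swap ` ?T"
  then obtain A B where x: "x = (A, B)" "B : GL n" "B\<^sup>T = B" "A : isometry_group n B" "char_poly A = \<phi>" by auto
  thus "x \<in> pairs n \<phi>" using isometry_iff[OF GL_carrier[OF x(2)]] GL_carrier by (auto simp: pairs_def)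
 next
  fix x assume xp: "x \<in> pairs n \<phi>"
  obtain A B where x: "x = (A, B)" by (cases x)
  note p = pairsD[OF xp[unfolded x]]
  have "(B, A) \<in> ?T" using p isometry_iff[OF p(3)] by simp
  thus "x \<in> prod.swap ` ?T" unfolding x by force
 qed
 from bij_betw_same_card[OF this] have "card (pairs n \<phi>) = card ?T" by simp
 also have "... = (\<Sum>B\<in>?S. card {A : isometry_group n B. char_poly A = \<phi>})"
 proof (rule card_SigmaI)
  show "finite ?S" by (rule finite_subset[OF _ finite_GL[of n]]) auto
  show "\<forall>B\<in>?S. finite {A : isometry_group n B. char_poly A = \<phi>}"
  proof
   show "finite {A : isometry_group n B. char_poly A = \<phi>}" for B
    by (rule finite_subset[OF _ finite_isometry_group[of n B]]) auto
  qed
 qed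
 finally show ?thesis .
qed

text \<open>The determinants of the representatives differ by a nonsquare, so their classes are
  disjoint, and they exhaust all forms because the product of two nonsquares is a square. A class
  has |GL_n| divided by the order of its isometry group members, which turns its share of the mass
  into a proportion.\<close>

theorem mass_two_classes:
 fixes \<phi> :: "'a::{field,finite} poly"
 assumes two: "(2::'a) ~= 0" and n: "n >= 1" "degree \<phi> = n"
  and B1: "B1 : GL n" "B1\<^sup>T = B1" and B2: "B2 : GL n" "B2\<^sup>T = B2"
  and ns: "\<nexists>x. det B1 * det B2 = x\<^sup>2"
 shows "mass \<phi> = char_poly_proportion (isometry_group n B1) \<phi> + char_poly_proportion (isometry_group n B2) \<phi>"
proof -
 define S where "S = {B :: 'a mat. B : GL n & B\<^sup>T = B}"
 define K where "K B = (%P. bil B P P) ` GL n" for B :: "'a mat"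
 define c where "c B = card {A : isometry_group n B. char_poly A = \<phi>}" for B
 have nz: "det B1 ~= 0" "det B2 ~= 0" using B1 B2 by (auto simp: GL_iff_det)
 have KS: "K B \<subseteq> S" if B: "B : GL n" "B\<^sup>T = B" for B
 proof
  fix y assume "y : K B"
  then obtain P where P: "y = bil B P P" "P : GL n" by (auto simp: K_def)
  show "y \<in> S" unfolding S_def P(1)
   using gram_transpose[OF B(2) GL_carrier[OF B(1)] GL_carrier[OF P(2)] GL_carrier[OF P(2)]] P(2) B(1)
   by (auto intro: GL_mult GL_transpose)
 qed
 have KD: "\<exists>p. p ~= 0 & det y = p\<^sup>2 * det B" if B: "B : GL n" and y: "y : K B" for B y
 proof -
  obtain P where P: "y = bil B P P" "P : GL n" using y by (auto simp: K_def)
  show ?thesis unfolding P(1) using det_transpose_mult[OF GL_carrier[OF B] GL_carrier[OF P(2)]] P(2)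
   by (auto simp: GL_iff_det)
 qed
 have KI: "B : K C" if B: "B \<in> S" and C: "C : GL n" "C\<^sup>T = C" and x: "det B * det C = x\<^sup>2" for B C x
 proof -
  have cz: "det C ~= 0" using C by (simp add: GL_iff_det)
  have "det B = (x / det C)\<^sup>2 * det C" using x cz by (simp add: power_divide power2_eq_square field_simps)
  then obtain P where "P : GL n" "bil C P P = B"
   using sym_congruent[OF two n(1) C] B unfolding S_def by blast
  thus ?thesis unfolding K_def by force
 qed
 have un: "S = K B1 \<union> K B2"
 proof (intro equalityI subsetI)
  fix B assume B: "B \<in> S"
  show "B : K B1 \<union> K B2"
  proof (cases "\<exists>x. det B * det B1 = x\<^sup>2")
   case True
   thus ?thesis using KI[OF B B1] by blast
  next
   case False
   then obtain t where "(det B * det B1) * (det B1 * det B2) = t\<^sup>2"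
    using nonsquare_mult_nonsquare[OF two _ ns, of "det B * det B1"] by blast
   hence "det B * det B2 = (t / det B1)\<^sup>2" using nz by (simp add: power_divide power2_eq_square field_simps)
   thus ?thesis using KI[OF B B2] by blast
  qed
 qed (use KS[OF B1] KS[OF B2] in auto)
 have dis: "K B1 \<inter> K B2 = {}"
 proof (rule ccontr)
  assume "K B1 \<inter> K B2 ~= {}"
  then obtain y where y: "y : K B1" "y : K B2" by blast
  obtain p r where p: "p ~= 0" "det y = p\<^sup>2 * det B1" and r: "det y = r\<^sup>2 * det B2"
   using KD[OF B1(1) y(1)] KD[OF B2(1) y(2)] by blast
  have "p\<^sup>2 * det B1 = r\<^sup>2 * det B2" using p r by simp
  hence "det B1 * det B2 = (r * det B2 / p)\<^sup>2" using p(1) by (simp add: power_divide power2_eq_square field_simps)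
  thus False using ns by blast
 qed
 have cK: "c y = c B" if B: "B : GL n" and y: "y : K B" for B y
 proof -
  obtain P where P: "y = bil B P P" "P : GL n" using y by (auto simp: K_def)
  show ?thesis unfolding c_def P(1) by (rule isometry_congruence_card[OF GL_carrier[OF B] P(2)])
 qed
 have finK: "finite (K B)" for B unfolding K_def using finite_GL by blast
 have "card (pairs n \<phi>) = sum c S" unfolding card_pairs_sum S_def c_def ..
 also have "... = sum c (K B1) + sum c (K B2)" unfolding un by (rule sum.union_disjoint[OF finK finK dis])
 also have "sum c (K B1) = card (K B1) * c B1" using cK[OF B1(1)] by simp
 also have "sum c (K B2) = card (K B2) * c B2" using cK[OF B2(1)] by simp
 finally have p: "card (pairs n \<phi>) = card (K B1) * c B1 + card (K B2) * c B2" .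
 have g: "card (GL n :: 'a mat set) = card (K B) * card (isometry_group n B)" if "B : GL n" for B
  unfolding K_def by (rule card_congruence_class[OF GL_carrier[OF that]])
 have quot: "real (card (K B) * c B) / real (card (GL n :: 'a mat set)) = char_poly_proportion (isometry_group n B) \<phi>" if B: "B : GL n" for B
 proof -
  have "card (K B) ~= 0" using g[OF B] card_GL_pos[of n, where 'a = 'a] by auto
  thus ?thesis unfolding g[OF B] char_poly_proportion_def c_def by simp
 qed
 show ?thesis unfolding mass_def n(2) p of_nat_add add_divide_distrib quot[OF B1(1)] quot[OF B2(1)] ..
qed

lemma diag_block_pair:
 "diag_block_mat [A, B] = four_block_mat A (zm (dim_row A) (dim_col B)) (zm (dim_row B) (dim_col A)) B"
 using diag_block_mat.simps(2)[of A "[B]"] by (simp only: diag_block_mat_singleton Let_def)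

lemma diag_block_pair_form:
 fixes A B :: "'a::field mat"
 assumes "A : GL a" "A\<^sup>T = A" "B : GL b" "B\<^sup>T = B"
 shows "diag_block_mat [A, B] : GL (a + b)" "(diag_block_mat [A, B])\<^sup>T = diag_block_mat [A, B]"
  "det (diag_block_mat [A, B]) = det A * det B"
proof -
 have d: "A : mats a a" "B : mats b b" using assms GL_carrier by auto
 have e: "diag_block_mat [A, B] = four_block_mat A (zm a b) (zm b a) B" unfolding diag_block_pair using d by auto
 have D: "det (four_block_mat A (zm a b) (zm b a) B) = det A * det B"
  by (rule det_four_block_mat_lower_left_zero) (use d in auto)
 thus "det (diag_block_mat [A, B]) = det A * det B" unfolding e .
 show "diag_block_mat [A, B] : GL (a + b)" unfolding e using D assms d by (auto simp: GL_iff_det)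
 show "(diag_block_mat [A, B])\<^sup>T = diag_block_mat [A, B]"
  unfolding e by (subst transpose_four_block_mat) (use d assms in auto)
qed

lemma hyperbolic_form_props:
 "(hyperbolic_form l :: 'a::field mat) : GL (2 * l)" "(hyperbolic_form l)\<^sup>T = (hyperbolic_form l :: 'a mat)"
 "det (hyperbolic_form l :: 'a mat) = (-1) ^ l"
proof -
 have "det (hyperbolic_form l :: 'a mat) = det (zm l l * zm l l - im l * im l :: 'a mat)"
  unfolding hyperbolic_form_def by (rule det_four_block_mat) auto
 also have "zm l l * zm l l - im l * im l = (-1) \<cdot>\<^sub>m (im l :: 'a mat)" by (rule eq_matI) auto
 finally show D: "det (hyperbolic_form l :: 'a mat) = (-1) ^ l" by simp
 have "(hyperbolic_form l :: 'a mat) : mats (2 * l) (2 * l)"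
  by (rule carrier_matI) (auto simp: hyperbolic_form_def)
 thus "(hyperbolic_form l :: 'a mat) : GL (2 * l)" using D by (simp add: GL_iff_det)
 show "(hyperbolic_form l)\<^sup>T = (hyperbolic_form l :: 'a mat)"
  unfolding hyperbolic_form_def by (subst transpose_four_block_mat) auto
qed

text \<open>All that has to be checked is that the two defining forms differ by a nonsquare. For
  even n the determinants are (-1)^l and (-1)^(l-1) times -\<delta>; for odd n scaling by \<delta>
  multiplies the determinant by the odd power \<delta>^n.\<close>

theorem mass_eq_proportions:
 fixes \<phi> :: "'a::{field,finite} poly"
 assumes two: "(2::'a) ~= 0" and n: "n >= 1" "degree \<phi> = n" and \<delta>: "\<nexists>x. \<delta> = x\<^sup>2"
 shows "mass \<phi> = char_poly_proportion (O_plus n) \<phi> + char_poly_proportion (O_minus \<delta> n) \<phi>"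
proof -
 have \<delta>0: "\<delta> ~= 0" using \<delta> by (metis zero_power2)
 let ?p = "form_plus n :: 'a mat" and ?m = "form_minus \<delta> n"
 have "?p : GL n & transpose_mat ?p = ?p & ?m : GL n & transpose_mat ?m = ?m & (\<exists>t. t ~= 0 & det ?p * det ?m = \<delta> * t\<^sup>2)"
 proof (cases "even n")
  case True
  then obtain l where l: "n = 2 * l" by (elim evenE)
  hence l0: "l = Suc (l - 1)" using n by simp
  let ?D = "mat_of_rows_list 2 [[1, 0], [0, - \<delta>]]"
  have D: "?D : mats 2 2" by (rule carrier_matI) (auto simp: mat_of_rows_list_def)
  have De: "?D = mat 2 2 (%(i, k). if i = k then if i = 0 then 1 else - \<delta> else 0)"
   by (rule eq_matI) (auto simp: mat_of_rows_list_def less_2_cases_iff)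
  have ut: "upper_triangular ?D" by (auto simp: mat_of_rows_list_def upper_triangular_def less_2_cases_iff numeral_2_eq_2 less_Suc_eq)
  have dD: "det ?D = - \<delta>" unfolding det_upper_triangular[OF ut D]
   by (simp add: diag_mat_def mat_of_rows_list_def numeral_2_eq_2)
  have DG: "?D : GL 2" using D dD \<delta>0 by (simp add: GL_iff_det)
  have Ds: "transpose_mat ?D = ?D"
   unfolding De by (rule eq_matI) auto
  note h = hyperbolic_form_props[of "l - 1", where 'a = 'a]
  note m = diag_block_pair_form[OF h(1,2) DG Ds]
  have p: "?p = hyperbolic_form l" and q: "?m = diag_block_mat [hyperbolic_form (l - 1), ?D]"
   using True l by (simp_all add: form_plus_def form_minus_def)
  have nn: "2 * (l - 1) + 2 = n" using l l0 by simp
  have "det ?p * det ?m = \<delta> * ((-1) ^ l)\<^sup>2"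
   unfolding p q m(3) h(3) dD hyperbolic_form_props(3)[of l] by (subst (1 3) l0) (simp add: power2_eq_square)
  thus ?thesis using hyperbolic_form_props(1,2)[of l, where 'a = 'a] m(1,2) l unfolding p q nn
   by (intro conjI exI[of _ "(-1) ^ l"]) auto
 next
  case False
  then obtain l where l: "n = 2 * l + 1" by (elim oddE)
  note m = diag_block_pair_form[OF GL_one transpose_one hyperbolic_form_props(1,2), of 1 l, where 'a = 'a]
  have p: "?p = diag_block_mat [im 1, hyperbolic_form l]" and q: "?m = \<delta> \<cdot>\<^sub>m ?p"
   using False l by (simp_all add: form_plus_def form_minus_def)
  have "1 + 2 * l = n" using l by simp
  from m(1)[unfolded this] have pG: "?p : GL n" unfolding p .
  have pt: "transpose_mat ?p = ?p" unfolding p by (rule m(2))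
  have dp: "det ?p ~= 0" and pc: "?p : mats n n" using pG by (auto simp: GL_iff_det)
  have dm: "det ?m = \<delta> ^ n * det ?p" unfolding q using pc by simp
  have "?m : GL n" using dm dp \<delta>0 pc by (simp add: GL_iff_det q)
  moreover have "transpose_mat ?m = ?m" unfolding q using pt by (simp add: transpose_smult)
  moreover have "det ?p * det ?m = \<delta> * (\<delta> ^ l * det ?p)\<^sup>2" 
  proof -
   have "\<delta> ^ n = \<delta> * (\<delta> ^ l)\<^sup>2" unfolding l by (simp add: mult.commute[of 2] flip: power_mult)
   thus ?thesis unfolding dm by (simp add: power_mult_distrib power2_eq_square mult_ac)
  qed
  ultimately show ?thesis using pG pt dp \<delta>0 by (intro conjI exI[of _ "\<delta> ^ l * det ?p"]) auto
 qed
 then obtain t where P: "?p : GL n" "transpose_mat ?p = ?p" and M: "?m : GL n" "transpose_mat ?m = ?m"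
  and t: "t ~= 0" "det ?p * det ?m = \<delta> * t\<^sup>2" by blast
 have "\<nexists>x. det ?p * det ?m = x\<^sup>2"
 proof
  assume "\<exists>x. det ?p * det ?m = x\<^sup>2"
  then obtain x where "\<delta> * t\<^sup>2 = x\<^sup>2" using t by auto
  hence "\<delta> = (x / t)\<^sup>2" using t(1) by (simp add: power_divide field_simps)
  thus False using \<delta> by blast
 qed
 from mass_two_classes[OF two n P M this] show ?thesis by (simp add: O_plus_def O_minus_def)
qed

section \<open>General linear groups over the finite subfields of an algebraic closure\<close>

lemma elements_mat_subset_iff:
 "elements_mat A \<subseteq> K \<longleftrightarrow> (\<forall>i<dim_row A. \<forall>j<dim_col A. A $$ (i, j) : K)"
 by (auto simp: elements_mat_def UN_subset_iff image_subset_iff)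

text \<open>A repeated root would also be a root of the derivative, so the multiset of roots is a
  set. Both the size of the fixed field and the fibres of the norm are counted in this way.\<close>

lemma card_roots_separable:
 fixes f :: "'k::alg_closed_field poly"
 assumes f: "f ~= 0" and sep: "!!x. poly f x = 0 ==> poly (pderiv f) x ~= 0"
 shows "card {x. poly f x = 0} = degree f"
proof -
 obtain S where S: "size S = degree f" "f = smult (lead_coeff f) (\<Prod>x\<in>#S. [:-x, 1:])"
  using alg_closed_imp_factorization[OF f] by blast
 have l: "lead_coeff f ~= 0" using f by simp
 have root: "poly f x = 0 \<longleftrightarrow> x \<in># S" for x
  by (subst S(2)) (use l in "auto simp: poly_prod_mset prod_mset_zero_iff")
 have "count S x <= 1" for x
 proof (rule ccontr)
  assume "\<not> count S x <= 1"
  hence "{#x, x#} \<subseteq># S" by (auto simp: subseteq_mset_def)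
  then obtain T where "S = {#x, x#} + T" by (metis subset_mset.add_diff_inverse)
  hence "f = smult (lead_coeff f) ([:-x, 1:] * ([:-x, 1:] * (\<Prod>x\<in>#T. [:-x, 1:])))" using S(2) by simp
  hence "f = [:-x, 1:] * ([:-x, 1:] * smult (lead_coeff f) (\<Prod>x\<in>#T. [:-x, 1:]))" by simp
  then obtain h where h: "f = [:-x, 1:] * ([:-x, 1:] * h)" by blast
  have "poly f x = 0" by (subst h) simp
  moreover have "poly (pderiv f) x = 0" by (subst h) (simp only: pderiv_mult poly_add poly_mult, simp)
  ultimately show False using sep by blast
 qed
 hence "S = mset_set (set_mset S)" by (intro multiset_eqI) (metis count_mset_set(1,3) count_eq_zero_iff finite_set_mset le_antisym not_in_iff count_greater_eq_one_iff)
 hence "size S = card (set_mset S)" by (metis size_mset_set)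
 moreover have "{x. poly f x = 0} = set_mset S" using root by auto
 ultimately show ?thesis using S(1) by simp
qed

text \<open>\<open>Q\<close> stands for a power of the characteristic, so that \<open>x \<mapsto> x ^ Q\<close> is a field endomorphism.\<close>

locale frobenius =
 fixes ty :: "'k::alg_closed_field itself" and Q :: nat
 assumes add: "!!x y :: 'k. (x + y) ^ Q = x ^ Q + y ^ Q" and Q1: "Q > 1" and Q0: "of_nat Q = (0 :: 'k)"
begin

abbreviation K :: "'k set" where "K \<equiv> fixed_field Q"

lemma frob_0: "(0::'k) ^ Q = 0" using Q1 by simp

lemma frob_minus: "(- x :: 'k) ^ Q = - (x ^ Q)"
proof -
 have "(x + - x) ^ Q = x ^ Q + (- x) ^ Q" by (rule add)
 thus ?thesis using frob_0 by (simp add: add_eq_0_iff)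
qed

lemma frob_sum: "(\<Sum>i\<in>A. f i :: 'k) ^ Q = (\<Sum>i\<in>A. f i ^ Q)"
 by (induction A rule: infinite_finite_induct) (simp_all add: add frob_0)

lemma K_closed: "0 : K" "1 : K" "x : K ==> y : K ==> x + y : K" "x : K ==> y : K ==> x * y : K" "x : K ==> - x : K"
 "x : K ==> y : K ==> x - y : K" "x : K ==> inverse x : K"
 using frob_0 add[of x "- y"] by (auto simp: fixed_field_def add power_mult_distrib frob_minus power_inverse)

lemma K_sum: "(!!i. i \<in> A ==> f i : K) ==> sum f A : K"
 by (induction A rule: infinite_finite_induct) (simp_all add: K_closed)

text \<open>The fixed field is the root set of x^Q - x, whose derivative is -1 because Q vanishes in
  the field.\<close>

lemma card_K: "card K = Q" and finite_K: "finite K"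
proof -
 let ?f = "monom 1 Q - [:0, 1:] :: 'k poly"
 have deg: "degree ?f = Q"
  unfolding diff_conv_add_uminus using Q1 by (subst degree_add_eq_left) (auto simp: degree_monom_eq)
 have nz: "?f ~= 0" using deg Q1 by auto
 have "pderiv ?f = [:-1:]" using Q0 by (simp add: pderiv_diff pderiv_monom pderiv_pCons one_pCons)
 hence "card {x. poly ?f x = 0} = Q" using card_roots_separable[OF nz] deg by simp
 moreover have "{x. poly ?f x = 0} = K" by (auto simp: fixed_field_def poly_monom)
 ultimately show "card K = Q" by simp
 thus "finite K" using Q1 by (metis card.infinite not_less0)
qed

lemma mult_entries:
 assumes "elements_mat A \<subseteq> K" "elements_mat D \<subseteq> K" "dim_col A = dim_row D"
 shows "elements_mat (A * D) \<subseteq> K"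
 using assms unfolding elements_mat_subset_iff by (auto simp: scalar_prod_def intro!: K_sum K_closed)

lemma finite_GL_over: "finite (GL_over n Q :: 'k mat set)"
proof (rule finite_subset[OF _ card_matrices_over(1)[OF finite_K, of n n]])
 show "(GL_over n Q :: 'k mat set) \<subseteq> {A : mats n n. elements_mat A \<subseteq> K}"
  by (auto simp: GL_over_def dest: GL_carrier)
qed

lemma GL_over_mult: "A : GL_over n Q ==> D : GL_over n Q ==> A * D : GL_over n (Q :: nat)" for A D :: "'k mat"
 unfolding GL_over_def using mult_entries[of A D] GL_dim by (auto simp: GL_mult)

definition e1 :: "nat => 'k mat" where
 "e1 m = vc (im 1) (zm m 1)"

lemma e1_carrier: "e1 m : mats (Suc m) 1"
 unfolding e1_def using vc_carrier[of "im 1 :: 'k mat" 1 1 "zm m 1" m] by simp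

lemma hc_e1:
 assumes "v : mats (Suc m) 1" "W : mats (Suc m) m"
 shows "hc v W * e1 m = v"
 unfolding e1_def using assms by (subst hc_mult_vc) (auto simp: mat_ring)

lemma e1_entries: "elements_mat (e1 m) \<subseteq> K"
 unfolding elements_mat_subset_iff e1_def by (auto simp: vc_def K_closed)

lemma first_column_stabilizer:
 assumes A: "A : GL (Suc m)" "A * e1 m = e1 m"
 obtains r C where "r : mats 1 m" "C : GL m" "A = four_block_mat (im 1) r (zm m 1) C"
proof -
 have "A : mats (Suc m) (1 + m)" using GL_carrier[OF A(1)] by simp
 then obtain v W where vW: "v : mats (Suc m) 1" "W : mats (Suc m) m" "A = hc v W" using hc_split by metis
 have v: "v = e1 m" using hc_e1[OF vW(1,2)] A(2) vW(3) by simp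
 have "W : mats (1 + m) m" using vW(2) by simp
 then obtain r C where rC: "r : mats 1 m" "C : mats m m" "W = vc r C" using vc_split by metis
 have Ae: "A = four_block_mat (im 1) r (zm m 1) C"
  unfolding vW(3) v rC(3) e1_def using rC four_block_hc_vc[of "im 1 :: 'k mat" 1 1 r m "zm m 1" m C]
   vc_hc[of "im 1 :: 'k mat" 1 1 r m "zm m 1" m C] by simp
 have "det A = det (im 1 :: 'k mat) * det C" unfolding Ae by (rule det_four_block_mat_lower_left_zero) (use rC in auto)
 hence "C : GL m" using A(1) rC by (simp add: GL_iff_det)
 thus thesis using that rC Ae by blast
qed

lemma four_block_GL:
 fixes r C :: "'k mat"
 assumes "r : mats 1 m" "C : GL m"
 shows "four_block_mat (im 1) r (zm m 1) C : GL (Suc m)" "four_block_mat (im 1) r (zm m 1) C * e1 m = e1 m"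
proof -
 note C = GL_carrier[OF assms(2)]
 have "det (four_block_mat (im 1) r (zm m 1) C) = det (im 1 :: 'k mat) * det C"
  by (rule det_four_block_mat_lower_left_zero) (use assms(1) C in auto)
 moreover have "four_block_mat (im 1) r (zm m 1) C : mats (1 + m) (1 + m)"
  using C by (intro four_block_carrier_mat) auto
 ultimately show "four_block_mat (im 1) r (zm m 1) C : GL (Suc m)" using assms(2) by (simp add: GL_iff_det)
 have "four_block_mat (im 1) r (zm m 1) C = hc (e1 m) (vc r C)"
  unfolding e1_def using assms(1) C four_block_hc_vc[of "im 1 :: 'k mat" 1 1 r m "zm m 1" m C]
   vc_hc[of "im 1 :: 'k mat" 1 1 r m "zm m 1" m C] by simp
 moreover have "vc r C : mats (Suc m) m" using vc_carrier[OF assms(1) C] by simp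
 ultimately show "four_block_mat (im 1) r (zm m 1) C * e1 m = e1 m" using hc_e1[OF e1_carrier] by simp
qed

lemma four_block_entries:
 fixes r C :: "'k mat"
 assumes "r : mats 1 m" "C : mats m m"
 shows "elements_mat (four_block_mat (im 1) r (zm m 1) C) \<subseteq> K \<longleftrightarrow> elements_mat r \<subseteq> K & elements_mat C \<subseteq> K"
proof
 let ?A = "four_block_mat (im 1) r (zm m 1) C"
 have d: "dim_row r = 1" "dim_col r = m" "dim_row C = m" "dim_col C = m" using assms by auto
 assume "elements_mat ?A \<subseteq> K"
 hence e: "?A $$ (i, k) : K" if "i < Suc m" "k < Suc m" for i k
  using that d unfolding elements_mat_subset_iff by simp
 have "r $$ (0, k) : K" if "k < m" for k using e[of 0 "Suc k"] that d by simp
 moreover have "C $$ (i, k) : K" if "i < m" "k < m" for i k using e[of "Suc i" "Suc k"] that d by simp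
 ultimately show "elements_mat r \<subseteq> K & elements_mat C \<subseteq> K" using d by (simp add: elements_mat_subset_iff)
next
 assume "elements_mat r \<subseteq> K & elements_mat C \<subseteq> K"
 thus "elements_mat (four_block_mat (im 1) r (zm m 1) C) \<subseteq> K"
  using assms unfolding elements_mat_subset_iff by (auto simp: K_closed)
qed

text \<open>With a nonzero first entry the remaining columns can be standard ones. If the first
  entry is 0, the column is reached from v + e1 by a row operation using another nonzero
  entry.\<close>

lemma GL_over_first_column:
 assumes v: "v : mats (Suc m) 1" "elements_mat v \<subseteq> K" "v ~= zm (Suc m) 1"
 shows "\<exists>A\<in>GL_over (Suc m) Q. A * e1 m = v"
proof -
 have top: "\<exists>A\<in>GL_over (Suc m) Q. A * e1 m = w"
  if w: "w : mats (Suc m) 1" "elements_mat w \<subseteq> K" "w $$ (0, 0) ~= 0" for w :: "'k mat"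
 proof -
  have "w : mats (1 + m) 1" using w(1) by simp
  then obtain x y where xy: "x : mats 1 1" "y : mats m 1" "w = vc x y" using vc_split by metis
  define A where "A = four_block_mat x (zm 1 m) y (im m)"
  have "det A = det x * det (im m :: 'k mat)"
   unfolding A_def by (rule det_four_block_mat_upper_right_zero) (use xy in auto)
  moreover have "w $$ (0, 0) = x $$ (0, 0)" unfolding xy(3) using xy(1) by (simp add: vc_def)
  ultimately have "det A ~= 0" using w(3) xy(1) by (simp add: det_single)
  moreover have "A : mats (1 + m) (1 + m)" unfolding A_def using xy by (intro four_block_carrier_mat) auto
  ultimately have AG: "A : GL (Suc m)" by (simp add: GL_iff_det)
  have Ah: "A = hc w (vc (zm 1 m) (im m))"
   unfolding A_def xy(3) using xy four_block_hc_vc[of x 1 1 "zm 1 m" m y m "im m"] vc_hc[of x 1 1 "zm 1 m" m y m "im m"] by simp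
  have z: "vc (zm 1 m) (im m :: 'k mat) : mats (Suc m) m"
   using vc_carrier[of "zm 1 m :: 'k mat" 1 m "im m" m] by simp
  have "elements_mat A \<subseteq> K" unfolding elements_mat_subset_iff
   using w(1,2) unfolding Ah elements_mat_subset_iff by (auto simp: hc_def vc_def K_closed)
  thus ?thesis using AG hc_e1[OF w(1) z] unfolding GL_over_def Ah[symmetric] by blast
 qed
 show ?thesis
 proof (cases "v $$ (0, 0) = 0")
  case False
  thus ?thesis using top[OF v(1,2)] by blast
 next
  case True
  have "\<exists>i<Suc m. v $$ (i, 0) ~= 0"
  proof (rule ccontr)
   assume "\<not> ?thesis"
   hence "v = zm (Suc m) 1" using v(1) by (intro eq_matI) auto
   thus False using v(3) by simp
  qed
  then obtain i where i: "i < Suc m" "v $$ (i, 0) ~= 0" by blast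
  hence i0: "i ~= 0" using True by metis
  define w where "w = v + e1 m"
  \<comment> \<open>Chosen so that adding \<open>c\<close> times row \<open>i\<close> to row 0 turns
    the entry 1 of \<open>w\<close> there back into the entry 0 of \<open>v\<close>.\<close>
  define c where "c = - inverse (v $$ (i, 0))"
  define L where "L = addrow_mat (Suc m) c 0 i"
  have e: "e1 m $$ (k, 0) = (if k = 0 then 1 else 0)" if "k < Suc m" for k using that by (auto simp: e1_def vc_def)
  have wk: "w $$ (k, 0) = v $$ (k, 0) + (if k = 0 then 1 else 0)" if "k < Suc m" for k
   using that v(1) e1_carrier[of m] e by (simp add: w_def)
  have w: "w : mats (Suc m) 1" unfolding w_def using v(1) e1_carrier by auto
  have wK: "elements_mat w \<subseteq> K" unfolding elements_mat_subset_iff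
   using w v(1,2) wk by (auto simp: elements_mat_subset_iff intro!: K_closed)
  obtain A where A: "A : GL_over (Suc m) Q" "A * e1 m = w" using top[OF w wK] wk[of 0] True by auto
  have "L * w = addrow c 0 i w" unfolding L_def using addrow_mat[OF w i(1)] by simp
  also have "... = v"
  proof (rule eq_matI)
   fix k l assume "k < dim_row v" "l < dim_col v"
   hence kl: "k < Suc m" "l = 0" using v(1) by auto
   show "addrow c 0 i w $$ (k, l) = v $$ (k, l)"
    using kl w i i0 True wk[OF kl(1)] wk[OF i(1)] wk[of 0] by (auto simp: c_def)
  qed (use v w in auto)
  finally have Lw: "L * w = v" .
  have "L : GL (Suc m)" using i i0 by (simp add: L_def GL_iff_det det_addrow_mat)
  moreover have "c : K" unfolding c_def using v(1,2) i(1) by (auto simp: elements_mat_subset_iff intro!: K_closed)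
  hence "elements_mat L \<subseteq> K" unfolding elements_mat_subset_iff by (auto simp: L_def K_closed)
  ultimately have LG: "L : GL_over (Suc m) Q" by (simp add: GL_over_def)
  have AL: "A : GL (Suc m)" "L : GL (Suc m)" using A(1) LG by (auto simp: GL_over_def)
  have "L * A * e1 m = L * (A * e1 m)"
   using GL_dim[OF AL(1)] GL_dim[OF AL(2)] e1_carrier[of m] by (intro mat_assoc) auto
  hence "L * A * e1 m = v" using A(2) Lw by simp
  thus ?thesis using GL_over_mult[OF LG A(1)] by blast
 qed
qed

lemma card_columns: "card {v : mats n 1. elements_mat v \<subseteq> K} = Q ^ n"
 using card_matrices_over(2)[OF finite_K, of n 1] by (simp add: card_K)

text \<open>The orbit of the first basis vector consists of all nonzero columns. Its stabilizer has
  a free first row of length m next to an invertible block of size m.\<close>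

theorem card_GL_over_Suc:
 "card (GL_over (Suc m) Q :: 'k mat set) = (Q ^ Suc m - 1) * (Q ^ m * card (GL_over m Q :: 'k mat set))"
proof -
 let ?G = "GL_over (Suc m) Q :: 'k mat set"
 let ?V = "{v : mats (Suc m) 1. elements_mat v \<subseteq> K} - {zm (Suc m) 1}"
 have "card ?G = card ((%A. A * e1 m) ` ?G) * card {A \<in> ?G. A * e1 m = e1 m}"
 proof (rule card_orbit_stabilizer)
  show "?G \<subseteq> GL (Suc m)" by (auto simp: GL_over_def)
  show "finite ?G" by (rule finite_GL_over)
  show "dim_row (e1 m) = Suc m" using e1_carrier by auto
 qed (rule GL_over_mult)
 also have "(%A. A * e1 m) ` ?G = ?V"
 proof (intro equalityI subsetI)
  fix v assume "v \<in> (%A. A * e1 m) ` ?G"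
  then obtain A where A: "v = A * e1 m" "A : GL (Suc m)" "elements_mat A \<subseteq> K" by (auto simp: GL_over_def)
  have "elements_mat v \<subseteq> K" unfolding A(1) by (rule mult_entries[OF A(3) e1_entries]) (use GL_dim[OF A(2)] e1_carrier[of m] in auto)
  moreover have "v ~= zm (Suc m) 1"
  proof
   assume "v = zm (Suc m) 1"
   hence "A * e1 m = A * zm (Suc m) 1" using A GL_dim[OF A(2)] by (simp add: mat_ring)
   hence "e1 m = zm (Suc m) 1" by (rule GL_cancel_left[OF A(2)]) (use e1_carrier[of m] in auto)
   hence "e1 m $$ (0, 0) = zm (Suc m) 1 $$ (0, 0)" by simp
   thus False by (simp add: e1_def vc_def)
  qed
  ultimately show "v \<in> ?V" using A GL_carrier[OF A(2)] e1_carrier[of m] by auto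
 next
  fix v assume "v \<in> ?V"
  thus "v \<in> (%A. A * e1 m) ` ?G" using GL_over_first_column[of v m] by auto
 qed
 also have "card ?V = Q ^ Suc m - 1"
  using card_columns[of "Suc m"] K_closed(1) by (subst card_Diff_singleton) (auto simp: elements_mat_subset_iff)
 also have "card {A \<in> ?G. A * e1 m = e1 m} = card ({r : mats 1 m. elements_mat r \<subseteq> K} \<times> (GL_over m Q :: 'k mat set))"
 proof (rule bij_betw_same_card[symmetric])
  let ?h = "%(r, C). four_block_mat (im 1) r (zm m 1) C :: 'k mat"
  show "bij_betw ?h ({r : mats 1 m. elements_mat r \<subseteq> K} \<times> GL_over m Q) {A \<in> ?G. A * e1 m = e1 m}"
   unfolding bij_betw_def
  proof (intro conjI equalityI subsetI)
   show "inj_on ?h ({r : mats 1 m. elements_mat r \<subseteq> K} \<times> GL_over m Q)"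
   proof (rule inj_onI)
    fix x y assume xy: "x \<in> {r : mats 1 m. elements_mat r \<subseteq> K} \<times> GL_over m Q" "y \<in> {r : mats 1 m. elements_mat r \<subseteq> K} \<times> GL_over m Q"
     and eq: "?h x = ?h y"
    obtain r C s D where e: "x = (r, C)" "y = (s, D)" by (cases x, cases y)
    have d: "r : mats 1 m" "s : mats 1 m" "C : mats m m" "D : mats m m"
     using xy by (auto simp: e GL_over_def dest: GL_carrier)
    have f: "four_block_mat (im 1) r (zm m 1) C = four_block_mat (im 1) s (zm m 1) D" using eq by (simp add: e)
    have "r $$ (0, k) = s $$ (0, k)" if "k < m" for k using arg_cong[OF f, of "%M. M $$ (0, Suc k)"] that d by simp
    hence "r = s" using d by (intro eq_matI) auto
    moreover have "C $$ (i, k) = D $$ (i, k)" if "i < m" "k < m" for i k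
     using arg_cong[OF f, of "%M. M $$ (Suc i, Suc k)"] that d by simp
    hence "C = D" using d by (intro eq_matI) auto
    ultimately show "x = y" by (simp add: e)
   qed
  next
   fix A assume "A \<in> ?h ` ({r : mats 1 m. elements_mat r \<subseteq> K} \<times> GL_over m Q)"
   then obtain r C where rC: "r : mats 1 m" "elements_mat r \<subseteq> K" "C : GL m" "elements_mat C \<subseteq> K"
    and A: "A = four_block_mat (im 1) r (zm m 1) C" by (auto simp: GL_over_def)
   show "A \<in> {A \<in> ?G. A * e1 m = e1 m}"
    using four_block_GL[OF rC(1,3)] four_block_entries[OF rC(1) GL_carrier[OF rC(3)]] rC unfolding A GL_over_def by auto
  next
   fix A assume A: "A \<in> {A \<in> ?G. A * e1 m = e1 m}"
   then obtain r C where rC: "r : mats 1 m" "C : GL m" "A = four_block_mat (im 1) r (zm m 1) C"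
    using first_column_stabilizer[of A m] by (auto simp: GL_over_def)
   hence "elements_mat r \<subseteq> K" "elements_mat C \<subseteq> K"
    using four_block_entries[OF rC(1) GL_carrier[OF rC(2)]] A by (auto simp: GL_over_def)
   hence "(r, C) \<in> {r : mats 1 m. elements_mat r \<subseteq> K} \<times> GL_over m Q" using rC by (simp add: GL_over_def)
   thus "A \<in> ?h ` ({r : mats 1 m. elements_mat r \<subseteq> K} \<times> GL_over m Q)" unfolding rC(3) by force
  qed
 qed
 also have "... = Q ^ m * card (GL_over m Q :: 'k mat set)"
  using card_matrices_over(2)[OF finite_K, of 1 m] by (simp add: card_cartesian_product card_K)
 finally show ?thesis .
qed

end

section \<open>Unitary groups through the action on unit vectors\<close>

locale frobenius_square = frobenius ty Q for ty :: "'k::alg_closed_field itself" and Q +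
 assumes two: "(2::'k) ~= 0"
begin

lemma square_frobenius: "frobenius TYPE('k) (Q\<^sup>2)"
proof
 fix x y :: 'k
 have "(z::'k) ^ Q\<^sup>2 = (z ^ Q) ^ Q" for z by (simp add: power2_eq_square power_mult)
 thus "(x + y) ^ Q\<^sup>2 = x ^ Q\<^sup>2 + y ^ Q\<^sup>2" by (simp add: add)
 show "1 < Q\<^sup>2" by (rule one_less_power[OF Q1]) simp
 show "of_nat (Q\<^sup>2) = (0::'k)" using Q0 by (simp add: power2_eq_square)
qed

sublocale sq: frobenius "TYPE('k)" "Q\<^sup>2"
 by (rule square_frobenius)

lemma frob_frob: "x : sq.K ==> (x ^ Q) ^ Q = x"
 by (simp add: fixed_field_def power2_eq_square flip: power_mult)

lemma frob_sq_K: "x : sq.K ==> x ^ Q : sq.K"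
 by (simp add: fixed_field_def power2_eq_square power_mult)

lemma frob_diff: "(x - y :: 'k) ^ Q = x ^ Q - y ^ Q"
 using add[of x "- y"] frob_minus[of y] by simp

text \<open>The conjugate transpose for the involution x^Q of the field with Q^2 elements. On larger
  fields it is still multiplicative but no involution, hence the entry condition in
  \<open>star_star\<close>.\<close>

definition star :: "'k mat => 'k mat" where
 "star A = (map_mat (%x. x ^ Q) A)\<^sup>T"

lemma star_dim [simp]: "dim_row (star A) = dim_col A" "dim_col (star A) = dim_row A"
 by (simp_all add: star_def)

lemma star_entry: "i < dim_col A ==> k < dim_row A ==> star A $$ (i, k) = A $$ (k, i) ^ Q"
 by (simp add: star_def)

lemma star_mult: "dim_col A = dim_row D ==> star (A * D) = star D * star A"
 by (rule eq_matI) (auto simp: star_entry scalar_prod_def frob_sum power_mult_distrib mult.commute intro!: sum.cong)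

lemma star_star: "elements_mat A \<subseteq> sq.K ==> star (star A) = A"
 by (rule eq_matI) (auto simp: star_entry frob_frob elements_mat_subset_iff)

lemma star_add: "dim_row A = dim_row D ==> dim_col A = dim_col D ==> star (A + D) = star A + star D"
 by (rule eq_matI) (auto simp: star_entry add)

lemma star_diff: "dim_row A = dim_row D ==> dim_col A = dim_col D ==> star (A - D) = star A - star D"
 by (rule eq_matI) (auto simp: star_entry frob_diff)

lemma star_smult: "star (c \<cdot>\<^sub>m A) = c ^ Q \<cdot>\<^sub>m star A"
 by (rule eq_matI) (auto simp: star_entry power_mult_distrib)

lemma star_one: "star (im n) = im n"
 using frob_0 by (intro eq_matI) (auto simp: star_entry)

lemma star_zero: "star (zm n m) = zm m n"
 using frob_0 by (intro eq_matI) (auto simp: star_entry)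

lemma U_over_iff: "A \<in> U_over n Q \<longleftrightarrow> A : mats n n & elements_mat A \<subseteq> sq.K & star A * A = im n"
proof
 assume A: "A : mats n n & elements_mat A \<subseteq> sq.K & star A * A = im n"
 have "A : GL n" by (rule GL_one_sided_inverse(2)[of "star A"]) (use A in "auto simp: star_def")
 thus "A \<in> U_over n Q" using A by (simp add: U_over_def GL_over_def star_def)
qed (auto simp: U_over_def GL_over_def star_def dest: GL_carrier)

lemma finite_U_over: "finite (U_over n Q :: 'k mat set)"
 by (rule finite_subset[OF _ sq.finite_GL_over[of n]]) (auto simp: U_over_def)

lemma U_over_mult:
 assumes "A \<in> U_over n Q" "D \<in> U_over n Q"
 shows "A * D \<in> (U_over n Q :: 'k mat set)"
proof -
 have A: "A : mats n n" "elements_mat A \<subseteq> sq.K" "star A * A = im n" using assms by (auto simp: U_over_iff)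
 have D: "D : mats n n" "elements_mat D \<subseteq> sq.K" "star D * D = im n" using assms by (auto simp: U_over_iff)
 have d: "dim_row A = n" "dim_col A = n" "dim_row D = n" "dim_col D = n" using A D by auto
 have "star (A * D) * (A * D) = star D * ((star A * A) * D)" using d by (simp add: star_mult mat_assoc)
 also have "... = im n" unfolding A(3) using D(3) d by (simp add: mat_one_left)
 finally show ?thesis using A D sq.mult_entries[OF A(2) D(2)] by (auto simp: U_over_iff)
qed

definition unit_vectors :: "nat => 'k mat set" where
 "unit_vectors n = {v : mats n 1. elements_mat v \<subseteq> sq.K & star v * v = im 1}"

lemma star_e1_mult:
 assumes "v : mats (Suc m) 1"
 shows "star (e1 m) * v = v $$ (0, 0) \<cdot>\<^sub>m im 1"
proof -
 have "v : mats (1 + m) 1" using assms by simp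
 then obtain x y where xy: "x : mats 1 1" "y : mats m 1" "v = vc x y" using vc_split by metis
 have e: "star (e1 m) = hc (im 1) (zm 1 m)"
  by (rule eq_matI) (use frob_0 in "auto simp: star_entry e1_def vc_def hc_def")
 have "star (e1 m) * v = x" unfolding e xy(3) using xy by (subst hc_mult_vc) (auto simp: mat_ring)
 also have "... = v $$ (0, 0) \<cdot>\<^sub>m im 1" unfolding xy(3) using xy by (intro eq_matI) (auto simp: vc_def)
 finally show ?thesis .
qed

lemma star_e1_e1: "star (e1 m) * e1 m = im 1"
proof -
 have "e1 m $$ (0, 0) = 1" by (simp add: e1_def vc_def)
 moreover have "1 \<cdot>\<^sub>m im 1 = (im 1 :: 'k mat)" by (rule eq_matI) auto
 ultimately show ?thesis using star_e1_mult[OF e1_carrier[of m]] by simp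
qed

text \<open>The matrix is 1 + c w w* with w = v - e1. The value c = 1 / (w* e1) makes it send e1 to
  v, and since w* w = -(s + s^Q) for s = w* e1, the same value makes it unitary.\<close>

lemma quasi_reflection:
 assumes v: "v \<in> unit_vectors (Suc m)" and v0: "v $$ (0, 0) ~= 1"
 shows "\<exists>A\<in>U_over (Suc m) Q. A * e1 m = v"
proof -
 let ?n = "Suc m"
 have vc: "v : mats ?n 1" and vK: "elements_mat v \<subseteq> sq.K" and vv: "star v * v = im 1"
  using v by (auto simp: unit_vectors_def)
 define t where "t = v $$ (0, 0)"
 have tK: "t : sq.K" using vc vK by (auto simp: t_def elements_mat_subset_iff)
 \<comment> \<open>This is the pairing of \<open>w\<close> with the first basis vector. It is
   nonzero exactly because the first entry of \<open>v\<close> differs from 1.\<close>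
 define s where "s = t ^ Q - 1"
 have sQ: "s ^ Q = t - 1" unfolding s_def frob_diff frob_frob[OF tK] by simp
 hence "s ^ Q ~= 0" using v0 by (simp add: t_def)
 hence s0: "s ~= 0" using frob_0 by metis
 have sK: "s : sq.K" unfolding s_def using frob_sq_K[OF tK] sq.K_closed by simp
 define c where "c = inverse s"
 have cK: "c : sq.K" unfolding c_def using sK sq.K_closed by simp
 have ec: "e1 m : mats ?n 1" by (rule e1_carrier)
 define w where "w = v - e1 m"
 have wc: "w : mats ?n 1" unfolding w_def by (rule minus_carrier_mat[OF ec])
 have wK: "elements_mat w \<subseteq> sq.K"
  unfolding elements_mat_subset_iff
 proof (intro allI impI)
  fix i k assume "i < dim_row w" "k < dim_col w"
  hence ik: "i < ?n" "k < 1" using wc by auto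
  hence "v $$ (i, k) : sq.K" "e1 m $$ (i, k) : sq.K"
   using vK sq.e1_entries[of m] vc ec unfolding elements_mat_subset_iff by auto
  thus "w $$ (i, k) : sq.K" using ik vc ec sq.K_closed by (simp add: w_def)
 qed
 have d: "dim_row v = ?n" "dim_col v = 1" "dim_row (e1 m) = ?n" "dim_col (e1 m) = 1" "dim_row w = ?n" "dim_col w = 1"
  using vc ec wc by auto
 have ee: "star (e1 m) * e1 m = im 1" by (rule star_e1_e1)
 have ev: "star (e1 m) * v = t \<cdot>\<^sub>m im 1" using star_e1_mult[OF vc] by (simp add: t_def)
 have "star v * e1 m = star (star (e1 m) * v)" using d by (simp add: star_mult star_star sq.e1_entries)
 hence ve: "star v * e1 m = t ^ Q \<cdot>\<^sub>m im 1" unfolding ev by (simp add: star_smult star_one)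
 have "star w * e1 m = star v * e1 m - star (e1 m) * e1 m" unfolding w_def using d by (simp add: star_diff mat_ring)
 also have "... = s \<cdot>\<^sub>m im 1" unfolding ve ee s_def by (rule eq_matI) auto
 finally have we: "star w * e1 m = s \<cdot>\<^sub>m im 1" .
 have "star w * v = star v * v - star (e1 m) * v" unfolding w_def using d by (simp add: star_diff mat_ring)
 hence "star w * w = (star v * v - star (e1 m) * v) - star w * e1 m" by (subst (2) w_def) (use d in "simp add: mat_ring")
 also have "... = (- (s ^ Q) - s) \<cdot>\<^sub>m im 1" unfolding we vv ev sQ by (rule eq_matI) auto
 finally have ww: "star w * w = (- (s ^ Q) - s) \<cdot>\<^sub>m im 1" .
 define P where "P = w * star w"
 have Pc: "dim_row P = ?n" "dim_col P = ?n" using d by (auto simp: P_def)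
 have Ps: "star P = P" unfolding P_def using d wK by (simp add: star_mult star_star)
 have "P * P = w * ((star w * w) * star w)" unfolding P_def using d by (simp add: mat_assoc)
 also have "... = (- (s ^ Q) - s) \<cdot>\<^sub>m P" unfolding ww P_def using d by (simp add: mat_ring)
 finally have PP: "P * P = (- (s ^ Q) - s) \<cdot>\<^sub>m P" .
 define T where "T = im ?n + c \<cdot>\<^sub>m P"
 have Tc: "T : mats ?n ?n" using Pc by (auto simp: T_def)
 have "T * e1 m = e1 m + c \<cdot>\<^sub>m (w * (star w * e1 m))" unfolding T_def P_def using d by (simp add: mat_ring)
 also have "w * (star w * e1 m) = s \<cdot>\<^sub>m w" unfolding we using d by (simp add: mat_ring)
 also have "e1 m + c \<cdot>\<^sub>m (s \<cdot>\<^sub>m w) = v" using d s0 by (intro eq_matI) (auto simp: c_def w_def simp flip: mult.assoc)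
 finally have Te: "T * e1 m = v" .
 have sT: "star T = im ?n + c ^ Q \<cdot>\<^sub>m P" unfolding T_def using Pc by (simp add: star_add star_one star_smult Ps)
 have "star T * T = (im ?n + c \<cdot>\<^sub>m P) + (c ^ Q \<cdot>\<^sub>m P + c ^ Q \<cdot>\<^sub>m (c \<cdot>\<^sub>m (P * P)))"
  unfolding sT unfolding T_def using Pc by (simp add: mat_ring) (rule eq_matI; simp add: algebra_simps)
 also have "... = im ?n"
 proof (rule eq_matI)
  fix i k assume "i < dim_row (im ?n :: 'k mat)" "k < dim_col (im ?n :: 'k mat)"
  hence ik: "i < ?n" "k < ?n" by auto
  have cQ: "c ^ Q = inverse (s ^ Q)" by (simp add: c_def power_inverse)
  \<comment> \<open>The unitarity condition for 1 + c P when P P = (-(s^Q) - s) P: with c = 1/s it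
    reads 1/s + 1/s^Q = (s + s^Q) / (s s^Q).\<close>
  have "c + c ^ Q + c ^ Q * c * (- (s ^ Q) - s) = 0"
   unfolding cQ using s0 \<open>s ^ Q ~= 0\<close> by (simp add: c_def field_simps)
  hence "(c + c ^ Q + c ^ Q * c * (- (s ^ Q) - s)) * P $$ (i, k) = 0" by simp
  thus "(im ?n + c \<cdot>\<^sub>m P + (c ^ Q \<cdot>\<^sub>m P + c ^ Q \<cdot>\<^sub>m (c \<cdot>\<^sub>m (P * P)))) $$ (i, k) = im ?n $$ (i, k)"
   unfolding PP using ik Pc by (simp add: algebra_simps)
 qed (use Pc in auto)
 finally have TT: "star T * T = im ?n" .
 have "elements_mat (star w) \<subseteq> sq.K" using wK frob_sq_K by (auto simp: elements_mat_subset_iff star_entry)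
 hence "elements_mat P \<subseteq> sq.K" unfolding P_def using sq.mult_entries[OF wK] by simp
 hence "elements_mat T \<subseteq> sq.K" using Pc cK sq.K_closed by (auto simp: elements_mat_subset_iff T_def)
 hence "T \<in> U_over ?n Q" using Tc TT by (simp add: U_over_iff)
 thus ?thesis using Te by blast
qed

text \<open>If the first entry is 1, the construction degenerates. It is then applied to -v, whose
  first entry is not 1 in odd characteristic, and the resulting matrix is negated.\<close>

lemma unitary_first_column:
 assumes v: "v \<in> unit_vectors (Suc m)"
 shows "\<exists>A\<in>U_over (Suc m) Q. A * e1 m = v"
proof (cases "v $$ (0, 0) = 1")
 case False
 thus ?thesis using quasi_reflection[OF v] by blast
next
 case True
 have d: "dim_row v = Suc m" "dim_col v = 1" and vK: "elements_mat v \<subseteq> sq.K" and vv: "star v * v = im 1"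
  using v by (auto simp: unit_vectors_def)
 have m1: "(-1::'k) ^ Q = -1" using frob_minus[of 1] by simp
 let ?v = "(-1) \<cdot>\<^sub>m v"
 have neg: "(-1) \<cdot>\<^sub>m ((-1) \<cdot>\<^sub>m M) = M" for M :: "'k mat" by (rule eq_matI) auto
 have "star ?v * ?v = im 1" using d vv by (simp add: star_smult m1 mat_ring neg)
 hence "?v \<in> unit_vectors (Suc m)"
  using d vK sq.K_closed by (auto simp: unit_vectors_def elements_mat_subset_iff)
 moreover have "?v $$ (0, 0) ~= 1"
 proof
  assume "?v $$ (0, 0) = 1"
  hence "(-1::'k) = 1" using True d by simp
  hence "(2::'k) = 0" by (metis add.right_inverse one_add_one)
  thus False using two by simp
 qed
 ultimately obtain A where A: "A \<in> U_over (Suc m) Q" "A * e1 m = ?v" using quasi_reflection by blast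
 have Ac: "dim_row A = Suc m" "dim_col A = Suc m" and AK: "elements_mat A \<subseteq> sq.K" and AA: "star A * A = im (Suc m)"
  using A by (auto simp: U_over_iff)
 have "star ((-1) \<cdot>\<^sub>m A) * ((-1) \<cdot>\<^sub>m A) = im (Suc m)" using Ac AA by (simp add: star_smult m1 mat_ring neg)
 hence "(-1) \<cdot>\<^sub>m A \<in> U_over (Suc m) Q"
  using Ac AK sq.K_closed by (auto simp: U_over_iff elements_mat_subset_iff)
 moreover have "((-1) \<cdot>\<^sub>m A) * e1 m = v" using A(2) Ac e1_carrier[of m] by (simp add: mat_smult_left neg)
 ultimately show ?thesis by blast
qed

text \<open>Unlike in the general linear group, fixing the first basis vector forces the rest of the
  first row to vanish, since the other columns are orthogonal to that vector.\<close>

lemma unitary_block_iff: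
 assumes r: "r : mats 1 m" and C: "C : mats m m"
 shows "star (four_block_mat (im 1) r (zm m 1) C) * four_block_mat (im 1) r (zm m 1) C = im (Suc m)
  \<longleftrightarrow> r = zm 1 m & star C * C = im m"
proof -
 have d: "dim_row r = 1" "dim_col r = m" "dim_row C = m" "dim_col C = m" using r C by auto
 have s: "star (four_block_mat (im 1) r (zm m 1) C) = four_block_mat (im 1) (zm 1 m) (star r) (star C)"
  by (rule eq_matI) (use d frob_0 in "auto simp: star_entry")
 have "four_block_mat (im 1) (zm 1 m) (star r) (star C) * four_block_mat (im 1) r (zm m 1) C
  = four_block_mat (im 1 * im 1 + zm 1 m * zm m 1) (im 1 * r + zm 1 m * C) (star r * im 1 + star C * zm m 1) (star r * r + star C * C)"
  by (rule mult_four_block_mat[of _ 1 1 _ m _ m _ _ 1 _ m]) (use d in "auto intro!: carrier_matI")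
 also have "... = four_block_mat (im 1) r (star r) (star r * r + star C * C)" using d by (simp add: mat_ring)
 finally have p: "star (four_block_mat (im 1) r (zm m 1) C) * four_block_mat (im 1) r (zm m 1) C
  = four_block_mat (im 1) r (star r) (star r * r + star C * C)" unfolding s .
 show ?thesis unfolding p
 proof
  assume e: "four_block_mat (im 1) r (star r) (star r * r + star C * C) = im (Suc m)"
  have "r $$ (0, k) = 0" if "k < m" for k using arg_cong[OF e, of "%M. M $$ (0, Suc k)"] that d by simp
  hence r0: "r = zm 1 m" using d by (intro eq_matI) auto
  have "(star C * C) $$ (i, k) = im m $$ (i, k)" if "i < m" "k < m" for i k
   using arg_cong[OF e[unfolded r0 star_zero], of "%M. M $$ (Suc i, Suc k)"] that d by (simp add: mat_ring)
  hence "star C * C = im m" using d by (intro eq_matI) auto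
  thus "r = zm 1 m & star C * C = im m" using r0 by simp
 next
  assume "r = zm 1 m & star C * C = im m"
  hence e: "r = zm 1 m" "star C * C = im m" by auto
  show "four_block_mat (im 1) r (star r) (star r * r + star C * C) = im (Suc m)"
   unfolding e star_zero by (rule eq_matI) (auto simp: mat_ring)
 qed
qed

text \<open>The orbit of the first basis vector is the set of unit vectors by transitivity, and its
  stabilizer is the unitary group of one dimension less.\<close>

theorem card_U_over_Suc:
 "card (U_over (Suc m) Q :: 'k mat set) = card (unit_vectors (Suc m)) * card (U_over m Q :: 'k mat set)"
proof -
 let ?G = "U_over (Suc m) Q :: 'k mat set"
 have GG: "?G \<subseteq> GL (Suc m)" by (auto simp: U_over_def GL_over_def)
 have "card ?G = card ((%A. A * e1 m) ` ?G) * card {A \<in> ?G. A * e1 m = e1 m}"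
 proof (rule card_orbit_stabilizer[OF GG finite_U_over])
  show "dim_row (e1 m) = Suc m" using e1_carrier by auto
 qed (rule U_over_mult)
 also have "(%A. A * e1 m) ` ?G = unit_vectors (Suc m)"
 proof (intro equalityI subsetI)
  fix v assume "v \<in> (%A. A * e1 m) ` ?G"
  then obtain A where A: "v = A * e1 m" "A : mats (Suc m) (Suc m)" "elements_mat A \<subseteq> sq.K" "star A * A = im (Suc m)"
   by (auto simp: U_over_iff)
  have d: "dim_row A = Suc m" "dim_col A = Suc m" "dim_row (e1 m) = Suc m" "dim_col (e1 m) = 1" using A e1_carrier[of m] by auto
  have "star v * v = star (e1 m) * ((star A * A) * e1 m)" unfolding A(1) using d by (simp add: star_mult mat_assoc)
  also have "... = star (e1 m) * e1 m" unfolding A(4) using d by (simp add: mat_one_left)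
  also have "... = im 1" by (rule star_e1_e1)
  finally show "v \<in> unit_vectors (Suc m)"
   using sq.mult_entries[OF A(3) sq.e1_entries[of m]] d unfolding unit_vectors_def A(1) by auto
 next
  fix v assume "v \<in> unit_vectors (Suc m)"
  thus "v \<in> (%A. A * e1 m) ` ?G" using unitary_first_column[of v m] by auto
 qed
 also have "card {A \<in> ?G. A * e1 m = e1 m} = card (U_over m Q :: 'k mat set)"
 proof (rule bij_betw_same_card[symmetric])
  let ?h = "%C. four_block_mat (im 1) (zm 1 m) (zm m 1) C :: 'k mat"
  have z: "elements_mat (zm 1 m :: 'k mat) \<subseteq> sq.K" using sq.K_closed by (simp add: elements_mat_subset_iff)
  show "bij_betw ?h (U_over m Q) {A \<in> ?G. A * e1 m = e1 m}"
   unfolding bij_betw_def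
  proof (intro conjI equalityI subsetI)
   show "inj_on ?h (U_over m Q)"
   proof (rule inj_onI)
    fix C D :: "'k mat" assume CD: "C \<in> U_over m Q" "D \<in> U_over m Q" and f: "?h C = ?h D"
    have d: "C : mats m m" "D : mats m m" using CD by (auto simp: U_over_iff)
    have "C $$ (i, k) = D $$ (i, k)" if "i < m" "k < m" for i k
     using arg_cong[OF f, of "%M. M $$ (Suc i, Suc k)"] that d by simp
    thus "C = D" using d by (intro eq_matI) auto
   qed
  next
   fix A assume "A \<in> ?h ` U_over m Q"
   then obtain C where CU: "C \<in> U_over m Q" and A: "A = ?h C" by blast
   have C: "C : mats m m" "elements_mat C \<subseteq> sq.K" "star C * C = im m" using CU by (auto simp: U_over_iff)
   moreover have "C : GL m" using CU by (simp add: U_over_def GL_over_def)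
   ultimately have C: "C : mats m m" "elements_mat C \<subseteq> sq.K" "star C * C = im m" "C : GL m" by auto
   have "A : GL (Suc m)" "A * e1 m = e1 m" unfolding A by (rule four_block_GL[OF _ C(4)]; simp)+
   moreover have "elements_mat A \<subseteq> sq.K" unfolding A using sq.four_block_entries[OF _ C(1), of "zm 1 m"] C(2) z by simp
   moreover have "star A * A = im (Suc m)" unfolding A using unitary_block_iff[OF _ C(1), of "zm 1 m"] C(3) by simp
   ultimately show "A \<in> {A \<in> ?G. A * e1 m = e1 m}" by (auto simp: U_over_iff dest: GL_carrier)
  next
   fix A assume A: "A \<in> {A \<in> ?G. A * e1 m = e1 m}"
   then obtain r C where rC: "r : mats 1 m" "C : GL m" "A = four_block_mat (im 1) r (zm m 1) C"
    using first_column_stabilizer[of A m] GG by auto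
   have Cc: "C : mats m m" using GL_carrier rC(2) by blast
   have AU: "star A * A = im (Suc m)" "elements_mat A \<subseteq> sq.K" using A by (auto simp: U_over_iff)
   have r0: "r = zm 1 m" and CC: "star C * C = im m"
    using AU(1) unitary_block_iff[OF rC(1) Cc] unfolding rC(3) by auto
   have "elements_mat C \<subseteq> sq.K" using AU(2) sq.four_block_entries[OF rC(1) Cc] unfolding rC(3) by auto
   hence "C \<in> U_over m Q" using CC Cc by (simp add: U_over_iff)
   thus "A \<in> ?h ` U_over m Q" unfolding rC(3) r0 by blast
  qed
 qed
 finally show ?thesis .
qed

text \<open>The polynomial x^(Q+1) - t is separable, as its derivative x^Q has no nonzero root. Its
  roots lie in the field with Q^2 elements because t^Q = t gives x^(Q^2) = x.\<close>

lemma norm_fiber: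
 assumes t: "t : K" "t ~= 0"
 shows "card {x : sq.K. x ^ Suc Q = t} = Suc Q"
proof -
 let ?f = "monom 1 (Suc Q) - [:t:] :: 'k poly"
 have deg: "degree ?f = Suc Q"
  unfolding diff_conv_add_uminus by (subst degree_add_eq_left) (auto simp: degree_monom_eq)
 have nz: "?f ~= 0" using deg by auto
 have pd: "pderiv ?f = monom 1 Q" using Q0 by (simp add: pderiv_diff pderiv_monom pderiv_pCons)
 have r: "poly ?f x = 0 \<longleftrightarrow> x ^ Suc Q = t" for x by (simp add: poly_monom)
 have c1: "card {x. poly ?f x = 0} = degree ?f"
 proof (rule card_roots_separable[OF nz])
  fix x assume "poly ?f x = 0"
  hence "x ^ Suc Q = t" using r by blast
  hence "x ~= 0" using t(2) by (metis power_0_Suc)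
  thus "poly (pderiv ?f) x ~= 0" unfolding pd by (simp add: poly_monom)
 qed
 have eq: "{x. poly ?f x = 0} = {x : sq.K. x ^ Suc Q = t}"
 proof -
  have "x : sq.K" if x: "x ^ Suc Q = t" for x
  proof -
   have x0: "x ^ Q ~= 0" using x t(2) by auto
   have "(x ^ Suc Q) ^ Q = x ^ Suc Q" using t(1) x by (simp add: fixed_field_def)
   hence "x ^ Q * x ^ Q\<^sup>2 = x ^ Q * x" by (simp add: power_mult_distrib power2_eq_square power_mult mult.commute)
   hence "x ^ Q\<^sup>2 = x" using mult_left_cancel[OF x0] by blast
   thus ?thesis by (simp add: fixed_field_def)
  qed
  thus ?thesis using r by blast
 qed
 show ?thesis unfolding eq[symmetric] c1 by (rule deg)
qed

lemma norm_in_K: "x : sq.K ==> x ^ Suc Q : K"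
 using frob_frob[of x] by (simp add: fixed_field_def power_mult_distrib mult.commute)

definition norm_vectors :: "nat => 'k => 'k mat set" where
 "norm_vectors n t = {v : mats n 1. elements_mat v \<subseteq> sq.K & (\<Sum>i<n. v $$ (i, 0) ^ Suc Q) = t}"

lemma finite_norm_vectors: "finite (norm_vectors n t)"
 by (rule finite_subset[OF _ card_matrices_over(1)[OF sq.finite_K, of n 1]]) (auto simp: norm_vectors_def)

lemma unit_vectors_eq: "unit_vectors n = norm_vectors n 1"
proof -
 have "star v * v = im 1 \<longleftrightarrow> (\<Sum>i<n. v $$ (i, 0) ^ Suc Q) = 1" if v: "v : mats n 1" for v
 proof -
  have "(star v * v) $$ (0, 0) = (\<Sum>i<n. v $$ (i, 0) ^ Suc Q)"
   using v by (auto simp: scalar_prod_def star_entry atLeast0LessThan mult.commute intro!: sum.cong)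
  moreover have "star v * v : mats 1 1" using v by (auto intro!: carrier_matI)
  ultimately show ?thesis by (subst scalar_mat_eq_iff) auto
 qed
 thus ?thesis unfolding unit_vectors_def norm_vectors_def by blast
qed

text \<open>Scaling a vector by \<open>c\<close> multiplies its norm by c^(Q+1), and every nonzero
  element of the small field is of this form.\<close>

lemma card_norm_vectors_scale:
 assumes t: "t : K" "t ~= 0"
 shows "card (norm_vectors n t) = card (norm_vectors n 1)"
proof -
 have "{x : sq.K. x ^ Suc Q = t} ~= {}" using norm_fiber[OF t] by (metis card.empty Zero_not_Suc)
 then obtain c where c: "c : sq.K" "c ^ Suc Q = t" by blast
 hence c0: "c ~= 0" using t(2) by auto
 have sc: "a \<cdot>\<^sub>m v \<in> norm_vectors n (a ^ Suc Q * u)" if "a : sq.K" "v \<in> norm_vectors n u" for a u v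
  using that sq.K_closed unfolding norm_vectors_def
  by (auto simp: elements_mat_subset_iff power_mult_distrib sum_distrib_left mult_ac)
 have ic: "inverse c : sq.K" using c sq.K_closed by simp
 have inv: "c \<cdot>\<^sub>m (inverse c \<cdot>\<^sub>m v) = v" "inverse c \<cdot>\<^sub>m (c \<cdot>\<^sub>m v) = v" for v
  using c0 by (auto intro!: eq_matI simp flip: mult.assoc)
 have it: "inverse c ^ Suc Q * t = 1" using c(2) t(2) by (simp add: power_inverse flip: power_Suc)
 show ?thesis
  by (rule bij_betw_same_card[OF bij_betw_byWitness[of _ "%v. c \<cdot>\<^sub>m v" "%v. inverse c \<cdot>\<^sub>m v"]])
   (use sc[OF c(1), of _ 1] sc[OF ic, of _ t] inv it c(2) in auto)
qed

text \<open>All Q^(2 n) vectors are sorted by their norm in the small field; the Q - 1 nonzero norms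
  are equally frequent.\<close>

lemma card_norm_vectors_total: "card (norm_vectors n 0) + (Q - 1) * card (norm_vectors n 1) = Q ^ (2 * n)"
proof -
 have "{v : mats n 1. elements_mat v \<subseteq> sq.K} = (\<Union>t\<in>K. norm_vectors n t)"
  by (auto simp: norm_vectors_def elements_mat_subset_iff intro!: K_sum norm_in_K[unfolded power_Suc])
 hence "Q ^ (2 * n) = card (\<Union>t\<in>K. norm_vectors n t)" using sq.card_columns[of n] by (simp add: power_mult)
 also have "... = (\<Sum>t\<in>K. card (norm_vectors n t))"
  by (rule card_UN_disjoint) (use finite_K finite_norm_vectors in "auto simp: norm_vectors_def")
 also have "... = card (norm_vectors n 0) + (\<Sum>t\<in>K - {0}. card (norm_vectors n t))"
  by (rule sum.remove) (use finite_K K_closed in auto)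
 also have "(\<Sum>t\<in>K - {0}. card (norm_vectors n t)) = (\<Sum>t\<in>K - {0}. card (norm_vectors n 1))"
  by (intro sum.cong refl card_norm_vectors_scale) auto
 also have "... = (Q - 1) * card (norm_vectors n 1)" using K_closed(1) by (simp add: card_Diff_singleton card_K)
 finally show ?thesis by simp
qed

lemma card_norm_vectors_Suc: "card (norm_vectors (Suc n) t) = (\<Sum>x\<in>sq.K. card (norm_vectors n (t - x ^ Suc Q)))"
proof -
 let ?h = "%(x, v). vc (mat 1 1 (%_. x)) v :: 'k mat"
 let ?S = "Sigma sq.K (%x. norm_vectors n (t - x ^ Suc Q))"
 have ent: "vc (mat 1 1 (%_. x)) v $$ (0, 0) = x" "i < n ==> vc (mat 1 1 (%_. x)) v $$ (Suc i, 0) = v $$ (i, 0)"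
  if "v : mats n 1" for x :: 'k and v i using that by (auto simp: vc_def)
 have "bij_betw ?h ?S (norm_vectors (Suc n) t)"
  unfolding bij_betw_def
 proof (intro conjI equalityI subsetI)
  show "inj_on ?h ?S"
  proof (rule inj_onI)
   fix a b assume ab: "a \<in> ?S" "b \<in> ?S" "?h a = ?h b"
   obtain x v y w where e: "a = (x, v)" "b = (y, w)" by (cases a, cases b)
   have c: "v : mats n 1" "w : mats n 1" using ab by (auto simp: e norm_vectors_def)
   have f: "vc (mat 1 1 (%_. x)) v = vc (mat 1 1 (%_. y)) w" using ab by (simp add: e)
   have "x = y" using ent(1)[OF c(1), of x] ent(1)[OF c(2), of y] f by simp
   moreover have "v $$ (i, 0) = w $$ (i, 0)" if "i < n" for i using ent(2)[OF c(1) that, of x] ent(2)[OF c(2) that, of y] f by simp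
   hence "v = w" using c by (intro eq_matI) auto
   ultimately show "a = b" by (simp add: e)
  qed
 next
  fix u assume "u \<in> ?h ` ?S"
  then obtain x v where u: "u = vc (mat 1 1 (%_. x)) v" and x: "x : sq.K" and v: "v : mats n 1" "elements_mat v \<subseteq> sq.K"
   "(\<Sum>i<n. v $$ (i, 0) ^ Suc Q) = t - x ^ Suc Q" by (auto simp: norm_vectors_def)
  have "(\<Sum>i<Suc n. u $$ (i, 0) ^ Suc Q) = x ^ Suc Q + (\<Sum>i<n. v $$ (i, 0) ^ Suc Q)"
   unfolding sum.lessThan_Suc_shift u ent(1)[OF v(1)] using ent(2)[OF v(1)] by simp
  hence "(\<Sum>i<Suc n. u $$ (i, 0) ^ Suc Q) = t" using v(3) by simp
  moreover have "u : mats (Suc n) 1" unfolding u using vc_carrier[of "mat 1 1 (%_. x)" 1 1 v n] v by simp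
  moreover have "elements_mat u \<subseteq> sq.K" using v x unfolding u elements_mat_subset_iff by (auto simp: vc_def)
  ultimately show "u \<in> norm_vectors (Suc n) t" by (simp add: norm_vectors_def)
 next
  fix u assume "u \<in> norm_vectors (Suc n) t"
  hence u: "u : mats (1 + n) 1" "elements_mat u \<subseteq> sq.K" "(\<Sum>i<Suc n. u $$ (i, 0) ^ Suc Q) = t"
   by (auto simp: norm_vectors_def)
  obtain a v where av: "a : mats 1 1" "v : mats n 1" "u = vc a v" using vc_split[OF u(1)] by metis
  have a: "a = mat 1 1 (%_. a $$ (0, 0))" using av(1) by (intro eq_matI) auto
  define x where "x = a $$ (0, 0)"
  have ux: "u = vc (mat 1 1 (%_. x)) v" using av(3) a x_def by simp
  have uK: "u $$ (i, 0) : sq.K" if "i < Suc n" for i using u(1,2) that by (auto simp: elements_mat_subset_iff)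
  have xK: "x : sq.K" using uK[of 0] ent(1)[OF av(2), of x] ux by simp
  have "v $$ (i, 0) : sq.K" if "i < n" for i using uK[of "Suc i"] ent(2)[OF av(2) that, of x] ux that by simp
  hence vK: "elements_mat v \<subseteq> sq.K" using av(2) by (auto simp: elements_mat_subset_iff)
  have "(\<Sum>i<Suc n. u $$ (i, 0) ^ Suc Q) = x ^ Suc Q + (\<Sum>i<n. v $$ (i, 0) ^ Suc Q)"
   unfolding sum.lessThan_Suc_shift ux ent(1)[OF av(2)] using ent(2)[OF av(2)] by simp
  hence "(\<Sum>i<n. v $$ (i, 0) ^ Suc Q) = t - x ^ Suc Q" using u(3) by (simp add: algebra_simps)
  hence "(x, v) \<in> ?S" using xK vK av(2) by (simp add: norm_vectors_def)
  thus "u \<in> ?h ` ?S" unfolding ux by force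
 qed
 from bij_betw_same_card[OF this] show ?thesis using finite_norm_vectors sq.finite_K by (simp add: card_SigmaI)
qed

text \<open>Sort by the first entry: Q + 1 entries have norm 1 and leave a vector of norm 0, all
  others leave a nonzero norm. Isotropic vectors are then eliminated through the total count. The
  factor Q on the left keeps the formula valid for n = 0.\<close>

theorem card_unit_vectors: "real Q * real (card (unit_vectors n)) = real Q ^ n * (real Q ^ n - (-1) ^ n)"
 unfolding unit_vectors_eq
proof (induction n)
 case 0
 have "norm_vectors 0 1 = {}" by (auto simp: norm_vectors_def)
 thus ?case by simp
next
 case (Suc n)
 let ?c = "card (norm_vectors n 1)" and ?z = "card (norm_vectors n 0)" and ?N = "{x : sq.K. x ^ Suc Q = 1}"
 have N: "card ?N = Suc Q" using norm_fiber K_closed by simp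
 have "card (norm_vectors (Suc n) 1) = (\<Sum>x\<in>sq.K. if x ^ Suc Q = 1 then ?z else ?c)"
  unfolding card_norm_vectors_Suc
 proof (intro sum.cong refl)
  fix x assume x: "x : sq.K"
  have K1: "1 - x ^ Suc Q : K" by (rule K_closed(6)[OF K_closed(2) norm_in_K[OF x]])
  show "card (norm_vectors n (1 - x ^ Suc Q)) = (if x ^ Suc Q = 1 then ?z else ?c)"
  proof (cases "x ^ Suc Q = 1")
   case True
   thus ?thesis by (simp only: diff_self simp_thms if_True)
  next
   case False
   hence "1 - x ^ Suc Q ~= 0" unfolding right_minus_eq by (rule not_sym)
   thus ?thesis unfolding if_not_P[OF False] by (rule card_norm_vectors_scale[OF K1])
  qed
 qed
 also have "... = (\<Sum>x\<in>sq.K \<inter> {x. x ^ Suc Q = 1}. ?z) + (\<Sum>x\<in>sq.K \<inter> - {x. x ^ Suc Q = 1}. ?c)"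
  by (rule sum.If_cases[OF sq.finite_K])
 also have "sq.K \<inter> {x. x ^ Suc Q = 1} = ?N" by blast
 also have "sq.K \<inter> - {x. x ^ Suc Q = 1} = sq.K - ?N" by blast
 also have "(\<Sum>x\<in>?N. ?z) + (\<Sum>x\<in>sq.K - ?N. ?c) = Suc Q * ?z + (Q\<^sup>2 - Suc Q) * ?c"
 proof -
  have "card (sq.K - ?N) = Q\<^sup>2 - Suc Q" using N sq.card_K by (subst card_Diff_subset) (auto simp: sq.finite_K)
  thus ?thesis using N by simp
 qed
 finally have n: "card (norm_vectors (Suc n) 1) = Suc Q * ?z + (Q\<^sup>2 - Suc Q) * ?c" .
 have le: "Suc Q <= Q\<^sup>2" using N card_mono[OF sq.finite_K, of ?N] sq.card_K by simp
 have r: "real (card (norm_vectors (Suc n) 1)) = real (Suc Q) * real ?z + (real Q ^ 2 - real (Suc Q)) * real ?c"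
  unfolding n using le by (simp only: of_nat_add of_nat_mult of_nat_diff of_nat_power)
 have "real ?z + (real Q - 1) * real ?c = real Q ^ (2 * n)"
  using arg_cong[OF card_norm_vectors_total[of n], of real] Q1 by (simp add: of_nat_diff)
 hence z: "real ?z = real Q ^ n * real Q ^ n - (real Q - 1) * real ?c" by (simp add: mult_2 power_add)
 have "real (card (norm_vectors (Suc n) 1)) = (real Q + 1) * (real Q ^ n * real Q ^ n) - real Q * real ?c"
  unfolding r z by (simp add: algebra_simps power2_eq_square)
 hence "real (card (norm_vectors (Suc n) 1)) = (real Q + 1) * (real Q ^ n * real Q ^ n) - real Q ^ n * (real Q ^ n - (-1) ^ n)"
  unfolding Suc .
 hence "real Q * real (card (norm_vectors (Suc n) 1)) = real Q * ((real Q + 1) * (real Q ^ n * real Q ^ n) - real Q ^ n * (real Q ^ n - (-1) ^ n))"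
  by simp
 thus ?case by (simp add: algebra_simps)
qed

end

section \<open>Comparison of the masses with the group orders\<close>

lemma of_nat_CARD: "of_nat CARD('a::{field,finite}) = (0::'a)"
proof -
 have "(\<Sum>x\<in>UNIV. x + (1::'a)) = (\<Sum>x\<in>UNIV. x)"
  by (rule sum.reindex_bij_betw) (auto intro!: bij_betwI[of _ _ _ "%x. x - 1"])
 thus ?thesis by (simp add: sum.distrib)
qed

lemma CHAR_prime_power_card:
 assumes "prime p" "CARD('a::{field,finite}) = p ^ r"
 shows "CHAR('a) = p"
proof -
 have "CHAR('a) dvd p ^ r" using of_nat_CARD[where 'a = 'a] unfolding of_nat_eq_0_iff_char_dvd assms(2) .
 moreover have "prime CHAR('a)" by (rule prime_CHAR_semidom) (simp add: finite_imp_CHAR_pos)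
 ultimately show ?thesis using assms(1) by (metis prime_dvd_power primes_dvd_imp_eq)
qed

text \<open>Powers of CARD('a) are powers of the characteristic, so raising to them is additive in
  the algebraic closure.\<close>

lemma frobenius_alg_closure:
 assumes p: "prime p" "CARD('a::{field,finite}) = p ^ r" and m: "m > 0"
 shows "frobenius TYPE('a alg_closure) (CARD('a) ^ m)"
proof
 have ch: "CHAR('a alg_closure) = p" using CHAR_prime_power_card[OF p] by simp
 show "(x + y) ^ (CARD('a) ^ m) = x ^ (CARD('a) ^ m) + y ^ (CARD('a) ^ m)" for x y :: "'a alg_closure"
  by (rule freshmans_dream'[of _ "r * m"]) (use p ch in "auto simp: power_mult")
 show "1 < CARD('a) ^ m" using CARD_field_gt_1 m by (rule one_less_power)
 have "of_nat CARD('a) = (0 :: 'a alg_closure)" using arg_cong[OF of_nat_CARD[where 'a = 'a], of to_ac] by simp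
 thus "of_nat (CARD('a) ^ m) = (0 :: 'a alg_closure)" using m by simp
qed

lemma card_GL_over_0: "card (GL_over 0 Q :: 'k::field mat set) = 1"
proof -
 have "(GL_over 0 Q :: 'k mat set) = {im 0}"
 proof (intro equalityI subsetI)
  fix A :: "'k mat" assume "A : GL_over 0 Q"
  hence "A : mats 0 0" by (auto simp: GL_over_def dest: GL_carrier)
  thus "A \<in> {im 0}" by (auto intro!: eq_matI)
 next
  fix A :: "'k mat" assume "A \<in> {im 0}"
  thus "A : GL_over 0 Q" using GL_one[of 0, where 'a = 'k] by (auto simp: GL_over_def elements_mat_def)
 qed
 thus ?thesis by simp
qed

lemma card_U_over_0: "card (U_over 0 Q :: 'k::field mat set) = 1"
proof -
 have "(map_mat (%x. x ^ Q) A)\<^sup>T * A = im 0" if "A : GL_over 0 (Q\<^sup>2)" for A :: "'k mat"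
  using that by (intro eq_matI) (auto simp: GL_over_def dest: GL_dim)
 hence "(U_over 0 Q :: 'k mat set) = GL_over 0 (Q\<^sup>2)" by (auto simp: U_over_def)
 thus ?thesis by (simp add: card_GL_over_0)
qed

text \<open>Multiplying the two recursions gives N_(k+1) u_(k+1) = Q^(2 k) N_k u_k; the exponents 2
  k for k < j add up to j (j - 1).\<close>

lemma order_recursion:
 fixes N :: "nat => real"
 assumes N: "N 0 = 1" "!!k. N (Suc k) * (Q ^ Suc k - s ^ Suc k) = Q ^ k * N k"
  and u: "u 0 = 1" "!!k. u (Suc k) = Q ^ k * (Q ^ Suc k - s ^ Suc k) * u k" and Q: "Q > 1" and s: "s = 1 \<or> s = -1"
 shows "N j = Q ^ (j * (j - 1)) / u j"
proof -
 have d: "Q ^ Suc k - s ^ Suc k > 0" for k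
 proof -
  have "Q ^ Suc k > 1" using Q by (intro one_less_power) auto
  moreover have "s ^ Suc k <= 1" using s by (cases "even k") auto
  ultimately show ?thesis by linarith
 qed
 have "N j = Q ^ (j * (j - 1)) / u j & u j > 0"
 proof (induction j)
  case (Suc k)
  have "N (Suc k) = Q ^ k * N k / (Q ^ Suc k - s ^ Suc k)" using N(2)[of k] d[of k] by (simp add: nonzero_eq_divide_eq)
  moreover have "Suc k * (Suc k - 1) = k + (k + k * (k - 1))" by (cases k) simp_all
  ultimately show ?case using Suc d[of k] Q by (simp only: u(2) power_add) (simp add: divide_simps)
 qed (use N u in simp)
 thus ?thesis ..
qed

text \<open>With Q = q^(m/2), where m is the degree of f, the recursion of the masses matches that
  of the unitary orders, where the number of unit vectors supplies the factor Q^(k+1) -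
  (-1)^(k+1).\<close>

theorem mass_self_conj_power_eq:
 fixes f :: "'a::{field,finite} poly"
 assumes p: "prime p" "CARD('a) = p ^ r" and char2: "(2::'a) ~= 0"
  and f: "monic f" "irreducible f" "conj_poly f = f" "f ~= [:-1, 1:]" "f ~= [:1, 1:]"
 shows "mass (f ^ j) = real CARD('a) ^ (degree f * j * (j - 1) div 2)
  / real (card (U_over j (CARD('a) ^ (degree f div 2)) :: 'a alg_closure mat set))"
proof -
 define \<mu> where "\<mu> = degree f div 2"
 define Q where "Q = CARD('a) ^ \<mu>"
 have deg: "degree f = 2 * \<mu>" using mass_self_conj_power(1)[OF char2 f] by (simp add: \<mu>_def)
 hence \<mu>: "\<mu> > 0" using irreducible_degree_pos[OF f(1,2)] by simp
 have two': "(2 :: 'a alg_closure) ~= 0" using char2 to_ac_eq_0_iff[of "2::'a"] by (metis to_ac_numeral)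
 interpret frobenius_square "TYPE('a alg_closure)" Q
  using frobenius_alg_closure[OF p \<mu>] two' unfolding Q_def frobenius_square_def frobenius_square_axioms_def by simp
 have q: "real Q > 1" using Q1 by simp
 have "mass (f ^ j) = real Q ^ (j * (j - 1)) / real (card (U_over j Q :: 'a alg_closure mat set))"
 proof (rule order_recursion[OF _ _ _ _ q, where s = "-1" and N = "%k. mass (f ^ k)"])
  fix k
  show "mass (f ^ Suc k) * (real Q ^ Suc k - (-1) ^ Suc k) = real Q ^ k * mass (f ^ k)"
   using mass_self_conj_power(2)[OF char2 f, of k] by (simp only: Q_def \<mu>_def of_nat_power)
  have "real Q * real (card (unit_vectors (Suc k))) = real Q * (real Q ^ k * (real Q ^ Suc k - (-1) ^ Suc k))"
   unfolding card_unit_vectors by simp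
  hence "real (card (unit_vectors (Suc k))) = real Q ^ k * (real Q ^ Suc k - (-1) ^ Suc k)"
   using q by (subst (asm) mult_left_cancel) auto
  thus "real (card (U_over (Suc k) Q :: 'a alg_closure mat set))
   = real Q ^ k * (real Q ^ Suc k - (-1) ^ Suc k) * real (card (U_over k Q :: 'a alg_closure mat set))"
   unfolding card_U_over_Suc by simp
 qed (simp_all add: card_U_over_0)
 moreover have "real CARD('a) ^ (degree f * j * (j - 1) div 2) = real Q ^ (j * (j - 1))"
  by (simp add: deg Q_def mult.assoc flip: power_mult)
 ultimately show ?thesis unfolding \<mu>_def[symmetric] Q_def[symmetric] by simp
qed

theorem mass_conj_pair_power_eq:
 fixes g :: "'a::{field,finite} poly"
 assumes p: "prime p" "CARD('a) = p ^ r" and two: "(2::'a) ~= 0"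
  and g: "monic g" "irreducible g" "coeff g 0 ~= 0" "conj_poly g ~= g"
 shows "mass ((g * conj_poly g) ^ j) = real CARD('a) ^ (degree g * j * (j - 1))
  / real (card (GL_over j (CARD('a) ^ degree g) :: 'a alg_closure mat set))"
proof -
 define Q where "Q = CARD('a) ^ degree g"
 interpret frobenius "TYPE('a alg_closure)" Q
  unfolding Q_def by (rule frobenius_alg_closure[OF p irreducible_degree_pos[OF g(1,2)]])
 have q: "real Q > 1" using Q1 by simp
 have "mass ((g * conj_poly g) ^ j) = real Q ^ (j * (j - 1)) / real (card (GL_over j Q :: 'a alg_closure mat set))"
 proof (rule order_recursion[OF _ _ _ _ q, where s = 1 and N = "%k. mass ((g * conj_poly g) ^ k)"])
  fix k
  show "mass ((g * conj_poly g) ^ Suc k) * (real Q ^ Suc k - 1 ^ Suc k) = real Q ^ k * mass ((g * conj_poly g) ^ k)"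
   using mass_conj_pair_power[OF two g, of k] by (simp only: Q_def of_nat_power power_one)
  have "Q ^ Suc k >= 1" using Q1 by (simp add: Suc_le_eq)
  thus "real (card (GL_over (Suc k) Q :: 'a alg_closure mat set))
   = real Q ^ k * (real Q ^ Suc k - 1 ^ Suc k) * real (card (GL_over k Q :: 'a alg_closure mat set))"
   unfolding card_GL_over_Suc power_one by (simp only: of_nat_mult of_nat_diff of_nat_power of_nat_1 mult_ac)
 qed (simp_all add: card_GL_over_0)
 moreover have "real CARD('a) ^ (degree g * j * (j - 1)) = real Q ^ (j * (j - 1))"
  by (simp add: Q_def mult.assoc flip: power_mult)
 ultimately show ?thesis unfolding Q_def[symmetric] by simp
qed

text \<open>From 2 l to 2 l + 2 the mass and the symplectic order each contribute q^(2 l + 1) to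
  their product, and the factors q^(2 l + 2) - 1 cancel. The exponents 2 (2 i + 1) for i < l add up
  to 2 l^2, which is k^2 / 2 for k = 2 l.\<close>

theorem mass_linear_power_eq:
 fixes c :: "'a::{field,finite}"
 assumes two: "(2::'a) ~= 0" and c: "c = 1 \<or> c = -1"
 shows "mass ([:c, 1:] ^ k) = F TYPE('a) k"
proof -
 let ?N = "%k. mass ([:c, 1:] ^ k)" and ?q = "real CARD('a)" and ?S = "%l. real (card (Sp (2 * l) :: 'a mat set))"
 have q: "?q > 1" using CARD_field_gt_1[where 'a = 'a] by simp
 have ex: "(2 * l)\<^sup>2 div 2 = 2 * l\<^sup>2" for l :: nat by (simp add: power2_eq_square)
 have E: "?N (2 * l) = ?q ^ (2 * l\<^sup>2) / ?S l & ?S l > 0" for l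
 proof (induction l)
  case 0
  thus ?case by (simp add: card_Sp_0)
 next
  case (Suc l)
  let ?d = "?q ^ (2 * l + 2) - 1"
  have "?q ^ (2 * l + 2) > 1" using q by (intro one_less_power) auto
  hence d: "?d > 0" by linarith
  have s: "2 * Suc l = 2 * l + 2" by simp
  have S: "?S (Suc l) = ?d * ?q ^ (2 * l + 1) * ?S l" unfolding s by (rule card_Sp_step[OF two])
  have pos: "?S (Suc l) > 0" unfolding S using Suc d q by simp
  have M: "?N (2 * Suc l) = ?q ^ (2 * l + 1) * ?N (2 * l) / ?d"
   unfolding s using mass_linear_power(2)[OF two c, of l] d by (simp only: nonzero_eq_divide_eq less_irrefl)
  have e: "2 * (Suc l)\<^sup>2 = (2 * l + 1) + ((2 * l + 1) + 2 * l\<^sup>2)" by (simp add: power2_eq_square)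
  have "?N (2 * Suc l) = ?q ^ (2 * (Suc l)\<^sup>2) / (?d * ?q ^ (2 * l + 1) * ?S l)"
   unfolding M e power_add[of _ "2 * l + 1"] using Suc d q by (simp add: divide_simps)
  thus ?case using pos unfolding S by blast
 qed
 show ?thesis
 proof (cases "even k")
  case True
  then obtain l where l: "k = 2 * l" by (elim evenE)
  show ?thesis unfolding l F_def ex using E[of l] by simp
 next
  case False
  then obtain l where l: "k = 2 * l + 1" by (elim oddE)
  show ?thesis unfolding l mass_linear_power(1)[OF two c] F_def using E[of l] ex[of l] by simp
 qed
qed

section \<open>Assembly over the distinct irreducible factors\<close>

lemma bez_distinct_irreducible:
 fixes p q :: "'a::field poly"
 assumes "monic p" "irreducible p" "monic q" "irreducible q" "p ~= q"
 shows "bez p q"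
proof (rule bez_irreducible[OF assms(1,2)])
 show "\<not> p dvd q"
 proof
  assume "p dvd q"
  hence "p dvd q ^ 1" by simp
  then obtain i where "i <= 1" "p = q ^ i" using dvd_irreducible_power[OF assms(3,4,1)] by blast
  hence "p = 1 \<or> p = q" by (cases i) auto
  thus False using assms(2,5) by auto
 qed
qed

lemma bez_powers: "bez p q ==> bez (p ^ i) (q ^ k)"
 using bez_power bez_sym by metis

lemma mass_prod:
 fixes h :: "'i => 'a::{field,finite} poly"
 assumes two: "(2::'a) ~= 0"
 shows "finite S ==> (!!i. i \<in> S ==> monic (h i) & conj_poly (h i) = h i)
  ==> (!!i k. i \<in> S ==> k \<in> S ==> i ~= k ==> bez (h i) (h k))
  ==> monic (\<Prod>i\<in>S. h i) & conj_poly (\<Prod>i\<in>S. h i) = (\<Prod>i\<in>S. h i) & mass (\<Prod>i\<in>S. h i) = (\<Prod>i\<in>S. mass (h i))"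
proof (induction S rule: finite_induct)
 case (insert x S)
 have IH: "monic (\<Prod>i\<in>S. h i)" "conj_poly (\<Prod>i\<in>S. h i) = (\<Prod>i\<in>S. h i)" "mass (\<Prod>i\<in>S. h i) = (\<Prod>i\<in>S. mass (h i))"
  using insert.IH insert.prems by auto
 have x: "monic (h x)" "conj_poly (h x) = h x" using insert.prems(1) by auto
 have "bez (h x) (\<Prod>i\<in>S. h i)"
  by (rule bez_prod[OF insert.hyps(1)]) (use insert.prems(2) insert.hyps(2) in auto)
 hence "mass (h x * (\<Prod>i\<in>S. h i)) = mass (h x) * mass (\<Prod>i\<in>S. h i)"
  using mass_mult[OF two _ x(2,1) IH(2,1)] by blast
 thus ?case using insert.hyps IH x by (simp add: lead_coeff_mult conj_poly_mult)
qed simp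

theorem theorem20:
 fixes p r q n a b :: nat
  and \<delta> :: "'a::{field,finite}"
  and \<phi> :: "'a poly"
  and I :: "'i set" and f :: "'i => 'a poly" and j :: "'i => nat"
  and I' :: "'j set" and g :: "'j => 'a poly" and j' :: "'j => nat"
 assumes "prime p" and "odd p" and "r >= 1" and "q = p ^ r" and "CARD('a) = q"
  and "\<not> (\<exists>x. \<delta> = x\<^sup>2)"
  and "monic \<phi>" and "degree \<phi> = n" and "n >= 1" and "coeff \<phi> 0 ~= 0"
  and "finite I" and "finite I'"
  and "!!i. i \<in> I ==> monic (f i) & irreducible (f i)"
  and "!!i. i \<in> I ==> conj_poly (f i) = f i & f i ~= [:-1, 1:] & f i ~= [:1, 1:]"
  and "!!i. i \<in> I' ==> monic (g i) & irreducible (g i)"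
  and "!!i. i \<in> I' ==> coeff (g i) 0 ~= 0 & conj_poly (g i) ~= g i"
  and "inj_on f I" and "inj_on g I'"
  and "!!i i'. i \<in> I ==> i' \<in> I' ==> f i ~= g i' & f i ~= conj_poly (g i')"
  and "!!i i'. i \<in> I' ==> i' \<in> I' ==> g i ~= conj_poly (g i')"
  and "\<phi> = [:-1, 1:] ^ a * [:1, 1:] ^ b * (\<Prod>i\<in>I. f i ^ j i)
       * (\<Prod>i\<in>I'. (g i * conj_poly (g i)) ^ j' i)"
 shows "(char_poly_proportion (O_plus n) \<phi> + char_poly_proportion (O_minus \<delta> n) \<phi>) / 2
  = F TYPE('a) a * F TYPE('a) b / 2
   * (\<Prod>i\<in>I. let m = degree (f i) in
     real q ^ (m * j i * (j i - 1) div 2)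
     / real (card (U_over (j i) (q ^ (m div 2)) :: 'a alg_closure mat set)))
   * (\<Prod>i\<in>I'. let m = degree (g i) in
     real q ^ (m * j' i * (j' i - 1))
     / real (card (GL_over (j' i) (q ^ m) :: 'a alg_closure mat set)))"
proof -
 note q = assms(5) and p = assms(1)
 have pr: "CARD('a) = p ^ r" using assms(4,5) by simp
 have two: "(2::'a) ~= 0"
 proof
  assume "(2::'a) = 0"
  hence "of_nat 2 = (0::'a)" by simp
  hence "CHAR('a) dvd 2" by (simp only: of_nat_eq_0_iff_char_dvd)
  hence "p dvd 2" using CHAR_prime_power_card[OF p pr] by simp
  thus False using p \<open>odd p\<close> by (metis primes_dvd_imp_eq two_is_prime_nat even_numeral)
 qed
 define cg where "cg i = conj_poly (g i)" for i
 define h where "h i = g i * cg i" for i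
 have f: "monic (f i)" "irreducible (f i)" "conj_poly (f i) = f i" "f i ~= [:-1, 1:]" "f i ~= [:1, 1:]" if "i \<in> I" for i
  using assms(13,14)[OF that] by auto
 have g: "monic (g i)" "irreducible (g i)" "coeff (g i) 0 ~= 0" "conj_poly (g i) ~= g i" if "i \<in> I'" for i
  using assms(15,16)[OF that] by auto
 have cg: "monic (cg i)" "irreducible (cg i)" "conj_poly (cg i) = g i" if "i \<in> I'" for i
  unfolding cg_def using g[OF that] by (auto intro: monic_conj_poly irreducible_conj_poly conj_poly_conj_poly)
 have h: "monic (h i)" "conj_poly (h i) = h i" if "i \<in> I'" for i
  using g[OF that] cg[OF that] by (auto simp: h_def lead_coeff_mult conj_poly_mult mult.commute cg_def)
 have l: "monic [:c, 1:]" "irreducible [:c, 1:]" "conj_poly [:c, 1:] = [:c, 1:]" if "c = 1 \<or> c = -1" for c :: 'a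
  using that irreducible_linear_field_poly[of 1 c] by (auto simp: conj_poly_def reflect_poly_def)
 note lm = l[OF disjI2[OF refl]] and lp = l[OF disjI1[OF refl]]
 have pm: "[:-1, 1:] ~= [:1, 1 :: 'a:]" 
 proof
  assume e: "[:-1, 1:] = [:1, 1 :: 'a:]"
  have "coeff [:-1, 1 :: 'a:] 0 = coeff [:1, 1 :: 'a:] 0" unfolding e ..
  hence "(-1::'a) = 1" by simp
  thus False using two by (metis add.right_inverse one_add_one)
 qed
 \<comment> \<open>The linear factors are self-conjugate while g and its conjugate are not, so these
   irreducibles are distinct.\<close>
 have lg: "bez [:c, 1:] (h i)" if c: "c = 1 \<or> c = -1" and i: "i \<in> I'" for c i
 proof -
  have "[:c, 1:] ~= g i" using g(4)[OF i] l(3)[OF c] by metis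
  moreover have "[:c, 1:] ~= cg i" using g(4)[OF i] cg(3)[OF i] l(3)[OF c] unfolding cg_def by metis
  ultimately show ?thesis unfolding h_def
   using bez_distinct_irreducible[OF l(1,2)[OF c]] g(1,2)[OF i] cg(1,2)[OF i] by (intro bez_mult) auto
 qed
 have lf: "bez [:c, 1:] (f i)" if c: "c = 1 \<or> c = -1" and i: "i \<in> I" for c i
  by (rule bez_distinct_irreducible[OF l(1,2)[OF c] f(1,2)[OF i]]) (use f(4,5)[OF i] c in auto)
 have fh: "bez (f i) (h k)" if i: "i \<in> I" and k: "k \<in> I'" for i k
  unfolding h_def
  using bez_distinct_irreducible[OF f(1,2)[OF i] g(1,2)[OF k]] bez_distinct_irreducible[OF f(1,2)[OF i] cg(1,2)[OF k]]
   assms(19)[OF i k] by (intro bez_mult) (auto simp: cg_def)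
 have ff: "bez (f i) (f k)" if i: "i \<in> I" and k: "k \<in> I" and ik: "i ~= k" for i k
  by (rule bez_distinct_irreducible[OF f(1,2)[OF i] f(1,2)[OF k]]) (use i k ik assms(17) in "auto dest: inj_onD")
 have hh: "bez (h i) (h k)" if i: "i \<in> I'" and k: "k \<in> I'" and ik: "i ~= k" for i k
 proof -
  have n1: "g i ~= g k" using i k ik assms(18) by (auto dest: inj_onD)
  have n2: "g i ~= cg k" "cg i ~= g k" using assms(20)[OF i k] assms(20)[OF k i] by (auto simp: cg_def)
  have n3: "cg i ~= cg k" using n1 cg(3)[OF i] cg(3)[OF k] by metis
  note b = bez_distinct_irreducible
  have "bez (g i) (h k)" unfolding h_def
   by (rule bez_mult[OF b[OF g(1,2)[OF i] g(1,2)[OF k] n1] b[OF g(1,2)[OF i] cg(1,2)[OF k] n2(1)]])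
  moreover have "bez (cg i) (h k)" unfolding h_def
   by (rule bez_mult[OF b[OF cg(1,2)[OF i] g(1,2)[OF k] n2(2)] b[OF cg(1,2)[OF i] cg(1,2)[OF k] n3]])
  ultimately show ?thesis unfolding h_def[of i] by (meson bez_mult bez_sym)
 qed
 define A B C D where "A = [:-1, 1 :: 'a:] ^ a" and "B = [:1, 1 :: 'a:] ^ b" and "C = (\<Prod>i\<in>I. f i ^ j i)" and "D = (\<Prod>i\<in>I'. h i ^ j' i)"
 have AB: "monic A" "conj_poly A = A" "monic B" "conj_poly B = B"
  unfolding A_def B_def using lm lp by (auto simp: conj_poly_power monic_power)
 have C: "monic C & conj_poly C = C & mass C = (\<Prod>i\<in>I. mass (f i ^ j i))"
  unfolding C_def by (rule mass_prod[OF two assms(11)]) (use f ff in "auto simp: conj_poly_power monic_power intro: bez_powers")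
 have D: "monic D & conj_poly D = D & mass D = (\<Prod>i\<in>I'. mass (h i ^ j' i))"
  unfolding D_def by (rule mass_prod[OF two assms(12)]) (use h hh in "auto simp: conj_poly_power monic_power intro: bez_powers")
 have bAB: "bez A B" unfolding A_def B_def using bez_distinct_irreducible[OF lm(1,2) lp(1,2) pm] by (rule bez_powers)
 have bC: "bez A C" "bez B C" unfolding A_def B_def C_def
  by (intro bez_prod assms(11) bez_powers lf; simp)+
 have bD: "bez A D" "bez B D" unfolding A_def B_def D_def
  by (intro bez_prod assms(12) bez_powers lg; simp)+
 have bCD: "bez C D" unfolding C_def
  by (rule bez_sym[OF bez_prod[OF assms(11)]], rule bez_sym, unfold D_def)
   (intro bez_prod assms(12) bez_powers fh; simp)
 \<comment> \<open>Four pairwise coprime self-conjugate parts; each is split off in turn, the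
   products over \<open>I\<close> and \<open>I'\<close> having been handled by
   \<open>mass_prod\<close>.\<close>
 have "mass \<phi> = mass (A * (B * (C * D)))"
  unfolding assms(21) A_def B_def C_def D_def h_def cg_def by (simp only: mult.assoc)
 also have "... = mass A * mass (B * (C * D))"
  by (rule mass_mult[OF two]) (use AB C D bAB bC bD in "auto simp: lead_coeff_mult conj_poly_mult intro!: bez_mult")
 also have "mass (B * (C * D)) = mass B * mass (C * D)"
  by (rule mass_mult[OF two]) (use AB C D bC bD in "auto simp: lead_coeff_mult conj_poly_mult intro!: bez_mult")
 also have "mass (C * D) = mass C * mass D"
  by (rule mass_mult[OF two bCD]) (use C D in auto)
 also have "mass A = F TYPE('a) a" unfolding A_def by (rule mass_linear_power_eq[OF two]) simp
 also have "mass B = F TYPE('a) b" unfolding B_def by (rule mass_linear_power_eq[OF two]) simp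
 also have "mass C = (\<Prod>i\<in>I. let m = degree (f i) in real q ^ (m * j i * (j i - 1) div 2)
     / real (card (U_over (j i) (q ^ (m div 2)) :: 'a alg_closure mat set)))"
  using C mass_self_conj_power_eq[OF p pr two f] unfolding Let_def q by (auto intro!: prod.cong)
 also have "mass D = (\<Prod>i\<in>I'. let m = degree (g i) in real q ^ (m * j' i * (j' i - 1))
     / real (card (GL_over (j' i) (q ^ m) :: 'a alg_closure mat set)))"
  using D mass_conj_pair_power_eq[OF p pr two g] unfolding Let_def q h_def cg_def by (auto intro!: prod.cong)
 finally show ?thesis
  using mass_eq_proportions[OF two assms(9,8,6)] by (simp add: mult.assoc)
qed

end
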